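(* Let $w$ be a doubling weight, $0<p<1$, $f\in L_p[-1,1]$, and let $n,r\in\mathbb{N}$ be such that $n\ge r$. Then there exists a positive constant $\vartheta$ depending only on $r$, $p$ and the doubling constant of $w$, such that, for any constant $0<A<\vartheta$ and $A/n\le t\le\vartheta/n$, we have $$\omega_\varphi^r(f,t)_{p,w_n}\sim\tilde\omega_\varphi^r(f,t)_{p,w_n}\sim R_{r,\varphi}(f,t)_{p,w_n}\sim R_{r,\varphi_n}(f,t)_{p,w_n}\sim R_{r,\varphi}^*(f,t)_{p,w_n},$$ where all equivalence constants depend only on $r$, $p$, $A$, $\vartheta$, and the doubling constant of the weight $w$.
   Context: A doubling weight is a nonnegative $w\in L_1[-1,1]$, extended by $0$ outside $[-1,1]$, for which there is a constant $L$ (the doubling constant of $w$) with $\int_{2I}w\le L\int_I w$ for all intervals $I\subset[-1,1]$, where $2I$ is the interval with the same center as $I$ and twice its length. Let $\varphi(x)=\sqrt{1-x^2}$, $\rho_n(x)=n^{-1}\sqrt{1-x^2}+n^{-2}$, $\varphi_n(x)=\varphi(x)+1/n=n\rho_n(x)$, and $w_n(x)=\frac{1}{\rho_n(x)}\int_{x-\rho_n(x)}^{x+\rho_n(x)}w(u)\,du$. For a weight $v$ on $[-1,1]$: $\|g\|_{p,v}=\left(\int_{-1}^1|g|^p v\right)^{1/p}$. $\Pi_n$ is the set of algebraic polynomials of degree $\le n-1$ and $E_n(f)_{p,v}=\inf_{P\in\Pi_n}\|f-P\|_{p,v}$. Symmetric difference: $\Delta_h^r(f,x)=\sum_{i=0}^r\binom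 ri(-1)^{r-i}f(x-rh/2+ih)$ if $x\pm rh/2\in[-1,1]$, and $0$ otherwise. Moduli: $\omega_\varphi^r(f,t)_{p,v}=\sup_{0<h\le t}\|\Delta_{h\varphi(\cdot)}^r(f,\cdot)\|_{p,v}$ and $\tilde\omega_\varphi^r(f,t)_{p,v}=\left(\frac1t\int_0^t\|\Delta^r_{h\varphi(\cdot)}(f,\cdot)\|_{p,v}^p\,dh\right)^{1/p}$. For $\psi\in\{\varphi,\varphi_n\}$: $R_{r,\psi}(f,t)_{p,w_n}=\inf_{P_n\in\Pi_n}\left(\|f-P_n\|_{p,w_n}+t^r\|\psi^r P_n^{(r)}\|_{p,w_n}\right)$. Further, $R_{r,\varphi}^*(f,t)_{p,w_n}=\|f-P_n^*\|_{p,w_n}+t^r\|\varphi^r(P_n^* )^{(r)}\|_{p,w_n}$, where $P_n^*\in\Pi_n$ is a polynomial of (near) best approximation to $f$ with weight $w_n$, i.e. $\|f-P_n^*\|_{p,w_n}\le c_0E_n(f)_{p,w_n}$ with a constant $c_0\ge1$ fixed once and for all (an absolute constant). $X\sim Y$ means $c^{-1}X\le Y\le cX$ for some constant $c>0$ (the equivalence constant). *)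

theory Defs
  imports "HOL-Analysis.Analysis" "HOL-Computational_Algebra.Polynomial"
begin

text \<open>
  The interval \<open>I\<close> is given by its center \<open>c\<close> and half-length \<open>d\<close>. Closed intervals suffice,
  since endpoints are null sets. \<open>L\<close> is any admissible constant, not necessarily the least one.
\<close>

definition doubling_weight :: "real \<Rightarrow> (real \<Rightarrow> real) \<Rightarrow> bool" where
  "doubling_weight L w \<longleftrightarrow>
     (\<forall>x. 0 \<le> w x) \<and> (\<forall>x. x \<notin> {-1..1} \<longrightarrow> w x = 0) \<and> set_integrable lebesgue {-1..1} w \<and>
     (\<forall>c d. 0 < d \<longrightarrow> {c - d..c + d} \<subseteq> {-1..1} \<longrightarrow>
        (LINT u:{c - 2 * d..c + 2 * d}|lebesgue. w u) \<le> L * (LINT u:{c - d..c + d}|lebesgue. w u))"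

definition phi :: "real \<Rightarrow> real" where
  "phi x = sqrt (1 - x\<^sup>2)"

definition rho :: "nat \<Rightarrow> real \<Rightarrow> real" where
  "rho n x = sqrt (1 - x\<^sup>2) / real n + 1 / (real n)\<^sup>2"

definition phi_n :: "nat \<Rightarrow> real \<Rightarrow> real" where
  "phi_n n x = phi x + 1 / real n"

definition avg_weight :: "(real \<Rightarrow> real) \<Rightarrow> nat \<Rightarrow> real \<Rightarrow> real" where
  "avg_weight w n x = 1 / rho n x * (LINT u:{x - rho n x..x + rho n x}|lebesgue. w u)"

definition Lp_space :: "real \<Rightarrow> (real \<Rightarrow> real) set" where
  "Lp_space p = {f. set_borel_measurable lebesgue {-1..1} f \<and>
                    set_integrable lebesgue {-1..1} (\<lambda>x. \<bar>f x\<bar> powr p)}"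

definition Lp_norm :: "real \<Rightarrow> (real \<Rightarrow> real) \<Rightarrow> (real \<Rightarrow> real) \<Rightarrow> real" where
  "Lp_norm p v g = (LINT x:{-1..1}|lebesgue. \<bar>g x\<bar> powr p * v x) powr (1 / p)"

definition Polys :: "nat \<Rightarrow> real poly set" where
  "Polys n = {P. degree P \<le> n - 1}"

definition best_approx :: "nat \<Rightarrow> (real \<Rightarrow> real) \<Rightarrow> real \<Rightarrow> (real \<Rightarrow> real) \<Rightarrow> real" where
  "best_approx n f p v = (INF P\<in>Polys n. Lp_norm p v (\<lambda>x. f x - poly P x))"

definition near_best :: "real \<Rightarrow> nat \<Rightarrow> (real \<Rightarrow> real) \<Rightarrow> real \<Rightarrow> (real \<Rightarrow> real) \<Rightarrow> real poly \<Rightarrow> bool" where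
  "near_best c0 n f p v P \<longleftrightarrow>
     P \<in> Polys n \<and> Lp_norm p v (\<lambda>x. f x - poly P x) \<le> c0 * best_approx n f p v"

definition sym_diff :: "nat \<Rightarrow> real \<Rightarrow> (real \<Rightarrow> real) \<Rightarrow> real \<Rightarrow> real" where
  "sym_diff r h f x =
     (if x - real r * h / 2 \<in> {-1..1} \<and> x + real r * h / 2 \<in> {-1..1}
      then \<Sum>i=0..r. real (r choose i) * (-1) ^ (r - i) * f (x - real r * h / 2 + real i * h)
      else 0)"

text \<open>
  Real-valued suprema and Bochner integrals lose nothing for \<open>f\<close> in \<open>Lp_space p\<close> and a bounded
  measurable weight such as \<open>avg_weight w n\<close>: where the difference of step \<open>h * phi x\<close> is not
  cut off, the maps sending \<open>x\<close> to \<open>x + (real i - real r / 2) * h * phi x\<close> have derivative at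
  least 1/2, so the norms of the differences are bounded uniformly in \<open>h\<close>.
\<close>

definition modulus :: "nat \<Rightarrow> (real \<Rightarrow> real) \<Rightarrow> real \<Rightarrow> real \<Rightarrow> (real \<Rightarrow> real) \<Rightarrow> real" where
  "modulus r f t p v = (SUP h\<in>{0<..t}. Lp_norm p v (\<lambda>x. sym_diff r (h * phi x) f x))"

definition avg_modulus :: "nat \<Rightarrow> (real \<Rightarrow> real) \<Rightarrow> real \<Rightarrow> real \<Rightarrow> (real \<Rightarrow> real) \<Rightarrow> real" where
  "avg_modulus r f t p v =
     (1 / t * (LINT h:{0..t}|lebesgue. Lp_norm p v (\<lambda>x. sym_diff r (h * phi x) f x) powr p))
       powr (1 / p)"

definition realization_at ::
    "nat \<Rightarrow> (real \<Rightarrow> real) \<Rightarrow> (real \<Rightarrow> real) \<Rightarrow> real \<Rightarrow> real \<Rightarrow> (real \<Rightarrow> real) \<Rightarrow> real poly \<Rightarrow> real" where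
  "realization_at r \<psi> f t p v P =
     Lp_norm p v (\<lambda>x. f x - poly P x) +
     t ^ r * Lp_norm p v (\<lambda>x. \<psi> x ^ r * poly ((pderiv ^^ r) P) x)"

definition realization ::
    "nat \<Rightarrow> (real \<Rightarrow> real) \<Rightarrow> nat \<Rightarrow> (real \<Rightarrow> real) \<Rightarrow> real \<Rightarrow> real \<Rightarrow> (real \<Rightarrow> real) \<Rightarrow> real" where
  "realization r \<psi> n f t p v = (INF P\<in>Polys n. realization_at r \<psi> f t p v P)"

definition equiv_upto :: "real \<Rightarrow> real \<Rightarrow> real \<Rightarrow> bool" where
  "equiv_upto C X Y \<longleftrightarrow> inverse C * X \<le> Y \<and> Y \<le> C * X"

end

theory Submission imports Defs begin

text \<open>
  In the variable \<open>\<alpha> = arccos x\<close> the averaged weight grows at most like a power of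
  \<open>1 + n \<bar>\<alpha> - \<beta>\<bar>\<close>, and nothing else about the weight matters. Kernels that decay faster than
  this power localize polynomial inequalities, so those pass from the unweighted to the weighted
  case: \<open>phi_n\<close> may be replaced by \<open>phi\<close>, and \<open>t ^ r * phi ^ r\<close> times the \<open>r\<close>-th derivative of \<open>P\<close> and the difference of \<open>P\<close> of
  step \<open>t * phi\<close> have comparable norms for small \<open>n * t\<close>. Whitney's theorem on the cells between
  consecutive Chebyshev knots, with averaged differences, and a partition of unity made of the same
  kernels give a Jackson inequality. The five quantities are then linked in a cycle: average
  modulus, modulus, realization with \<open>phi\<close>, with \<open>phi_n\<close>, at \<open>Pstar\<close>, and back to the average modulus.
\<close>

subsection \<open>Powers with exponent at most one\<close>

text \<open>The obstacle is p < 1. There is no duality and no integral Minkowski inequality, and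
  \<open>f\<close> need not be locally integrable, so smoothing by integral means is out of reach;
  what survives is subadditivity of the p-th power. Hence smoothness is read off polynomials, and
  estimates are made for p-th power integrals in ennreal, where Tonelli needs no integrability and
  finiteness matters when a term is absorbed or a root is taken. The bound t <= \<theta> / n comes
  from the reverse estimate, derivatives by differences: replacing a difference by its leading term
  costs a factor of order (n t)^p, which must be small enough to be absorbed. The lower bound
  \<open>A\<close> enters through Jackson's inequality, as the fineness of the mesh: with about 4 pi
  n / A cells, every difference that fits into two adjacent cells has step at most (A / n) *
  \<open>phi\<close>. So \<theta> is independent of \<open>A\<close>, while the equivalence
  constants are not. Jackson's inequality has to be proved with differences averaged over the step,
  since the average modulus, dominated by the modulus, is where the cycle closes; therefore
  Whitney's theorem is needed in averaged form too.\<close>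

definition pw :: "real \<Rightarrow> real \<Rightarrow> ennreal" where
  "pw p y = ennreal (\<bar>y\<bar> powr p)"

abbreviation pint :: "real \<Rightarrow> real set \<Rightarrow> (real \<Rightarrow> real) \<Rightarrow> ennreal" where
  "pint p A F \<equiv> (\<integral>\<^sup>+x\<in>A. pw p (F x) \<partial>lborel)"

abbreviation wpint :: "real \<Rightarrow> real set \<Rightarrow> (real \<Rightarrow> real) \<Rightarrow> (real \<Rightarrow> real) \<Rightarrow> ennreal" where
  "wpint p A v F \<equiv> (\<integral>\<^sup>+x\<in>A. ennreal (v x) * pw p (F x) \<partial>lborel)"

abbreviation kernel_avg :: "nat \<Rightarrow> real \<Rightarrow> nat \<Rightarrow> real poly \<Rightarrow> real \<Rightarrow> ennreal" where
  "kernel_avg n p M Q \<alpha> \<equiv> (\<integral>\<^sup>+\<beta>\<in>{0..pi}. pw p (poly Q (cos \<beta>)) * ennreal (real n / (1 + real n * \<bar>\<alpha> - \<beta>\<bar>) ^ M) \<partial>lborel)"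

lemma pw_0 [simp]: "pw p 0 = 0"
  by (simp add: pw_def)

lemma pw_minus [simp]: "pw p (- x) = pw p x"
  by (simp add: pw_def)

lemma pw_mult: "pw p (a * b) = pw p a * pw p b"
  by (simp add: pw_def abs_mult powr_mult ennreal_mult)

lemma pw_less_top [simp]: "pw p x < \<infinity>" "pw p x \<noteq> \<infinity>"
  by (auto simp: pw_def)

lemma pw_mono: "\<bar>x\<bar> \<le> \<bar>y\<bar> \<Longrightarrow> 0 \<le> p \<Longrightarrow> pw p x \<le> pw p y"
  by (auto simp: pw_def intro!: ennreal_leI powr_mono2)

lemma measurable_pw [measurable (raw)]:
  "f \<in> borel_measurable M \<Longrightarrow> (\<lambda>x. pw p (f x)) \<in> borel_measurable M"
  unfolding pw_def by measurable

text \<open>On [0, 1] the power lies above the diagonal; this is applied to the shares of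
  \<open>a\<close> and \<open>b\<close> in their sum, which add up to 1.\<close>

lemma powr_add_le:
  fixes a b p :: real
  assumes "0 \<le> a" "0 \<le> b" "0 < p" "p \<le> 1"
  shows "(a + b) powr p \<le> a powr p + b powr p"
proof (cases "a + b = 0")
  case False
  then have pos: "a + b > 0" using assms by linarith
  have *: "x powr p \<ge> x" if "0 \<le> x" "x \<le> 1" for x :: real
  proof (cases "x = 0")
    case False
    then have "x powr 1 \<le> x powr p" using that assms by (intro powr_mono') auto
    then show ?thesis using that by simp
  qed simp
  have "1 = a / (a + b) + b / (a + b)" using pos by (simp add: add_divide_distrib[symmetric])
  also have "\<dots> \<le> (a / (a + b)) powr p + (b / (a + b)) powr p"
    using assms pos by (intro add_mono *) auto
  also have "\<dots> = (a powr p + b powr p) / (a + b) powr p"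
    using assms pos by (simp add: powr_divide add_divide_distrib)
  finally show ?thesis using pos by (simp add: field_simps)
qed (use assms in auto)

lemma pw_add: "0 < p \<Longrightarrow> p \<le> 1 \<Longrightarrow> pw p (a + b) \<le> pw p a + pw p b"
proof -
  assume p: "0 < p" "p \<le> 1"
  have "\<bar>a + b\<bar> powr p \<le> (\<bar>a\<bar> + \<bar>b\<bar>) powr p" using p by (intro powr_mono2) auto
  also have "\<dots> \<le> \<bar>a\<bar> powr p + \<bar>b\<bar> powr p" using p by (intro powr_add_le) auto
  finally have "ennreal (\<bar>a + b\<bar> powr p) \<le> ennreal (\<bar>a\<bar> powr p + \<bar>b\<bar> powr p)"
    by (rule ennreal_leI)
  then show ?thesis by (simp add: pw_def)
qed

lemma pw_diff: "0 < p \<Longrightarrow> p \<le> 1 \<Longrightarrow> pw p (a - b) \<le> pw p a + pw p b"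
  using pw_add[of p a "- b"] by simp

lemma pw_sum:
  assumes "0 < p" "p \<le> 1"
  shows "pw p (\<Sum>i\<in>S. f i) \<le> (\<Sum>i\<in>S. pw p (f i))"
proof (induction S rule: infinite_finite_induct)
  case (insert x S)
  then show ?case
    using pw_add[OF assms, of "f x" "\<Sum>i\<in>S. f i"]
    by simp (meson add_left_mono order_trans)
qed auto

section \<open>Integrals over sets with respect to Lebesgue measure\<close>

lemma set_nn_integral_translate:
  fixes F :: "real \<Rightarrow> ennreal"
  assumes [measurable]: "F \<in> borel_measurable borel"
  shows "(\<integral>\<^sup>+x\<in>{a..b}. F (x + c) \<partial>lborel) = (\<integral>\<^sup>+x\<in>{a + c..b + c}. F x \<partial>lborel)"
proof -
  have "(\<integral>\<^sup>+x\<in>{a + c..b + c}. F x \<partial>lborel) =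
      (\<integral>\<^sup>+x. F (c + 1 * x) * indicator {a + c..b + c} (c + 1 * x) \<partial>lborel)"
    by (subst nn_integral_real_affine[where c = 1 and t = c]) auto
  also have "\<dots> = (\<integral>\<^sup>+x\<in>{a..b}. F (x + c) \<partial>lborel)"
    by (intro nn_integral_cong) (auto simp: indicator_def add.commute)
  finally show ?thesis by simp
qed

lemma set_nn_integral_scale:
  fixes F :: "real \<Rightarrow> ennreal"
  assumes [measurable]: "F \<in> borel_measurable borel" and "0 < c"
  shows "ennreal c * (\<integral>\<^sup>+x\<in>{a..b}. F (c * x) \<partial>lborel) = (\<integral>\<^sup>+x\<in>{c * a..c * b}. F x \<partial>lborel)"
proof -
  have "(\<integral>\<^sup>+x\<in>{c * a..c * b}. F x \<partial>lborel) =
      ennreal c * (\<integral>\<^sup>+x. F (0 + c * x) * indicator {c * a..c * b} (0 + c * x) \<partial>lborel)"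
    using assms(2) by (subst nn_integral_real_affine[where c = c and t = 0]) auto
  also have "(\<integral>\<^sup>+x. F (0 + c * x) * indicator {c * a..c * b} (0 + c * x) \<partial>lborel)
      = (\<integral>\<^sup>+x\<in>{a..b}. F (c * x) \<partial>lborel)"
    using assms(2) by (intro nn_integral_cong) (auto simp: indicator_def)
  finally show ?thesis by simp
qed

lemma set_nn_integral_mono_set:
  fixes F G :: "'a \<Rightarrow> ennreal"
  assumes "A \<subseteq> B" "\<And>x. x \<in> A \<Longrightarrow> F x \<le> G x"
  shows "(\<integral>\<^sup>+x\<in>A. F x \<partial>M) \<le> (\<integral>\<^sup>+x\<in>B. G x \<partial>M)"
  using assms by (intro nn_integral_mono) (auto simp: indicator_def)

lemma set_nn_integral_Un_le:
  fixes F :: "'a \<Rightarrow> ennreal"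
  assumes [measurable]: "F \<in> borel_measurable M" "A \<in> sets M" "B \<in> sets M"
  shows "(\<integral>\<^sup>+x\<in>A \<union> B. F x \<partial>M) \<le> (\<integral>\<^sup>+x\<in>A. F x \<partial>M) + (\<integral>\<^sup>+x\<in>B. F x \<partial>M)"
  by (subst nn_integral_add[symmetric]) (auto intro!: nn_integral_mono simp: indicator_def)

lemma set_nn_integral_UN_le:
  fixes F :: "'a \<Rightarrow> ennreal"
  assumes [measurable]: "F \<in> borel_measurable M" "\<And>i. i \<in> I \<Longrightarrow> A i \<in> sets M" and "finite I"
  shows "(\<integral>\<^sup>+x\<in>(\<Union>i\<in>I. A i). F x \<partial>M) \<le> (\<Sum>i\<in>I. \<integral>\<^sup>+x\<in>A i. F x \<partial>M)"
proof -
  have "(\<integral>\<^sup>+x\<in>(\<Union>i\<in>I. A i). F x \<partial>M) \<le> (\<integral>\<^sup>+x. (\<Sum>i\<in>I. F x * indicator (A i) x) \<partial>M)"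
  proof (intro nn_integral_mono)
    fix x
    show "F x * indicator (\<Union>i\<in>I. A i) x \<le> (\<Sum>i\<in>I. F x * indicator (A i) x)"
    proof (cases "\<exists>i\<in>I. x \<in> A i")
      case True
      then obtain i where i: "i \<in> I" "x \<in> A i" by auto
      have "F x * indicator (A i) x \<le> (\<Sum>i\<in>I. F x * indicator (A i) x)"
        using i assms(3) by (intro member_le_sum) auto
      then show ?thesis using i by (auto simp: indicator_def split: if_splits)
    qed auto
  qed
  also have "\<dots> = (\<Sum>i\<in>I. \<integral>\<^sup>+x\<in>A i. F x \<partial>M)"
    by (rule nn_integral_sum) auto
  finally show ?thesis .
qed

lemma set_nn_integral_sum:
  fixes F :: "'i \<Rightarrow> 'a \<Rightarrow> ennreal"
  assumes [measurable]: "\<And>i. i \<in> I \<Longrightarrow> F i \<in> borel_measurable M" "A \<in> sets M"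
  shows "(\<integral>\<^sup>+x\<in>A. (\<Sum>i\<in>I. F i x) \<partial>M) = (\<Sum>i\<in>I. \<integral>\<^sup>+x\<in>A. F i x \<partial>M)"
  unfolding sum_distrib_right by (rule nn_integral_sum) auto

lemma set_nn_integral_add:
  fixes F G :: "'a \<Rightarrow> ennreal"
  assumes [measurable]: "F \<in> borel_measurable M" "G \<in> borel_measurable M" "A \<in> sets M"
  shows "(\<integral>\<^sup>+x\<in>A. (F x + G x) \<partial>M) = (\<integral>\<^sup>+x\<in>A. F x \<partial>M) + (\<integral>\<^sup>+x\<in>A. G x \<partial>M)"
  unfolding distrib_right by (rule nn_integral_add) auto

lemma set_nn_integral_cmult:
  fixes F :: "'a \<Rightarrow> ennreal"
  assumes [measurable]: "F \<in> borel_measurable M" "A \<in> sets M"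
  shows "(\<integral>\<^sup>+x\<in>A. c * F x \<partial>M) = c * (\<integral>\<^sup>+x\<in>A. F x \<partial>M)"
  unfolding mult.assoc by (rule nn_integral_cmult) auto

lemma set_nn_integral_multc:
  fixes F :: "'a \<Rightarrow> ennreal"
  assumes [measurable]: "F \<in> borel_measurable M" "A \<in> sets M"
  shows "(\<integral>\<^sup>+x\<in>A. F x * c \<partial>M) = (\<integral>\<^sup>+x\<in>A. F x \<partial>M) * c"
  using set_nn_integral_cmult[OF assms, of c] by (simp add: mult.commute)

lemma set_nn_integral_swap:
  fixes F :: "real \<Rightarrow> real \<Rightarrow> ennreal"
  assumes [measurable]: "(\<lambda>(x, y). F x y) \<in> borel_measurable (borel \<Otimes>\<^sub>M borel)"
    "A \<in> sets borel" "B \<in> sets borel"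
  shows "(\<integral>\<^sup>+x\<in>A. (\<integral>\<^sup>+y\<in>B. F x y \<partial>lborel) \<partial>lborel) = (\<integral>\<^sup>+y\<in>B. (\<integral>\<^sup>+x\<in>A. F x y \<partial>lborel) \<partial>lborel)"
proof -
  have m: "(\<lambda>(x, y). F x y * indicator B y * indicator A x) \<in> borel_measurable (lborel \<Otimes>\<^sub>M lborel)"
    by measurable
  have "(\<integral>\<^sup>+x\<in>A. (\<integral>\<^sup>+y\<in>B. F x y \<partial>lborel) \<partial>lborel) =
      (\<integral>\<^sup>+x. (\<integral>\<^sup>+y. F x y * indicator B y * indicator A x \<partial>lborel) \<partial>lborel)"
    by (intro nn_integral_cong nn_integral_multc[symmetric]) measurable
  also have "\<dots> = (\<integral>\<^sup>+y. (\<integral>\<^sup>+x. F x y * indicator B y * indicator A x \<partial>lborel) \<partial>lborel)"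
    using lborel_pair.Fubini'[OF m] by simp
  also have "\<dots> = (\<integral>\<^sup>+y. (\<integral>\<^sup>+x. F x y * indicator A x * indicator B y \<partial>lborel) \<partial>lborel)"
    by (simp only: mult.assoc mult.commute mult.left_commute)
  also have "\<dots> = (\<integral>\<^sup>+y\<in>B. (\<integral>\<^sup>+x\<in>A. F x y \<partial>lborel) \<partial>lborel)"
    by (intro nn_integral_cong nn_integral_multc) measurable
  finally show ?thesis .
qed

text \<open>Good parameters are chosen in this way: the constant in the base case on the circle, and
  the step \<open>v\<close> in Whitney's theorem. If \<open>F\<close> exceeded its mean everywhere,
  its integral would exceed itself; the failure of the claim at one point already forces the
  integral to be finite.\<close>

lemma exists_le_average:
  fixes F :: "real \<Rightarrow> ennreal"
  assumes [measurable]: "F \<in> borel_measurable borel" and "a < b"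
  shows "\<exists>x\<in>{a..b}. ennreal (b - a) * F x \<le> (\<integral>\<^sup>+x\<in>{a..b}. F x \<partial>lborel)"
proof (rule ccontr)
  assume notex: "\<not> ?thesis"
  define I where "I = (\<integral>\<^sup>+x\<in>{a..b}. F x \<partial>lborel)"
  have *: "ennreal (b - a) * F x > I" if "x \<in> {a..b}" for x
    using notex that by (auto simp: I_def not_le)
  have fin: "I < \<infinity>" using *[of a] assms(2) by (auto simp: order.strict_implies_order less_top[symmetric])
  define K where "K = I / ennreal (b - a)"
  have K: "F x > K" if "x \<in> {a..b}" for x
    using *[OF that] assms(2) fin unfolding K_def
    by (subst divide_less_ennreal) (auto simp: mult.commute)
  have IK: "(\<integral>\<^sup>+x. K * indicator {a..b} x \<partial>lborel) = I"
  proof -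
    have "(\<integral>\<^sup>+x. K * indicator {a..b} x \<partial>lborel) = K * ennreal (b - a)"
      using assms(2) by (subst nn_integral_cmult_indicator) auto
    also have "\<dots> = ennreal (b - a) * I / ennreal (b - a)"
      by (simp add: K_def mult.commute ennreal_times_divide)
    also have "\<dots> = I"
      using assms(2) by (simp add: mult.commute[of _ I] mult_divide_eq_ennreal)
    finally show ?thesis .
  qed
  have "(\<integral>\<^sup>+x. K * indicator {a..b} x \<partial>lborel) < (\<integral>\<^sup>+x. F x * indicator {a..b} x \<partial>lborel)"
  proof (rule nn_integral_less)
    show "(\<integral>\<^sup>+x. K * indicator {a..b} x \<partial>lborel) \<noteq> \<infinity>" using IK fin by simp
    show "AE x in lborel. K * indicator {a..b} x \<le> F x * indicator {a..b} x"
      using K by (auto simp: indicator_def intro!: less_imp_le)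
    show "\<not> (AE x in lborel. F x * indicator {a..b} x \<le> K * indicator {a..b} x)"
    proof
      assume "AE x in lborel. F x * indicator {a..b} x \<le> K * indicator {a..b} x"
      then have "AE x in lborel. x \<notin> {a..b}"
      proof eventually_elim
        case (elim x)
        then show ?case using K[of x] by (cases "x \<in> {a..b}") auto
      qed
      then have "emeasure lborel {a..b} = 0"
        using AE_iff_measurable[of "{a..b}" lborel "\<lambda>x. x \<notin> {a..b}"]
        by (auto simp: atLeastAtMost_def atLeast_def atMost_def Int_def)
      then show False using assms(2) by simp
    qed
  qed auto
  then show False using IK by (simp add: I_def)
qed


text \<open>Moving \<open>E\<close> to the left is legitimate only if it is finite; the finiteness
  facts about differences and polynomials proved below serve this purpose.\<close>

lemma ennreal_absorb:
  fixes E X :: ennreal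
  assumes "E < \<infinity>" "ennreal a * E \<le> E + X" "1 < a"
  shows "E \<le> ennreal (1 / (a - 1)) * X"
proof (cases "X = \<infinity>")
  case False
  then obtain x where x: "X = ennreal x" "0 \<le> x" by (cases X) auto
  obtain e where e: "E = ennreal e" "0 \<le> e" using assms(1) by (cases E) auto
  have "ennreal (a * e) \<le> ennreal (e + x)" using assms(2,3) x e by (simp add: ennreal_mult)
  then have "a * e \<le> e + x" using x e by (subst (asm) ennreal_le_iff) auto
  then have "e \<le> 1 / (a - 1) * x" using assms(3) by (simp add: field_simps)
  then show ?thesis using assms(3) x e by (subst x, subst e) (simp add: ennreal_mult[symmetric] ennreal_leI)
qed (use assms in \<open>auto simp: ennreal_mult_top\<close>)

lemma ennreal_absorb_half:
  fixes E X :: ennreal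
  assumes "E < \<infinity>" "E \<le> X + ennreal c * E" "c \<le> 1 / 2"
  shows "E \<le> 2 * X"
proof -
  have "2 * E \<le> 2 * X + 2 * (ennreal c * E)" using mult_left_mono[OF assms(2), of 2] by (simp add: distrib_left)
  also have "2 * (ennreal c * E) = ennreal (2 * c) * E" by (simp add: ennreal_mult' mult.assoc)
  also have "\<dots> \<le> 1 * E" using assms(3) by (intro mult_right_mono) auto
  finally have "ennreal 2 * E \<le> E + 2 * X" by (simp add: add.commute)
  from ennreal_absorb[OF assms(1) this] show ?thesis by simp
qed

subsection \<open>Whitney's theorem with averaged differences\<close>

text \<open>Forward differences are iterates of one linear operator, so they commute and obey
  operator identities. Whitney's theorem is proved for them and transferred to centred differences
  only at its end.\<close>

definition fdiff :: "real \<Rightarrow> (real \<Rightarrow> real) \<Rightarrow> real \<Rightarrow> real" where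
  "fdiff s g x = g (x + s) - g x"

text \<open>The average over the step is kept instead of a supremum because on the circle it does
  not increase when the step is doubled.\<close>

abbreviation step_avg :: "real \<Rightarrow> nat \<Rightarrow> real \<Rightarrow> (real \<Rightarrow> real) \<Rightarrow> ennreal" where
  "step_avg p k v d \<equiv> (\<integral>\<^sup>+s\<in>{0..v}. pint p {0..v} (\<lambda>x. (fdiff s ^^ k) d x) \<partial>lborel)"

lemma fdiff_pow_expand:
  "(fdiff s ^^ k) g x = (\<Sum>i\<le>k. (-1) ^ (k + i) * real (k choose i) * g (x + real i * s))"
proof (induction k arbitrary: x)
  case (Suc k)
  define a where "a i = g (x + real i * s)" for i :: nat
  have "(fdiff s ^^ Suc k) g x =
      (\<Sum>i\<le>k. (-1) ^ (k + i) * real (k choose i) * a (Suc i)) -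
      (\<Sum>i\<le>k. (-1) ^ (k + i) * real (k choose i) * a i)"
    by (simp add: fdiff_def Suc.IH a_def algebra_simps)
  also have "(\<Sum>i\<le>k. (-1) ^ (k + i) * real (k choose i) * a i) =
     (\<Sum>i\<le>Suc k. (-1) ^ (k + i) * real (k choose i) * a i)"
    by simp
  also have "\<dots> = (-1) ^ k * a 0 + (\<Sum>i\<le>k. (-1) ^ (k + Suc i) * real (k choose Suc i) * a (Suc i))"
    by (subst sum.atMost_Suc_shift) simp
  finally have "(fdiff s ^^ Suc k) g x = (-1) ^ Suc k * a 0 +
      (\<Sum>i\<le>k. (-1) ^ (k + i) * real (k choose i) * a (Suc i) -
         (-1) ^ (k + Suc i) * real (k choose Suc i) * a (Suc i))"
    by (simp add: sum.distrib sum_negf)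
  also have "\<dots> = (-1) ^ Suc k * a 0 +
      (\<Sum>i\<le>k. (-1) ^ (Suc k + Suc i) * real (Suc k choose Suc i) * a (Suc i))"
    by (intro arg_cong2[where f = "(+)"] sum.cong refl) (simp add: algebra_simps)
  also have "\<dots> = (\<Sum>i\<le>Suc k. (-1) ^ (Suc k + i) * real (Suc k choose i) * a i)"
    by (subst sum.atMost_Suc_shift) simp
  finally show ?case by (simp add: a_def)
qed simp

lemma fdiff_pow_diff:
  "(fdiff s ^^ k) (\<lambda>x. g x - h x) = (\<lambda>x. (fdiff s ^^ k) g x - (fdiff s ^^ k) h x)"
  by (rule ext) (simp add: fdiff_pow_expand sum_subtractf right_diff_distrib)

lemma fdiff_pow_cmult:
  "(fdiff s ^^ k) (\<lambda>x. c * g x) = (\<lambda>x. c * (fdiff s ^^ k) g x)"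
  by (rule ext) (simp add: fdiff_pow_expand sum_distrib_left mult_ac)

lemma fdiff_commute: "fdiff s (fdiff t g) = fdiff t (fdiff s g)"
  by (rule ext) (simp add: fdiff_def algebra_simps)

lemma fdiff_pow_commute: "(fdiff s ^^ k) ((fdiff t ^^ l) g) = (fdiff t ^^ l) ((fdiff s ^^ k) g)"
proof -
  have 1: "fdiff s ((fdiff t ^^ l) g) = (fdiff t ^^ l) (fdiff s g)" for g
    by (induction l) (simp_all, metis fdiff_commute)
  show ?thesis by (induction k arbitrary: g) (auto simp: 1 funpow_swap1)
qed

lemma measurable_fdiff [measurable (raw)]:
  assumes [measurable]: "g \<in> borel_measurable borel" "u \<in> borel_measurable M" "y \<in> borel_measurable M"
  shows "(\<lambda>z. (fdiff (u z) ^^ k) g (y z)) \<in> borel_measurable M"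
  unfolding fdiff_pow_expand by measurable

lemma pw_of_nat_mult_le:
  assumes "0 < p" "p \<le> 1"
  shows "pw p (real m * y) \<le> of_nat m * pw p y"
  using pw_sum[OF assms, of "\<lambda>_. y" "{..<m}"] by simp

lemma pw_fdiff_le:
  assumes "0 < p" "p \<le> 1"
  shows "pw p ((fdiff s ^^ k) g x) \<le> ennreal (2 ^ k) * (\<Sum>i\<le>k. pw p (g (x + real i * s)))"
proof -
  have "pw p ((fdiff s ^^ k) g x) \<le> (\<Sum>i\<le>k. pw p ((-1) ^ (k + i) * real (k choose i) * g (x + real i * s)))"
    unfolding fdiff_pow_expand by (rule pw_sum[OF assms])
  also have "\<dots> \<le> (\<Sum>i\<le>k. ennreal (2 ^ k) * pw p (g (x + real i * s)))"
  proof (intro sum_mono)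
    fix i
    have "pw p ((-1) ^ (k + i) * real (k choose i) * g (x + real i * s))
        = pw p (real (k choose i) * g (x + real i * s))"
      by (cases "even (k + i)") auto
    also have "\<dots> \<le> of_nat (k choose i) * pw p (g (x + real i * s))"
      by (rule pw_of_nat_mult_le[OF assms])
    also have "\<dots> \<le> of_nat (2 ^ k) * pw p (g (x + real i * s))"
      by (intro mult_right_mono) (simp_all only: of_nat_le_iff binomial_le_pow2 zero_le)
    finally show "pw p ((-1) ^ (k + i) * real (k choose i) * g (x + real i * s)) \<le> ennreal (2 ^ k) * pw p (g (x + real i * s))"
      by (simp only: ennreal_of_nat_eq_real_of_nat of_nat_power of_nat_numeral)
  qed
  finally show ?thesis by (simp add: sum_distrib_left)
qed

text \<open>With T the shift by \<open>s\<close>, the difference of step \<open>2 * s\<close> is (T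
  + 1)(T - 1). The left side is thus ((T + 1)^k - 2^k)(T - 1)^k applied to \<open>g\<close>, and the
  first factor is divisible by T - 1. The induction peels off one factor T + 1 after another;
  \<open>e\<close> below is \<open>g\<close> with one factor applied.\<close>

lemma fdiff_double_bound:
  "\<bar>(fdiff (2 * s) ^^ k) g x - 2 ^ k * (fdiff s ^^ k) g x\<bar> \<le>
     real k * 2 ^ k * (\<Sum>i\<le>2 * k. \<bar>(fdiff s ^^ Suc k) g (x + real i * s)\<bar>)"
proof (induction k arbitrary: g)
  case (Suc k)
  define e where "e = fdiff (2 * s) g"
  have e: "e = (\<lambda>y. fdiff s g (y + s) + fdiff s g y)"
    by (rule ext) (simp add: e_def fdiff_def algebra_simps)
  have e': "(fdiff s ^^ j) e y = (fdiff s ^^ Suc j) g (y + s) + (fdiff s ^^ Suc j) g y" for j y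
  proof -
    have "(fdiff s ^^ j) e y = (fdiff s ^^ j) (fdiff s g) (y + s) + (fdiff s ^^ j) (fdiff s g) y"
      unfolding e fdiff_pow_expand by (simp add: sum.distrib[symmetric] algebra_simps)
    then show ?thesis by (simp add: funpow_swap1)
  qed
  define A where "A i = \<bar>(fdiff s ^^ Suc (Suc k)) g (x + real i * s)\<bar>" for i
  define S where "S = (\<Sum>i\<le>2 * Suc k. A i)"
  have A0: "A i \<ge> 0" for i by (simp add: A_def)
  have S0: "S \<ge> 0" unfolding S_def by (intro sum_nonneg A0)
  have "(fdiff (2 * s) ^^ Suc k) g x - 2 ^ Suc k * (fdiff s ^^ Suc k) g x
      = ((fdiff (2 * s) ^^ k) e x - 2 ^ k * (fdiff s ^^ k) e x)
        + 2 ^ k * ((fdiff s ^^ Suc k) g (x + s) - (fdiff s ^^ Suc k) g x)"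
  proof -
    have "(fdiff (2 * s) ^^ Suc k) g = (fdiff (2 * s) ^^ k) e" by (simp add: e_def funpow_swap1)
    then show ?thesis by (simp only: e') (simp add: algebra_simps)
  qed
  also have "(fdiff s ^^ Suc k) g (x + s) - (fdiff s ^^ Suc k) g x = (fdiff s ^^ Suc (Suc k)) g x"
    by (simp add: fdiff_def)
  finally have "\<bar>(fdiff (2 * s) ^^ Suc k) g x - 2 ^ Suc k * (fdiff s ^^ Suc k) g x\<bar>
      \<le> \<bar>(fdiff (2 * s) ^^ k) e x - 2 ^ k * (fdiff s ^^ k) e x\<bar> + 2 ^ k * A 0"
    using abs_triangle_ineq[of "(fdiff (2 * s) ^^ k) e x - 2 ^ k * (fdiff s ^^ k) e x"
        "2 ^ k * (fdiff s ^^ Suc (Suc k)) g x"] by (simp add: A_def abs_mult)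
  also have "\<bar>(fdiff (2 * s) ^^ k) e x - 2 ^ k * (fdiff s ^^ k) e x\<bar> \<le>
      real k * 2 ^ k * (\<Sum>i\<le>2 * k. \<bar>(fdiff s ^^ Suc k) e (x + real i * s)\<bar>)"
    by (rule Suc.IH)
  also have "(\<Sum>i\<le>2 * k. \<bar>(fdiff s ^^ Suc k) e (x + real i * s)\<bar>) \<le> (\<Sum>i\<le>2 * k. A (Suc i) + A i)"
  proof (intro sum_mono)
    fix i
    show "\<bar>(fdiff s ^^ Suc k) e (x + real i * s)\<bar> \<le> A (Suc i) + A i"
      unfolding e' A_def
      using abs_triangle_ineq[of "(fdiff s ^^ Suc (Suc k)) g (x + real i * s + s)"
          "(fdiff s ^^ Suc (Suc k)) g (x + real i * s)"]
      by (simp add: algebra_simps)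
  qed
  also have "\<dots> \<le> S + S"
  proof -
    have "(\<Sum>i\<le>2 * k. A (Suc i)) = (\<Sum>i\<in>Suc ` {..2 * k}. A i)"
      by (simp add: sum.reindex)
    also have "\<dots> \<le> S" unfolding S_def by (intro sum_mono2) (auto simp: A0)
    moreover have "(\<Sum>i\<le>2 * k. A i) \<le> S"
      unfolding S_def by (intro sum_mono2) (auto simp: A0)
    ultimately show ?thesis by (simp add: sum.distrib)
  qed
  also have "A 0 \<le> S"
    unfolding S_def by (intro member_le_sum) (auto simp: A0)
  finally have "\<bar>(fdiff (2 * s) ^^ Suc k) g x - 2 ^ Suc k * (fdiff s ^^ Suc k) g x\<bar>
     \<le> real k * 2 ^ k * (2 * S) + 2 ^ k * S"
    by (simp add: mult_left_mono)
  also have "\<dots> \<le> real (Suc k) * 2 ^ Suc k * S"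
    using S0 by (simp add: algebra_simps)
  finally show ?case by (simp add: A_def S_def)
qed simp

section \<open>Functions on a circle of length \<open>v\<close>\<close>

lemma periodic_add_int:
  fixes F :: "real \<Rightarrow> 'a"
  assumes "\<And>x. F (x + v) = F x"
  shows "F (x + of_int m * v) = F x"
proof -
  have nat: "F (x + real k * v) = F x" for k x
  proof (induction k)
    case (Suc k)
    have "F (x + real (Suc k) * v) = F ((x + real k * v) + v)" by (simp add: algebra_simps)
    then show ?case using Suc assms by simp
  qed simp
  show ?thesis
  proof (cases "m \<ge> 0")
    case True
    then show ?thesis using nat[of x "nat m"] by simp
  next
    case False
    then show ?thesis using nat[of "x + of_int m * v" "nat (- m)"] by simp
  qed
qed

lemma periodic_integral_shift_le:
  fixes F :: "real \<Rightarrow> ennreal"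
  assumes [measurable]: "F \<in> borel_measurable borel" and per: "\<And>x. F (x + v) = F x" and "0 < v"
  shows "(\<integral>\<^sup>+x\<in>{0..v}. F (x + a) \<partial>lborel) \<le> (\<integral>\<^sup>+x\<in>{0..v}. F x \<partial>lborel)"
proof -
  \<comment> \<open>The shift is reduced modulo the period and the period is cut at
    \<open>b\<close>; the two pieces share one point, hence the comparison almost everywhere at the
    end.\<close>
  define b where "b = v * frac (a / v)"
  have b: "0 \<le> b" "b \<le> v" using assms(3) frac_lt_1[of "a / v"] frac_ge_0[of "a / v"]
    by (auto simp: b_def mult_le_cancel_left1)
  have ab: "a = b + of_int \<lfloor>a / v\<rfloor> * v" using assms(3) by (simp add: b_def frac_def field_simps)
  have "F (x + a) = F (x + b)" for x
  proof -
    have "x + a = x + b + of_int \<lfloor>a / v\<rfloor> * v" using ab by linarith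
    then show ?thesis using periodic_add_int[of F v "x + b" "\<lfloor>a / v\<rfloor>", OF per] by metis
  qed
  then have "(\<integral>\<^sup>+x\<in>{0..v}. F (x + a) \<partial>lborel) = (\<integral>\<^sup>+x\<in>{0..v}. F (x + b) \<partial>lborel)"
    by (intro nn_integral_cong) metis
  also have "\<dots> = (\<integral>\<^sup>+x\<in>{b..v + b}. F x \<partial>lborel)"
    using set_nn_integral_translate[OF assms(1), where a = 0 and b = v and c = b] by simp
  also have "{b..v + b} = {b..v} \<union> {v..v + b}" using b by auto
  also have "(\<integral>\<^sup>+x\<in>\<dots>. F x \<partial>lborel) \<le> (\<integral>\<^sup>+x\<in>{b..v}. F x \<partial>lborel) + (\<integral>\<^sup>+x\<in>{v..v + b}. F x \<partial>lborel)"
    by (rule set_nn_integral_Un_le) auto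
  also have "(\<integral>\<^sup>+x\<in>{v..v + b}. F x \<partial>lborel) = (\<integral>\<^sup>+x\<in>{0..b}. F x \<partial>lborel)"
    using set_nn_integral_translate[OF assms(1), where a = 0 and b = b and c = v] unfolding per by (simp add: add.commute[of b v])
  also have "(\<integral>\<^sup>+x\<in>{b..v}. F x \<partial>lborel) + (\<integral>\<^sup>+x\<in>{0..b}. F x \<partial>lborel)
      = (\<integral>\<^sup>+x. F x * indicator {b..v} x + F x * indicator {0..b} x \<partial>lborel)"
    by (rule nn_integral_add[symmetric]) auto
  also have "\<dots> \<le> (\<integral>\<^sup>+x\<in>{0..v}. F x \<partial>lborel)"
  proof (rule nn_integral_mono_AE)
    show "AE x in lborel. F x * indicator {b..v} x + F x * indicator {0..b} x \<le> F x * indicator {0..v} x"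
      using AE_lborel_singleton[of b] by eventually_elim (use b in \<open>auto simp: indicator_def\<close>)
  qed
  finally show ?thesis .
qed

text \<open>The doubling map runs through the period twice at double speed, so it preserves the
  mean.\<close>

lemma periodic_integral_double_le:
  fixes F :: "real \<Rightarrow> ennreal"
  assumes [measurable]: "F \<in> borel_measurable borel" and per: "\<And>x. F (x + v) = F x" and "0 < v"
  shows "(\<integral>\<^sup>+x\<in>{0..v}. F (2 * x) \<partial>lborel) \<le> (\<integral>\<^sup>+x\<in>{0..v}. F x \<partial>lborel)"
proof -
  define I where "I = (\<integral>\<^sup>+x\<in>{0..v}. F x \<partial>lborel)"
  have "ennreal 2 * (\<integral>\<^sup>+x\<in>{0..v}. F (2 * x) \<partial>lborel) = (\<integral>\<^sup>+x\<in>{0..2 * v}. F x \<partial>lborel)"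
    using set_nn_integral_scale[OF assms(1), of 2 0 v] by simp
  also have "{0..2 * v} = {0..v} \<union> {v..2 * v}" using assms(3) by auto
  also have "(\<integral>\<^sup>+x\<in>\<dots>. F x \<partial>lborel) \<le> I + (\<integral>\<^sup>+x\<in>{v..2 * v}. F x \<partial>lborel)"
    unfolding I_def by (rule set_nn_integral_Un_le) auto
  also have "(\<integral>\<^sup>+x\<in>{v..2 * v}. F x \<partial>lborel) = I"
    using set_nn_integral_translate[OF assms(1), where a = 0 and b = v and c = v] unfolding per by (simp add: I_def mult_2[symmetric])
  finally have *: "ennreal 2 * (\<integral>\<^sup>+x\<in>{0..v}. F (2 * x) \<partial>lborel) \<le> I + I" .
  have "I + I = ennreal 2 * I" by (simp add: mult_2)
  with * have "ennreal 2 * (\<integral>\<^sup>+x\<in>{0..v}. F (2 * x) \<partial>lborel) \<le> ennreal 2 * I" by (simp only:)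
  then show ?thesis unfolding I_def[symmetric]
    using ennreal_mult_le_mult_iff[of "ennreal 2" "\<integral>\<^sup>+x\<in>{0..v}. F (2 * x) \<partial>lborel" I]
    by (simp only: ennreal_eq_0_iff ennreal_neq_top) simp
qed

lemma set_nn_integral_const_mult_le:
  fixes F :: "real \<Rightarrow> ennreal"
  assumes "\<And>x. x \<in> {a..b} \<Longrightarrow> F x \<le> c" "a \<le> b"
  shows "(\<integral>\<^sup>+x\<in>{a..b}. F x \<partial>lborel) \<le> c * ennreal (b - a)"
proof -
  have "(\<integral>\<^sup>+x\<in>{a..b}. F x \<partial>lborel) \<le> (\<integral>\<^sup>+x\<in>{a..b}. c \<partial>lborel)"
    using assms by (intro set_nn_integral_mono_set) auto
  also have "\<dots> = c * ennreal (b - a)"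
    using assms(2) by (subst nn_integral_cmult_indicator) auto
  finally show ?thesis .
qed

section \<open>Differences of polynomials\<close>

lemma pderiv_pow_shift:
  "(pderiv ^^ k) (pcompose P [:s, 1:]) = pcompose ((pderiv ^^ k) P) [:s, 1:]"
  by (induction k) (auto simp: pderiv_pcompose pderiv_pCons)

lemma pderiv_pow_diff: "(pderiv ^^ k) (P - Q) = (pderiv ^^ k) P - (pderiv ^^ k) (Q :: real poly)"
  by (induction k) (auto simp: pderiv_diff)

lemma poly_MVT_le:
  fixes a b :: real
  assumes "a \<le> b"
  obtains \<xi> where "a \<le> \<xi>" "\<xi> \<le> b" "poly P b - poly P a = (b - a) * poly (pderiv P) \<xi>"
proof (cases "a = b")
  case False
  then obtain x where "a < x" "x < b" "poly P b - poly P a = (b - a) * poly (pderiv P) x"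
    using poly_MVT[of a b P] assms by auto
  then show ?thesis using that[of x] by auto
qed (use that[of a] in auto)

text \<open>The induction hypothesis is applied to the polynomial P(x + s) - P(x) instead of
  \<open>P\<close>; the mean value theorem then turns the increment of the \<open>r\<close>-th
  derivative into one more derivative.\<close>

lemma fdiff_poly_MVT:
  assumes "0 \<le> s"
  shows "\<exists>\<xi>. x \<le> \<xi> \<and> \<xi> \<le> x + real r * s \<and>
    (fdiff s ^^ r) (poly P) x = s ^ r * poly ((pderiv ^^ r) P) \<xi>"
proof (induction r arbitrary: P)
  case (Suc r)
  define P1 where "P1 = pcompose P [:s, 1:] - P"
  have P1: "fdiff s (poly P) = poly P1"
    by (rule ext) (simp add: fdiff_def P1_def poly_pcompose add.commute)
  obtain \<xi> where \<xi>: "x \<le> \<xi>" "\<xi> \<le> x + real r * s"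
    "(fdiff s ^^ r) (poly P1) x = s ^ r * poly ((pderiv ^^ r) P1) \<xi>"
    using Suc.IH[of P1] by auto
  have "poly ((pderiv ^^ r) P1) \<xi> = poly ((pderiv ^^ r) P) (\<xi> + s) - poly ((pderiv ^^ r) P) \<xi>"
    by (simp add: P1_def pderiv_pow_diff pderiv_pow_shift poly_pcompose add.commute)
  moreover obtain \<eta> where \<eta>: "\<xi> \<le> \<eta>" "\<eta> \<le> \<xi> + s"
    "poly ((pderiv ^^ r) P) (\<xi> + s) - poly ((pderiv ^^ r) P) \<xi> = s * poly (pderiv ((pderiv ^^ r) P)) \<eta>"
    using poly_MVT_le[of \<xi> "\<xi> + s" "(pderiv ^^ r) P"] assms by auto
  ultimately have "(fdiff s ^^ Suc r) (poly P) x = s ^ Suc r * poly ((pderiv ^^ Suc r) P) \<eta>"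
    using \<xi>(3) by (simp add: P1[symmetric] funpow_swap1)
  then show ?case using \<xi> \<eta> by (intro exI[of _ \<eta>]) (auto simp: algebra_simps)
qed auto

lemma pderiv_pow_eq_0:
  fixes P :: "real poly"
  assumes "degree P < r" shows "(pderiv ^^ r) P = 0"
  using assms
proof (induction r arbitrary: P)
  case (Suc r)
  show ?case
  proof (cases "degree P = 0")
    case True
    then have "pderiv P = 0" by (simp add: pderiv_eq_0_iff)
    moreover have "(pderiv ^^ r) (0 :: real poly) = 0" by (induction r) auto
    ultimately show ?thesis by (simp add: funpow_swap1)
  next
    case False
    then have "degree (pderiv P) < r" using Suc.prems by (simp add: degree_pderiv)
    then show ?thesis using Suc.IH[of "pderiv P"] by (simp add: funpow_swap1)
  qed
qed auto

lemma fdiff_poly_eq_0: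
  assumes "0 \<le> s" "degree P < r"
  shows "(fdiff s ^^ r) (poly P) x = 0"
  using fdiff_poly_MVT[OF assms(1), of x r P] pderiv_pow_eq_0[OF assms(2)] by auto

text \<open>The polynomial is the generalized binomial coefficient of x / v over k, and Pascal's
  rule lowers k under a difference of step \<open>v\<close>. It lifts a constant correction of a
  \<open>k\<close>-th difference to a polynomial correction of the function itself.\<close>

lemma binomial_poly:
  fixes v :: real
  assumes "v \<noteq> 0"
  shows "\<exists>b. degree b \<le> k \<and> (fdiff v ^^ k) (poly b) = (\<lambda>_. 1)"
proof -
  define b where "b k = smult (1 / fact k) (\<Prod>i\<in>{0..<k}. [:- real i, 1 / v:])" for k
  have pb: "poly (b k) x = (x / v) gchoose k" for k x
    by (simp add: b_def poly_prod gbinomial_prod_rev)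
  have "degree (b k) \<le> k" for k
  proof -
    have "degree (\<Prod>i\<in>{0..<k}. [:- real i, 1 / v:]) \<le> sum (degree \<circ> (\<lambda>i. [:- real i, 1 / v:])) {0..<k}"
      by (rule degree_prod_sum_le) auto
    also have "\<dots> \<le> (\<Sum>i\<in>{0..<k}. 1)" by (intro sum_mono) auto
    finally show ?thesis unfolding b_def using degree_smult_le le_trans by fastforce
  qed
  moreover have "fdiff v (poly (b (Suc k))) = poly (b k)" for k
  proof
    fix x
    have "(x + v) / v = x / v + 1" using assms by (simp add: field_simps)
    then show "fdiff v (poly (b (Suc k))) x = poly (b k) x"
      by (simp add: fdiff_def pb gbinomial_Suc_Suc)
  qed
  then have "(fdiff v ^^ k) (poly (b k)) = (\<lambda>_. 1)" for k
    by (induction k) (auto simp: funpow_swap1 pb)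
  ultimately show ?thesis by blast
qed

text \<open>A Marchaud inequality without remainder: doubling the step preserves the averaged norm of the
  \<open>k\<close>-th difference on the circle but multiplies the difference itself by about \<open>2 ^ k\<close>.\<close>

lemma circle_step:
  assumes p: "0 < p" "p \<le> 1" and "1 \<le> k"
  shows "\<exists>C\<ge>0. \<forall>v>0. \<forall>d. d \<in> borel_measurable borel \<longrightarrow> (\<forall>x. d (x + v) = d x) \<longrightarrow>
     pint p {0..v} d < \<infinity> \<longrightarrow>
     step_avg p k v d \<le>
     ennreal C * step_avg p (Suc k) v d"
proof -
  define a where "a = (2 ^ k :: real) powr p"
  define c where "c = (real k * 2 ^ k) powr p * (2 * real k + 1)"
  \<comment> \<open>The gain of the whole argument: for \<open>1 \<le> k\<close> doubling the step
    enlarges the difference by a factor above 1, while the average norm stays put.\<close>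
  have a1: "1 < a" unfolding a_def using p \<open>1 \<le> k\<close> by (intro gr_one_powr) auto
  have c0: "c \<ge> 0" by (simp add: c_def)
  have "step_avg p k v d \<le>
     ennreal (1 / (a - 1) * c) * step_avg p (Suc k) v d"
    if v: "v > 0" and [measurable]: "d \<in> borel_measurable borel" and per: "\<And>x. d (x + v) = d x"
      and fin: "pint p {0..v} d < \<infinity>" for v d
  proof -
    define G where "G j s = pint p {0..v} (\<lambda>x. (fdiff s ^^ j) d x)" for j s
    have [measurable]: "G j \<in> borel_measurable borel" for j
      unfolding G_def by measurable
    have perd: "(fdiff s ^^ j) d (x + v) = (fdiff s ^^ j) d x" for j s x
      unfolding fdiff_pow_expand
    proof (intro sum.cong refl arg_cong2[where f = "(*)"])
      fix i
      have "x + v + real i * s = x + real i * s + v" by simp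
      then show "d (x + v + real i * s) = d (x + real i * s)" using per by metis
    qed
    \<comment> \<open>The norm is periodic in the step as well, since adding \<open>v\<close> to the
      step moves every node by a multiple of the period. So the doubling map can be applied to the
      step.\<close>
    have Gper: "G j (s + v) = G j s" for j s
    proof -
      have "(fdiff (s + v) ^^ j) d x = (fdiff s ^^ j) d x" for x
        unfolding fdiff_pow_expand
      proof (intro sum.cong refl arg_cong2[where f = "(*)"])
        fix i
        have "x + real i * (s + v) = x + real i * s + of_int (int i) * v" by (simp add: algebra_simps)
        then show "d (x + real i * (s + v)) = d (x + real i * s)"
          using periodic_add_int[of d v "x + real i * s" "int i", OF per] by metis
      qed
      then show ?thesis by (simp add: G_def)
    qed
    have shift: "pint p {0..v} (\<lambda>x. (fdiff s ^^ j) d (x + b)) \<le> G j s" for j s b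
      unfolding G_def by (rule periodic_integral_shift_le) (use v perd in auto)
    have main: "ennreal a * G k s \<le> G k (2 * s) + ennreal c * G (Suc k) s" for s
    proof -
      have pt: "ennreal a * pw p ((fdiff s ^^ k) d x) \<le> pw p ((fdiff (2 * s) ^^ k) d x) +
          pw p (real k * 2 ^ k) * (\<Sum>i\<le>2 * k. pw p ((fdiff s ^^ Suc k) d (x + real i * s)))" for x
      proof -
        define S where "S = (\<Sum>i\<le>2 * k. \<bar>(fdiff s ^^ Suc k) d (x + real i * s)\<bar>)"
        have S0: "S \<ge> 0" unfolding S_def by (intro sum_nonneg) auto
        have "ennreal a * pw p ((fdiff s ^^ k) d x) = pw p (2 ^ k * (fdiff s ^^ k) d x)"
          unfolding pw_mult by (simp add: pw_def a_def)
        also have "\<dots> \<le> pw p (\<bar>(fdiff (2 * s) ^^ k) d x\<bar> + real k * 2 ^ k * S)"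
          using fdiff_double_bound[where s = s and k = k and g = d and x = x] p S0 unfolding S_def[symmetric]
          by (intro pw_mono) auto
        also have "\<dots> \<le> pw p \<bar>(fdiff (2 * s) ^^ k) d x\<bar> + pw p (real k * 2 ^ k) * pw p S"
          unfolding pw_mult[symmetric] by (rule pw_add[OF p])
        also have "pw p S \<le> (\<Sum>i\<le>2 * k. pw p \<bar>(fdiff s ^^ Suc k) d (x + real i * s)\<bar>)"
          unfolding S_def by (rule pw_sum[OF p])
        finally show ?thesis by (simp add: pw_def mult_left_mono)
      qed
      have "ennreal a * G k s = (\<integral>\<^sup>+x\<in>{0..v}. ennreal a * pw p ((fdiff s ^^ k) d x) \<partial>lborel)"
        unfolding G_def by (rule set_nn_integral_cmult[symmetric]) measurable
      also have "\<dots> \<le> (\<integral>\<^sup>+x\<in>{0..v}. (pw p ((fdiff (2 * s) ^^ k) d x) +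
          pw p (real k * 2 ^ k) * (\<Sum>i\<le>2 * k. pw p ((fdiff s ^^ Suc k) d (x + real i * s)))) \<partial>lborel)"
        by (intro set_nn_integral_mono_set pt order_refl)
      also have "\<dots> = G k (2 * s) + pw p (real k * 2 ^ k) *
          (\<Sum>i\<le>2 * k. \<integral>\<^sup>+x\<in>{0..v}. pw p ((fdiff s ^^ Suc k) d (x + real i * s)) \<partial>lborel)"
        unfolding G_def by (simp add: set_nn_integral_add set_nn_integral_cmult set_nn_integral_sum
            del: funpow.simps)
      also have "(\<Sum>i\<le>2 * k. \<integral>\<^sup>+x\<in>{0..v}. pw p ((fdiff s ^^ Suc k) d (x + real i * s)) \<partial>lborel)
          \<le> (\<Sum>i\<le>2 * k. G (Suc k) s)"
        by (intro sum_mono shift)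
      also have "\<dots> = ennreal (2 * real k + 1) * G (Suc k) s"
        by (simp add: ennreal_plus ennreal_mult' ennreal_of_nat_eq_real_of_nat[symmetric] add.commute)
      finally show ?thesis
        by (simp add: c_def pw_def ennreal_mult mult.assoc add_left_mono mult_left_mono)
    qed
    define E where "E j = (\<integral>\<^sup>+s\<in>{0..v}. G j s \<partial>lborel)" for j
    have Efin: "E k < \<infinity>"
    proof -
      have Gb: "G k s \<le> ennreal (2 ^ k) * (of_nat (Suc k) * G 0 0)" for s
      proof -
        have "G k s \<le> (\<integral>\<^sup>+x\<in>{0..v}. ennreal (2 ^ k) * (\<Sum>i\<le>k. pw p (d (x + real i * s))) \<partial>lborel)"
          unfolding G_def by (intro set_nn_integral_mono_set pw_fdiff_le p order_refl)
        also have "\<dots> = ennreal (2 ^ k) * (\<Sum>i\<le>k. \<integral>\<^sup>+x\<in>{0..v}. pw p (d (x + real i * s)) \<partial>lborel)"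
          by (simp add: set_nn_integral_cmult set_nn_integral_sum)
        also have "\<dots> \<le> ennreal (2 ^ k) * (\<Sum>i\<le>k. G 0 0)"
          using shift[of 0 0] by (intro mult_left_mono sum_mono) auto
        finally show ?thesis by simp
      qed
      have "E k \<le> ennreal (2 ^ k) * (of_nat (Suc k) * G 0 0) * ennreal (v - 0)"
        unfolding E_def using v Gb by (intro set_nn_integral_const_mult_le) auto
      also have "\<dots> < \<infinity>"
      proof -
        have "G 0 0 < \<infinity>" using fin by (simp add: G_def)
        then show ?thesis
          by (auto simp: ennreal_mult_less_top of_nat_less_top simp del: of_nat_Suc)
      qed
      finally show ?thesis .
    qed
    \<comment> \<open>Integrating \<open>main\<close> over the step bounds the term with the doubled
      step by \<open>E k\<close> itself, which is then absorbed because \<open>a\<close> exceeds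
      1.\<close>
    have "ennreal a * E k = (\<integral>\<^sup>+s\<in>{0..v}. ennreal a * G k s \<partial>lborel)"
      unfolding E_def by (rule set_nn_integral_cmult[symmetric]) measurable
    also have "\<dots> \<le> (\<integral>\<^sup>+s\<in>{0..v}. (G k (2 * s) + ennreal c * G (Suc k) s) \<partial>lborel)"
      by (intro set_nn_integral_mono_set main order_refl)
    also have "\<dots> = (\<integral>\<^sup>+s\<in>{0..v}. G k (2 * s) \<partial>lborel) + ennreal c * E (Suc k)"
      unfolding E_def by (simp add: set_nn_integral_add set_nn_integral_cmult)
    also have "(\<integral>\<^sup>+s\<in>{0..v}. G k (2 * s) \<partial>lborel) \<le> E k"
      unfolding E_def by (rule periodic_integral_double_le) (use v Gper in auto)
    finally have "ennreal a * E k \<le> E k + ennreal c * E (Suc k)" by (simp add: add_right_mono)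
    from ennreal_absorb[OF Efin this a1]
    show ?thesis using a1 c0 unfolding E_def G_def by (subst ennreal_mult) (auto simp: mult.assoc)
  qed
  moreover have "1 / (a - 1) * c \<ge> 0" using a1 c0 by simp
  ultimately show ?thesis by (intro exI[of _ "1 / (a - 1) * c"]) simp
qed

text \<open>In the base case the constant is a value \<open>d y\<close> that is no worse than the
  mean over all y; after a shift on the circle the double integral of \<open>d x - d y\<close> is
  the averaged first difference. Each higher order follows from \<open>circle_step\<close>, which
  bounds a lower difference by the next one without a remainder.\<close>

lemma circle_const:
  assumes p: "0 < p" "p \<le> 1" and "1 \<le> r"
  shows "\<exists>C\<ge>0. \<forall>v>0. \<forall>d. d \<in> borel_measurable borel \<longrightarrow> (\<forall>x. d (x + v) = d x) \<longrightarrow>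
     pint p {0..v} d < \<infinity> \<longrightarrow>
     (\<exists>c. ennreal v * pint p {0..v} (\<lambda>x. d x - c) \<le>
       ennreal C * step_avg p r v d)"
  using \<open>1 \<le> r\<close>
proof (induction r rule: nat_induct_at_least)
  case base
  have "\<exists>c. ennreal v * pint p {0..v} (\<lambda>x. d x - c) \<le>
       (\<integral>\<^sup>+s\<in>{0..v}. pint p {0..v} (\<lambda>x. fdiff s d x) \<partial>lborel)"
    if v: "v > 0" and [measurable]: "d \<in> borel_measurable borel" and per: "\<And>x. d (x + v) = d x" for v d
  proof -
    obtain y where y: "ennreal (v - 0) * pint p {0..v} (\<lambda>x. d x - d y) \<le>
      (\<integral>\<^sup>+y\<in>{0..v}. pint p {0..v} (\<lambda>x. d x - d y) \<partial>lborel)"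
      using exists_le_average[of "\<lambda>y. \<integral>\<^sup>+x\<in>{0..v}. pw p (d x - d y) \<partial>lborel" 0 v] v by auto
    also have "\<dots> \<le> (\<integral>\<^sup>+y\<in>{0..v}. pint p {0..v} (\<lambda>x. d (x + y) - d y) \<partial>lborel)"
    proof (rule set_nn_integral_mono_set[OF order_refl])
      fix y
      have "d (x + v + y) = d (x + y)" for x
        using per[of "x + y"] by (simp add: algebra_simps)
      then show "pint p {0..v} (\<lambda>x. d x - d y) \<le> pint p {0..v} (\<lambda>x. d (x + y) - d y)"
        using periodic_integral_shift_le[of "\<lambda>x. pw p (d (x + y) - d y)" v "- y"] v by simp
    qed
    also have "\<dots> = (\<integral>\<^sup>+x\<in>{0..v}. pint p {0..v} (\<lambda>y. d (x + y) - d y) \<partial>lborel)"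
      by (rule set_nn_integral_swap) measurable
    finally show ?thesis by (auto simp: fdiff_def add.commute)
  qed
  then show ?case by (intro exI[of _ 1]) simp
next
  case (Suc r)
  obtain C where C: "C \<ge> 0" "\<forall>v>0. \<forall>d. d \<in> borel_measurable borel \<longrightarrow> (\<forall>x. d (x + v) = d x) \<longrightarrow>
     pint p {0..v} d < \<infinity> \<longrightarrow>
     (\<exists>c. ennreal v * pint p {0..v} (\<lambda>x. d x - c) \<le>
       ennreal C * step_avg p r v d)"
    using Suc.IH by (elim exE conjE)
  obtain D where D: "D \<ge> 0" "\<forall>v>0. \<forall>d. d \<in> borel_measurable borel \<longrightarrow> (\<forall>x. d (x + v) = d x) \<longrightarrow>
     pint p {0..v} d < \<infinity> \<longrightarrow>
     step_avg p r v d \<le>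
     ennreal D * step_avg p (Suc r) v d"
    using circle_step[OF p Suc.hyps(1)] by (elim exE conjE)
  show ?case
  proof (rule exI[of _ "C * D"], intro conjI allI impI)
    show "0 \<le> C * D" using C D by simp
    fix v :: real and d :: "real \<Rightarrow> real"
    assume *: "0 < v" "d \<in> borel_measurable borel" "\<forall>x. d (x + v) = d x"
      "pint p {0..v} d < \<infinity>"
    obtain c where "ennreal v * pint p {0..v} (\<lambda>x. d x - c) \<le>
       ennreal C * step_avg p r v d"
      using C(2)[rule_format, OF *(1,2) *(3)[rule_format] *(4)] by (elim exE)
    also have "\<dots> \<le> ennreal C * (ennreal D *
       step_avg p (Suc r) v d)"
      by (intro mult_left_mono D(2)[rule_format, OF *(1,2) *(3)[rule_format] *(4)]) auto
    finally show "\<exists>c. ennreal v * pint p {0..v} (\<lambda>x. d x - c) \<le>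
       ennreal (C * D) * step_avg p (Suc r) v d"
      using C(1) D(1) by (auto simp: ennreal_mult mult.assoc)
  qed
qed

lemma fdiff_pow_Suc_inner: "(fdiff v ^^ Suc k) g x = (fdiff v ^^ k) g (x + v) - (fdiff v ^^ k) g x"
  by (simp add: fdiff_def)

lemma nn_integral_lborel_shift:
  fixes F :: "real \<Rightarrow> ennreal"
  assumes "F \<in> borel_measurable borel"
  shows "(\<integral>\<^sup>+x. F (x + c) \<partial>lborel) = (\<integral>\<^sup>+x. F x \<partial>lborel)"
  using nn_integral_real_affine[OF assms, of 1 c] by (simp add: add.commute)

lemma set_nn_integral_translate_le:
  fixes F :: "real \<Rightarrow> ennreal"
  assumes "F \<in> borel_measurable borel" "{a + c..b + c} \<subseteq> S"
  shows "(\<integral>\<^sup>+x\<in>{a..b}. F (x + c) \<partial>lborel) \<le> (\<integral>\<^sup>+x\<in>S. F x \<partial>lborel)"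
  unfolding set_nn_integral_translate[OF assms(1)]
  using assms(2) by (rule set_nn_integral_mono_set) simp

text \<open>In contrast to \<open>step_avg\<close>, all nodes are kept inside the unit interval,
  where the function is given.\<close>

abbreviation diff_avg :: "real \<Rightarrow> nat \<Rightarrow> (real \<Rightarrow> real) \<Rightarrow> ennreal" where
  "diff_avg p r g \<equiv> (\<integral>\<^sup>+s\<in>{0..1 / real r}. pint p {0..1 - real r * s} (\<lambda>x. (fdiff s ^^ r) g x) \<partial>lborel)"

text \<open>One descent in the order of the difference. If the difference of order
  \<open>Suc j\<close> and fixed step \<open>v\<close> is small, then \<open>d\<close>, the one of
  order \<open>j\<close>, is nearly \<open>v\<close>-periodic: it is close to the periodic extension
  \<open>e\<close> of its restriction to one period, and on the circle \<open>e\<close> is nearly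
  constant. The lower bound on \<open>v\<close> limits the number of periods in the unit interval to
  \<open>4 * r\<close>; the upper bound leaves room for a point of the first period,
  \<open>r\<close> steps of length at most \<open>v\<close> and \<open>j\<close> further steps
  \<open>v\<close>.\<close>

lemma whitney_step_aux:
  fixes g :: "real \<Rightarrow> real" and C0 :: real
  assumes p: "0 < p" "p \<le> 1" and r: "1 \<le> r"
  assumes v: "1 / (4 * real r) \<le> v" "v \<le> 1 / (2 * real r)" and j: "j < r"
  assumes g[measurable]: "g \<in> borel_measurable borel"
    and fin: "pint p {0..1} g < \<infinity>"
  assumes C0: "C0 \<ge> 0" "\<forall>v>0. \<forall>d. d \<in> borel_measurable borel \<longrightarrow> (\<forall>x. d (x + v) = d x) \<longrightarrow>
     pint p {0..v} d < \<infinity> \<longrightarrow>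
     (\<exists>c. ennreal v * pint p {0..v} (\<lambda>x. d x - c) \<le>
       ennreal C0 * step_avg p r v d)"
  defines "K \<equiv> 4 * r"
  defines "A \<equiv> pint p {0..1 - real (Suc j) * v} (\<lambda>x. (fdiff v ^^ Suc j) g x)"
  shows "\<exists>c. pint p {0..1 - real j * v} (\<lambda>x. (fdiff v ^^ j) g x - c) \<le>
    of_nat K * A + of_nat (Suc K) * (of_nat K * (ennreal C0 *
      (ennreal (2 ^ r) * (of_nat r * diff_avg p r g) + ennreal (2 ^ r) * (of_nat (Suc r) * (of_nat K * A)))))"
proof -
  have v0: "v > 0" using v(1) r by (smt (verit) divide_pos_pos of_nat_0_less_iff zero_less_one mult_pos_pos less_le_trans)
  have Kv: "real K * v \<ge> 1" using v(1) r by (simp add: K_def field_simps)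
  have rv: "2 * real r * v \<le> 1" using v(2) r by (simp add: field_simps)
  have jr: "real j + 1 \<le> real r" using j by linarith
  have mulv: "x * v \<le> y * v" if "x \<le> y" for x y using that v0 by simp
  have jv: "(real r + real j + 1) * v \<le> 1" using mulv[of "real r + real j + 1" "2 * real r"] jr rv by linarith
  have jv': "real r * v + real j * v + v \<le> 1" using jv by (simp add: algebra_simps)
  have nv: "0 \<le> real i * v" for i using v0 by simp
  define B where "B = 1 - real j * v"
  define d where "d = (fdiff v ^^ j) g"
  define e where "e x = d (v * frac (x / v))" for x
  have [measurable]: "d \<in> borel_measurable borel" unfolding d_def by measurable
  have [measurable]: "e \<in> borel_measurable borel" unfolding e_def frac_def by measurable
  have e_per: "e (x + v) = e x" for x
  proof -
    have "(x + v) / v = x / v + 1" using v0 by (simp add: field_simps)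
    then show ?thesis by (simp add: e_def frac_def)
  qed
  have e_eq: "e x = d x" if "0 \<le> x" "x < v" for x
  proof -
    have "\<lfloor>x / v\<rfloor> = 0" using that v0 by (intro floor_unique) auto
    then show ?thesis using v0 by (simp add: e_def frac_def)
  qed
  \<comment> \<open>The cutoff is part of \<open>H\<close>, so that its translates may be integrated
    over the whole line.\<close>
  define H where "H z = pw p ((fdiff v ^^ Suc j) g z) * indicator {0..1 - real (Suc j) * v} z" for z
  have [measurable]: "H \<in> borel_measurable borel" unfolding H_def by measurable
  have de: "pw p (d y - e y) \<le> (\<Sum>l\<in>{1..K}. H (y - real l * v))" if y: "0 \<le> y" "y \<le> B" for y
  proof -
    define i where "i = nat \<lfloor>y / v\<rfloor>"
    define y0 where "y0 = v * frac (y / v)"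
    have "y = y0 + of_int \<lfloor>y / v\<rfloor> * v" using v0 by (simp add: y0_def frac_def field_simps)
    moreover have "0 \<le> \<lfloor>y / v\<rfloor>" using y v0 by simp
    ultimately have yi: "y = y0 + real i * v" by (simp add: i_def)
    have y0: "0 \<le> y0" using v0 by (simp add: y0_def)
    have "real i * v \<le> real K * v" using Kv y yi y0 v0 B_def by (smt (verit) mult_nonneg_nonneg of_nat_0_le_iff)
    then have iK: "i \<le> K" using v0 by simp
    \<comment> \<open>A point and its representative in the first period are a whole number of steps
      \<open>v\<close> apart, so \<open>d - e\<close> telescopes into differences of order
      \<open>Suc j\<close>.\<close>
    have tele: "d y - d (y - real m * v) = (\<Sum>l\<in>{1..m}. (fdiff v ^^ Suc j) g (y - real l * v))" for m
    proof (induction m)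
      case (Suc m)
      have "(fdiff v ^^ Suc j) g (y - real (Suc m) * v) = d (y - real m * v) - d (y - real (Suc m) * v)"
        unfolding fdiff_pow_Suc_inner d_def by (simp add: algebra_simps)
      then show ?case using Suc by simp
    qed simp
    have "y - real i * v = y0" using yi by simp
    then have "e y = d (y - real i * v)" by (simp add: e_def y0_def)
    then have "pw p (d y - e y) \<le> (\<Sum>l\<in>{1..i}. pw p ((fdiff v ^^ Suc j) g (y - real l * v)))"
      unfolding tele[of i, symmetric] using tele[of i] pw_sum[OF p] by metis
    also have "\<dots> \<le> (\<Sum>l\<in>{1..i}. H (y - real l * v))"
    proof (intro sum_mono)
      fix l assume l: "l \<in> {1..i}"
      have "1 * v \<le> real l * v" "real l * v \<le> real i * v" using l mulv[of 1 "real l"] mulv[of "real l" "real i"] by auto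
      then have "y - real l * v \<in> {0..1 - real (Suc j) * v}"
        using yi y0 y B_def by (auto simp: algebra_simps)
      then show "pw p ((fdiff v ^^ Suc j) g (y - real l * v)) \<le> H (y - real l * v)"
        unfolding H_def by simp
    qed
    also have "\<dots> \<le> (\<Sum>l\<in>{1..K}. H (y - real l * v))"
      using iK by (intro sum_mono2) auto
    finally show ?thesis .
  qed
  define D where "D = pint p {0..B} (\<lambda>x. d x - e x)"
  have D: "D \<le> of_nat K * A"
  proof -
    have "D \<le> (\<integral>\<^sup>+y. (\<Sum>l\<in>{1..K}. H (y - real l * v)) \<partial>lborel)"
      unfolding D_def using de by (intro nn_integral_mono) (auto simp: indicator_def)
    also have "\<dots> = (\<Sum>l\<in>{1..K}. \<integral>\<^sup>+y. H (y - real l * v) \<partial>lborel)"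
      by (intro nn_integral_sum) measurable
    also have "\<dots> = (\<Sum>l\<in>{1..K}. \<integral>\<^sup>+y. H y \<partial>lborel)"
    proof (intro sum.cong refl)
      fix l
      show "(\<integral>\<^sup>+y. H (y - real l * v) \<partial>lborel) = (\<integral>\<^sup>+y. H y \<partial>lborel)"
        using nn_integral_lborel_shift[of H "- (real l * v)"] by simp
    qed
    also have "\<dots> = of_nat K * A" by (simp add: H_def A_def)
    finally show ?thesis .
  qed
  have e_fin: "pint p {0..v} e < \<infinity>"
  proof -
    define I where "I = pint p {0..1} g"
    have "pint p {0..v} e = pint p {0..v} d"
    proof (rule nn_integral_cong_AE)
      show "AE x in lborel. pw p (e x) * indicator {0..v} x = pw p (d x) * indicator {0..v} x"
        using AE_lborel_singleton[of v]
      proof eventually_elim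
        case (elim x)
        then show ?case using e_eq[of x] by (cases "0 \<le> x \<and> x < v") auto
      qed
    qed
    also have "\<dots> \<le> (\<integral>\<^sup>+x\<in>{0..v}. ennreal (2 ^ j) * (\<Sum>i\<le>j. pw p (g (x + real i * v))) \<partial>lborel)"
      unfolding d_def by (rule set_nn_integral_mono_set[OF order_refl]) (rule pw_fdiff_le[OF p])
    also have "\<dots> = ennreal (2 ^ j) * (\<Sum>i\<le>j. \<integral>\<^sup>+x\<in>{0..v}. pw p (g (x + real i * v)) \<partial>lborel)"
      by (simp add: set_nn_integral_cmult set_nn_integral_sum)
    also have "\<dots> \<le> ennreal (2 ^ j) * (\<Sum>i\<le>j. I)"
    proof (intro mult_left_mono sum_mono)
      fix i assume "i \<in> {..j}"
      then have "real i * v \<le> real j * v" by (intro mulv) auto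
      then have "v + real i * v \<le> 1" using jv' nv[of r] by linarith
      then have "{0 + real i * v..v + real i * v} \<subseteq> {0..1}" using nv[of i] by auto
      then show "pint p {0..v} (\<lambda>x. g (x + real i * v)) \<le> I"
        unfolding I_def
        by (intro set_nn_integral_translate_le[of "\<lambda>x. pw p (g x)"]) measurable
    qed auto
    also have "\<dots> < \<infinity>"
      using fin unfolding I_def[symmetric] by (auto simp: ennreal_mult_less_top of_nat_less_top simp del: of_nat_Suc)
    finally show ?thesis .
  qed
  define E where "E = diff_avg p r g"
  \<comment> \<open>Differences with different steps commute, so the \<open>r\<close>-th difference
    of \<open>d\<close> is a combination of at most \<open>r\<close> translates of the
    \<open>r\<close>-th difference of \<open>g\<close>.\<close>
  have ds: "pint p {0..v} (\<lambda>x. (fdiff s ^^ r) d x) \<le>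
      ennreal (2 ^ r) * (of_nat r * pint p {0..1 - real r * s} (\<lambda>x. (fdiff s ^^ r) g x))"
    if s: "0 \<le> s" "s \<le> v" for s
  proof -
    define J where "J = pint p {0..1 - real r * s} (\<lambda>x. (fdiff s ^^ r) g x)"
    define h where "h = (fdiff s ^^ r) g"
    have [measurable]: "h \<in> borel_measurable borel" unfolding h_def by measurable
    have "(fdiff s ^^ r) d = (fdiff v ^^ j) h" unfolding d_def h_def by (rule fdiff_pow_commute)
    then have "pint p {0..v} (\<lambda>x. (fdiff s ^^ r) d x) \<le>
       (\<integral>\<^sup>+x\<in>{0..v}. ennreal (2 ^ j) * (\<Sum>i\<le>j. pw p (h (x + real i * v))) \<partial>lborel)"
      by (simp only:) (rule set_nn_integral_mono_set[OF order_refl], rule pw_fdiff_le[OF p])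
    also have "\<dots> = ennreal (2 ^ j) * (\<Sum>i\<le>j. \<integral>\<^sup>+x\<in>{0..v}. pw p (h (x + real i * v)) \<partial>lborel)"
      by (simp add: set_nn_integral_cmult set_nn_integral_sum)
    also have "\<dots> \<le> ennreal (2 ^ j) * (\<Sum>i\<le>j. J)"
    proof (intro mult_left_mono sum_mono)
      fix i assume "i \<in> {..j}"
      then have "real i * v \<le> real j * v" by (intro mulv) auto
      moreover have "real r * s \<le> real r * v" using s by (intro mult_left_mono) auto
      ultimately have "v + real i * v \<le> 1 - real r * s" using jv' by linarith
      then have "{0 + real i * v..v + real i * v} \<subseteq> {0..1 - real r * s}" using nv[of i] by auto
      then show "pint p {0..v} (\<lambda>x. h (x + real i * v)) \<le> J"
        unfolding J_def h_def[symmetric]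
        by (intro set_nn_integral_translate_le[of "\<lambda>x. pw p (h x)"]) measurable
    qed auto
    also have "\<dots> \<le> ennreal (2 ^ r) * (of_nat r * J)"
    proof (rule mult_mono)
      show "ennreal (2 ^ j) \<le> ennreal (2 ^ r)" using j by (intro ennreal_leI power_increasing) auto
      have "of_nat (Suc j) * J \<le> of_nat r * J"
        using j by (intro mult_right_mono of_nat_mono) auto
      then show "(\<Sum>i\<le>j. J) \<le> of_nat r * J" by simp
    qed auto
    finally show ?thesis by (simp add: J_def)
  qed
  \<comment> \<open>For the correction \<open>d - e\<close> the differences are bounded trivially:
    it is small itself.\<close>
  have es: "pint p {0..v} (\<lambda>x. (fdiff s ^^ r) (\<lambda>x. d x - e x) x) \<le>
      ennreal (2 ^ r) * (of_nat (Suc r) * D)"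
    if s: "0 \<le> s" "s \<le> v" for s
  proof -
    have "pint p {0..v} (\<lambda>x. (fdiff s ^^ r) (\<lambda>x. d x - e x) x) \<le>
       (\<integral>\<^sup>+x\<in>{0..v}. ennreal (2 ^ r) * (\<Sum>i\<le>r. pw p (d (x + real i * s) - e (x + real i * s))) \<partial>lborel)"
      by (rule set_nn_integral_mono_set[OF order_refl]) (rule pw_fdiff_le[OF p])
    also have "\<dots> = ennreal (2 ^ r) * (\<Sum>i\<le>r. \<integral>\<^sup>+x\<in>{0..v}. pw p (d (x + real i * s) - e (x + real i * s)) \<partial>lborel)"
      by (simp add: set_nn_integral_cmult set_nn_integral_sum)
    also have "\<dots> \<le> ennreal (2 ^ r) * (\<Sum>i\<le>r. D)"
    proof (intro mult_left_mono sum_mono)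
      fix i assume "i \<in> {..r}"
      then have "real i * s \<le> real r * v" using s by (intro mult_mono) auto
      then have "{0 + real i * s..v + real i * s} \<subseteq> {0..B}"
        using jv v0 s by (auto simp: algebra_simps B_def)
      then show "pint p {0..v} (\<lambda>x. d (x + real i * s) - e (x + real i * s)) \<le> D"
        unfolding D_def
        by (intro set_nn_integral_translate_le[of "\<lambda>x. pw p (d x - e x)"]) measurable
    qed auto
    finally show ?thesis by simp
  qed
  have Er: "step_avg p r v e \<le>
      ennreal (2 ^ r) * (of_nat r * E) + ennreal (2 ^ r) * (of_nat (Suc r) * (of_nat K * A))"
  proof -
    define J where "J s = pint p {0..1 - real r * s} (\<lambda>x. (fdiff s ^^ r) g x)" for s
    have Jm[measurable]: "J \<in> borel_measurable borel"
    proof -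
      have "J = (\<lambda>s. \<integral>\<^sup>+x. pw p ((fdiff s ^^ r) g x) * (if 0 \<le> x \<and> x \<le> 1 - real r * s then 1 else 0) \<partial>lborel)"
        unfolding J_def by (intro ext nn_integral_cong) (auto simp: indicator_def)
      then show ?thesis by simp
    qed
    have pt: "pint p {0..v} (\<lambda>x. (fdiff s ^^ r) e x) \<le>
       ennreal (2 ^ r) * (of_nat r * J s) + ennreal (2 ^ r) * (of_nat (Suc r) * D)" if s: "0 \<le> s" "s \<le> v" for s
    proof -
      have "pint p {0..v} (\<lambda>x. (fdiff s ^^ r) e x) \<le>
        (\<integral>\<^sup>+x\<in>{0..v}. (pw p ((fdiff s ^^ r) d x) + pw p ((fdiff s ^^ r) (\<lambda>x. d x - e x) x)) \<partial>lborel)"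
      proof (rule set_nn_integral_mono_set[OF order_refl])
        fix x
        have "(fdiff s ^^ r) e x = (fdiff s ^^ r) d x - (fdiff s ^^ r) (\<lambda>x. d x - e x) x"
          by (simp add: fdiff_pow_diff)
        then show "pw p ((fdiff s ^^ r) e x) \<le> pw p ((fdiff s ^^ r) d x) + pw p ((fdiff s ^^ r) (\<lambda>x. d x - e x) x)"
          by (simp only: pw_diff[OF p])
      qed
      also have "\<dots> = pint p {0..v} (\<lambda>x. (fdiff s ^^ r) d x) +
           pint p {0..v} (\<lambda>x. (fdiff s ^^ r) (\<lambda>x. d x - e x) x)"
        by (rule set_nn_integral_add) measurable
      also have "\<dots> \<le> ennreal (2 ^ r) * (of_nat r * J s) + ennreal (2 ^ r) * (of_nat (Suc r) * D)"
        unfolding J_def by (intro add_mono ds es s)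
      finally show ?thesis .
    qed
    have "step_avg p r v e \<le>
      (\<integral>\<^sup>+s\<in>{0..v}. (ennreal (2 ^ r) * (of_nat r * J s) + ennreal (2 ^ r) * (of_nat (Suc r) * D)) \<partial>lborel)"
      by (rule set_nn_integral_mono_set[OF order_refl], simp only: atLeastAtMost_iff, elim conjE, rule pt)
    also have "\<dots> = ennreal (2 ^ r) * (of_nat r * (\<integral>\<^sup>+s\<in>{0..v}. J s \<partial>lborel)) +
        (\<integral>\<^sup>+s\<in>{0..v}. ennreal (2 ^ r) * (of_nat (Suc r) * D) \<partial>lborel)"
      by (simp add: set_nn_integral_add set_nn_integral_cmult del: of_nat_Suc)
    also have "\<dots> \<le> ennreal (2 ^ r) * (of_nat r * E) + ennreal (2 ^ r) * (of_nat (Suc r) * D)"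
    proof (intro add_mono mult_left_mono)
      have "{0..v} \<subseteq> {0..1 / real r}" using v(2) r by (auto simp: field_simps intro: order_trans)
      then show "(\<integral>\<^sup>+s\<in>{0..v}. J s \<partial>lborel) \<le> E"
        unfolding E_def J_def[symmetric] by (intro set_nn_integral_mono_set) auto
      have "(\<integral>\<^sup>+s\<in>{0..v}. ennreal (2 ^ r) * (of_nat (Suc r) * D) \<partial>lborel)
         \<le> ennreal (2 ^ r) * (of_nat (Suc r) * D) * ennreal (v - 0)"
        using v0 by (intro set_nn_integral_const_mult_le) auto
      also have "\<dots> \<le> ennreal (2 ^ r) * (of_nat (Suc r) * D) * ennreal 1"
        using rv r mulv[of 1 "2 * real r"] by (intro mult_left_mono ennreal_leI) auto
      finally show "(\<integral>\<^sup>+s\<in>{0..v}. ennreal (2 ^ r) * (of_nat (Suc r) * D) \<partial>lborel)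
         \<le> ennreal (2 ^ r) * (of_nat (Suc r) * D)" by simp
    qed auto
    also have "\<dots> \<le> ennreal (2 ^ r) * (of_nat r * E) + ennreal (2 ^ r) * (of_nat (Suc r) * (of_nat K * A))"
      by (intro add_mono mult_left_mono D) auto
    finally show ?thesis .
  qed
  obtain c where c: "ennreal v * pint p {0..v} (\<lambda>x. e x - c) \<le>
       ennreal C0 * step_avg p r v e"
    using C0(2)[rule_format, OF v0 _ e_per e_fin] by auto
  define Y where "Y = ennreal C0 * (ennreal (2 ^ r) * (of_nat r * E) + ennreal (2 ^ r) * (of_nat (Suc r) * (of_nat K * A)))"
  define X where "X = pint p {0..v} (\<lambda>x. e x - c)"
  have vX: "ennreal v * X \<le> Y"
    unfolding X_def Y_def using c mult_left_mono[OF Er, of "ennreal C0"] by (meson order_trans zero_le)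
  have X: "X \<le> of_nat K * Y"
  proof -
    have "X = ennreal 1 * X" by simp
    also have "\<dots> \<le> ennreal (real K * v) * X" using Kv by (intro mult_right_mono ennreal_leI) auto
    also have "\<dots> = of_nat K * (ennreal v * X)"
      using v0 by (simp add: ennreal_mult ennreal_of_nat_eq_real_of_nat mult.assoc)
    also have "\<dots> \<le> of_nat K * Y" using vX by (intro mult_left_mono) auto
    finally show ?thesis .
  qed
  have "pint p {0..B} (\<lambda>x. d x - c) \<le> (\<integral>\<^sup>+x\<in>{0..B}. (pw p (d x - e x) + pw p (e x - c)) \<partial>lborel)"
  proof (rule set_nn_integral_mono_set[OF order_refl])
    fix x show "pw p (d x - c) \<le> pw p (d x - e x) + pw p (e x - c)"
      using pw_add[OF p, of "d x - e x" "e x - c"] by simp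
  qed
  also have "\<dots> = D + pint p {0..B} (\<lambda>x. e x - c)"
    unfolding D_def by (rule set_nn_integral_add) measurable
  also have "pint p {0..B} (\<lambda>x. e x - c) \<le> of_nat (Suc K) * X"
  proof -
    have "{0..B} \<subseteq> (\<Union>i\<in>{..K}. {0 + real i * v..v + real i * v})"
    proof
      fix y assume "y \<in> {0..B}"
      then have y: "0 \<le> y" "y \<le> 1" using v0 by (auto simp: B_def intro: order_trans)
      define i where "i = nat \<lfloor>y / v\<rfloor>"
      have "0 \<le> \<lfloor>y / v\<rfloor>" using y v0 by simp
      then have i: "real i \<le> y / v" "y / v < real i + 1" unfolding i_def by linarith+
      then have i': "real i * v \<le> y" "y < (real i + 1) * v" using v0 by (simp_all add: field_simps)
      have "real i * v \<le> real K * v" using i'(1) y Kv by linarith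
      then have "i \<le> K" using v0 by simp
      then show "y \<in> (\<Union>i\<in>{..K}. {0 + real i * v..v + real i * v})" using i'
        by (auto intro!: bexI[of _ i] simp: algebra_simps)
    qed
    then have "pint p {0..B} (\<lambda>x. e x - c) \<le>
        (\<integral>\<^sup>+x\<in>(\<Union>i\<in>{..K}. {0 + real i * v..v + real i * v}). pw p (e x - c) \<partial>lborel)"
      by (rule set_nn_integral_mono_set) simp
    also have "\<dots> \<le> (\<Sum>i\<le>K. \<integral>\<^sup>+x\<in>{0 + real i * v..v + real i * v}. pw p (e x - c) \<partial>lborel)"
      by (rule set_nn_integral_UN_le) auto
    also have "\<dots> = (\<Sum>i\<le>K. X)"
    proof (intro sum.cong refl)
      fix i
      have "e (x + real i * v) = e x" for x
        using periodic_add_int[of e v x "int i"] e_per by simp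
      then show "pint p {0 + real i * v..v + real i * v} (\<lambda>x. e x - c) = X"
        unfolding X_def by (subst set_nn_integral_translate[symmetric]) auto
    qed
    finally show ?thesis by simp
  qed
  also have "\<dots> \<le> of_nat (Suc K) * (of_nat K * Y)" by (intro mult_left_mono X) auto
  finally show ?thesis using add_right_mono[OF D, of "of_nat (Suc K) * (of_nat K * Y)"]
    unfolding B_def d_def Y_def E_def by (intro exI[of _ c]) (meson order_trans add_left_mono)
qed


text \<open>One step \<open>v\<close> is fixed whose \<open>r\<close>-th difference is controlled by
  the average over all steps. Descending from order \<open>r\<close> to order 0, the constant found
  at each order is removed by a multiple of the binomial polynomial of that order. The averaged
  \<open>r\<close>-th difference is blind to polynomials of degree below \<open>r\<close>, so the
  same right side serves at every stage.\<close>

lemma whitney_unit: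
  assumes p: "0 < p" "p \<le> 1" and r: "1 \<le> r"
  shows "\<exists>C\<ge>0. \<forall>f. f \<in> borel_measurable borel \<longrightarrow> pint p {0..1} f < \<infinity> \<longrightarrow>
     (\<exists>q. degree q < r \<and> pint p {0..1} (\<lambda>x. f x - poly q x) \<le> ennreal C * diff_avg p r f)"
proof -
  obtain C0 where C0: "C0 \<ge> 0" "\<forall>v>0. \<forall>d. d \<in> borel_measurable borel \<longrightarrow> (\<forall>x. d (x + v) = d x) \<longrightarrow>
     pint p {0..v} d < \<infinity> \<longrightarrow>
     (\<exists>c. ennreal v * pint p {0..v} (\<lambda>x. d x - c) \<le>
       ennreal C0 * step_avg p r v d)"
    using circle_const[OF p r] by (elim exE conjE)
  define K where "K = 4 * r"
  define c1 where "c1 = real K"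
  \<comment> \<open>The growth of the constant in one descent. It is iterated from
    \<open>4 * r\<close>, the reciprocal length of the interval from which \<open>v\<close> is
    chosen.\<close>
  define N where "N y = c1 * y + (c1 + 1) * (c1 * (C0 * (2 ^ r * real r + 2 ^ r * ((real r + 1) * (c1 * y)))))" for y
  have N0: "N y \<ge> 0" if "y \<ge> 0" for y unfolding N_def c1_def using that C0(1) by simp
  define Cm where "Cm m = (N ^^ m) (real (4 * r))" for m
  have Cm0: "Cm m \<ge> 0" for m by (induction m) (auto simp: Cm_def N0)
  have "\<exists>q. degree q < r \<and> pint p {0..1} (\<lambda>x. f x - poly q x) \<le> ennreal (Cm r) * diff_avg p r f"
    if [measurable]: "f \<in> borel_measurable borel" and fin: "pint p {0..1} f < \<infinity>" for f
  proof -
    define E where "E = diff_avg p r f"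
    define J where "J s = pint p {0..1 - real r * s} (\<lambda>x. (fdiff s ^^ r) f x)" for s
    have Jm[measurable]: "J \<in> borel_measurable borel"
    proof -
      have "J = (\<lambda>s. \<integral>\<^sup>+x. pw p ((fdiff s ^^ r) f x) * (if 0 \<le> x \<and> x \<le> 1 - real r * s then 1 else 0) \<partial>lborel)"
        unfolding J_def by (intro ext nn_integral_cong) (auto simp: indicator_def)
      then show ?thesis by simp
    qed
    have lt: "1 / (4 * real r) < 1 / (2 * real r)" using r by (simp add: field_simps)
    obtain v where v: "1 / (4 * real r) \<le> v" "v \<le> 1 / (2 * real r)"
      and "ennreal (1 / (2 * real r) - 1 / (4 * real r)) * J v \<le> (\<integral>\<^sup>+s\<in>{1 / (4 * real r)..1 / (2 * real r)}. J s \<partial>lborel)"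
      using exists_le_average[OF Jm lt] by auto
    note this(3)
    also have "1 / (2 * real r) - 1 / (4 * real r) = 1 / real (4 * r)" using r by (simp add: field_simps)
    also have "(\<integral>\<^sup>+s\<in>{1 / (4 * real r)..1 / (2 * real r)}. J s \<partial>lborel) \<le> E"
      unfolding E_def J_def[symmetric] using r by (intro set_nn_integral_mono_set) (auto simp: field_simps)
    finally have "ennreal (real (4 * r)) * (ennreal (1 / real (4 * r)) * J v) \<le> ennreal (real (4 * r)) * E"
      by (rule mult_left_mono) simp
    then have Jv: "J v \<le> ennreal (real (4 * r)) * E"
      using r by (subst (asm) mult.assoc[symmetric], subst (asm) ennreal_mult[symmetric]) auto
    have v0: "v > 0" using v(1) r by (smt (verit) divide_pos_pos of_nat_0_less_iff zero_less_one mult_pos_pos less_le_trans)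
    have "\<exists>q. degree q < r \<and> pint p {0..1 - real (r - m) * v} (\<lambda>x. (fdiff v ^^ (r - m)) (\<lambda>x. f x - poly q x) x)
         \<le> ennreal (Cm m) * E" if "m \<le> r" for m
      using that
    proof (induction m)
      case 0
      show ?case using Jv r by (intro exI[of _ 0]) (simp add: Cm_def J_def)
    next
      case (Suc m)
      then obtain q where q: "degree q < r"
        "pint p {0..1 - real (r - m) * v} (\<lambda>x. (fdiff v ^^ (r - m)) (\<lambda>x. f x - poly q x) x) \<le> ennreal (Cm m) * E"
        by auto
      define j where "j = r - Suc m"
      have j: "j < r" "Suc j = r - m" using Suc.prems by (auto simp: j_def)
      define g where "g x = f x - poly q x" for x
      have [measurable]: "poly q \<in> borel_measurable borel"
        by (intro borel_measurable_continuous_onI continuous_intros)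
      have [measurable]: "g \<in> borel_measurable borel" unfolding g_def by measurable
      have gfin: "pint p {0..1} g < \<infinity>"
      proof -
        have "bounded (poly q ` {0..1})"
          by (intro compact_imp_bounded compact_continuous_image continuous_intros) auto
        then obtain M where "\<forall>y\<in>poly q ` {0..1}. norm y \<le> M" unfolding bounded_iff ..
        then have M: "\<bar>poly q x\<bar> \<le> M" if "x \<in> {0..1}" for x using that by auto
        have "pint p {0..1} g \<le> (\<integral>\<^sup>+x\<in>{0..1}. (pw p (f x) + pw p M) \<partial>lborel)"
        proof (rule set_nn_integral_mono_set[OF order_refl])
          fix x :: real assume "x \<in> {0..1}"
          have "pw p (g x) \<le> pw p (f x) + pw p (poly q x)" unfolding g_def by (rule pw_diff[OF p])
          also have "pw p (poly q x) \<le> pw p M" using M[OF \<open>x \<in> {0..1}\<close>] p by (intro pw_mono) auto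
          finally show "pw p (g x) \<le> pw p (f x) + pw p M" by (simp add: add_left_mono)
        qed
        also have "\<dots> = pint p {0..1} f + (\<integral>\<^sup>+x\<in>{0..1::real}. pw p M \<partial>lborel)"
          by (rule set_nn_integral_add) auto
        also have "\<dots> < \<infinity>" using fin pw_less_top(1)[of p M] by (simp add: nn_integral_cmult)
        finally show ?thesis .
      qed
      \<comment> \<open>The polynomial subtracted so far does not change the averaged
        difference.\<close>
      have gE: "diff_avg p r g = E"
        unfolding E_def
      proof (intro nn_integral_cong)
        fix s :: real
        have "(fdiff s ^^ r) g x = (fdiff s ^^ r) f x" if "0 \<le> s" for x
          unfolding g_def fdiff_pow_diff using fdiff_poly_eq_0[OF that q(1)] by simp
        then show "pint p {0..1 - real r * s} (\<lambda>x. (fdiff s ^^ r) g x) * indicator {0..1 / real r} s =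
           pint p {0..1 - real r * s} (\<lambda>x. (fdiff s ^^ r) f x) * indicator {0..1 / real r} s"
          by (cases "0 \<le> s") auto
      qed
      define A where "A = pint p {0..1 - real (Suc j) * v} (\<lambda>x. (fdiff v ^^ Suc j) g x)"
      have A: "A \<le> ennreal (Cm m) * E" using q(2) unfolding A_def j(2) g_def .
      obtain c where c: "pint p {0..1 - real j * v} (\<lambda>x. (fdiff v ^^ j) g x - c) \<le>
        of_nat K * A + of_nat (Suc K) * (of_nat K * (ennreal C0 *
          (ennreal (2 ^ r) * (of_nat r * E) + ennreal (2 ^ r) * (of_nat (Suc r) * (of_nat K * A)))))"
        using whitney_step_aux[OF p r v j(1) \<open>g \<in> _\<close> gfin C0] unfolding A_def K_def gE by (elim exE)
      also have "\<dots> \<le> of_nat K * (ennreal (Cm m) * E) + of_nat (Suc K) * (of_nat K * (ennreal C0 *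
          (ennreal (2 ^ r) * (of_nat r * E) + ennreal (2 ^ r) * (of_nat (Suc r) * (of_nat K * (ennreal (Cm m) * E))))))"
        by (intro add_mono mult_left_mono A order_refl) auto
      also have "\<dots> = ennreal (N (Cm m)) * E"
      proof -
        have e: "of_nat n = ennreal (real n)" for n by (simp add: ennreal_of_nat_eq_real_of_nat)
        show ?thesis unfolding N_def c1_def e
          using C0(1) Cm0[of m] by (simp add: ennreal_plus ennreal_mult distrib_right distrib_left mult_ac add_ac)
      qed
      finally have c': "pint p {0..1 - real j * v} (\<lambda>x. (fdiff v ^^ j) g x - c) \<le> ennreal (Cm (Suc m)) * E"
        by (simp add: Cm_def)
      obtain b where b: "degree b \<le> j" "(fdiff v ^^ j) (poly b) = (\<lambda>_. 1)"
        using binomial_poly[of v j] v0 by auto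
      have "(fdiff v ^^ j) (\<lambda>x. f x - poly (q + smult c b) x) = (\<lambda>x. (fdiff v ^^ j) g x - c)"
      proof -
        have "(\<lambda>x. f x - poly (q + smult c b) x) = (\<lambda>x. g x - c * poly b x)" by (auto simp: g_def)
        then show ?thesis by (simp add: fdiff_pow_diff fdiff_pow_cmult b(2))
      qed
      moreover have "degree (q + smult c b) < r"
        using q(1) b(1) j(1) degree_smult_le[of c b] by (intro degree_add_less) auto
      ultimately show ?case using c' unfolding j_def[symmetric] by (intro exI[of _ "q + smult c b"]) auto
    qed
    from this[of r] show ?thesis by (simp add: E_def)
  qed
  then show ?thesis using Cm0[of r] by (intro exI[of _ "Cm r"]) auto
qed

section \<open>Growth of polynomials outside an interval\<close>

lemma lagrange_interpolation:
  fixes z :: "nat \<Rightarrow> real"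
  assumes inj: "inj_on z {..<r}" and deg: "degree q < r"
  shows "poly q x = (\<Sum>i<r. poly q (z i) * (\<Prod>j\<in>{..<r} - {i}. (x - z j) / (z i - z j)))"
proof -
  define L where "L i = (\<Prod>j\<in>{..<r} - {i}. smult (1 / (z i - z j)) [:- z j, 1:])" for i
  define R where "R = (\<Sum>i<r. smult (poly q (z i)) (L i))"
  have L: "poly (L i) x = (\<Prod>j\<in>{..<r} - {i}. (x - z j) / (z i - z j))" for i x
    unfolding L_def poly_prod by (intro prod.cong refl) (simp add: diff_divide_distrib)
  have "degree (L i) < r" if "i < r" for i
  proof -
    have "degree (L i) \<le> sum (degree \<circ> (\<lambda>j. smult (1 / (z i - z j)) [:- z j, 1:])) ({..<r} - {i})"
      unfolding L_def by (rule degree_prod_sum_le) auto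
    also have "\<dots> \<le> (\<Sum>j\<in>{..<r} - {i}. 1)"
      by (intro sum_mono) (auto simp: o_def)
    also have "\<dots> < r" using that by simp
    finally show ?thesis .
  qed
  then have "degree R < r" unfolding R_def using deg
    by (intro degree_sum_less) (auto intro: le_less_trans[OF degree_smult_le])
  have "poly R (z k) = poly q (z k)" if "k < r" for k
  proof -
    have "poly R (z k) = (\<Sum>i<r. if i = k then poly q (z k) else 0)"
      unfolding R_def poly_sum
    proof (intro sum.cong refl)
      fix i assume i: "i \<in> {..<r}"
      show "poly (smult (poly q (z i)) (L i)) (z k) = (if i = k then poly q (z k) else 0)"
      proof (cases "i = k")
        case True
        have "(z k - z j) / (z k - z j) = 1" if "j \<in> {..<r} - {k}" for j
          using that inj \<open>k < r\<close> by (auto simp: inj_on_def)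
        then show ?thesis using True by (simp add: L)
      next
        case False
        then have "(\<Prod>j\<in>{..<r} - {i}. (z k - z j) / (z i - z j)) = 0"
          using that by (intro prod_zero) auto
        then show ?thesis using False by (simp add: L)
      qed
    qed
    then show ?thesis using that by simp
  qed
  then have "R = q"
    using \<open>degree R < r\<close> deg inj
    by (intro poly_eqI_degree[where A = "z ` {..<r}"]) (auto simp: card_image)
  then have "poly q x = poly R x" by simp
  then show ?thesis unfolding R_def by (simp add: poly_sum L)
qed

lemma borel_measurable_poly [measurable]: "poly (q :: real poly) \<in> borel_measurable borel"
  by (intro borel_measurable_continuous_onI continuous_intros)

text \<open>Interpolate at the \<open>r\<close> nodes u + i / r and average over the offset u, so
  that each node sweeps one \<open>r\<close>-th part of the unit interval. This gives an explicit
  constant that grows only like a power of the distance, as the comparison of distant cells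
  requires.\<close>

lemma poly_growth_unit:
  assumes p: "0 < p" "p \<le> 1" and r: "1 \<le> r" and deg: "degree q < r"
  shows "pw p (poly q x) \<le> ennreal (real r ^ 2 * (real r * (1 + \<bar>x\<bar>)) ^ r) * pint p {0..1} (\<lambda>y. poly q y)"
proof -
  define I where "I = pint p {0..1} (\<lambda>y. poly q y)"
  define M where "M = (real r * (1 + \<bar>x\<bar>)) ^ r"
  have rx: "1 \<le> real r * (1 + \<bar>x\<bar>)" using r mult_mono[of 1 "real r" 1 "1 + \<bar>x\<bar>"] by simp
  then have M1: "M \<ge> 1" unfolding M_def by (rule one_le_power)
  have pt: "pw p (poly q x) \<le> ennreal M * (\<Sum>i<r. pw p (poly q (u + real i / real r)))"
    if u: "u \<in> {0..1 / real r}" for u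
  proof -
    define z where "z i = u + real i / real r" for i
    have inj: "inj_on z {..<r}" using r by (auto simp: inj_on_def z_def)
    have z01: "0 \<le> z i" "z i \<le> 1" if "i < r" for i
    proof -
      show "0 \<le> z i" using u by (auto simp: z_def)
      have "z i \<le> 1 / real r + real i / real r" using u by (auto simp: z_def)
      also have "\<dots> = (real i + 1) / real r" by (simp add: add_divide_distrib)
      also have "\<dots> \<le> 1" using that r by (simp add: field_simps)
      finally show "z i \<le> 1" .
    qed
    have fac: "\<bar>(x - z j) / (z i - z j)\<bar> \<le> real r * (1 + \<bar>x\<bar>)" if "i < r" "j < r" "i \<noteq> j" for i j
    proof -
      have "z i - z j = (real i - real j) / real r" by (simp add: z_def diff_divide_distrib)
      moreover have "1 \<le> \<bar>real i - real j\<bar>" using that by linarith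
      ultimately have "1 / real r \<le> \<bar>z i - z j\<bar>" using r by (simp add: divide_right_mono)
      moreover have "\<bar>x - z j\<bar> \<le> 1 + \<bar>x\<bar>" using z01[of j] that by linarith
      ultimately have "\<bar>x - z j\<bar> / \<bar>z i - z j\<bar> \<le> (1 + \<bar>x\<bar>) / (1 / real r)"
        using r by (intro frac_le) auto
      then show ?thesis by (simp add: mult.commute)
    qed
    have L: "\<bar>\<Prod>j\<in>{..<r} - {i}. (x - z j) / (z i - z j)\<bar> \<le> M" if "i < r" for i
    proof -
      have "\<bar>\<Prod>j\<in>{..<r} - {i}. (x - z j) / (z i - z j)\<bar> \<le> (\<Prod>j\<in>{..<r} - {i}. real r * (1 + \<bar>x\<bar>))"
        unfolding abs_prod using that by (intro prod_mono) (auto intro!: fac simp del: abs_divide)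
      also have "\<dots> = (real r * (1 + \<bar>x\<bar>)) ^ (r - 1)" using that by simp
      also have "\<dots> \<le> M" unfolding M_def using rx by (intro power_increasing) auto
      finally show ?thesis .
    qed
    have "pw p (poly q x) \<le> (\<Sum>i<r. pw p (poly q (z i) * (\<Prod>j\<in>{..<r} - {i}. (x - z j) / (z i - z j))))"
      by (subst lagrange_interpolation[OF inj deg]) (rule pw_sum[OF p])
    also have "\<dots> \<le> (\<Sum>i<r. ennreal M * pw p (poly q (z i)))"
    proof (intro sum_mono)
      fix i assume "i \<in> {..<r}"
      then have "pw p (\<Prod>j\<in>{..<r} - {i}. (x - z j) / (z i - z j)) \<le> pw p M"
        using L[of i] M1 p by (intro pw_mono) auto
      \<comment> \<open>Since M >= 1 and p <= 1, the power may be traded for \<open>M\<close>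
        itself, which removes p from the constant.\<close>
      also have "pw p M \<le> ennreal M"
        using M1 p powr_mono[of p 1 M] by (auto simp: pw_def intro!: ennreal_leI)
      finally show "pw p (poly q (z i) * (\<Prod>j\<in>{..<r} - {i}. (x - z j) / (z i - z j))) \<le> ennreal M * pw p (poly q (z i))"
        unfolding pw_mult by (subst mult.commute) (rule mult_right_mono, auto)
    qed
    finally show ?thesis by (simp add: sum_distrib_left z_def)
  qed
  have "ennreal (1 / real r) * pw p (poly q x) = pint p {0..1 / real r} (\<lambda>u. poly q x)"
    by (subst nn_integral_cmult_indicator) (auto simp: mult.commute)
  also have "\<dots> \<le> (\<integral>\<^sup>+u\<in>{0..1 / real r}. ennreal M * (\<Sum>i<r. pw p (poly q (u + real i / real r))) \<partial>lborel)"
    by (rule set_nn_integral_mono_set[OF order_refl pt])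
  also have "\<dots> = ennreal M * (\<Sum>i<r. \<integral>\<^sup>+u\<in>{0..1 / real r}. pw p (poly q (u + real i / real r)) \<partial>lborel)"
    by (simp add: set_nn_integral_cmult set_nn_integral_sum)
  also have "\<dots> \<le> ennreal M * (\<Sum>i<r. I)"
  proof (intro mult_left_mono sum_mono)
    fix i assume i: "i \<in> {..<r}"
    have "1 / real r + real i / real r = (real i + 1) / real r" by (simp add: add_divide_distrib)
    also have "\<dots> \<le> 1" using i r by (simp add: field_simps)
    finally have "{0 + real i / real r..1 / real r + real i / real r} \<subseteq> {0..1}"
      by (auto intro: order_trans[of 0 "real i / real r"])
    then show "pint p {0..1 / real r} (\<lambda>u. poly q (u + real i / real r)) \<le> I"
      unfolding I_def by (intro set_nn_integral_translate_le[of "\<lambda>y. pw p (poly q y)"]) measurable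
  qed auto
  finally have "ennreal (real r) * (ennreal (1 / real r) * pw p (poly q x)) \<le> ennreal (real r) * (ennreal M * (of_nat r * I))"
    by (intro mult_left_mono) auto
  also have "ennreal (real r) * (ennreal (1 / real r) * pw p (poly q x)) = pw p (poly q x)"
    using r by (subst mult.assoc[symmetric], subst ennreal_mult[symmetric]) auto
  also have "ennreal (real r) * (ennreal M * (of_nat r * I)) = ennreal (real r ^ 2 * M) * I"
    using M1 by (simp add: ennreal_of_nat_eq_real_of_nat ennreal_mult power2_eq_square mult_ac)
  finally show ?thesis by (simp add: I_def M_def)
qed

lemma set_nn_integral_affine:
  fixes F :: "real \<Rightarrow> ennreal"
  assumes "F \<in> borel_measurable borel" "a < b"
  shows "(\<integral>\<^sup>+x\<in>{a..b}. F x \<partial>lborel) = ennreal (b - a) * (\<integral>\<^sup>+y\<in>{0..1}. F (a + (b - a) * y) \<partial>lborel)"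
proof -
  have [measurable]: "F \<in> borel_measurable borel" by fact
  have "(\<integral>\<^sup>+x\<in>{a..b}. F x \<partial>lborel) = ennreal \<bar>b - a\<bar> *
     (\<integral>\<^sup>+y. F (a + (b - a) * y) * indicator {a..b} (a + (b - a) * y) \<partial>lborel)"
    using assms(2) by (intro nn_integral_real_affine) auto
  also have "(\<integral>\<^sup>+y. F (a + (b - a) * y) * indicator {a..b} (a + (b - a) * y) \<partial>lborel)
      = (\<integral>\<^sup>+y\<in>{0..1}. F (a + (b - a) * y) \<partial>lborel)"
  proof (intro nn_integral_cong arg_cong2[where f = "(*)"] refl)
    fix y
    have "a + (b - a) * y \<le> b \<longleftrightarrow> (b - a) * y \<le> (b - a) * 1" by auto
    then have "a + (b - a) * y \<in> {a..b} \<longleftrightarrow> y \<in> {0..1}"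
      using assms(2) by (simp add: zero_le_mult_iff)
    then show "indicator {a..b} (a + (b - a) * y) = (indicator {0..1} y :: ennreal)"
      by (simp add: indicator_def)
  qed
  finally show ?thesis using assms(2) by simp
qed

lemma poly_growth:
  assumes p: "0 < p" "p \<le> 1" and r: "1 \<le> r" and deg: "degree q < r" and "a < b"
  shows "ennreal (b - a) * pw p (poly q x) \<le>
    ennreal (real r ^ (r + 2) * (1 + \<bar>x - a\<bar> / (b - a)) ^ r) * pint p {a..b} (\<lambda>y. poly q y)"
proof -
  define Q where "Q = pcompose q [:a, b - a:]"
  define y where "y = (x - a) / (b - a)"
  have Q: "poly Q u = poly q (a + (b - a) * u)" for u by (simp add: Q_def poly_pcompose mult.commute)
  have "degree Q < r"
    using deg degree_pcompose_le[of q "[:a, b - a:]"] assms(5) by (auto simp: Q_def)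
  from poly_growth_unit[OF p r this, of y]
  have "pw p (poly q x) \<le> ennreal (real r ^ 2 * (real r * (1 + \<bar>y\<bar>)) ^ r) * pint p {0..1} (\<lambda>u. poly q (a + (b - a) * u))"
    using assms(5) unfolding Q by (simp add: y_def)
  then have "ennreal (b - a) * pw p (poly q x) \<le> ennreal (b - a) * (ennreal (real r ^ 2 * (real r * (1 + \<bar>y\<bar>)) ^ r) * pint p {0..1} (\<lambda>u. poly q (a + (b - a) * u)))"
    by (intro mult_left_mono) auto
  also have "\<dots> = ennreal (real r ^ 2 * (real r * (1 + \<bar>y\<bar>)) ^ r) * pint p {a..b} (\<lambda>y. poly q y)"
    using assms(5) by (subst set_nn_integral_affine[of "\<lambda>y. pw p (poly q y)"]) (auto simp: mult_ac)
  also have "real r ^ 2 * (real r * (1 + \<bar>y\<bar>)) ^ r = real r ^ (r + 2) * (1 + \<bar>x - a\<bar> / (b - a)) ^ r"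
    using assms(5) by (simp add: y_def abs_divide power_mult_distrib power_add power2_eq_square)
  finally show ?thesis .
qed

section \<open>Whitney's theorem with steps proportional to \<open>phi\<close>\<close>

lemma sym_diff_eq_fdiff:
  assumes "x - real r * h / 2 \<in> {-1..1}" "x + real r * h / 2 \<in> {-1..1}"
  shows "sym_diff r h f x = (fdiff h ^^ r) f (x - real r * h / 2)"
proof -
  have "(-1) ^ (r - i) = ((-1) ^ (r + i) :: real)" if "i \<le> r" for i
    using that by (cases "even i"; cases "even r") (auto simp: uminus_power_if)
  then show ?thesis unfolding sym_diff_def fdiff_pow_expand using assms
    by (auto simp: atLeast0AtMost mult_ac intro!: sum.cong)
qed

lemma measurable_phi [measurable]: "phi \<in> borel_measurable borel"
  unfolding phi_def by measurable

lemma phi_nonneg: "x \<in> {-1..1} \<Longrightarrow> 0 \<le> phi x"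
  by (auto simp: phi_def abs_square_le_1 abs_le_iff)

lemma measurable_sym_diff [measurable (raw)]:
  assumes [measurable]: "f \<in> borel_measurable borel" "h \<in> borel_measurable M" "x \<in> borel_measurable M"
  shows "(\<lambda>z. sym_diff r (h z) f (x z)) \<in> borel_measurable M"
  unfolding sym_diff_def atLeastAtMost_iff by measurable

text \<open>The average is written as one double integral over the region of all (s, x) whose nodes
  lie in the interval, a form that can be sheared and rescaled. The step scales with the length as
  well as the point does, which leaves one factor \<open>b - a\<close> on the left.\<close>

lemma whitney_interval:
  assumes p: "0 < p" "p \<le> 1" and r: "1 \<le> r"
  shows "\<exists>C\<ge>0. \<forall>f a b. f \<in> borel_measurable borel \<longrightarrow> a < b \<longrightarrow> pint p {a..b} f < \<infinity> \<longrightarrow>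
     (\<exists>q. degree q < r \<and> ennreal (b - a) * pint p {a..b} (\<lambda>x. f x - poly q x) \<le>
       ennreal C * (\<integral>\<^sup>+s. (\<integral>\<^sup>+x. pw p ((fdiff s ^^ r) f x) * indicator {(s, x). 0 \<le> s \<and> a \<le> x \<and> x + real r * s \<le> b} (s, x) \<partial>lborel) \<partial>lborel))"
proof -
  obtain C where C: "C \<ge> 0" "\<forall>f. f \<in> borel_measurable borel \<longrightarrow> pint p {0..1} f < \<infinity> \<longrightarrow>
     (\<exists>q. degree q < r \<and> pint p {0..1} (\<lambda>x. f x - poly q x) \<le> ennreal C * diff_avg p r f)"
    using whitney_unit[OF p r] by (elim exE conjE)
  show ?thesis
  proof (rule exI[of _ C], intro conjI allI impI)
    fix f :: "real \<Rightarrow> real" and a b :: real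
    assume [measurable]: "f \<in> borel_measurable borel" and ab: "a < b" and fin: "pint p {a..b} f < \<infinity>"
    define l where "l = b - a"
    have l: "l > 0" using ab by (simp add: l_def)
    define g where "g y = f (a + l * y)" for y
    have [measurable]: "g \<in> borel_measurable borel" unfolding g_def by measurable
    have "ennreal l * pint p {0..1} g < \<infinity>"
      using fin unfolding g_def l_def by (subst (asm) set_nn_integral_affine) (use ab in auto)
    then have gfin: "pint p {0..1} g < \<infinity>"
      using l by (auto simp: ennreal_mult_less_top)
    then obtain q where q: "degree q < r" "pint p {0..1} (\<lambda>x. g x - poly q x) \<le> ennreal C * diff_avg p r g"
      using C(2)[rule_format, OF \<open>g \<in> borel_measurable borel\<close> gfin] by auto
    define h where "h s x = pw p ((fdiff s ^^ r) f x) * indicator {(s, x). 0 \<le> s \<and> a \<le> x \<and> x + real r * s \<le> b} (s, x)" for s x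
    have h_alt: "h = (\<lambda>s x. pw p ((fdiff s ^^ r) f x) * (if 0 \<le> s \<and> a \<le> x \<and> x + real r * s \<le> b then 1 else 0))"
      unfolding h_def by (auto simp: indicator_def fun_eq_iff)
    have hm[measurable]: "(\<lambda>(s, x). h s x) \<in> borel_measurable (borel \<Otimes>\<^sub>M borel)"
      unfolding h_alt by measurable
    have hm'[measurable]: "(\<lambda>s. h (u s) (v s)) \<in> borel_measurable M" if [measurable]: "u \<in> borel_measurable M" "v \<in> borel_measurable M" for u v and M :: "'a measure"
      unfolding h_alt by measurable
    define H where "H = (\<integral>\<^sup>+s. (\<integral>\<^sup>+x. h s x \<partial>lborel) \<partial>lborel)"
    have gd: "(fdiff s ^^ r) g y = (fdiff (l * s) ^^ r) f (a + l * y)" for s y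
      unfolding fdiff_pow_expand g_def by (intro sum.cong refl) (simp add: algebra_simps)
    have "diff_avg p r g \<le> (\<integral>\<^sup>+s. (\<integral>\<^sup>+y. h (l * s) (a + l * y) \<partial>lborel) \<partial>lborel)"
    proof (intro nn_integral_mono)
      fix s :: real
      have "pint p {0..1 - real r * s} (\<lambda>x. (fdiff s ^^ r) g x) \<le> (\<integral>\<^sup>+y. h (l * s) (a + l * y) \<partial>lborel)"
        if "0 \<le> s"
      proof (intro nn_integral_mono)
        fix y
        have "a + l * y + real r * (l * s) \<le> b" if "y \<le> 1 - real r * s"
        proof -
          have "l * (y + real r * s) \<le> l * 1" using that l by (intro mult_left_mono) auto
          then show ?thesis by (simp add: algebra_simps l_def)
        qed
        then show "pw p ((fdiff s ^^ r) g y) * indicator {0..1 - real r * s} y \<le> h (l * s) (a + l * y)"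
          using l that unfolding h_def gd by (auto simp: indicator_def)
      qed
      then show "pint p {0..1 - real r * s} (\<lambda>x. (fdiff s ^^ r) g x) * indicator {0..1 / real r} s
         \<le> (\<integral>\<^sup>+y. h (l * s) (a + l * y) \<partial>lborel)"
        by (auto simp: indicator_def)
    qed
    then have "ennreal l * (ennreal l * diff_avg p r g) \<le> ennreal l * (ennreal l * (\<integral>\<^sup>+s. (\<integral>\<^sup>+y. h (l * s) (a + l * y) \<partial>lborel) \<partial>lborel))"
      by (intro mult_left_mono) auto
    also have "ennreal l * (\<integral>\<^sup>+s. (\<integral>\<^sup>+y. h (l * s) (a + l * y) \<partial>lborel) \<partial>lborel) = (\<integral>\<^sup>+s. (\<integral>\<^sup>+y. h s (a + l * y) \<partial>lborel) \<partial>lborel)"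
      using nn_integral_real_affine[of "\<lambda>s. \<integral>\<^sup>+y. h s (a + l * y) \<partial>lborel" l 0] l by simp
    also have "ennreal l * \<dots> = (\<integral>\<^sup>+s. ennreal l * (\<integral>\<^sup>+y. h s (a + l * y) \<partial>lborel) \<partial>lborel)"
      by (rule nn_integral_cmult[symmetric]) measurable
    also have "\<dots> = H"
      unfolding H_def
    proof (rule nn_integral_cong)
      fix s
      show "ennreal l * (\<integral>\<^sup>+y. h s (a + l * y) \<partial>lborel) = (\<integral>\<^sup>+x. h s x \<partial>lborel)"
        using nn_integral_real_affine[of "h s" l a] l by simp
    qed
    finally have H: "ennreal l * (ennreal l * diff_avg p r g) \<le> H" .
    define Q where "Q = pcompose q [:- a / l, 1 / l:]"
    have Q: "poly Q (a + l * y) = poly q y" for y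
      using l by (simp add: Q_def poly_pcompose field_simps)
    have "degree Q < r" using q(1) degree_pcompose_le[of q "[:- a / l, 1 / l:]"] l by (auto simp: Q_def)
    have "pint p {a..b} (\<lambda>x. f x - poly Q x) = ennreal l * pint p {0..1} (\<lambda>x. g x - poly q x)"
      using ab by (subst set_nn_integral_affine) (auto simp: l_def[symmetric] Q g_def)
    then have "ennreal l * pint p {a..b} (\<lambda>x. f x - poly Q x) \<le> ennreal l * (ennreal l * (ennreal C * diff_avg p r g))"
      using q(2) by (auto intro!: mult_left_mono)
    also have "\<dots> = ennreal C * (ennreal l * (ennreal l * diff_avg p r g))" by (simp add: mult_ac)
    also have "\<dots> \<le> ennreal C * H" by (intro mult_left_mono H) auto
    finally show "\<exists>q. degree q < r \<and> ennreal (b - a) * pint p {a..b} (\<lambda>x. f x - poly q x) \<le>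
       ennreal C * (\<integral>\<^sup>+s. (\<integral>\<^sup>+x. pw p ((fdiff s ^^ r) f x) * indicator {(s, x). 0 \<le> s \<and> a \<le> x \<and> x + real r * s \<le> b} (s, x) \<partial>lborel) \<partial>lborel)"
      using \<open>degree Q < r\<close> unfolding l_def H_def h_def by auto
  qed (use C in auto)
qed

text \<open>Centre the differences and substitute s = h * \<open>phi x\<close>. The Jacobian
  \<open>phi x\<close> is at most \<open>M * (b - a)\<close>, and its factor \<open>b - a\<close>
  cancels the one on the left of \<open>whitney_interval\<close>. The condition on s and x says that
  every difference fitting into the interval has h <= t.\<close>

lemma whitney_phi:
  assumes p: "0 < p" "p \<le> 1" and r: "1 \<le> r"
  shows "\<exists>C\<ge>0. \<forall>f a b t M. f \<in> borel_measurable borel \<longrightarrow> a < b \<longrightarrow> {a..b} \<subseteq> {-1..1} \<longrightarrow>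
     pint p {a..b} f < \<infinity> \<longrightarrow> 0 < t \<longrightarrow> 0 \<le> M \<longrightarrow>
     (\<forall>x s. 0 \<le> s \<longrightarrow> a \<le> x - real r * s / 2 \<longrightarrow> x + real r * s / 2 \<le> b \<longrightarrow> s \<le> t * phi x) \<longrightarrow>
     (\<forall>x\<in>{a..b}. phi x \<le> M * (b - a)) \<longrightarrow>
     (\<exists>q. degree q < r \<and> pint p {a..b} (\<lambda>x. f x - poly q x) \<le>
       ennreal (C * M) * (\<integral>\<^sup>+x\<in>{a..b}. pint p {0..t} (\<lambda>h. sym_diff r (h * phi x) f x) \<partial>lborel))"
proof -
  obtain C where C: "C \<ge> 0" "\<forall>f a b. f \<in> borel_measurable borel \<longrightarrow> a < b \<longrightarrow> pint p {a..b} f < \<infinity> \<longrightarrow>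
     (\<exists>q. degree q < r \<and> ennreal (b - a) * pint p {a..b} (\<lambda>x. f x - poly q x) \<le>
       ennreal C * (\<integral>\<^sup>+s. (\<integral>\<^sup>+x. pw p ((fdiff s ^^ r) f x) * indicator {(s, x). 0 \<le> s \<and> a \<le> x \<and> x + real r * s \<le> b} (s, x) \<partial>lborel) \<partial>lborel))"
    using whitney_interval[OF p r] by (elim exE conjE)
  show ?thesis
  proof (rule exI[of _ C], intro conjI allI impI)
    fix f :: "real \<Rightarrow> real" and a b t M :: real
    assume [measurable]: "f \<in> borel_measurable borel" and ab: "a < b" "{a..b} \<subseteq> {-1..1}"
      and fin: "pint p {a..b} f < \<infinity>" and t: "0 < t" and M: "0 \<le> M"
      and h1: "\<forall>x s. 0 \<le> s \<longrightarrow> a \<le> x - real r * s / 2 \<longrightarrow> x + real r * s / 2 \<le> b \<longrightarrow> s \<le> t * phi x"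
      and h2: "\<forall>x\<in>{a..b}. phi x \<le> M * (b - a)"
    define h where "h s x = pw p ((fdiff s ^^ r) f x) * indicator {(s, x). 0 \<le> s \<and> a \<le> x \<and> x + real r * s \<le> b} (s, x)" for s x
    have h_alt: "h = (\<lambda>s x. pw p ((fdiff s ^^ r) f x) * (if 0 \<le> s \<and> a \<le> x \<and> x + real r * s \<le> b then 1 else 0))"
      unfolding h_def by (auto simp: indicator_def fun_eq_iff)
    have hm[measurable]: "(\<lambda>(s, x). h s x) \<in> borel_measurable (borel \<Otimes>\<^sub>M borel)"
      unfolding h_alt by measurable
    have hm'[measurable]: "(\<lambda>s. h (u s) (v s)) \<in> borel_measurable M" if [measurable]: "u \<in> borel_measurable M" "v \<in> borel_measurable M" for u v and M :: "'a measure"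
      unfolding h_alt by measurable
    define G where "G x = pint p {0..t} (\<lambda>h. sym_diff r (h * phi x) f x)" for x
    have [measurable]: "G \<in> borel_measurable borel" unfolding G_def by measurable
    obtain q where q: "degree q < r" "ennreal (b - a) * pint p {a..b} (\<lambda>x. f x - poly q x) \<le>
       ennreal C * (\<integral>\<^sup>+s. (\<integral>\<^sup>+x. h s x \<partial>lborel) \<partial>lborel)"
      using C(2)[rule_format, OF _ ab(1) fin] unfolding h_def by auto
    have "(\<integral>\<^sup>+s. (\<integral>\<^sup>+x. h s x \<partial>lborel) \<partial>lborel) = (\<integral>\<^sup>+s. (\<integral>\<^sup>+x. h s (x - real r * s / 2) \<partial>lborel) \<partial>lborel)"
    proof (rule nn_integral_cong)
      fix s
      show "(\<integral>\<^sup>+x. h s x \<partial>lborel) = (\<integral>\<^sup>+x. h s (x - real r * s / 2) \<partial>lborel)"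
        using nn_integral_lborel_shift[of "h s" "- (real r * s / 2)"] by simp
    qed
    also have "\<dots> = (\<integral>\<^sup>+x. (\<integral>\<^sup>+s. h s (x - real r * s / 2) \<partial>lborel) \<partial>lborel)"
      using set_nn_integral_swap[of "\<lambda>s x. h s (x - real r * s / 2)" UNIV UNIV] by simp
    also have "\<dots> \<le> (\<integral>\<^sup>+x\<in>{a..b}. ennreal (M * (b - a)) * G x \<partial>lborel)"
    proof (intro nn_integral_mono)
      fix x
      define S where "S s = pw p (sym_diff r s f x)" for s
      have [measurable]: "S \<in> borel_measurable borel" unfolding S_def by measurable
      have hS: "h s (x - real r * s / 2) \<le> S s * indicator {0..t * phi x} s * indicator {a..b} x" for s
      proof (cases "0 \<le> s \<and> a \<le> x - real r * s / 2 \<and> x + real r * s / 2 \<le> b")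
        case True
        then have "0 \<le> real r * s / 2" by simp
        then have *: "x \<in> {a..b}" "x - real r * s / 2 \<in> {a..b}" "x + real r * s / 2 \<in> {a..b}"
          using True unfolding atLeastAtMost_iff by (intro conjI; linarith)+
        then have "S s = pw p ((fdiff s ^^ r) f (x - real r * s / 2))"
          unfolding S_def using ab(2) by (subst sym_diff_eq_fdiff) auto
        then show ?thesis using * True h1 by (auto simp: h_def indicator_def)
      next
        case False
        then have "h s (x - real r * s / 2) = 0" by (auto simp: h_def indicator_def field_simps)
        then show ?thesis by simp
      qed
      show "(\<integral>\<^sup>+s. h s (x - real r * s / 2) \<partial>lborel) \<le> ennreal (M * (b - a)) * G x * indicator {a..b} x"
      proof (cases "x \<in> {a..b}")
        case False
        have "h s (x - real r * s / 2) = 0" for s using hS[of s] False by simp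
        then show ?thesis by simp
      next
        case True
        then have ph: "phi x \<ge> 0" using ab by (intro phi_nonneg) auto
        have "(\<integral>\<^sup>+s. h s (x - real r * s / 2) \<partial>lborel) \<le> (\<integral>\<^sup>+s\<in>{0..t * phi x}. S s \<partial>lborel)"
          using hS True by (intro nn_integral_mono) simp
        also have "\<dots> = ennreal (phi x) * G x"
        \<comment> \<open>Where the Jacobian vanishes the scaling fails, but the range of steps is
          then a single point.\<close>
        proof (cases "phi x = 0")
          case True
          have "(\<integral>\<^sup>+s\<in>{0..t * phi x}. S s \<partial>lborel) = 0"
          proof (subst nn_integral_0_iff_AE)
            show "AE s in lborel. S s * indicator {0..t * phi x} s = 0"
              using AE_lborel_singleton[of 0] by eventually_elim (auto simp: True)
          qed auto
          then show ?thesis using True by simp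
        next
          case False
          then have "phi x > 0" using ph by simp
          from set_nn_integral_scale[OF \<open>S \<in> _\<close> this, of 0 t]
          show ?thesis unfolding G_def S_def by (simp add: mult.commute)
        qed
        also have "\<dots> \<le> ennreal (M * (b - a)) * G x"
          using h2 True by (intro mult_right_mono ennreal_leI) auto
        finally show ?thesis using True by simp
      qed
    qed
    also have "\<dots> = ennreal (M * (b - a)) * (\<integral>\<^sup>+x\<in>{a..b}. G x \<partial>lborel)"
      by (rule set_nn_integral_cmult) auto
    finally have "ennreal (b - a) * pint p {a..b} (\<lambda>x. f x - poly q x) \<le>
       ennreal C * (ennreal (M * (b - a)) * (\<integral>\<^sup>+x\<in>{a..b}. G x \<partial>lborel))"
      by (intro order_trans[OF q(2)] mult_left_mono) auto
    also have "\<dots> = ennreal (b - a) * (ennreal (C * M) * (\<integral>\<^sup>+x\<in>{a..b}. G x \<partial>lborel))"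
      using C(1) M ab(1) by (simp add: ennreal_mult mult_ac)
    finally have "pint p {a..b} (\<lambda>x. f x - poly q x) \<le> ennreal (C * M) * (\<integral>\<^sup>+x\<in>{a..b}. G x \<partial>lborel)"
      using ab(1) by (subst (asm) ennreal_mult_le_mult_iff) auto
    then show "\<exists>q. degree q < r \<and> pint p {a..b} (\<lambda>x. f x - poly q x) \<le>
       ennreal (C * M) * (\<integral>\<^sup>+x\<in>{a..b}. pint p {0..t} (\<lambda>h. sym_diff r (h * phi x) f x) \<partial>lborel)"
      using q(1) unfolding G_def by auto
  qed (use C in auto)
qed

subsection \<open>Localizing kernels\<close>

text \<open>Chebyshev polynomials of the first kind.\<close>

fun cheb :: "nat \<Rightarrow> real poly" where
  "cheb 0 = 1"
| "cheb (Suc 0) = [:0, 1:]"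
| "cheb (Suc (Suc n)) = [:0, 2:] * cheb (Suc n) - cheb n"

lemma poly_cheb_cos: "poly (cheb k) (cos u) = cos (real k * u)"
proof (induction k rule: cheb.induct)
  case (3 n)
  have "cos (real (Suc (Suc n)) * u) + cos (real n * u) = 2 * cos u * cos (real (Suc n) * u)"
    using cos_add[of "real (Suc n) * u" u] cos_diff[of "real (Suc n) * u" u]
    by (simp add: algebra_simps)
  then show ?case using 3 by simp
qed auto

lemma degree_cheb_le: "degree (cheb k) \<le> k"
proof (induction k rule: cheb.induct)
  case (3 n)
  have "degree ([:0, 2:] * cheb (Suc n)) \<le> Suc (Suc n)"
    using degree_mult_le[of "[:0, 2:]" "cheb (Suc n)"] 3 by auto
  then show ?case using 3 by (simp del: mult_pCons_left) (intro degree_diff_le, auto)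
qed auto

definition cos_sums :: "nat \<Rightarrow> (real \<Rightarrow> real) set" where
  "cos_sums d = {g. \<exists>c. \<forall>u. g u = (\<Sum>k\<le>d. c k * cos (real k * u))}"

lemma cos_sums_add: "g \<in> cos_sums d \<Longrightarrow> h \<in> cos_sums d \<Longrightarrow> (\<lambda>u. g u + h u) \<in> cos_sums d"
proof -
  assume "g \<in> cos_sums d" "h \<in> cos_sums d"
  then obtain a b where "\<And>u. g u = (\<Sum>k\<le>d. a k * cos (real k * u))" "\<And>u. h u = (\<Sum>k\<le>d. b k * cos (real k * u))"
    unfolding cos_sums_def by auto
  then show ?thesis unfolding cos_sums_def
    by (auto intro!: exI[of _ "\<lambda>k. a k + b k"] simp: sum.distrib algebra_simps)
qed

lemma cos_sums_cmult: "g \<in> cos_sums d \<Longrightarrow> (\<lambda>u. c * g u) \<in> cos_sums d"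
proof -
  assume "g \<in> cos_sums d"
  then obtain a where "\<And>u. g u = (\<Sum>k\<le>d. a k * cos (real k * u))"
    unfolding cos_sums_def by auto
  then show ?thesis unfolding cos_sums_def
    by (auto intro!: exI[of _ "\<lambda>k. c * a k"] simp: sum_distrib_left algebra_simps)
qed

lemma cos_sums_cos: "k \<le> d \<Longrightarrow> (\<lambda>u. cos (real k * u)) \<in> cos_sums d"
  unfolding cos_sums_def
  by (auto intro!: exI[of _ "\<lambda>i. if i = k then 1 else 0"] simp: if_distrib[of "\<lambda>x. x * _"] cong: if_cong)

lemma cos_sums_sum: "(\<And>i. i \<in> I \<Longrightarrow> g i \<in> cos_sums d) \<Longrightarrow> (\<lambda>u. \<Sum>i\<in>I. g i u) \<in> cos_sums d"
proof (induction I rule: infinite_finite_induct)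
  case (insert x F)
  then show ?case using cos_sums_add[of "g x" d "\<lambda>u. \<Sum>i\<in>F. g i u"] by simp
qed (auto simp: cos_sums_def intro!: exI[of _ "\<lambda>_. 0"])

text \<open>Horner's scheme, with the product formula for two cosines in each step. The coefficients
  remain anonymous: Parseval's identity only needs that they exist.\<close>

lemma poly_cos_in_cos_sums: "degree P \<le> d \<Longrightarrow> (\<lambda>u. poly P (cos u)) \<in> cos_sums d"
proof (induction P arbitrary: d)
  case 0
  then show ?case using cos_sums_sum[of "{}" "\<lambda>_ _. 0" d] by simp
next
  case (pCons a P)
  have const: "(\<lambda>u. a) \<in> cos_sums d"
    using cos_sums_cmult[OF cos_sums_cos[of 0 d], of a] by simp
  show ?case
  proof (cases "P = 0")
    case True
    then show ?thesis using const by simp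
  next
    case False
    then obtain d' where d': "d = Suc d'" "degree P \<le> d'" using pCons.prems by (cases d) auto
    from pCons.IH[OF this(2)] obtain c where c: "\<And>u. poly P (cos u) = (\<Sum>k\<le>d'. c k * cos (real k * u))"
      unfolding cos_sums_def by auto
    have "(\<lambda>u. cos u * cos (real k * u)) \<in> cos_sums d" if "k \<le> d'" for k
    proof (cases k)
      case 0
      then show ?thesis using cos_sums_cos[of 1 d] d' by simp
    next
      case (Suc l)
      have eq: "(\<lambda>u. cos u * cos (real k * u)) = (\<lambda>u. (1 / 2) * (cos (real (Suc k) * u) + cos (real l * u)))"
      proof
        fix u show "cos u * cos (real k * u) = (1 / 2) * (cos (real (Suc k) * u) + cos (real l * u))"
        using cos_add[of "real k * u" u] cos_diff[of "real k * u" u] Suc by (simp add: algebra_simps)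
      qed
      have "(\<lambda>u. (1 / 2) * (cos (real (Suc k) * u) + cos (real l * u))) \<in> cos_sums d"
        using that d' Suc by (intro cos_sums_cmult cos_sums_add cos_sums_cos) auto
      then show ?thesis unfolding eq .
    qed
    then have "(\<lambda>u. \<Sum>k\<le>d'. c k * (cos u * cos (real k * u))) \<in> cos_sums d"
      by (intro cos_sums_sum cos_sums_cmult) auto
    then have "(\<lambda>u. cos u * poly P (cos u)) \<in> cos_sums d"
      by (simp add: c sum_distrib_left mult_ac)
    from cos_sums_add[OF const this] show ?thesis by simp
  qed
qed

section \<open>Dirichlet sums and Fejer kernels\<close>

definition dirichlet :: "nat \<Rightarrow> real \<Rightarrow> complex" where
  "dirichlet \<nu> u = (\<Sum>j<\<nu>. cis (real j * u))"

lemma dirichlet_0 [simp]: "dirichlet \<nu> 0 = of_nat \<nu>"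
  by (simp add: dirichlet_def)

lemma norm_dirichlet_le: "norm (dirichlet \<nu> u) \<le> real \<nu>"
  unfolding dirichlet_def by (rule order_trans[OF norm_sum]) simp

lemma norm_dirichlet_mult_sin: "norm (dirichlet \<nu> u) * \<bar>sin (u / 2)\<bar> \<le> 1"
proof -
  have "(cis u - 1) * dirichlet \<nu> u = cis (real \<nu> * u) - 1"
  proof (induction \<nu>)
    case (Suc \<nu>)
    have "cis u * cis (real \<nu> * u) = cis (real (Suc \<nu>) * u)"
      by (simp add: cis_mult distrib_right add.commute)
    moreover have "dirichlet (Suc \<nu>) u = dirichlet \<nu> u + cis (real \<nu> * u)"
      by (simp add: dirichlet_def)
    ultimately show ?case using Suc by (simp only: distrib_left left_diff_distrib mult_1) simp
  qed (simp add: dirichlet_def)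
  then have "norm (cis u - 1) * norm (dirichlet \<nu> u) = norm (cis (real \<nu> * u) - 1)"
    by (simp only: norm_mult[symmetric])
  also have "\<dots> \<le> norm (cis (real \<nu> * u)) + norm (1 :: complex)" by (rule norm_triangle_ineq4)
  also have "\<dots> = 2" by simp
  also have "norm (cis u - 1) = 2 * \<bar>sin (u / 2)\<bar>"
  proof -
    have c: "cos u = 1 - 2 * (sin (u / 2))\<^sup>2"
      using cos_double_sin[of "u / 2"] by simp
    have "(norm (cis u - 1))\<^sup>2 = (cos u - 1)\<^sup>2 + (sin u)\<^sup>2" by (simp add: cmod_power2)
    also have "(sin u)\<^sup>2 = 1 - (cos u)\<^sup>2" by (rule sin_squared_eq)
    also have "(cos u - 1)\<^sup>2 + (1 - (cos u)\<^sup>2) = 2 - 2 * cos u" by (simp add: power2_eq_square algebra_simps)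
    also have "\<dots> = (2 * \<bar>sin (u / 2)\<bar>)\<^sup>2"
      unfolding c by (simp add: power_mult_distrib)
    finally show ?thesis by (rule power2_eq_imp_eq) auto
  qed
  finally show ?thesis by (simp add: mult_ac)
qed

text \<open>In the square only cosines of differences of two indices survive, which makes it real,
  even and, up to a factor, Fejer's kernel.\<close>

lemma dirichlet_sq_poly: "\<exists>P. degree P \<le> \<nu> - 1 \<and> (\<forall>u. (norm (dirichlet \<nu> u))\<^sup>2 = poly P (cos u))"
proof -
  define dst where "dst j l = (if j \<le> l then l - j else j - l)" for j l :: nat
  define P where "P = (\<Sum>j<\<nu>. \<Sum>l<\<nu>. cheb (dst j l))"
  have "degree P \<le> \<nu> - 1" unfolding P_def
    by (intro degree_sum_le) (auto simp: dst_def intro: order_trans[OF degree_cheb_le])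
  moreover have "(norm (dirichlet \<nu> u))\<^sup>2 = poly P (cos u)" for u
  proof -
    have "(norm (dirichlet \<nu> u))\<^sup>2 = (\<Sum>j<\<nu>. cos (real j * u))\<^sup>2 + (\<Sum>j<\<nu>. sin (real j * u))\<^sup>2"
      by (simp add: cmod_power2 dirichlet_def)
    also have "\<dots> = (\<Sum>j<\<nu>. \<Sum>l<\<nu>. cos (real j * u) * cos (real l * u) + sin (real j * u) * sin (real l * u))"
      by (simp add: power2_eq_square sum_product sum.distrib)
    also have "\<dots> = (\<Sum>j<\<nu>. \<Sum>l<\<nu>. cos (real (dst j l) * u))"
    proof (intro sum.cong refl)
      fix j l
      have "cos (real j * u) * cos (real l * u) + sin (real j * u) * sin (real l * u) = cos (real j * u - real l * u)"
        by (simp add: cos_diff)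
      also have "\<dots> = cos (real (dst j l) * u)"
      proof (cases "j \<le> l")
        case True
        have "cos (real j * u - real l * u) = cos (- (real l * u - real j * u))" by simp
        also have "\<dots> = cos (real l * u - real j * u)" by (rule cos_minus)
        finally show ?thesis using True by (simp add: dst_def of_nat_diff left_diff_distrib)
      qed (simp add: dst_def of_nat_diff left_diff_distrib)
      finally show "cos (real j * u) * cos (real l * u) + sin (real j * u) * sin (real l * u) = cos (real (dst j l) * u)" .
    qed
    also have "\<dots> = poly P (cos u)" by (simp add: P_def poly_sum poly_cheb_cos)
    finally show ?thesis .
  qed
  ultimately show ?thesis by blast
qed

lemma sin_half_ge:
  assumes "0 \<le> u" "u \<le> pi" shows "u / pi \<le> sin (u / 2)"
proof -
  have "concave_on {0..pi / 2} sin"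
    by (rule f''_le0_imp_concave[where f' = cos and f'' = "\<lambda>x. - sin x"])
      (auto intro!: derivative_eq_intros sin_ge_zero)
  then have "(1 - u / pi) * sin 0 + (u / pi) * sin (pi / 2) \<le> sin ((1 - u / pi) *\<^sub>R 0 + (u / pi) *\<^sub>R (pi / 2))"
    by (rule concave_onD) (use assms in \<open>auto simp: field_simps\<close>)
  then show ?thesis by simp
qed

text \<open>The difference of the squares is sin \<alpha> sin \<beta>. Hence the reflected copy of a
  kernel, taken at \<alpha> + \<beta>, satisfies the same decay bound in |\<alpha> - \<beta>| as the
  kernel itself, and symmetrizing does not spoil localization.\<close>

lemma sin_half_sum_ge:
  assumes "\<alpha> \<in> {0..pi}" "\<beta> \<in> {0..pi}"
  shows "\<bar>sin ((\<alpha> - \<beta>) / 2)\<bar> \<le> sin ((\<alpha> + \<beta>) / 2)"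
proof -
  have "(sin ((\<alpha> + \<beta>) / 2))\<^sup>2 - (sin ((\<alpha> - \<beta>) / 2))\<^sup>2 = sin \<alpha> * sin \<beta>"
  proof -
    have "cos (\<alpha> - \<beta>) = 1 - 2 * (sin ((\<alpha> - \<beta>) / 2))\<^sup>2" "cos (\<alpha> + \<beta>) = 1 - 2 * (sin ((\<alpha> + \<beta>) / 2))\<^sup>2"
      using cos_double_sin[of "(\<alpha> - \<beta>) / 2"] cos_double_sin[of "(\<alpha> + \<beta>) / 2"]
      by (simp_all only: mult_2 field_sum_of_halves)
    then show ?thesis by (simp add: cos_diff cos_add)
  qed
  moreover have "0 \<le> sin \<alpha> * sin \<beta>" using assms by (intro mult_nonneg_nonneg sin_ge_zero) auto
  ultimately have "\<bar>sin ((\<alpha> - \<beta>) / 2)\<bar> \<le> \<bar>sin ((\<alpha> + \<beta>) / 2)\<bar>"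
    by (simp add: abs_le_square_iff)
  moreover have "0 \<le> sin ((\<alpha> + \<beta>) / 2)" using assms by (intro sin_ge_zero) auto
  ultimately show ?thesis by simp
qed

lemma norm_dirichlet_decay:
  assumes "1 \<le> \<nu>" "0 \<le> \<delta>" "\<delta> / pi \<le> \<bar>sin (u / 2)\<bar>"
  shows "norm (dirichlet \<nu> u) / real \<nu> \<le> (1 + pi) / (1 + real \<nu> * \<delta>)"
proof (cases "real \<nu> * \<delta> \<le> pi")
  case True
  have "norm (dirichlet \<nu> u) / real \<nu> \<le> 1" using norm_dirichlet_le[of \<nu> u] assms(1) by simp
  also have "1 \<le> (1 + pi) / (1 + real \<nu> * \<delta>)"
    using True assms by (simp add: field_simps add_pos_nonneg)
  finally show ?thesis .
next
  case False
  then have d: "\<delta> > 0" using assms by (cases "\<delta> = 0") auto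
  have "norm (dirichlet \<nu> u) * (\<delta> / pi) \<le> norm (dirichlet \<nu> u) * \<bar>sin (u / 2)\<bar>"
    by (intro mult_left_mono assms) auto
  also have "\<dots> \<le> 1" by (rule norm_dirichlet_mult_sin)
  finally have "norm (dirichlet \<nu> u) \<le> pi / \<delta>" using d by (simp add: field_simps)
  then have "norm (dirichlet \<nu> u) / real \<nu> \<le> pi / \<delta> / real \<nu>" by (intro divide_right_mono) auto
  also have "\<dots> = pi / (real \<nu> * \<delta>)" by (simp add: mult.commute)
  also have "\<dots> \<le> (1 + pi) / (1 + real \<nu> * \<delta>)"
  proof -
    define y where "y = real \<nu> * \<delta>"
    have "pi < y" using False by (simp add: y_def)
    then have "0 < y" using pi_gt_zero by linarith
    then have "pi / y \<le> (1 + pi) / (1 + y)" using \<open>pi < y\<close> by (simp add: divide_simps algebra_simps)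
    then show ?thesis by (simp add: y_def)
  qed
  finally show ?thesis .
qed

text \<open>Multiplication by 2 sin(h / 2) makes the sum telescope, and for \<open>k < 2 * N\<close>
  this factor is positive. At k = 2 N the nodes alias and every term is -1.\<close>

lemma sum_cos_nodes:
  assumes "0 < k" "k < 2 * N"
  shows "(\<Sum>i<N. cos (real k * ((real i + 1 / 2) * pi / real N))) = 0"
proof -
  define h where "h = real k * pi / real N"
  have N: "real N > 0" using assms by simp
  have "(\<Sum>i<N. cos (real k * ((real i + 1 / 2) * pi / real N))) * (2 * sin (h / 2)) =
      (\<Sum>i<N. sin (real (Suc i) * h) - sin (real i * h))"
    unfolding sum_distrib_right
  proof (intro sum.cong refl)
    fix i
    have e: "real k * ((real i + 1 / 2) * pi / real N) = (real i * h + h / 2)"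
      using N by (simp add: h_def field_simps)
    have "sin (real (Suc i) * h) - sin (real i * h) = sin ((real i * h + h / 2) + h / 2) - sin ((real i * h + h / 2) - h / 2)"
      by (simp add: algebra_simps)
    also have "\<dots> = cos (real i * h + h / 2) * (2 * sin (h / 2))"
      unfolding sin_add[of "real i * h + h / 2"] sin_diff[of "real i * h + h / 2"] by simp
    finally show "cos (real k * ((real i + 1 / 2) * pi / real N)) * (2 * sin (h / 2)) = sin (real (Suc i) * h) - sin (real i * h)"
      unfolding e by simp
  qed
  also have "\<dots> = sin (real N * h) - sin (real 0 * h)" by (rule sum_lessThan_telescope)
  also have "\<dots> = 0" using N by (simp add: h_def)
  finally have "(\<Sum>i<N. cos (real k * ((real i + 1 / 2) * pi / real N))) * (2 * sin (h / 2)) = 0" .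
  moreover have "sin (h / 2) > 0"
  proof (rule sin_gt_zero)
    show "0 < h / 2" using assms N by (simp add: h_def)
    have "real k < 2 * real N" using assms by linarith
    then show "h / 2 < pi" using N pi_gt_zero by (simp add: h_def field_simps)
  qed
  ultimately show ?thesis by simp
qed

text \<open>\<open>D \<alpha>\<close> is the \<open>m\<close>-th power of a Fejer kernel centred at \<open>\<alpha>\<close>, made even so that it is a
  polynomial in the cosine. It serves both as a localizing multiplier and, summed over equidistant
  nodes, as a partition of unity.\<close>

lemma localizer:
  assumes "1 \<le> \<nu>"
  obtains D :: "real \<Rightarrow> real poly" where
    "\<And>\<alpha>. degree (D \<alpha>) \<le> m * (\<nu> - 1)"
    "\<And>\<alpha> \<beta>. poly (D \<alpha>) (cos \<beta>) = poly (D \<beta>) (cos \<alpha>)"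
    "\<And>\<alpha> \<beta>. 0 \<le> poly (D \<alpha>) (cos \<beta>)"
    "\<And>\<alpha>. 1 \<le> poly (D \<alpha>) (cos \<alpha>)"
    "\<And>\<alpha> \<beta>. \<alpha> \<in> {0..pi} \<Longrightarrow> \<beta> \<in> {0..pi} \<Longrightarrow>
       poly (D \<alpha>) (cos \<beta>) \<le> 2 * ((1 + pi) / (1 + real \<nu> * \<bar>\<alpha> - \<beta>\<bar>)) ^ (2 * m)"
    "\<And>N \<alpha> \<alpha>'. m * (\<nu> - 1) < 2 * N \<Longrightarrow>
       (\<Sum>i<N. poly (D \<alpha>) (cos ((real i + 1 / 2) * pi / real N))) =
       (\<Sum>i<N. poly (D \<alpha>') (cos ((real i + 1 / 2) * pi / real N)))"
proof -
  obtain P where P: "degree P \<le> \<nu> - 1" "\<And>u. (norm (dirichlet \<nu> u))\<^sup>2 = poly P (cos u)"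
    using dirichlet_sq_poly by blast
  define J where "J u = ((norm (dirichlet \<nu> u) / real \<nu>)\<^sup>2) ^ m" for u
  define d where "d = m * (\<nu> - 1)"
  have "J u = poly (smult (1 / real \<nu> ^ 2) P ^ m) (cos u)" for u
    by (simp add: J_def P(2)[symmetric] power_divide poly_power)
  then have Jeq: "J = (\<lambda>u. poly (smult (1 / real \<nu> ^ 2) P ^ m) (cos u))" by (rule ext)
  have "degree (smult (1 / real \<nu> ^ 2) P ^ m) \<le> degree (smult (1 / real \<nu> ^ 2) P) * m"
    by (rule degree_power_le)
  also have "\<dots> \<le> (\<nu> - 1) * m"
    by (intro mult_right_mono order_trans[OF degree_smult_le P(1)]) simp
  finally have "degree (smult (1 / real \<nu> ^ 2) P ^ m) \<le> d" by (simp add: d_def mult.commute)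
  from poly_cos_in_cos_sums[OF this] have "J \<in> cos_sums d" unfolding Jeq .
  then obtain c where c: "\<And>u. J u = (\<Sum>k\<le>d. c k * cos (real k * u))" unfolding cos_sums_def by auto
  \<comment> \<open>By the addition theorem J(\<alpha> - \<beta>) + J(\<alpha> + \<beta>) is a
    combination of cos(k \<alpha>) cos(k \<beta>): a polynomial in cos \<beta>, and symmetric in the
    two angles.\<close>
  define D where "D \<alpha> = (\<Sum>k\<le>d. smult (2 * c k * cos (real k * \<alpha>)) (cheb k))" for \<alpha>
  have D: "poly (D \<alpha>) (cos \<beta>) = J (\<alpha> - \<beta>) + J (\<alpha> + \<beta>)" for \<alpha> \<beta>
  proof -
    have "J (\<alpha> - \<beta>) + J (\<alpha> + \<beta>) = (\<Sum>k\<le>d. c k * (cos (real k * \<alpha> - real k * \<beta>) + cos (real k * \<alpha> + real k * \<beta>)))"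
      unfolding c by (simp add: sum.distrib[symmetric] algebra_simps)
    also have "\<dots> = (\<Sum>k\<le>d. 2 * c k * cos (real k * \<alpha>) * cos (real k * \<beta>))"
      by (intro sum.cong refl) (simp add: cos_diff cos_add)
    finally show ?thesis by (simp add: D_def poly_sum poly_cheb_cos)
  qed
  have J0: "J u \<ge> 0" for u by (simp add: J_def)
  show ?thesis
  proof (rule that[of D])
    fix \<alpha> \<beta>
    show "degree (D \<alpha>) \<le> m * (\<nu> - 1)"
      unfolding D_def d_def[symmetric]
      by (intro degree_sum_le) (auto intro: order_trans[OF degree_smult_le] order_trans[OF degree_cheb_le])
    show "poly (D \<alpha>) (cos \<beta>) = poly (D \<beta>) (cos \<alpha>)"
      by (simp add: D_def poly_sum poly_cheb_cos mult_ac)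
    show "0 \<le> poly (D \<alpha>) (cos \<beta>)" using J0 by (simp add: D)
    have "J 0 = 1" using assms by (simp add: J_def)
    then show "1 \<le> poly (D \<alpha>) (cos \<alpha>)" using J0[of "\<alpha> + \<alpha>"] by (simp add: D)
  next
    fix \<alpha> \<beta> assume ab: "\<alpha> \<in> {0..pi}" "\<beta> \<in> {0..pi}"
    have s1: "\<bar>\<alpha> - \<beta>\<bar> / pi \<le> \<bar>sin ((\<alpha> - \<beta>) / 2)\<bar>"
    proof -
      have "\<bar>\<alpha> - \<beta>\<bar> / pi \<le> sin (\<bar>\<alpha> - \<beta>\<bar> / 2)" using ab by (intro sin_half_ge) auto
      also have "\<dots> \<le> \<bar>sin (\<bar>\<alpha> - \<beta>\<bar> / 2)\<bar>" by simp
      also have "\<dots> = \<bar>sin ((\<alpha> - \<beta>) / 2)\<bar>"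
      proof (cases "\<alpha> \<ge> \<beta>")
        case False
        then have "\<bar>\<alpha> - \<beta>\<bar> / 2 = - ((\<alpha> - \<beta>) / 2)" by linarith
        then show ?thesis by (simp only: sin_minus abs_minus_cancel)
      qed simp
      finally show ?thesis .
    qed
    have s2: "\<bar>\<alpha> - \<beta>\<bar> / pi \<le> \<bar>sin ((\<alpha> + \<beta>) / 2)\<bar>"
      using s1 sin_half_sum_ge[OF ab] by linarith
    have "J u \<le> ((1 + pi) / (1 + real \<nu> * \<bar>\<alpha> - \<beta>\<bar>)) ^ (2 * m)"
      if "\<bar>\<alpha> - \<beta>\<bar> / pi \<le> \<bar>sin (u / 2)\<bar>" for u
    proof -
      have "J u = (norm (dirichlet \<nu> u) / real \<nu>) ^ (2 * m)" by (simp add: J_def power_mult)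
      also have "\<dots> \<le> ((1 + pi) / (1 + real \<nu> * \<bar>\<alpha> - \<beta>\<bar>)) ^ (2 * m)"
        by (intro power_mono norm_dirichlet_decay assms that) auto
      finally show ?thesis .
    qed
    from add_mono[OF this[OF s1] this[OF s2]]
    show "poly (D \<alpha>) (cos \<beta>) \<le> 2 * ((1 + pi) / (1 + real \<nu> * \<bar>\<alpha> - \<beta>\<bar>)) ^ (2 * m)"
      unfolding D mult_2[of "_ ^ _"] .
  next
    fix N \<alpha> \<alpha>' assume N: "m * (\<nu> - 1) < 2 * N"
    \<comment> \<open>At the equidistant nodes every frequency except 0 cancels, and with it the
      dependence on the centre.\<close>
    have *: "(\<Sum>i<N. poly (D \<alpha>) (cos ((real i + 1 / 2) * pi / real N))) = 2 * c 0 * real N" for \<alpha>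
    proof -
      have "(\<Sum>i<N. poly (D \<alpha>) (cos ((real i + 1 / 2) * pi / real N))) =
         (\<Sum>i<N. \<Sum>k\<le>d. 2 * c k * cos (real k * \<alpha>) * cos (real k * ((real i + 1 / 2) * pi / real N)))"
        by (simp add: D_def poly_sum poly_cheb_cos)
      also have "\<dots> = (\<Sum>k\<le>d. 2 * c k * cos (real k * \<alpha>) * (\<Sum>i<N. cos (real k * ((real i + 1 / 2) * pi / real N))))"
        by (subst sum.swap) (simp add: sum_distrib_left)
      also have "\<dots> = (\<Sum>k\<le>d. if k = 0 then 2 * c 0 * real N else 0)"
      proof (intro sum.cong refl)
        fix k assume "k \<in> {..d}"
        then have "k < 2 * N" using N by (simp add: d_def)
        then show "2 * c k * cos (real k * \<alpha>) * (\<Sum>i<N. cos (real k * ((real i + 1 / 2) * pi / real N))) =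
            (if k = 0 then 2 * c 0 * real N else 0)"
          using sum_cos_nodes[of k N] by (cases "k = 0") auto
      qed
      finally show ?thesis by simp
    qed
    show "(\<Sum>i<N. poly (D \<alpha>) (cos ((real i + 1 / 2) * pi / real N))) =
       (\<Sum>i<N. poly (D \<alpha>') (cos ((real i + 1 / 2) * pi / real N)))"
      by (rule trans[OF *[of \<alpha>] *[of \<alpha>', symmetric]])
  qed
qed

section \<open>Inequalities of Nikolskii, Bernstein and Markov\<close>

lemma has_integral_cos_int:
  fixes j :: int
  assumes "j \<noteq> 0"
  shows "((\<lambda>u. cos (of_int j * u)) has_integral 0) {0..pi}"
proof -
  have "((\<lambda>u. cos (of_int j * u)) has_integral (sin (of_int j * pi) / of_int j - sin (of_int j * 0) / of_int j)) {0..pi}"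
  proof (rule fundamental_theorem_of_calculus)
    fix x assume "x \<in> {0..pi}"
    show "((\<lambda>u. sin (of_int j * u) / of_int j) has_vector_derivative cos (of_int j * x)) (at x within {0..pi})"
      unfolding has_real_derivative_iff_has_vector_derivative[symmetric]
      using assms by (auto intro!: derivative_eq_intros)
  qed simp
  then show ?thesis by (simp add: mult.commute sin_int_times_real)
qed

lemma has_integral_cos_cos:
  fixes k l :: nat
  shows "((\<lambda>u. cos (real k * u) * cos (real l * u)) has_integral
     (if k = l then (if k = 0 then pi else pi / 2) else 0)) {0..pi}"
proof -
  have e: "(\<lambda>u. cos (real k * u) * cos (real l * u)) =
      (\<lambda>u. (1 / 2) * cos (of_int (int k + int l) * u) + (1 / 2) * cos (of_int (int k - int l) * u))"
  proof
    fix u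
    show "cos (real k * u) * cos (real l * u) =
       (1 / 2) * cos (of_int (int k + int l) * u) + (1 / 2) * cos (of_int (int k - int l) * u)"
      using cos_add[of "real k * u" "real l * u"] cos_diff[of "real k * u" "real l * u"]
      by (simp add: distrib_right left_diff_distrib add_divide_distrib diff_divide_distrib)
  qed
  have *: "((\<lambda>u. cos (of_int j * u)) has_integral (if j = 0 then pi else 0)) {0..pi}" for j :: int
    using has_integral_cos_int[of j] has_integral_const_real[of "1 :: real" 0 pi] by auto
  have "((\<lambda>u. (1 / 2) * cos (of_int (int k + int l) * u) + (1 / 2) * cos (of_int (int k - int l) * u))
     has_integral ((1 / 2) * (if int k + int l = 0 then pi else 0) + (1 / 2) * (if int k - int l = 0 then pi else 0))) {0..pi}"
    by (intro has_integral_add has_integral_mult_right *)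
  then show ?thesis unfolding e by (auto split: if_splits)
qed

lemma has_integral_cos_sum_sq:
  "((\<lambda>u. (\<Sum>k\<le>d. c k * cos (real k * u))\<^sup>2) has_integral
     (\<Sum>k\<le>d. (c k)\<^sup>2 * (if k = 0 then pi else pi / 2))) {0..pi}"
proof -
  have e: "(\<lambda>u. (\<Sum>k\<le>d. c k * cos (real k * u))\<^sup>2) =
     (\<lambda>u. \<Sum>k\<le>d. \<Sum>l\<le>d. (c k * c l) * (cos (real k * u) * cos (real l * u)))"
    by (rule ext) (simp add: power2_eq_square sum_product mult_ac)
  have "((\<lambda>u. \<Sum>k\<le>d. \<Sum>l\<le>d. (c k * c l) * (cos (real k * u) * cos (real l * u))) has_integral
     (\<Sum>k\<le>d. \<Sum>l\<le>d. (c k * c l) * (if k = l then (if k = 0 then pi else pi / 2) else 0))) {0..pi}"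
    by (intro has_integral_sum has_integral_mult_right has_integral_cos_cos finite_atMost)
  also have "(\<Sum>k\<le>d. \<Sum>l\<le>d. (c k * c l) * (if k = l then (if k = 0 then pi else pi / 2) else 0)) =
     (\<Sum>k\<le>d. (c k)\<^sup>2 * (if k = 0 then pi else pi / 2))"
    by (intro sum.cong refl) (simp add: if_distrib[of "\<lambda>x. _ * x"] power2_eq_square cong: if_cong)
  finally show ?thesis unfolding e .
qed

text \<open>Let S be the maximum of |g|. From g^2 <= S^(2-p) |g|^p the p-integral controls the
  square integral; Parseval and Cauchy-Schwarz pass to the sum of the absolute cosine coefficients,
  which in turn dominates S, and a power of S cancels. Having the coefficient sum and not merely S
  yields Bernstein's and Markov's inequalities by termwise differentiation.\<close>

lemma nikolskii:
  fixes R :: "real poly"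
  assumes p: "0 < p" "p \<le> 1" and deg: "degree R < N"
  defines "B \<equiv> 2 / pi * real N * integral {0..pi} (\<lambda>u. \<bar>poly R (cos u)\<bar> powr p)"
  shows "\<bar>poly R (cos \<alpha>)\<bar> powr p \<le> B"
    and "\<bar>sin \<alpha>\<bar> * \<bar>poly (pderiv R) (cos \<alpha>)\<bar> \<le> real N * B powr (1 / p)"
    and "\<bar>poly (pderiv R) (cos \<alpha>)\<bar> \<le> real N ^ 2 * B powr (1 / p)"
proof -
  define g where "g u = poly R (cos u)" for u
  obtain d where N: "N = Suc d" "degree R \<le> d" using deg by (cases N) auto
  obtain c where c: "\<And>u. g u = (\<Sum>k\<le>d. c k * cos (real k * u))"
    using poly_cos_in_cos_sums[OF N(2)] unfolding cos_sums_def g_def by auto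
  have gcont: "continuous_on A g" for A unfolding g_def by (intro continuous_intros)
  have "\<exists>a\<in>{-1..1::real}. \<forall>y\<in>{-1..1}. \<bar>poly R y\<bar> \<le> \<bar>poly R a\<bar>"
    by (intro continuous_attains_sup continuous_intros) auto
  then obtain a where a: "a \<in> {-1..1::real}" "\<And>y. y \<in> {-1..1} \<Longrightarrow> \<bar>poly R y\<bar> \<le> \<bar>poly R a\<bar>" by auto
  define S where "S = \<bar>poly R a\<bar>"
  have S: "\<bar>g u\<bar> \<le> S" for u unfolding g_def S_def by (rule a(2)) auto
  have Sa: "S = \<bar>g (arccos a)\<bar>" using a(1) by (simp add: S_def g_def)
  have S0: "S \<ge> 0" by (simp add: S_def)
  define X where "X = integral {0..pi} (\<lambda>u. \<bar>g u\<bar> powr p)"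
  have BX: "B = 2 / pi * real N * X" unfolding B_def X_def g_def ..
  have int_p: "(\<lambda>u. \<bar>g u\<bar> powr p) integrable_on {0..pi}"
    using p by (intro integrable_continuous_interval continuous_on_powr' continuous_intros gcont) auto
  have X0: "X \<ge> 0" unfolding X_def by (rule integral_nonneg[OF int_p]) simp
  define T where "T = (\<Sum>k\<le>d. (c k)\<^sup>2)"
  have T: "pi / 2 * T \<le> S powr (2 - p) * X"
  proof -
    have "pi / 2 * T \<le> (\<Sum>k\<le>d. (c k)\<^sup>2 * (if k = 0 then pi else pi / 2))"
      unfolding T_def sum_distrib_left
    proof (intro sum_mono)
      fix k
      have "(c k)\<^sup>2 * (pi / 2) \<le> (c k)\<^sup>2 * (if k = 0 then pi else pi / 2)"
        by (intro mult_left_mono) auto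
      then show "pi / 2 * (c k)\<^sup>2 \<le> (c k)\<^sup>2 * (if k = 0 then pi else pi / 2)" by (simp add: mult.commute)
    qed
    also have "\<dots> \<le> S powr (2 - p) * X"
    proof (rule has_integral_le[OF has_integral_cos_sum_sq[where d = d and c = c]])
      show "((\<lambda>u. S powr (2 - p) * \<bar>g u\<bar> powr p) has_integral S powr (2 - p) * X) {0..pi}"
        unfolding X_def by (intro has_integral_mult_right integrable_integral int_p)
      fix u
      have "(g u)\<^sup>2 = \<bar>g u\<bar> powr (2 - p) * \<bar>g u\<bar> powr p"
        by (cases "g u = 0") (auto simp: powr_add[symmetric])
      also have "\<dots> \<le> S powr (2 - p) * \<bar>g u\<bar> powr p"
        using S[of u] p by (intro mult_right_mono powr_mono2) auto
      finally show "(\<Sum>k\<le>d. c k * cos (real k * u))\<^sup>2 \<le> S powr (2 - p) * \<bar>g u\<bar> powr p"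
        by (simp add: c)
    qed
    finally show ?thesis .
  qed
  have T': "real N * T \<le> S powr (2 - p) * B"
  proof -
    have "real N * T = (2 / pi * real N) * (pi / 2 * T)" by simp
    also have "\<dots> \<le> (2 / pi * real N) * (S powr (2 - p) * X)" by (intro mult_left_mono T) simp
    finally show ?thesis by (simp add: BX mult_ac)
  qed
  have cs: "(\<Sum>k\<le>d. \<bar>c k\<bar>)\<^sup>2 \<le> real N * T"
  proof -
    have "(\<Sum>k\<le>d. \<bar>c k\<bar> * 1)\<^sup>2 \<le> (\<Sum>k\<le>d. \<bar>c k\<bar>\<^sup>2) * (\<Sum>k\<le>d. 1\<^sup>2)"
      by (rule Cauchy_Schwarz_ineq_sum)
    then show ?thesis by (simp add: T_def N mult.commute)
  qed
  have g_le: "\<bar>g u\<bar> \<le> (\<Sum>k\<le>d. \<bar>c k\<bar>)" for u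
  proof -
    have "\<bar>g u\<bar> \<le> (\<Sum>k\<le>d. \<bar>c k * cos (real k * u)\<bar>)" unfolding c by (rule sum_abs)
    also have "\<dots> \<le> (\<Sum>k\<le>d. \<bar>c k\<bar>)"
      by (intro sum_mono) (auto simp: abs_mult mult_left_le)
    finally show ?thesis .
  qed
  have SB: "S powr p \<le> B"
  proof (cases "S = 0")
    case True
    then show ?thesis using X0 p by (simp add: BX)
  next
    case False
    then have Sp: "S > 0" using S0 by simp
    have "S powr (2 - p) * S powr p = S\<^sup>2" using Sp by (simp add: powr_add[symmetric])
    also have "\<dots> \<le> (\<Sum>k\<le>d. \<bar>c k\<bar>)\<^sup>2" using g_le[of "arccos a"] S0 unfolding Sa by (intro power_mono) auto
    also have "\<dots> \<le> S powr (2 - p) * B" using cs T' by linarith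
    finally show ?thesis using Sp by simp
  qed
  have B0: "B \<ge> 0" using SB powr_ge_zero[of S p] by linarith
  \<comment> \<open>The bound just found for \<open>S\<close> is fed back to eliminate
    \<open>S\<close> from the estimate of the coefficient sum.\<close>
  have cB: "(\<Sum>k\<le>d. \<bar>c k\<bar>) \<le> B powr (1 / p)"
  proof -
    have SB': "S \<le> B powr (1 / p)"
    proof -
      have "S = (S powr p) powr (1 / p)" using p S0 by (simp add: powr_powr)
      also have "\<dots> \<le> B powr (1 / p)" using SB p by (intro powr_mono2) auto
      finally show ?thesis .
    qed
    have "(\<Sum>k\<le>d. \<bar>c k\<bar>)\<^sup>2 \<le> S powr (2 - p) * B" using cs T' by linarith
    also have "\<dots> \<le> (B powr (1 / p)) powr (2 - p) * (B powr (1 / p)) powr p"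
      using SB' S0 p B0 by (intro mult_mono powr_mono2) (auto simp: powr_powr)
    also have "\<dots> = (B powr (1 / p))\<^sup>2"
      by (cases "B = 0") (auto simp: powr_add[symmetric])
    finally show ?thesis by (rule power2_le_imp_le) simp
  qed
  show "\<bar>poly R (cos \<alpha>)\<bar> powr p \<le> B"
  proof -
    have "\<bar>poly R (cos \<alpha>)\<bar> powr p \<le> S powr p" using S[of \<alpha>] p unfolding g_def by (intro powr_mono2) auto
    then show ?thesis using SB by linarith
  qed
  have deriv: "poly (pderiv R) (cos u) * sin u = (\<Sum>k\<le>d. real k * c k * sin (real k * u))" for u
  proof -
    have 1: "(g has_real_derivative (poly (pderiv R) (cos u) * (- sin u))) (at u)"
      unfolding g_def by (rule DERIV_chain2[OF poly_DERIV DERIV_cos])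
    have "((\<lambda>u. \<Sum>k\<le>d. c k * cos (real k * u)) has_real_derivative (\<Sum>k\<le>d. c k * (- sin (real k * u) * real k))) (at u)"
      by (intro DERIV_sum DERIV_cmult) (auto intro!: derivative_eq_intros)
    then have 2: "(g has_real_derivative (\<Sum>k\<le>d. c k * (- sin (real k * u) * real k))) (at u)"
      using c by presburger
    from DERIV_unique[OF 1 2] show ?thesis by (simp add: sum_negf mult_ac)
  qed
  have Nk: "real k \<le> real N" if "k \<le> d" for k using that N by simp
  have "\<bar>poly (pderiv R) (cos \<alpha>) * sin \<alpha>\<bar> \<le> (\<Sum>k\<le>d. \<bar>real k * c k * sin (real k * \<alpha>)\<bar>)"
    unfolding deriv by (rule sum_abs)
  also have "\<dots> \<le> (\<Sum>k\<le>d. real N * \<bar>c k\<bar>)"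
  proof (intro sum_mono)
    fix k assume "k \<in> {..d}"
    then have "real k * \<bar>c k\<bar> * \<bar>sin (real k * \<alpha>)\<bar> \<le> real N * \<bar>c k\<bar> * 1"
      using Nk by (intro mult_mono) auto
    then show "\<bar>real k * c k * sin (real k * \<alpha>)\<bar> \<le> real N * \<bar>c k\<bar>" by (simp add: abs_mult)
  qed
  also have "\<dots> \<le> real N * B powr (1 / p)"
    unfolding sum_distrib_left[symmetric] by (intro mult_left_mono cB) auto
  finally show "\<bar>sin \<alpha>\<bar> * \<bar>poly (pderiv R) (cos \<alpha>)\<bar> \<le> real N * B powr (1 / p)"
    by (simp add: abs_mult mult.commute)
  \<comment> \<open>This permits division by \<open>sin u\<close>; the additional factor
    \<open>k\<close> turns the order \<open>N\<close> of Bernstein into the order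
    \<open>N ^ 2\<close> of Markov. The endpoints, where the sine vanishes, are reached by
    continuity.\<close>
  have sin_mult: "\<bar>sin (real k * u)\<bar> \<le> real k * \<bar>sin u\<bar>" for k u
  proof (induction k)
    case (Suc k)
    have "real (Suc k) * u = real k * u + u" by (simp add: distrib_right)
    then have "\<bar>sin (real (Suc k) * u)\<bar> = \<bar>sin (real k * u) * cos u + cos (real k * u) * sin u\<bar>"
      by (simp only: sin_add)
    also have "\<dots> \<le> \<bar>sin (real k * u) * cos u\<bar> + \<bar>cos (real k * u) * sin u\<bar>" by (rule abs_triangle_ineq)
    also have "\<dots> \<le> \<bar>sin (real k * u)\<bar> * 1 + 1 * \<bar>sin u\<bar>"
      unfolding abs_mult by (intro add_mono mult_left_mono mult_right_mono) auto
    finally show ?case using Suc by (simp add: distrib_right)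
  qed simp
  have inner: "\<bar>poly (pderiv R) (cos u)\<bar> \<le> real N ^ 2 * B powr (1 / p)" if "sin u \<noteq> 0" for u
  proof -
    have "\<bar>poly (pderiv R) (cos u) * sin u\<bar> \<le> (\<Sum>k\<le>d. \<bar>real k * c k * sin (real k * u)\<bar>)"
      unfolding deriv by (rule sum_abs)
    also have "\<dots> \<le> (\<Sum>k\<le>d. (real N ^ 2 * \<bar>sin u\<bar>) * \<bar>c k\<bar>)"
    proof (intro sum_mono)
      fix k assume "k \<in> {..d}"
      then have "real k * \<bar>c k\<bar> * \<bar>sin (real k * u)\<bar> \<le> real N * \<bar>c k\<bar> * (real k * \<bar>sin u\<bar>)"
        using Nk sin_mult[of k u] by (intro mult_mono) auto
      also have "\<dots> \<le> real N * \<bar>c k\<bar> * (real N * \<bar>sin u\<bar>)"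
        using Nk \<open>k \<in> {..d}\<close> by (intro mult_left_mono mult_right_mono) auto
      finally show "\<bar>real k * c k * sin (real k * u)\<bar> \<le> (real N ^ 2 * \<bar>sin u\<bar>) * \<bar>c k\<bar>"
        by (simp add: abs_mult power2_eq_square mult_ac)
    qed
    also have "\<dots> \<le> (real N ^ 2 * \<bar>sin u\<bar>) * B powr (1 / p)"
      unfolding sum_distrib_left[symmetric] by (intro mult_left_mono cB) auto
    finally have "\<bar>poly (pderiv R) (cos u)\<bar> * \<bar>sin u\<bar> \<le> (real N ^ 2 * B powr (1 / p)) * \<bar>sin u\<bar>"
      by (simp add: abs_mult mult_ac)
    then show ?thesis using that by simp
  qed
  have "\<bar>poly (pderiv R) y\<bar> \<le> real N ^ 2 * B powr (1 / p)" if y: "y \<in> {-1..1}" for y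
  proof -
    have "y \<in> closure {-1<..<1::real}" using y by simp
    moreover have "\<bar>poly (pderiv R) x\<bar> \<le> real N ^ 2 * B powr (1 / p)" if "x \<in> {-1<..<1}" for x
    proof -
      have "sin (arccos x) \<noteq> 0" using that by (intro sin_arccos_nonzero) auto
      then show ?thesis using inner[of "arccos x"] that by simp
    qed
    moreover have "continuous_on (closure {-1<..<1::real}) (\<lambda>x. \<bar>poly (pderiv R) x\<bar>)"
      by (intro continuous_intros)
    ultimately show ?thesis
      using continuous_le_on_closure[of "{-1<..<1}" "\<lambda>x. \<bar>poly (pderiv R) x\<bar>" y "real N ^ 2 * B powr (1 / p)"] by blast
  qed
  then show "\<bar>poly (pderiv R) (cos \<alpha>)\<bar> \<le> real N ^ 2 * B powr (1 / p)" by simp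
qed

lemma has_integral_decay:
  assumes "1 \<le> n" "\<alpha> \<in> {0..pi}"
  shows "\<exists>I\<le>2. ((\<lambda>\<beta>. real n / (1 + real n * \<bar>\<alpha> - \<beta>\<bar>)\<^sup>2) has_integral I) {0..pi}"
proof -
  define F where "F \<beta> = real n / (1 + real n * \<bar>\<alpha> - \<beta>\<bar>)\<^sup>2" for \<beta>
  have pos: "1 + real n * y > 0" if "y \<ge> 0" for y using that by (simp add: add_pos_nonneg)
  have 1: "(F has_integral (1 / (1 + real n * (\<alpha> - \<alpha>)) - 1 / (1 + real n * (\<alpha> - 0)))) {0..\<alpha>}"
  proof (rule fundamental_theorem_of_calculus)
    fix x assume x: "x \<in> {0..\<alpha>}"
    then have "1 + real n * (\<alpha> - x) \<noteq> 0" using pos[of "\<alpha> - x"] by auto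
    then have "((\<lambda>x. 1 / (1 + real n * (\<alpha> - x))) has_real_derivative (real n / (1 + real n * (\<alpha> - x))\<^sup>2)) (at x within {0..\<alpha>})"
      by (auto intro!: derivative_eq_intros simp: power2_eq_square)
    then show "((\<lambda>x. 1 / (1 + real n * (\<alpha> - x))) has_vector_derivative F x) (at x within {0..\<alpha>})"
      unfolding has_real_derivative_iff_has_vector_derivative[symmetric] using x by (simp add: F_def)
  qed (use assms in auto)
  have 2: "(F has_integral (- (1 / (1 + real n * (pi - \<alpha>))) - - (1 / (1 + real n * (\<alpha> - \<alpha>))))) {\<alpha>..pi}"
  proof (rule fundamental_theorem_of_calculus)
    fix x assume x: "x \<in> {\<alpha>..pi}"
    then have "1 + real n * (x - \<alpha>) \<noteq> 0" using pos[of "x - \<alpha>"] by auto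
    then have "((\<lambda>x. - (1 / (1 + real n * (x - \<alpha>)))) has_real_derivative (real n / (1 + real n * (x - \<alpha>))\<^sup>2)) (at x within {\<alpha>..pi})"
      by (auto intro!: derivative_eq_intros simp: power2_eq_square)
    then show "((\<lambda>x. - (1 / (1 + real n * (x - \<alpha>)))) has_vector_derivative F x) (at x within {\<alpha>..pi})"
      unfolding has_real_derivative_iff_has_vector_derivative[symmetric] using x by (simp add: F_def abs_minus_commute)
  qed (use assms in auto)
  have "(F has_integral ((1 / (1 + real n * (\<alpha> - \<alpha>)) - 1 / (1 + real n * (\<alpha> - 0))) +
      (- (1 / (1 + real n * (pi - \<alpha>))) - - (1 / (1 + real n * (\<alpha> - \<alpha>)))))) {0..pi}"
    using assms 1 2 by (intro has_integral_combine[of 0 \<alpha> pi]) auto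
  moreover have "(1 / (1 + real n * (\<alpha> - \<alpha>)) - 1 / (1 + real n * (\<alpha> - 0))) +
      (- (1 / (1 + real n * (pi - \<alpha>))) - - (1 / (1 + real n * (\<alpha> - \<alpha>)))) \<le> 2"
  proof -
    have "1 / (1 + real n * (\<alpha> - 0)) \<ge> 0" "1 / (1 + real n * (pi - \<alpha>)) \<ge> 0"
      using assms by auto
    moreover have "1 / (1 + real n * (\<alpha> - \<alpha>)) = 1" by simp
    ultimately show ?thesis by linarith
  qed
  ultimately show ?thesis unfolding F_def by blast
qed

lemma nn_integral_decay_le:
  assumes "1 \<le> n" "\<alpha> \<in> {0..pi}"
  shows "(\<integral>\<^sup>+\<beta>\<in>{0..pi}. ennreal (real n / (1 + real n * \<bar>\<alpha> - \<beta>\<bar>)\<^sup>2) \<partial>lborel) \<le> 2"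
proof -
  obtain I where I: "I \<le> 2" "((\<lambda>\<beta>. real n / (1 + real n * \<bar>\<alpha> - \<beta>\<bar>)\<^sup>2) has_integral I) {0..pi}"
    using has_integral_decay[OF assms] by auto
  have "(\<integral>\<^sup>+\<beta>\<in>{0..pi}. ennreal (real n / (1 + real n * \<bar>\<alpha> - \<beta>\<bar>)\<^sup>2) \<partial>lborel) = ennreal I"
    using nn_integral_has_integral_lebesgue[OF _ I(2)] by (simp add: indicator_mult_ennreal mult.commute)
  then show ?thesis using I(1) by (simp add: ennreal_le_iff2 ennreal_leI[of I 2, simplified])
qed

text \<open>Applying the Nikolskii inequality to the product with the localizer centred at \<open>\<alpha>\<close> turns the
  global estimates into local ones.\<close>

lemma local_nikolskii:
  assumes p: "0 < p" "p \<le> 1" and M: "2 \<le> M"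
  shows "\<exists>C\<ge>0. \<forall>n\<ge>1. \<forall>Q. \<forall>\<alpha>\<in>{0..pi}. degree Q < n \<longrightarrow>
    (let Y = integral {0..pi} (\<lambda>\<beta>. real n * (\<bar>poly Q (cos \<beta>)\<bar> powr p / (1 + real n * \<bar>\<alpha> - \<beta>\<bar>) ^ M)) in
      \<bar>poly Q (cos \<alpha>)\<bar> powr p \<le> C * Y \<and>
      ((sin \<alpha> + 1 / real n) * \<bar>poly (pderiv Q) (cos \<alpha>)\<bar>) powr p \<le> C * real n powr p * Y)"
proof -
  \<comment> \<open>The localizer decays with order \<open>2 * m\<close> and is raised to the power
    p, so this \<open>m\<close> yields decay of order \<open>M\<close>.\<close>
  define m where "m = nat \<lceil>real M / (2 * p)\<rceil>"
  have m: "real M \<le> real (2 * m) * p"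
  proof -
    have "real M / (2 * p) \<le> real m" unfolding m_def by linarith
    then show ?thesis using p by (simp add: field_simps)
  qed
  define c where "c = 2 * (1 + pi) ^ (2 * m)"
  have c0: "c \<ge> 0" by (simp add: c_def)
  define m1 where "m1 = real m + 1"
  have m1: "m1 \<ge> 1" by (simp add: m1_def)
  define k1 where "k1 = 2 / pi * m1 * c powr p"
  define k2 where "k2 = (m1 + m1\<^sup>2) powr p * k1 * (1 + 2 * k1)"
  define C where "C = k1 + 2 * k2"
  have k1: "k1 \<ge> 0" unfolding k1_def using m1 by simp
  have k2: "k2 \<ge> 0" unfolding k2_def using k1 by simp
  have main: "\<bar>poly Q (cos \<alpha>)\<bar> powr p \<le> C * Y \<and>
      ((sin \<alpha> + 1 / real n) * \<bar>poly (pderiv Q) (cos \<alpha>)\<bar>) powr p \<le> C * real n powr p * Y"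
    if n: "1 \<le> n" and deg: "degree Q < n" and \<alpha>: "\<alpha> \<in> {0..pi}"
      and Y: "Y = integral {0..pi} (\<lambda>\<beta>. real n * (\<bar>poly Q (cos \<beta>)\<bar> powr p / (1 + real n * \<bar>\<alpha> - \<beta>\<bar>) ^ M))" for n Q \<alpha> Y
  proof -
    obtain D where D: "degree D \<le> m * (n - 1)" "\<And>\<beta>. 0 \<le> poly D (cos \<beta>)" "1 \<le> poly D (cos \<alpha>)"
      "\<And>\<beta>. \<beta> \<in> {0..pi} \<Longrightarrow> poly D (cos \<beta>) \<le> 2 * ((1 + pi) / (1 + real n * \<bar>\<alpha> - \<beta>\<bar>)) ^ (2 * m)"
      using localizer[OF n, of m] \<alpha> by metis
    define N where "N = (m + 1) * n"
    have N: "real N = m1 * real n" by (simp add: N_def m1_def algebra_simps)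
    have Ns: "m * (n - 1) + (n - 1) < N" using n by (cases n) (auto simp: N_def algebra_simps)
    have pos: "1 + real n * \<bar>\<alpha> - \<beta>\<bar> \<ge> 1" for \<beta> by simp
    have Dp: "poly D (cos \<beta>) powr p \<le> c powr p / (1 + real n * \<bar>\<alpha> - \<beta>\<bar>) ^ M" if "\<beta> \<in> {0..pi}" for \<beta>
    proof -
      define y where "y = 1 + real n * \<bar>\<alpha> - \<beta>\<bar>"
      have y: "y \<ge> 1" by (simp add: y_def)
      have "poly D (cos \<beta>) \<le> c / y ^ (2 * m)" using D(4)[OF that] by (simp add: c_def y_def power_divide)
      then have "poly D (cos \<beta>) powr p \<le> (c / y ^ (2 * m)) powr p" using D(2) p by (intro powr_mono2) auto
      also have "\<dots> = c powr p / y powr (real (2 * m) * p)"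
        using y c0 by (simp add: powr_divide powr_powr powr_realpow[symmetric])
      also have "\<dots> \<le> c powr p / y powr real M"
        using y m by (intro divide_left_mono powr_mono) auto
      also have "y powr real M = y ^ M" using y by (simp add: powr_realpow)
      finally show ?thesis by (simp add: y_def)
    qed
    have contQ: "continuous_on {0..pi} (\<lambda>\<beta>. \<bar>poly Q (cos \<beta>)\<bar> powr p)"
      using p by (intro continuous_on_powr' continuous_intros) auto
    have yM: "continuous_on {0..pi} (\<lambda>\<beta>. (1 + real n * \<bar>\<alpha> - \<beta>\<bar>) ^ M)" by (intro continuous_intros)
    have pos': "0 < 1 + real n * \<bar>\<alpha> - \<beta>\<bar>" for \<beta> using pos[of \<beta>] by linarith
    have nz: "(1 + real n * \<bar>\<alpha> - \<beta>\<bar>) ^ M > 0" for \<beta> by (intro zero_less_power pos')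
    have nz': "(1 + real n * \<bar>\<alpha> - \<beta>\<bar>) ^ M \<noteq> 0" for \<beta> using nz[of \<beta>] by (rule less_imp_neq[symmetric])
    have integ: "(\<lambda>\<beta>. \<bar>poly Q (cos \<beta>)\<bar> powr p / (1 + real n * \<bar>\<alpha> - \<beta>\<bar>) ^ M) integrable_on {0..pi}"
      by (intro integrable_continuous_interval continuous_on_divide contQ yM ballI nz')
    have Yn: "Y = real n * integral {0..pi} (\<lambda>\<beta>. \<bar>poly Q (cos \<beta>)\<bar> powr p / (1 + real n * \<bar>\<alpha> - \<beta>\<bar>) ^ M)"
      unfolding Y by (rule integral_mult_right)
    have Y0: "Y \<ge> 0" unfolding Yn using integ nz by (intro mult_nonneg_nonneg integral_nonneg) (auto intro: less_imp_le)
    define B where "B R = 2 / pi * real N * integral {0..pi} (\<lambda>u. \<bar>poly R (cos u)\<bar> powr p)" for R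
    have intR: "(\<lambda>u. \<bar>poly R (cos u)\<bar> powr p) integrable_on {0..pi}" for R
      using p by (intro integrable_continuous_interval continuous_on_powr' continuous_intros) auto
    have BQ: "B (Q * D) \<le> k1 * Y"
    proof -
      have "integral {0..pi} (\<lambda>u. \<bar>poly (Q * D) (cos u)\<bar> powr p) \<le>
        integral {0..pi} (\<lambda>\<beta>. c powr p * (\<bar>poly Q (cos \<beta>)\<bar> powr p / (1 + real n * \<bar>\<alpha> - \<beta>\<bar>) ^ M))"
      proof (intro integral_le intR integrable_on_mult_right integ)
        fix \<beta> assume b: "\<beta> \<in> {0..pi}"
        have "\<bar>poly (Q * D) (cos \<beta>)\<bar> powr p = \<bar>poly Q (cos \<beta>)\<bar> powr p * poly D (cos \<beta>) powr p"
          using D(2)[of \<beta>] by (simp add: abs_mult powr_mult)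
        also have "\<dots> \<le> \<bar>poly Q (cos \<beta>)\<bar> powr p * (c powr p / (1 + real n * \<bar>\<alpha> - \<beta>\<bar>) ^ M)"
          by (intro mult_left_mono Dp b) auto
        finally show "\<bar>poly (Q * D) (cos \<beta>)\<bar> powr p \<le> c powr p * (\<bar>poly Q (cos \<beta>)\<bar> powr p / (1 + real n * \<bar>\<alpha> - \<beta>\<bar>) ^ M)"
          by (simp add: mult_ac)
      qed
      also have "\<dots> = c powr p * integral {0..pi} (\<lambda>\<beta>. \<bar>poly Q (cos \<beta>)\<bar> powr p / (1 + real n * \<bar>\<alpha> - \<beta>\<bar>) ^ M)"
        by (rule integral_mult_right)
      finally have "B (Q * D) \<le> 2 / pi * real N * (c powr p * integral {0..pi} (\<lambda>\<beta>. \<bar>poly Q (cos \<beta>)\<bar> powr p / (1 + real n * \<bar>\<alpha> - \<beta>\<bar>) ^ M))"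
        unfolding B_def by (intro mult_left_mono) auto
      also have "\<dots> = k1 * Y" by (simp add: k1_def Yn N mult_ac)
      finally show ?thesis .
    qed
    \<comment> \<open>The global inequality is applied to the localizer as well: its p-integral is
      of order 1 / n, which compensates the factor \<open>N\<close>.\<close>
    have BD: "B D \<le> 2 * k1"
    proof -
      obtain I where I: "I \<le> 2" "((\<lambda>\<beta>. real n / (1 + real n * \<bar>\<alpha> - \<beta>\<bar>)\<^sup>2) has_integral I) {0..pi}"
        using has_integral_decay[OF n \<alpha>] by auto
      have "integral {0..pi} (\<lambda>u. real n * (\<bar>poly D (cos u)\<bar> powr p)) \<le> c powr p * I"
      proof (rule has_integral_le[OF integrable_integral has_integral_mult_right[OF I(2)]])
        fix \<beta> assume b: "\<beta> \<in> {0..pi}"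
        have "real n * \<bar>poly D (cos \<beta>)\<bar> powr p \<le> real n * (c powr p / (1 + real n * \<bar>\<alpha> - \<beta>\<bar>) ^ M)"
          using Dp[OF b] D(2)[of \<beta>] by (intro mult_left_mono) auto
        also have "\<dots> \<le> real n * (c powr p / (1 + real n * \<bar>\<alpha> - \<beta>\<bar>)\<^sup>2)"
          by (intro mult_left_mono divide_left_mono power_increasing mult_pos_pos zero_less_power pos' M pos) auto
        finally show "real n * \<bar>poly D (cos \<beta>)\<bar> powr p \<le> c powr p * (real n / (1 + real n * \<bar>\<alpha> - \<beta>\<bar>)\<^sup>2)"
          by (simp add: mult_ac)
      qed (intro integrable_on_mult_right intR)
      also have "\<dots> \<le> c powr p * 2" by (intro mult_left_mono I(1)) auto
      also have "integral {0..pi} (\<lambda>u. real n * (\<bar>poly D (cos u)\<bar> powr p)) = real n * integral {0..pi} (\<lambda>u. \<bar>poly D (cos u)\<bar> powr p)"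
        by (rule integral_mult_right)
      finally have "2 / pi * m1 * (real n * integral {0..pi} (\<lambda>u. \<bar>poly D (cos u)\<bar> powr p)) \<le> 2 / pi * m1 * (c powr p * 2)"
        using m1 by (intro mult_left_mono) auto
      then show ?thesis by (simp add: B_def N k1_def mult_ac)
    qed
    have degR: "degree (Q * D) < N"
      using degree_mult_le[of Q D] D(1) deg Ns by linarith
    have degD: "degree D < N" using D(1) Ns by linarith
    have Q_le: "\<bar>poly Q (cos \<alpha>)\<bar> \<le> \<bar>poly (Q * D) (cos \<alpha>)\<bar>"
      using D(3) mult_left_mono[of 1 "\<bar>poly D (cos \<alpha>)\<bar>" "\<bar>poly Q (cos \<alpha>)\<bar>"] by (simp add: abs_mult)
    have Qp: "\<bar>poly Q (cos \<alpha>)\<bar> powr p \<le> k1 * Y"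
    proof -
      have "\<bar>poly Q (cos \<alpha>)\<bar> powr p \<le> \<bar>poly (Q * D) (cos \<alpha>)\<bar> powr p"
        using Q_le p by (intro powr_mono2) auto
      also have "\<dots> \<le> B (Q * D)" unfolding B_def by (rule nikolskii(1)[OF p degR])
      finally show ?thesis using BQ by linarith
    qed
    define s where "s = sin \<alpha> + 1 / real n"
    have sin0: "sin \<alpha> \<ge> 0" using \<alpha> by (intro sin_ge_zero) auto
    have s0: "s \<ge> 0" unfolding s_def using sin0 by simp
    have der: "(s * \<bar>poly (pderiv R) (cos \<alpha>)\<bar>) powr p \<le> (m1 + m1\<^sup>2) powr p * real n powr p * B R"
      if "degree R < N" for R
    proof -
      have B0: "0 \<le> B R" using nikolskii(1)[OF p that, of \<alpha>] powr_ge_zero[of "\<bar>poly R (cos \<alpha>)\<bar>" p] unfolding B_def by linarith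
      have "s * \<bar>poly (pderiv R) (cos \<alpha>)\<bar> = \<bar>sin \<alpha>\<bar> * \<bar>poly (pderiv R) (cos \<alpha>)\<bar> + 1 / real n * \<bar>poly (pderiv R) (cos \<alpha>)\<bar>"
        using sin0 by (simp add: s_def distrib_right)
      also have "\<dots> \<le> real N * B R powr (1 / p) + 1 / real n * (real N ^ 2 * B R powr (1 / p))"
        unfolding B_def by (intro add_mono mult_left_mono nikolskii(2)[OF p that] nikolskii(3)[OF p that]) auto
      also have "\<dots> = (m1 + m1\<^sup>2) * real n * B R powr (1 / p)"
        unfolding N using n by (simp add: power2_eq_square field_simps)
      finally have "(s * \<bar>poly (pderiv R) (cos \<alpha>)\<bar>) powr p \<le> ((m1 + m1\<^sup>2) * real n * B R powr (1 / p)) powr p"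
        using s0 p by (intro powr_mono2) auto
      also have "\<dots> = (m1 + m1\<^sup>2) powr p * real n powr p * B R"
        using m1 p B0 by (simp add: powr_mult powr_powr)
      finally show ?thesis .
    qed
    \<comment> \<open>Product rule: Q' D = (Q D)' - Q D', where D >= 1 at the centre. Both terms on
      the right are values or derivatives covered by the global estimates.\<close>
    have "s * \<bar>poly (pderiv Q) (cos \<alpha>)\<bar> \<le> s * (\<bar>poly (pderiv Q) (cos \<alpha>)\<bar> * poly D (cos \<alpha>))"
      using s0 D(3) mult_left_mono[of 1 "poly D (cos \<alpha>)" "\<bar>poly (pderiv Q) (cos \<alpha>)\<bar>"] by (intro mult_left_mono) auto
    also have "\<bar>poly (pderiv Q) (cos \<alpha>)\<bar> * poly D (cos \<alpha>) = \<bar>poly (pderiv (Q * D)) (cos \<alpha>) - poly Q (cos \<alpha>) * poly (pderiv D) (cos \<alpha>)\<bar>"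
      using D(3) by (simp add: pderiv_mult abs_mult)
    also have "s * \<dots> \<le> s * \<bar>poly (pderiv (Q * D)) (cos \<alpha>)\<bar> + \<bar>poly Q (cos \<alpha>)\<bar> * (s * \<bar>poly (pderiv D) (cos \<alpha>)\<bar>)"
    proof -
      have "\<bar>poly (pderiv (Q * D)) (cos \<alpha>) - poly Q (cos \<alpha>) * poly (pderiv D) (cos \<alpha>)\<bar> \<le>
        \<bar>poly (pderiv (Q * D)) (cos \<alpha>)\<bar> + \<bar>poly Q (cos \<alpha>)\<bar> * \<bar>poly (pderiv D) (cos \<alpha>)\<bar>"
        unfolding abs_mult[symmetric] by (rule abs_triangle_ineq4)
      from mult_left_mono[OF this s0] show ?thesis by (simp add: distrib_left mult_ac)
    qed
    finally have "(s * \<bar>poly (pderiv Q) (cos \<alpha>)\<bar>) powr p \<le>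
        (s * \<bar>poly (pderiv (Q * D)) (cos \<alpha>)\<bar> + \<bar>poly Q (cos \<alpha>)\<bar> * (s * \<bar>poly (pderiv D) (cos \<alpha>)\<bar>)) powr p"
      using s0 p by (intro powr_mono2) auto
    also have "\<dots> \<le> (s * \<bar>poly (pderiv (Q * D)) (cos \<alpha>)\<bar>) powr p + (\<bar>poly Q (cos \<alpha>)\<bar> * (s * \<bar>poly (pderiv D) (cos \<alpha>)\<bar>)) powr p"
      using s0 p by (intro powr_add_le) auto
    also have "(\<bar>poly Q (cos \<alpha>)\<bar> * (s * \<bar>poly (pderiv D) (cos \<alpha>)\<bar>)) powr p =
        \<bar>poly Q (cos \<alpha>)\<bar> powr p * (s * \<bar>poly (pderiv D) (cos \<alpha>)\<bar>) powr p"
      using s0 by (simp add: powr_mult)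
    also have "(s * \<bar>poly (pderiv (Q * D)) (cos \<alpha>)\<bar>) powr p \<le> (m1 + m1\<^sup>2) powr p * real n powr p * (k1 * Y)"
      by (rule order_trans[OF der[OF degR]]) (intro mult_left_mono BQ, simp)
    also have "\<bar>poly Q (cos \<alpha>)\<bar> powr p * (s * \<bar>poly (pderiv D) (cos \<alpha>)\<bar>) powr p \<le>
        (k1 * Y) * ((m1 + m1\<^sup>2) powr p * real n powr p * (2 * k1))"
      by (intro mult_mono Qp order_trans[OF der[OF degD]] mult_left_mono BD) (use k1 Y0 in auto)
    finally have "(s * \<bar>poly (pderiv Q) (cos \<alpha>)\<bar>) powr p \<le> k2 * real n powr p * Y"
      by (simp add: k2_def algebra_simps)
    also have "\<dots> \<le> C * real n powr p * Y"
      using k1 k2 Y0 by (intro mult_right_mono) (auto simp: C_def)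
    finally have "(s * \<bar>poly (pderiv Q) (cos \<alpha>)\<bar>) powr p \<le> C * real n powr p * Y" by simp
    moreover have "k1 * Y \<le> C * Y" using k2 Y0 by (intro mult_right_mono) (auto simp: C_def)
    ultimately show ?thesis using Qp unfolding s_def by linarith
  qed
  have "C \<ge> 0" using k1 k2 by (simp add: C_def)
  then show ?thesis unfolding Let_def
    by (intro exI[of _ C] conjI[of "0 \<le> C"], assumption) (intro allI ballI impI, rule main[OF _ _ _ refl])
qed

text \<open>The Henstock-Kurzweil integral is exchanged for a nonnegative one, to which Tonelli's
  theorem will be applied.\<close>

lemma local_nikolskii_pw:
  assumes p: "0 < p" "p \<le> 1" and M: "2 \<le> M"
  shows "\<exists>C\<ge>0. \<forall>n\<ge>1. \<forall>Q. \<forall>\<alpha>\<in>{0..pi}. degree Q < n \<longrightarrow>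
      pw p (poly Q (cos \<alpha>)) \<le> ennreal C *
        kernel_avg n p M Q \<alpha> \<and>
      pw p ((sin \<alpha> + 1 / real n) * poly (pderiv Q) (cos \<alpha>)) \<le> ennreal (C * real n powr p) *
        kernel_avg n p M Q \<alpha>"
proof -
  obtain C where C: "C \<ge> 0" "\<forall>n\<ge>1. \<forall>Q. \<forall>\<alpha>\<in>{0..pi}. degree Q < n \<longrightarrow>
    (let Y = integral {0..pi} (\<lambda>\<beta>. real n * (\<bar>poly Q (cos \<beta>)\<bar> powr p / (1 + real n * \<bar>\<alpha> - \<beta>\<bar>) ^ M)) in
      \<bar>poly Q (cos \<alpha>)\<bar> powr p \<le> C * Y \<and>
      ((sin \<alpha> + 1 / real n) * \<bar>poly (pderiv Q) (cos \<alpha>)\<bar>) powr p \<le> C * real n powr p * Y)"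
    using local_nikolskii[OF p M] by (elim exE conjE)
  show ?thesis
  proof (rule exI[of _ C], rule conjI[OF C(1)], intro allI ballI impI)
    fix n :: nat and Q :: "real poly" and \<alpha> :: real
    assume n: "1 \<le> n" and \<alpha>: "\<alpha> \<in> {0..pi}" and deg: "degree Q < n"
    define F where "F \<beta> = real n * (\<bar>poly Q (cos \<beta>)\<bar> powr p / (1 + real n * \<bar>\<alpha> - \<beta>\<bar>) ^ M)" for \<beta>
    define Y where "Y = integral {0..pi} F"
    have pos: "0 < 1 + real n * \<bar>\<alpha> - \<beta>\<bar>" for \<beta> by (rule order_less_le_trans[OF zero_less_one]) simp
    have F0: "0 \<le> F \<beta>" for \<beta> unfolding F_def using pos[of \<beta>] by (intro mult_nonneg_nonneg divide_nonneg_nonneg) auto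
    have "(1 + real n * \<bar>\<alpha> - \<beta>\<bar>) ^ M \<noteq> 0" for \<beta> using pos[of \<beta>] by (metis less_irrefl power_not_zero)
    then have "F integrable_on {0..pi}" unfolding F_def using p
      by (intro integrable_continuous_interval continuous_intros continuous_on_powr' ballI) auto
    then have FY: "(F has_integral Y) {0..pi}" unfolding Y_def by (rule integrable_integral)
    have Y0: "0 \<le> Y" using FY F0 by (rule has_integral_nonneg)
    have "ennreal Y = (\<integral>\<^sup>+\<beta>\<in>{0..pi}. ennreal (F \<beta>) \<partial>lborel)"
      unfolding nn_integral_set_ennreal
      using nn_integral_has_integral_lebesgue[OF F0 FY] by (simp add: mult.commute)
    also have "\<dots> = kernel_avg n p M Q \<alpha>"
    proof (intro nn_integral_cong arg_cong2[where f = "(*)"] refl)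
      fix \<beta>
      have Fe: "F \<beta> = \<bar>poly Q (cos \<beta>)\<bar> powr p * (real n / (1 + real n * \<bar>\<alpha> - \<beta>\<bar>) ^ M)" by (simp add: F_def)
      show "ennreal (F \<beta>) = pw p (poly Q (cos \<beta>)) * ennreal (real n / (1 + real n * \<bar>\<alpha> - \<beta>\<bar>) ^ M)"
        unfolding pw_def Fe by (rule ennreal_mult') simp
    qed
    finally have EY: "ennreal Y = kernel_avg n p M Q \<alpha>" .
    have b: "\<bar>poly Q (cos \<alpha>)\<bar> powr p \<le> C * Y"
      "((sin \<alpha> + 1 / real n) * \<bar>poly (pderiv Q) (cos \<alpha>)\<bar>) powr p \<le> C * real n powr p * Y"
      using C(2)[rule_format, OF n \<alpha> deg] unfolding Let_def F_def[symmetric] Y_def[symmetric] by auto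
    have s: "0 \<le> sin \<alpha> + 1 / real n" using \<alpha> sin_ge_zero[of \<alpha>] by auto
    show "pw p (poly Q (cos \<alpha>)) \<le> ennreal C *
        kernel_avg n p M Q \<alpha> \<and>
      pw p ((sin \<alpha> + 1 / real n) * poly (pderiv Q) (cos \<alpha>)) \<le> ennreal (C * real n powr p) *
        kernel_avg n p M Q \<alpha>"
      unfolding EY[symmetric]
      unfolding pw_def abs_mult abs_of_nonneg[OF s]
      using b C(1) Y0 by (auto simp: ennreal_mult[symmetric] intro!: ennreal_leI)
  qed
qed

subsection \<open>Polynomial inequalities for slowly varying weights\<close>

text \<open>Both angles are arbitrary, so decay is limited as well as growth. For the averaged
  weight, \<open>c\<close> and \<open>s\<close> will depend only on the doubling constant and not on
  \<open>n\<close>.\<close>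

definition slow_weight :: "nat \<Rightarrow> real \<Rightarrow> nat \<Rightarrow> (real \<Rightarrow> real) \<Rightarrow> bool" where
  "slow_weight n c s v \<longleftrightarrow> v \<in> borel_measurable borel \<and> (\<forall>\<alpha>. 0 \<le> v \<alpha>) \<and>
     (\<forall>\<alpha>\<in>{0..pi}. \<forall>\<beta>\<in>{0..pi}. v \<alpha> \<le> c * (1 + real n * \<bar>\<alpha> - \<beta>\<bar>) ^ s * v \<beta>)"

abbreviation slow_cos :: "nat \<Rightarrow> real \<Rightarrow> nat \<Rightarrow> (real \<Rightarrow> real) \<Rightarrow> bool" where
  "slow_cos n c s W \<equiv> slow_weight n c s (\<lambda>\<alpha>. W (cos \<alpha>))"

lemma slow_weightD:
  assumes "slow_weight n c s v"
  shows "v \<in> borel_measurable borel" "\<And>\<alpha>. 0 \<le> v \<alpha>"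
    "\<And>\<alpha> \<beta>. \<alpha> \<in> {0..pi} \<Longrightarrow> \<beta> \<in> {0..pi} \<Longrightarrow> v \<alpha> \<le> c * (1 + real n * \<bar>\<alpha> - \<beta>\<bar>) ^ s * v \<beta>"
  using assms by (auto simp: slow_weight_def)

lemma slow_weight_integral_finite:
  assumes "slow_weight n c s v" "0 \<le> c" and p: "0 < p"
  shows "wpint p {0..pi} v (\<lambda>\<alpha>. poly Q (cos \<alpha>)) < \<infinity>"
proof -
  have "bounded ((\<lambda>\<alpha>. poly Q (cos \<alpha>)) ` {0..pi})"
    by (intro compact_imp_bounded compact_continuous_image continuous_intros) auto
  then obtain B where "\<forall>y\<in>(\<lambda>\<alpha>. poly Q (cos \<alpha>)) ` {0..pi}. norm y \<le> B" unfolding bounded_iff ..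
  then have B: "\<bar>poly Q (cos \<alpha>)\<bar> \<le> B" if "\<alpha> \<in> {0..pi}" for \<alpha> using that by auto
  define K where "K = c * (1 + real n * pi) ^ s * v 0"
  have vK: "v \<alpha> \<le> K" if "\<alpha> \<in> {0..pi}" for \<alpha>
  proof -
    have "v \<alpha> \<le> c * (1 + real n * \<bar>\<alpha> - 0\<bar>) ^ s * v 0"
      by (rule slow_weightD(3)[OF assms(1) that]) simp
    also have "\<dots> \<le> K" unfolding K_def using that assms(2) slow_weightD(2)[OF assms(1), of 0]
      by (intro mult_right_mono mult_left_mono power_mono add_left_mono) (auto intro!: mult_left_mono)
    finally show ?thesis .
  qed
  have "wpint p {0..pi} v (\<lambda>\<alpha>. poly Q (cos \<alpha>))
      \<le> ennreal K * pw p B * ennreal (pi - 0)"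
    using p vK order_trans[OF B abs_ge_self[of B]]
    by (intro set_nn_integral_const_mult_le mult_mono ennreal_leI pw_mono) auto
  also have "\<dots> < \<infinity>" using pw_less_top(1)[of p B] by (auto simp: ennreal_mult_less_top)
  finally show ?thesis .
qed

text \<open>The hypothesis on \<open>G\<close> is the shape of every local estimate above, so all weighted
  inequalities reduce to integrating the kernel over \<open>S\<close>.\<close>

lemma kernel_transfer:
  fixes G H :: "real \<Rightarrow> ennreal"
  assumes v: "slow_weight n c s v" and c: "0 \<le> c" and S: "S \<subseteq> {0..pi}" "S \<in> sets borel" and M: "s + 2 \<le> M"
    and C: "0 \<le> C" and [measurable]: "H \<in> borel_measurable borel"
    and G: "\<And>\<alpha>. \<alpha> \<in> S \<Longrightarrow> G \<alpha> \<le> ennreal C * (\<integral>\<^sup>+\<beta>\<in>{0..pi}. H \<beta> * ennreal (real n / (1 + real n * \<bar>\<alpha> - \<beta>\<bar>) ^ M) \<partial>lborel)"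
    and \<kappa>: "0 \<le> \<kappa>" "\<And>\<beta>. \<beta> \<in> {0..pi} \<Longrightarrow> (\<integral>\<^sup>+\<alpha>\<in>S. ennreal (real n / (1 + real n * \<bar>\<beta> - \<alpha>\<bar>)\<^sup>2) \<partial>lborel) \<le> ennreal \<kappa>"
  shows "(\<integral>\<^sup>+\<alpha>\<in>S. ennreal (v \<alpha>) * G \<alpha> \<partial>lborel) \<le> ennreal (C * c * \<kappa>) * (\<integral>\<^sup>+\<beta>\<in>{0..pi}. ennreal (v \<beta>) * H \<beta> \<partial>lborel)"
proof -
  note [measurable] = slow_weightD(1)[OF v] S(2)
  \<comment> \<open>Of the M >= s + 2 powers available, s pay for moving the weight from \<alpha> to
    \<beta>; the two that remain make the kernel integrable uniformly in \<open>n\<close>.\<close>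
  have pt: "ennreal (v \<alpha>) * (H \<beta> * ennreal (real n / (1 + real n * \<bar>\<alpha> - \<beta>\<bar>) ^ M)) \<le>
      ennreal c * (ennreal (v \<beta>) * H \<beta> * ennreal (real n / (1 + real n * \<bar>\<beta> - \<alpha>\<bar>)\<^sup>2))"
    if ab: "\<alpha> \<in> {0..pi}" "\<beta> \<in> {0..pi}" for \<alpha> \<beta>
  proof -
    define y where "y = 1 + real n * \<bar>\<alpha> - \<beta>\<bar>"
    have y: "y \<ge> 1" by (simp add: y_def)
    have "v \<alpha> * (real n / y ^ M) \<le> (c * y ^ s * v \<beta>) * (real n / y ^ (s + 2))"
      using slow_weightD(3)[OF v ab] slow_weightD(2)[OF v] y M c unfolding y_def[symmetric]
      by (intro mult_mono divide_left_mono power_increasing) auto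
    also have "\<dots> = c * (v \<beta> * (real n / y\<^sup>2))" using y by (simp add: power_add power2_eq_square)
    finally have le: "ennreal (v \<alpha> * (real n / y ^ M)) \<le> ennreal (c * (v \<beta> * (real n / y\<^sup>2)))"
      by (rule ennreal_leI)
    define e1 where "e1 = real n / y ^ M"
    define e2 where "e2 = real n / y\<^sup>2"
    have "0 \<le> e1" "0 \<le> e2" using y by (auto simp: e1_def e2_def)
    moreover have "H \<beta> * ennreal (v \<alpha> * e1) \<le> H \<beta> * ennreal (c * (v \<beta> * e2))"
      using le unfolding e1_def e2_def by (intro mult_left_mono) auto
    moreover have "1 + real n * \<bar>\<beta> - \<alpha>\<bar> = y" by (simp add: y_def abs_minus_commute)
    ultimately show ?thesis
      using c slow_weightD(2)[OF v] unfolding y_def[symmetric]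
      by (simp add: ennreal_mult mult_ac e1_def[symmetric] e2_def[symmetric])
  qed
  have "(\<integral>\<^sup>+\<alpha>\<in>S. ennreal (v \<alpha>) * G \<alpha> \<partial>lborel) \<le>
    (\<integral>\<^sup>+\<alpha>\<in>S. ennreal (C * c) * (\<integral>\<^sup>+\<beta>\<in>{0..pi}. ennreal (v \<beta>) * H \<beta> * ennreal (real n / (1 + real n * \<bar>\<beta> - \<alpha>\<bar>)\<^sup>2) \<partial>lborel) \<partial>lborel)"
  proof (rule set_nn_integral_mono_set[OF order_refl])
    fix \<alpha> assume a: "\<alpha> \<in> S"
    have "ennreal (v \<alpha>) * G \<alpha> \<le> ennreal (v \<alpha>) * (ennreal C * (\<integral>\<^sup>+\<beta>\<in>{0..pi}. H \<beta> * ennreal (real n / (1 + real n * \<bar>\<alpha> - \<beta>\<bar>) ^ M) \<partial>lborel))"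
      by (intro mult_left_mono G a) auto
    also have "\<dots> = ennreal C * (\<integral>\<^sup>+\<beta>\<in>{0..pi}. ennreal (v \<alpha>) * (H \<beta> * ennreal (real n / (1 + real n * \<bar>\<alpha> - \<beta>\<bar>) ^ M)) \<partial>lborel)"
    proof -
      have "(\<integral>\<^sup>+\<beta>\<in>{0..pi}. ennreal (v \<alpha>) * (H \<beta> * ennreal (real n / (1 + real n * \<bar>\<alpha> - \<beta>\<bar>) ^ M)) \<partial>lborel) =
        ennreal (v \<alpha>) * (\<integral>\<^sup>+\<beta>\<in>{0..pi}. H \<beta> * ennreal (real n / (1 + real n * \<bar>\<alpha> - \<beta>\<bar>) ^ M) \<partial>lborel)"
        by (rule set_nn_integral_cmult; measurable)
      then show ?thesis by (simp only: mult.left_commute)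
    qed
    also have "\<dots> \<le> ennreal C * (\<integral>\<^sup>+\<beta>\<in>{0..pi}. ennreal c * (ennreal (v \<beta>) * H \<beta> * ennreal (real n / (1 + real n * \<bar>\<beta> - \<alpha>\<bar>)\<^sup>2)) \<partial>lborel)"
      by (intro mult_left_mono set_nn_integral_mono_set[OF order_refl] pt) (use a S in auto)
    also have "\<dots> = ennreal (C * c) * (\<integral>\<^sup>+\<beta>\<in>{0..pi}. ennreal (v \<beta>) * H \<beta> * ennreal (real n / (1 + real n * \<bar>\<beta> - \<alpha>\<bar>)\<^sup>2) \<partial>lborel)"
      using C c by (subst set_nn_integral_cmult) (auto simp: ennreal_mult mult_ac)
    finally show "ennreal (v \<alpha>) * G \<alpha> \<le> ennreal (C * c) * (\<integral>\<^sup>+\<beta>\<in>{0..pi}. ennreal (v \<beta>) * H \<beta> * ennreal (real n / (1 + real n * \<bar>\<beta> - \<alpha>\<bar>)\<^sup>2) \<partial>lborel)" .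
  qed
  also have "\<dots> = ennreal (C * c) * (\<integral>\<^sup>+\<alpha>\<in>S. (\<integral>\<^sup>+\<beta>\<in>{0..pi}. ennreal (v \<beta>) * H \<beta> * ennreal (real n / (1 + real n * \<bar>\<beta> - \<alpha>\<bar>)\<^sup>2) \<partial>lborel) \<partial>lborel)"
    by (rule set_nn_integral_cmult; measurable)
  finally have A: "(\<integral>\<^sup>+\<alpha>\<in>S. ennreal (v \<alpha>) * G \<alpha> \<partial>lborel) \<le> ennreal (C * c) *
     (\<integral>\<^sup>+\<alpha>\<in>S. (\<integral>\<^sup>+\<beta>\<in>{0..pi}. ennreal (v \<beta>) * H \<beta> * ennreal (real n / (1 + real n * \<bar>\<beta> - \<alpha>\<bar>)\<^sup>2) \<partial>lborel) \<partial>lborel)" .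
  have "(\<integral>\<^sup>+\<alpha>\<in>S. (\<integral>\<^sup>+\<beta>\<in>{0..pi}. ennreal (v \<beta>) * H \<beta> * ennreal (real n / (1 + real n * \<bar>\<beta> - \<alpha>\<bar>)\<^sup>2) \<partial>lborel) \<partial>lborel) =
     (\<integral>\<^sup>+\<beta>\<in>{0..pi}. (\<integral>\<^sup>+\<alpha>\<in>S. ennreal (v \<beta>) * H \<beta> * ennreal (real n / (1 + real n * \<bar>\<beta> - \<alpha>\<bar>)\<^sup>2) \<partial>lborel) \<partial>lborel)"
    by (rule set_nn_integral_swap; measurable)
  also have "\<dots> \<le> (\<integral>\<^sup>+\<beta>\<in>{0..pi}. ennreal (v \<beta>) * H \<beta> * ennreal \<kappa> \<partial>lborel)"
  proof (rule set_nn_integral_mono_set[OF order_refl])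
    fix \<beta> :: real assume b: "\<beta> \<in> {0..pi}"
    have "(\<integral>\<^sup>+\<alpha>\<in>S. ennreal (v \<beta>) * H \<beta> * ennreal (real n / (1 + real n * \<bar>\<beta> - \<alpha>\<bar>)\<^sup>2) \<partial>lborel) =
      ennreal (v \<beta>) * H \<beta> * (\<integral>\<^sup>+\<alpha>\<in>S. ennreal (real n / (1 + real n * \<bar>\<beta> - \<alpha>\<bar>)\<^sup>2) \<partial>lborel)"
      by (rule set_nn_integral_cmult; measurable)
    also have "\<dots> \<le> ennreal (v \<beta>) * H \<beta> * ennreal \<kappa>" by (intro mult_left_mono \<kappa> b) auto
    finally show "(\<integral>\<^sup>+\<alpha>\<in>S. ennreal (v \<beta>) * H \<beta> * ennreal (real n / (1 + real n * \<bar>\<beta> - \<alpha>\<bar>)\<^sup>2) \<partial>lborel) \<le> ennreal (v \<beta>) * H \<beta> * ennreal \<kappa>" .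
  qed
  also have "\<dots> = (\<integral>\<^sup>+\<beta>\<in>{0..pi}. ennreal (v \<beta>) * H \<beta> \<partial>lborel) * ennreal \<kappa>"
    by (rule set_nn_integral_multc) auto
  finally have "ennreal (C * c) *
     (\<integral>\<^sup>+\<alpha>\<in>S. (\<integral>\<^sup>+\<beta>\<in>{0..pi}. ennreal (v \<beta>) * H \<beta> * ennreal (real n / (1 + real n * \<bar>\<beta> - \<alpha>\<bar>)\<^sup>2) \<partial>lborel) \<partial>lborel) \<le>
     ennreal (C * c) * ((\<integral>\<^sup>+\<beta>\<in>{0..pi}. ennreal (v \<beta>) * H \<beta> \<partial>lborel) * ennreal \<kappa>)"
    by (rule mult_left_mono) simp
  also have "\<dots> = ennreal (C * c * \<kappa>) * (\<integral>\<^sup>+\<beta>\<in>{0..pi}. ennreal (v \<beta>) * H \<beta> \<partial>lborel)"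
    using C c \<kappa>(1) by (simp only: ennreal_mult mult_nonneg_nonneg mult_ac)
  finally show ?thesis using A by (rule order_trans[rotated])
qed


text \<open>A substitute for a maximal function: moving the point of evaluation by at most b / n
  changes the bases in the kernel by a factor of at most 1 + b. The map \<gamma> will come from a
  choice of mean value points and may fail to be measurable; the integral containing it is only
  estimated by monotonicity.\<close>

lemma slow_weight_sup:
  assumes p: "0 < p" "p \<le> 1" and c: "0 \<le> c" and b: "0 \<le> b"
  shows "\<exists>C\<ge>0. \<forall>n\<ge>1. \<forall>Q v S \<gamma>. degree Q < n \<longrightarrow> slow_weight n c s v \<longrightarrow> S \<subseteq> {0..pi} \<longrightarrow> S \<in> sets borel \<longrightarrow>
    (\<forall>\<alpha>\<in>S. \<gamma> \<alpha> \<in> {0..pi} \<and> \<bar>\<alpha> - \<gamma> \<alpha>\<bar> \<le> b / real n) \<longrightarrow>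
    wpint p S v (\<lambda>\<alpha>. poly Q (cos (\<gamma> \<alpha>))) \<le>
      ennreal C * wpint p {0..pi} v (\<lambda>\<alpha>. poly Q (cos \<alpha>))"
proof -
  obtain C where C: "C \<ge> 0" "\<forall>n\<ge>1. \<forall>Q. \<forall>\<alpha>\<in>{0..pi}. degree Q < n \<longrightarrow>
      pw p (poly Q (cos \<alpha>)) \<le> ennreal C *
        kernel_avg n p (s + 2) Q \<alpha> \<and>
      pw p ((sin \<alpha> + 1 / real n) * poly (pderiv Q) (cos \<alpha>)) \<le> ennreal (C * real n powr p) *
        kernel_avg n p (s + 2) Q \<alpha>"
    using local_nikolskii_pw[OF p, of "s + 2"] by (auto elim: exE conjE)
  define C' where "C' = C * (1 + b) ^ (s + 2)"
  have C': "C' \<ge> 0" unfolding C'_def using C(1) b by simp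
  show ?thesis
  proof (rule exI[of _ "C' * c * 2"], rule conjI, use C' c in simp, intro allI impI)
    fix n :: nat and Q :: "real poly" and v S \<gamma>
    assume n: "1 \<le> n" and deg: "degree Q < n" and v: "slow_weight n c s v" and S: "S \<subseteq> {0..pi}" "S \<in> sets borel"
      and \<gamma>: "\<forall>\<alpha>\<in>S. \<gamma> \<alpha> \<in> {0..pi} \<and> \<bar>\<alpha> - \<gamma> \<alpha>\<bar> \<le> b / real n"
    show "wpint p S v (\<lambda>\<alpha>. poly Q (cos (\<gamma> \<alpha>))) \<le>
      ennreal (C' * c * 2) * wpint p {0..pi} v (\<lambda>\<alpha>. poly Q (cos \<alpha>))"
    proof (rule kernel_transfer[OF v c S order_refl C'])
      fix \<alpha> assume a: "\<alpha> \<in> S"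
      have g: "\<gamma> \<alpha> \<in> {0..pi}" "\<bar>\<alpha> - \<gamma> \<alpha>\<bar> \<le> b / real n" using \<gamma> a by auto
      have "pw p (poly Q (cos (\<gamma> \<alpha>))) \<le> ennreal C *
        kernel_avg n p (s + 2) Q (\<gamma> \<alpha>)"
        using C(2)[rule_format, OF n g(1) deg] by simp
      also have "\<dots> \<le> ennreal C *
        (\<integral>\<^sup>+\<beta>\<in>{0..pi}. ennreal ((1 + b) ^ (s + 2)) * (pw p (poly Q (cos \<beta>)) * ennreal (real n / (1 + real n * \<bar>\<alpha> - \<beta>\<bar>) ^ (s + 2))) \<partial>lborel)"
      proof (intro mult_left_mono set_nn_integral_mono_set[OF order_refl])
        fix \<beta>
        have nb: "real n * \<bar>\<alpha> - \<gamma> \<alpha>\<bar> \<le> b" using g(2) n by (simp add: field_simps)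
        define x where "x = real n * \<bar>\<gamma> \<alpha> - \<beta>\<bar>"
        have x0: "x \<ge> 0" by (simp add: x_def)
        have "real n * \<bar>\<alpha> - \<beta>\<bar> \<le> real n * (\<bar>\<alpha> - \<gamma> \<alpha>\<bar> + \<bar>\<gamma> \<alpha> - \<beta>\<bar>)" by (intro mult_left_mono) auto
        then have "1 + real n * \<bar>\<alpha> - \<beta>\<bar> \<le> 1 + b + x" using nb by (simp add: distrib_left x_def)
        also have "\<dots> \<le> (1 + b) * (1 + x)" using b x0 by (simp add: algebra_simps)
        finally have le: "1 + real n * \<bar>\<alpha> - \<beta>\<bar> \<le> (1 + b) * (1 + x)" .
        have pos: "0 < 1 + real n * \<bar>\<alpha> - \<beta>\<bar>" by (rule order_less_le_trans[OF zero_less_one]) simp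
        have "real n / (1 + x) ^ (s + 2) = (1 + b) ^ (s + 2) * (real n / ((1 + b) * (1 + x)) ^ (s + 2))"
          using b by (simp add: power_mult_distrib)
        also have "\<dots> \<le> (1 + b) ^ (s + 2) * (real n / (1 + real n * \<bar>\<alpha> - \<beta>\<bar>) ^ (s + 2))"
          using le pos b by (intro mult_left_mono divide_left_mono power_mono mult_pos_pos zero_less_power) (auto intro: add_pos_nonneg x0)
        finally have "ennreal (real n / (1 + x) ^ (s + 2)) \<le> ennreal ((1 + b) ^ (s + 2)) * ennreal (real n / (1 + real n * \<bar>\<alpha> - \<beta>\<bar>) ^ (s + 2))"
          using b by (subst ennreal_mult'[symmetric]) (auto intro!: ennreal_leI)
        from mult_left_mono[OF this zero_le, of "pw p (poly Q (cos \<beta>))"]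
        show "pw p (poly Q (cos \<beta>)) * ennreal (real n / (1 + real n * \<bar>\<gamma> \<alpha> - \<beta>\<bar>) ^ (s + 2)) \<le>
          ennreal ((1 + b) ^ (s + 2)) * (pw p (poly Q (cos \<beta>)) * ennreal (real n / (1 + real n * \<bar>\<alpha> - \<beta>\<bar>) ^ (s + 2)))"
          unfolding x_def by (simp only: mult.left_commute)
      qed auto
      also have "\<dots> = ennreal C' *
        kernel_avg n p (s + 2) Q \<alpha>"
        using C(1) b unfolding C'_def by (subst set_nn_integral_cmult) (auto simp: ennreal_mult mult.assoc)
      finally show "pw p (poly Q (cos (\<gamma> \<alpha>))) \<le> ennreal C' *
        kernel_avg n p (s + 2) Q \<alpha>" .
    next
      fix \<beta> :: real assume "\<beta> \<in> {0..pi}"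
      then have "(\<integral>\<^sup>+\<alpha>\<in>{0..pi}. ennreal (real n / (1 + real n * \<bar>\<beta> - \<alpha>\<bar>)\<^sup>2) \<partial>lborel) \<le> 2"
        by (rule nn_integral_decay_le[OF n])
      then show "(\<integral>\<^sup>+\<alpha>\<in>S. ennreal (real n / (1 + real n * \<bar>\<beta> - \<alpha>\<bar>)\<^sup>2) \<partial>lborel) \<le> ennreal 2"
        using set_nn_integral_mono_set[OF S(1), of "\<lambda>\<alpha>. ennreal (real n / (1 + real n * \<bar>\<beta> - \<alpha>\<bar>)\<^sup>2)" "\<lambda>\<alpha>. ennreal (real n / (1 + real n * \<bar>\<beta> - \<alpha>\<bar>)\<^sup>2)" lborel]
        by (auto intro: order_trans)
    qed auto
  qed
qed

text \<open>The factor with the summand 1 / n unites Bernstein's inequality in the interior with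
  Markov's at the endpoints.\<close>

lemma slow_weight_bernstein:
  assumes p: "0 < p" "p \<le> 1" and c: "0 \<le> c"
  shows "\<exists>C\<ge>0. \<forall>n\<ge>1. \<forall>Q v. degree Q < n \<longrightarrow> slow_weight n c s v \<longrightarrow>
    wpint p {0..pi} v (\<lambda>\<alpha>. (sin \<alpha> + 1 / real n) * poly (pderiv Q) (cos \<alpha>)) \<le>
      ennreal (C * real n powr p) * wpint p {0..pi} v (\<lambda>\<alpha>. poly Q (cos \<alpha>))"
proof -
  obtain C where C: "C \<ge> 0" "\<forall>n\<ge>1. \<forall>Q. \<forall>\<alpha>\<in>{0..pi}. degree Q < n \<longrightarrow>
      pw p (poly Q (cos \<alpha>)) \<le> ennreal C *
        kernel_avg n p (s + 2) Q \<alpha> \<and>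
      pw p ((sin \<alpha> + 1 / real n) * poly (pderiv Q) (cos \<alpha>)) \<le> ennreal (C * real n powr p) *
        kernel_avg n p (s + 2) Q \<alpha>"
    using local_nikolskii_pw[OF p, of "s + 2"] by (auto elim: exE conjE)
  show ?thesis
  proof (rule exI[of _ "C * c * 2"], rule conjI, use C c in simp, intro allI impI)
    fix n :: nat and Q :: "real poly" and v
    assume n: "1 \<le> n" and deg: "degree Q < n" and v: "slow_weight n c s v"
    have C': "0 \<le> C * real n powr p" using C(1) by simp
    have "wpint p {0..pi} v (\<lambda>\<alpha>. (sin \<alpha> + 1 / real n) * poly (pderiv Q) (cos \<alpha>)) \<le>
      ennreal (C * real n powr p * c * 2) * wpint p {0..pi} v (\<lambda>\<alpha>. poly Q (cos \<alpha>))"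
    proof (rule kernel_transfer[OF v c order_refl _ order_refl C'])
      fix \<alpha> :: real assume a: "\<alpha> \<in> {0..pi}"
      show "pw p ((sin \<alpha> + 1 / real n) * poly (pderiv Q) (cos \<alpha>)) \<le> ennreal (C * real n powr p) *
        kernel_avg n p (s + 2) Q \<alpha>"
        using C(2)[rule_format, OF n a deg] by simp
    next
      fix \<beta> :: real assume "\<beta> \<in> {0..pi}"
      then show "(\<integral>\<^sup>+\<alpha>\<in>{0..pi}. ennreal (real n / (1 + real n * \<bar>\<beta> - \<alpha>\<bar>)\<^sup>2) \<partial>lborel) \<le> ennreal 2"
        using nn_integral_decay_le[OF n, of \<beta>] by simp
    qed auto
    then show "wpint p {0..pi} v (\<lambda>\<alpha>. (sin \<alpha> + 1 / real n) * poly (pderiv Q) (cos \<alpha>)) \<le>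
      ennreal (C * c * 2 * real n powr p) * wpint p {0..pi} v (\<lambda>\<alpha>. poly Q (cos \<alpha>))"
      by (simp only: mult_ac)
  qed
qed

text \<open>Near the endpoints the kernel bound has small integral, which is absorbed.\<close>

lemma slow_weight_remez:
  assumes p: "0 < p" "p \<le> 1" and c: "0 \<le> c"
  shows "\<exists>\<delta>>0. \<delta> \<le> 1 \<and> (\<forall>n\<ge>1. \<forall>Q v. degree Q < n \<longrightarrow> slow_weight n c s v \<longrightarrow>
    wpint p {0..pi} v (\<lambda>\<alpha>. poly Q (cos \<alpha>)) \<le>
      2 * wpint p {\<delta> / real n..pi - \<delta> / real n} v (\<lambda>\<alpha>. poly Q (cos \<alpha>)))"
proof -
  obtain C where C: "C \<ge> 0" "\<forall>n\<ge>1. \<forall>Q. \<forall>\<alpha>\<in>{0..pi}. degree Q < n \<longrightarrow>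
      pw p (poly Q (cos \<alpha>)) \<le> ennreal C *
        kernel_avg n p (s + 2) Q \<alpha> \<and>
      pw p ((sin \<alpha> + 1 / real n) * poly (pderiv Q) (cos \<alpha>)) \<le> ennreal (C * real n powr p) *
        kernel_avg n p (s + 2) Q \<alpha>"
    using local_nikolskii_pw[OF p, of "s + 2"] by (auto elim: exE conjE)
  \<comment> \<open>Two end pieces of length \<delta> / n under a kernel of height n integrate to at
    most 2 \<delta>, and C c 2 \<delta> must not exceed 1 / 2 for the absorption.\<close>
  define \<delta> where "\<delta> = 1 / (4 * (C * c + 1))"
  have Cc: "C * c \<ge> 0" using C(1) c by simp
  have \<delta>: "0 < \<delta>" "\<delta> \<le> 1" "C * c * (2 * \<delta>) \<le> 1 / 2" using Cc by (auto simp: \<delta>_def field_simps)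
  show ?thesis
  proof (rule exI[of _ \<delta>], intro conjI allI impI \<delta>)
    fix n :: nat and Q :: "real poly" and v
    assume n: "1 \<le> n" and deg: "degree Q < n" and v: "slow_weight n c s v"
    note [measurable] = slow_weightD(1)[OF v]
    define F where "F \<alpha> = ennreal (v \<alpha>) * pw p (poly Q (cos \<alpha>))" for \<alpha>
    have [measurable]: "F \<in> borel_measurable borel" unfolding F_def by measurable
    define E where "E = {0..\<delta> / real n} \<union> {pi - \<delta> / real n..pi}"
    have dn: "0 < \<delta> / real n" "\<delta> / real n \<le> 1" using \<delta> n by (auto simp: field_simps)
    have pi1: "1 < pi" using pi_gt3 by linarith
    have E: "E \<subseteq> {0..pi}" "E \<in> sets borel" unfolding E_def using dn pi1 by auto
    have EF: "(\<integral>\<^sup>+\<alpha>\<in>E. ennreal (v \<alpha>) * pw p (poly Q (cos \<alpha>)) \<partial>lborel) \<le> ennreal (C * c * (2 * \<delta>)) *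
        wpint p {0..pi} v (\<lambda>\<alpha>. poly Q (cos \<alpha>))"
    proof (rule kernel_transfer[OF v c E order_refl C(1)])
      fix \<alpha> assume a: "\<alpha> \<in> E"
      then have "\<alpha> \<in> {0..pi}" using E by auto
      from C(2)[rule_format, OF n this deg]
      show "pw p (poly Q (cos \<alpha>)) \<le> ennreal C *
        kernel_avg n p (s + 2) Q \<alpha>" by simp
    next
      fix \<beta> :: real
      have le: "ennreal (real n / (1 + real n * \<bar>\<beta> - \<alpha>\<bar>)\<^sup>2) \<le> ennreal (real n)" for \<alpha>
      proof (rule ennreal_leI)
        define y where "y = 1 + real n * \<bar>\<beta> - \<alpha>\<bar>"
        have "y \<ge> 1" by (simp add: y_def)
        then have "real n / y\<^sup>2 \<le> real n / 1" by (intro divide_left_mono) (auto intro!: one_le_power)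
        then show "real n / (1 + real n * \<bar>\<beta> - \<alpha>\<bar>)\<^sup>2 \<le> real n" by (simp add: y_def)
      qed
      have "(\<integral>\<^sup>+\<alpha>\<in>E. ennreal (real n / (1 + real n * \<bar>\<beta> - \<alpha>\<bar>)\<^sup>2) \<partial>lborel) \<le> (\<integral>\<^sup>+\<alpha>\<in>E. ennreal (real n) \<partial>lborel)"
        by (rule set_nn_integral_mono_set[OF order_refl le])
      also have "\<dots> \<le> (\<integral>\<^sup>+\<alpha>\<in>{0..\<delta> / real n}. ennreal (real n) \<partial>lborel) + (\<integral>\<^sup>+\<alpha>\<in>{pi - \<delta> / real n..pi}. ennreal (real n) \<partial>lborel)"
        unfolding E_def by (rule set_nn_integral_Un_le) auto
      also have "\<dots> = ennreal (real n) * ennreal (\<delta> / real n) + ennreal (real n) * ennreal (\<delta> / real n)"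
        using dn by (simp add: nn_integral_cmult_indicator)
      also have "\<dots> = ennreal (2 * \<delta>)"
        using n \<delta>(1) by (simp add: ennreal_mult[symmetric] ennreal_plus[symmetric] del: ennreal_plus)
      finally show "(\<integral>\<^sup>+\<alpha>\<in>E. ennreal (real n / (1 + real n * \<bar>\<beta> - \<alpha>\<bar>)\<^sup>2) \<partial>lborel) \<le> ennreal (2 * \<delta>)" .
    qed (use \<delta> in auto)
    have "{0..pi} \<subseteq> {\<delta> / real n..pi - \<delta> / real n} \<union> E" unfolding E_def by auto
    then have "(\<integral>\<^sup>+\<alpha>\<in>{0..pi}. F \<alpha> \<partial>lborel) \<le> (\<integral>\<^sup>+\<alpha>\<in>{\<delta> / real n..pi - \<delta> / real n} \<union> E. F \<alpha> \<partial>lborel)"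
      by (rule set_nn_integral_mono_set) simp
    also have "\<dots> \<le> (\<integral>\<^sup>+\<alpha>\<in>{\<delta> / real n..pi - \<delta> / real n}. F \<alpha> \<partial>lborel) + (\<integral>\<^sup>+\<alpha>\<in>E. F \<alpha> \<partial>lborel)"
      using E(2) by (intro set_nn_integral_Un_le) auto
    also have "\<dots> \<le> (\<integral>\<^sup>+\<alpha>\<in>{\<delta> / real n..pi - \<delta> / real n}. F \<alpha> \<partial>lborel) +
        ennreal (C * c * (2 * \<delta>)) * (\<integral>\<^sup>+\<alpha>\<in>{0..pi}. F \<alpha> \<partial>lborel)"
      using EF unfolding F_def by (rule add_left_mono)
    finally show "wpint p {0..pi} v (\<lambda>\<alpha>. poly Q (cos \<alpha>)) \<le>
      2 * wpint p {\<delta> / real n..pi - \<delta> / real n} v (\<lambda>\<alpha>. poly Q (cos \<alpha>))"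
      unfolding F_def using \<delta>(3) slow_weight_integral_finite[OF v c p(1)] by (intro ennreal_absorb_half)
  qed
qed

section \<open>Return from the angle to the interval\<close>

definition wint :: "real \<Rightarrow> (real \<Rightarrow> real) \<Rightarrow> (real \<Rightarrow> real) \<Rightarrow> ennreal" where
  "wint p W F = (\<integral>\<^sup>+x\<in>{-1..1}. pw p (F x) * ennreal (W x) \<partial>lborel)"

abbreviation step_wint :: "nat \<Rightarrow> real \<Rightarrow> (real \<Rightarrow> real) \<Rightarrow> (real \<Rightarrow> real) \<Rightarrow> real \<Rightarrow> ennreal" where
  "step_wint r p W f \<equiv> (\<lambda>h. wint p W (\<lambda>x. sym_diff r (h * phi x) f x))"

abbreviation phi_wint :: "nat \<Rightarrow> real \<Rightarrow> (real \<Rightarrow> real) \<Rightarrow> real poly \<Rightarrow> ennreal" where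
  "phi_wint r p W Q \<equiv> wint p W (\<lambda>x. phi x ^ r * poly Q x)"

text \<open>The substitution rule wants an increasing map, so the variable is reflected first and -
  cos is substituted.\<close>

lemma nn_integral_cos_substitution:
  fixes G :: "real \<Rightarrow> real"
  assumes [measurable]: "G \<in> borel_measurable borel"
  shows "(\<integral>\<^sup>+x\<in>{-1..1}. ennreal (G x) \<partial>lborel) = (\<integral>\<^sup>+\<alpha>\<in>{0..pi}. ennreal (G (cos \<alpha>) * sin \<alpha>) \<partial>lborel)"
proof -
  have "(\<integral>\<^sup>+x\<in>{-1..1}. ennreal (G x) \<partial>lborel) =
     ennreal \<bar>-1\<bar> * (\<integral>\<^sup>+x. ennreal (G (0 + (-1) * x)) * indicator {-1..1} (0 + (-1) * x) \<partial>lborel)"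
    by (rule nn_integral_real_affine) auto
  also have "\<dots> = (\<integral>\<^sup>+x. ennreal (G (- x) * indicator {- cos 0..- cos pi} x) \<partial>lborel)"
    by (simp, intro nn_integral_cong) (auto simp: indicator_def)
  also have "\<dots> = (\<integral>\<^sup>+\<alpha>. ennreal (G (- (- cos \<alpha>)) * sin \<alpha> * indicator {0..pi} \<alpha>) \<partial>lborel)"
    by (rule nn_integral_substitution[where g = "\<lambda>\<alpha>. - cos \<alpha>" and g' = sin and f = "\<lambda>x. G (- x)"])
      (auto simp: set_borel_measurable_def intro!: derivative_eq_intros continuous_intros sin_ge_zero)
  also have "\<dots> = (\<integral>\<^sup>+\<alpha>\<in>{0..pi}. ennreal (G (cos \<alpha>) * sin \<alpha>) \<partial>lborel)"
    by (intro nn_integral_cong) (auto simp: indicator_def)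
  finally show ?thesis .
qed

lemma wint_cos:
  assumes [measurable]: "F \<in> borel_measurable borel" "W \<in> borel_measurable borel" and W: "\<And>x. 0 \<le> W x"
  shows "wint p W F = wpint p {0..pi} (\<lambda>\<alpha>. W (cos \<alpha>) * sin \<alpha>) (\<lambda>\<alpha>. F (cos \<alpha>))"
proof -
  have "wint p W F = (\<integral>\<^sup>+x\<in>{-1..1}. ennreal (\<bar>F x\<bar> powr p * W x) \<partial>lborel)"
    unfolding wint_def pw_def by (simp add: ennreal_mult' W)
  also have "\<dots> = (\<integral>\<^sup>+\<alpha>\<in>{0..pi}. ennreal (\<bar>F (cos \<alpha>)\<bar> powr p * W (cos \<alpha>) * sin \<alpha>) \<partial>lborel)"
    by (rule nn_integral_cos_substitution) measurable
  also have "\<dots> = wpint p {0..pi} (\<lambda>\<alpha>. W (cos \<alpha>) * sin \<alpha>) (\<lambda>\<alpha>. F (cos \<alpha>))"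
  proof (intro nn_integral_cong)
    fix \<alpha>
    have "ennreal (\<bar>F (cos \<alpha>)\<bar> powr p * W (cos \<alpha>) * sin \<alpha>) = ennreal (W (cos \<alpha>) * sin \<alpha>) * pw p (F (cos \<alpha>))"
      unfolding pw_def by (subst mult.commute[of "ennreal (_ * _)"], subst ennreal_mult'[symmetric]) (auto simp: mult.assoc)
    then show "ennreal (\<bar>F (cos \<alpha>)\<bar> powr p * W (cos \<alpha>) * sin \<alpha>) * indicator {0..pi} \<alpha> =
      ennreal (W (cos \<alpha>) * sin \<alpha>) * pw p (F (cos \<alpha>)) * indicator {0..pi} \<alpha>" by simp
  qed
  finally show ?thesis .
qed

lemma sin_ge_linear:
  assumes "0 \<le> a" "\<alpha> \<in> {a..pi - a}"
  shows "2 * a / pi \<le> sin \<alpha>"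
proof (cases "\<alpha> \<le> pi / 2")
  case True
  have "2 * a / pi \<le> (2 * \<alpha>) / pi" using assms by (intro divide_right_mono) auto
  also have "\<dots> \<le> sin (2 * \<alpha> / 2)" using assms True by (intro sin_half_ge) auto
  finally show ?thesis by simp
next
  case False
  have "2 * a / pi \<le> (2 * (pi - \<alpha>)) / pi" using assms by (intro divide_right_mono) auto
  also have "\<dots> \<le> sin (2 * (pi - \<alpha>) / 2)" using assms False by (intro sin_half_ge) auto
  also have "2 * (pi - \<alpha>) / 2 = pi - \<alpha>" by (rule nonzero_mult_div_cancel_left) simp
  finally show ?thesis by simp
qed

lemma abs_sin_diff_le: "\<bar>sin \<alpha> - sin \<beta>\<bar> \<le> \<bar>\<alpha> - \<beta> :: real\<bar>"
proof -
  have *: "\<bar>sin b - sin a\<bar> \<le> b - a" if "a < b" for a b :: real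
  proof -
    note ab = that
    obtain z where "sin b - sin a = (b - a) * cos z"
      using MVT2[OF ab, of sin cos] DERIV_sin by blast
    then have "\<bar>sin b - sin a\<bar> = (b - a) * \<bar>cos z\<bar>" using that by (simp add: abs_mult)
    also have "\<dots> \<le> (b - a) * 1" using that by (intro mult_left_mono) auto
    finally show ?thesis by simp
  qed
  show ?thesis using *[of \<alpha> \<beta>] *[of \<beta> \<alpha>] by (cases \<alpha> \<beta> rule: linorder_cases) (auto simp: abs_minus_commute)
qed

text \<open>The difference of cosines is 2 sin((\<alpha> + \<gamma>) / 2) sin((\<gamma> - \<alpha>)
  / 2), and the first sine is at least sin \<alpha> / 2 by the formula for sin \<alpha> + sin
  \<gamma>. So steps proportional to \<open>phi\<close> move the angle by an amount proportional to
  the step size, uniformly up to the endpoints.\<close>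

lemma cos_close_imp_angle_close:
  assumes "\<alpha> \<in> {0..pi}" "\<gamma> \<in> {0..pi}" "\<bar>cos \<alpha> - cos \<gamma>\<bar> \<le> \<kappa> * sin \<alpha>" "0 \<le> \<kappa>"
  shows "\<bar>\<alpha> - \<gamma>\<bar> \<le> pi * \<kappa>"
proof (cases "sin \<alpha> = 0")
  case True
  then have "cos \<alpha> = cos \<gamma>" using assms(3) by simp
  then have "\<alpha> = \<gamma>" using assms(1,2) cos_inj_pi[of \<alpha> \<gamma>] by auto
  then show ?thesis using assms(4) by simp
next
  case False
  then have s: "sin \<alpha> > 0" using assms(1) sin_ge_zero[of \<alpha>] by auto
  have half: "sin \<alpha> / 2 \<le> sin ((\<alpha> + \<gamma>) / 2)"
  proof -
    have "sin \<alpha> \<le> sin \<alpha> + sin \<gamma>" using assms(2) sin_ge_zero[of \<gamma>] by auto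
    also have "\<dots> = 2 * sin ((\<alpha> + \<gamma>) / 2) * cos ((\<alpha> - \<gamma>) / 2)" by (rule sin_plus_sin)
    also have "\<dots> \<le> 2 * sin ((\<alpha> + \<gamma>) / 2) * 1"
      using assms(1,2) by (intro mult_left_mono mult_nonneg_nonneg sin_ge_zero) auto
    finally show ?thesis by simp
  qed
  have dist: "\<bar>\<alpha> - \<gamma>\<bar> / pi \<le> \<bar>sin ((\<gamma> - \<alpha>) / 2)\<bar>"
  proof -
    have "\<bar>\<alpha> - \<gamma>\<bar> / pi \<le> sin (\<bar>\<alpha> - \<gamma>\<bar> / 2)" using assms(1,2) by (intro sin_half_ge) auto
    also have "\<dots> \<le> \<bar>sin ((\<gamma> - \<alpha>) / 2)\<bar>"
    proof (cases "\<alpha> \<ge> \<gamma>")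
      case True
      then have "\<bar>\<alpha> - \<gamma>\<bar> / 2 = - ((\<gamma> - \<alpha>) / 2)" by (simp add: minus_divide_left)
      then show ?thesis by (simp only: sin_minus)
    next
      case False
      then have "\<bar>\<alpha> - \<gamma>\<bar> / 2 = (\<gamma> - \<alpha>) / 2" by (simp add: abs_if)
      then show ?thesis by (simp only: abs_ge_self)
    qed
    finally show ?thesis .
  qed
  have "sin \<alpha> * (\<bar>\<alpha> - \<gamma>\<bar> / pi) = 2 * (sin \<alpha> / 2) * (\<bar>\<alpha> - \<gamma>\<bar> / pi)" by simp
  also have "\<dots> \<le> 2 * sin ((\<alpha> + \<gamma>) / 2) * \<bar>sin ((\<gamma> - \<alpha>) / 2)\<bar>"
    using half dist s by (intro mult_mono mult_left_mono) auto
  also have "\<dots> = \<bar>2 * sin ((\<alpha> + \<gamma>) / 2) * sin ((\<gamma> - \<alpha>) / 2)\<bar>"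
    using half s by (simp add: abs_mult)
  also have "\<dots> = \<bar>cos \<alpha> - cos \<gamma>\<bar>" by (simp only: cos_diff_cos)
  also have "\<dots> \<le> \<kappa> * sin \<alpha>" by fact
  finally have "sin \<alpha> * (\<bar>\<alpha> - \<gamma>\<bar> / pi) \<le> sin \<alpha> * \<kappa>" by (simp add: mult.commute)
  then have "\<bar>\<alpha> - \<gamma>\<bar> / pi \<le> \<kappa>" using s by (simp only: mult_le_cancel_left_pos)
  then show ?thesis by (simp add: field_simps)
qed

text \<open>The exponent collects \<open>k * p\<close> from the p-th power of \<open>phi ^ k\<close>
  and 1 from dx = sin \<alpha> d\<alpha>. The summand 1 / n keeps the weight away from 0 at the
  endpoints, without which slow variation would fail.\<close>

definition ang_weight :: "nat \<Rightarrow> real \<Rightarrow> (real \<Rightarrow> real) \<Rightarrow> nat \<Rightarrow> real \<Rightarrow> real" where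
  "ang_weight n p W k \<alpha> = W (cos \<alpha>) * (sin \<alpha> + 1 / real n) powr (real k * p + 1)"

text \<open>By the Lipschitz bound for the sine, sin + 1 / n changes at most by the factor 1 + n
  |\<alpha> - \<beta>|; since p <= 1, its power adds at most k + 1 to the growth exponent.\<close>

lemma slow_ang_weight:
  assumes p: "0 < p" "p \<le> 1" and n: "1 \<le> n" and c: "0 \<le> c"
    and W: "slow_cos n c s W"
  shows "slow_weight n c (s + (k + 1)) (ang_weight n p W k)"
  unfolding slow_weight_def
proof (intro conjI allI ballI)
  note [measurable] = slow_weightD(1)[OF W]
  show "ang_weight n p W k \<in> borel_measurable borel" unfolding ang_weight_def by measurable
  show "0 \<le> ang_weight n p W k \<alpha>" for \<alpha> unfolding ang_weight_def using slow_weightD(2)[OF W] by simp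
  fix \<alpha> \<beta> :: real assume ab: "\<alpha> \<in> {0..pi}" "\<beta> \<in> {0..pi}"
  define y where "y = 1 + real n * \<bar>\<alpha> - \<beta>\<bar>"
  have y: "y \<ge> 1" by (simp add: y_def)
  have sb: "0 < sin \<beta> + 1 / real n" "0 < sin \<alpha> + 1 / real n"
    using ab n by (auto intro!: add_nonneg_pos sin_ge_zero)
  have "sin \<alpha> + 1 / real n \<le> sin \<beta> + 1 / real n + \<bar>\<alpha> - \<beta>\<bar>"
    using abs_sin_diff_le[of \<alpha> \<beta>] by linarith
  also have "\<bar>\<alpha> - \<beta>\<bar> = real n * \<bar>\<alpha> - \<beta>\<bar> * (1 / real n)" using n by simp
  also have "\<dots> \<le> real n * \<bar>\<alpha> - \<beta>\<bar> * (sin \<beta> + 1 / real n)"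
    using ab sin_ge_zero[of \<beta>] by (intro mult_left_mono) auto
  finally have "sin \<alpha> + 1 / real n \<le> y * (sin \<beta> + 1 / real n)" by (simp add: y_def algebra_simps)
  then have "(sin \<alpha> + 1 / real n) powr (real k * p + 1) \<le> (y * (sin \<beta> + 1 / real n)) powr (real k * p + 1)"
    using sb p by (intro powr_mono2) auto
  also have "\<dots> = y powr (real k * p + 1) * (sin \<beta> + 1 / real n) powr (real k * p + 1)"
    using y sb by (simp add: powr_mult)
  also have "\<dots> \<le> y powr real (k + 1) * (sin \<beta> + 1 / real n) powr (real k * p + 1)"
    using y p mult_left_le[of p "real k"] by (intro mult_right_mono powr_mono) auto
  also have "y powr real (k + 1) = y ^ (k + 1)" using y by (subst powr_realpow) auto
  finally have 1: "(sin \<alpha> + 1 / real n) powr (real k * p + 1) \<le> y ^ (k + 1) * (sin \<beta> + 1 / real n) powr (real k * p + 1)" .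
  have "ang_weight n p W k \<alpha> \<le> (c * y ^ s * W (cos \<beta>)) * (y ^ (k + 1) * (sin \<beta> + 1 / real n) powr (real k * p + 1))"
    unfolding ang_weight_def using slow_weightD(3)[OF W ab] 1 c y slow_weightD(2)[OF W]
    by (intro mult_mono) (auto simp: y_def)
  then show "ang_weight n p W k \<alpha> \<le> c * (1 + real n * \<bar>\<alpha> - \<beta>\<bar>) ^ (s + (k + 1)) * ang_weight n p W k \<beta>"
    unfolding ang_weight_def y_def[symmetric] by (simp add: power_add mult_ac)
qed

lemma slow_weight_cmult:
  assumes "slow_weight n c s v" "0 \<le> k"
  shows "slow_weight n c s (\<lambda>\<alpha>. k * v \<alpha>)"
  unfolding slow_weight_def
proof (intro conjI allI ballI)
  note [measurable] = slow_weightD(1)[OF assms(1)]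
  show "(\<lambda>\<alpha>. k * v \<alpha>) \<in> borel_measurable borel" by measurable
  show "0 \<le> k * v \<alpha>" for \<alpha> using slow_weightD(2)[OF assms(1)] assms(2) by simp
  show "k * v \<alpha> \<le> c * (1 + real n * \<bar>\<alpha> - \<beta>\<bar>) ^ s * (k * v \<beta>)" if "\<alpha> \<in> {0..pi}" "\<beta> \<in> {0..pi}" for \<alpha> \<beta>
    using mult_left_mono[OF slow_weightD(3)[OF assms(1) that] assms(2)] by (simp add: mult_ac)
qed

lemma degree_pderiv_pow_le: "degree ((pderiv ^^ k) P) \<le> degree (P :: real poly)"
  by (induction k) (auto simp: degree_pderiv intro: order_trans[OF diff_le_self])

abbreviation ang_int :: "nat \<Rightarrow> real \<Rightarrow> (real \<Rightarrow> real) \<Rightarrow> nat \<Rightarrow> real poly \<Rightarrow> ennreal" where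
  "ang_int n p W k Q \<equiv> wpint p {0..pi} (ang_weight n p W k) (\<lambda>\<alpha>. poly Q (cos \<alpha>))"

lemma ang_int_le_mid:
  assumes p: "0 < p" "p \<le> 1" and c: "0 \<le> c"
  shows "\<exists>\<delta> C. 0 < \<delta> \<and> \<delta> \<le> 1 \<and> 0 \<le> C \<and> (\<forall>n\<ge>1. \<forall>Q W. degree Q < n \<longrightarrow> slow_cos n c s W \<longrightarrow>
    ang_int n p W k Q \<le> ennreal C *
      wpint p {\<delta> / real n..pi - \<delta> / real n} (\<lambda>\<alpha>. W (cos \<alpha>) * sin \<alpha>) (\<lambda>\<alpha>. sin \<alpha> ^ k * poly Q (cos \<alpha>)))"
proof -
  obtain \<delta> where \<delta>: "\<delta> > 0" "\<delta> \<le> 1" "\<forall>n\<ge>1. \<forall>Q v. degree Q < n \<longrightarrow> slow_weight n c (s + (k + 1)) v \<longrightarrow>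
    wpint p {0..pi} v (\<lambda>\<alpha>. poly Q (cos \<alpha>)) \<le>
      2 * wpint p {\<delta> / real n..pi - \<delta> / real n} v (\<lambda>\<alpha>. poly Q (cos \<alpha>))"
    using slow_weight_remez[OF p c, of "s + (k + 1)"] by (auto elim: exE conjE)
  define L where "L = (1 + pi / (2 * \<delta>)) powr (real k * p + 1)"
  have L0: "L \<ge> 0" by (simp add: L_def)
  have main: "ang_int n p W k Q \<le> ennreal (2 * L) *
      wpint p {\<delta> / real n..pi - \<delta> / real n} (\<lambda>\<alpha>. W (cos \<alpha>) * sin \<alpha>) (\<lambda>\<alpha>. sin \<alpha> ^ k * poly Q (cos \<alpha>))"
    if n: "1 \<le> n" and deg: "degree Q < n" and W: "slow_cos n c s W" for n Q W
  proof -
    note [measurable] = slow_weightD(1)[OF W]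
    have "ang_int n p W k Q \<le> 2 * wpint p {\<delta> / real n..pi - \<delta> / real n} (ang_weight n p W k) (\<lambda>\<alpha>. poly Q (cos \<alpha>))"
      using \<delta>(3)[rule_format, OF n deg slow_ang_weight[OF p n c W]] .
    also have "\<dots> \<le> 2 * (\<integral>\<^sup>+\<alpha>\<in>{\<delta> / real n..pi - \<delta> / real n}. ennreal L * (ennreal (W (cos \<alpha>) * sin \<alpha>) * pw p (sin \<alpha> ^ k * poly Q (cos \<alpha>))) \<partial>lborel)"
    proof (rule mult_left_mono[OF set_nn_integral_mono_set[OF order_refl]])
      fix \<alpha> assume a: "\<alpha> \<in> {\<delta> / real n..pi - \<delta> / real n}"
      have dn: "0 < \<delta> / real n" using \<delta> n by simp
      have sin: "2 * (\<delta> / real n) / pi \<le> sin \<alpha>" using dn by (intro sin_ge_linear a) simp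
      then have s0: "sin \<alpha> > 0" using dn by (smt (verit) divide_pos_pos pi_gt_zero)
      have "1 / real n = pi / (2 * \<delta>) * (2 * (\<delta> / real n) / pi)" using \<delta> by simp
      also have "\<dots> \<le> pi / (2 * \<delta>) * sin \<alpha>" using sin \<delta>(1) by (intro mult_left_mono) auto
      finally have "sin \<alpha> + 1 / real n \<le> (1 + pi / (2 * \<delta>)) * sin \<alpha>" by (simp add: algebra_simps)
      then have "(sin \<alpha> + 1 / real n) powr (real k * p + 1) \<le> ((1 + pi / (2 * \<delta>)) * sin \<alpha>) powr (real k * p + 1)"
        using s0 p by (intro powr_mono2) auto
      also have "\<dots> = L * (sin \<alpha> * (sin \<alpha> ^ k) powr p)"
        using s0 \<delta>(1) unfolding L_def by (subst powr_mult) (auto simp: powr_add powr_powr[symmetric] powr_realpow)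
      finally have le: "(sin \<alpha> + 1 / real n) powr (real k * p + 1) \<le> L * (sin \<alpha> * (sin \<alpha> ^ k) powr p)" .
      have "ang_weight n p W k \<alpha> \<le> W (cos \<alpha>) * (L * (sin \<alpha> * (sin \<alpha> ^ k) powr p))"
        unfolding ang_weight_def using le slow_weightD(2)[OF W] by (intro mult_left_mono) auto
      also have "\<dots> = L * (W (cos \<alpha>) * sin \<alpha>) * (sin \<alpha> ^ k) powr p" by (simp add: mult_ac)
      finally have "ennreal (ang_weight n p W k \<alpha>) \<le> ennreal L * ennreal (W (cos \<alpha>) * sin \<alpha>) * pw p (sin \<alpha> ^ k)"
        using L0 s0 slow_weightD(2)[OF W] by (simp add: pw_def ennreal_mult[symmetric] ennreal_leI)
      then have "ennreal (ang_weight n p W k \<alpha>) * pw p (poly Q (cos \<alpha>)) \<le> ennreal L * ennreal (W (cos \<alpha>) * sin \<alpha>) * pw p (sin \<alpha> ^ k) * pw p (poly Q (cos \<alpha>))"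
        by (rule mult_right_mono) simp
      then show "ennreal (ang_weight n p W k \<alpha>) * pw p (poly Q (cos \<alpha>)) \<le> ennreal L * (ennreal (W (cos \<alpha>) * sin \<alpha>) * pw p (sin \<alpha> ^ k * poly Q (cos \<alpha>)))"
        by (simp only: pw_mult mult.assoc)
    qed simp
    also have "\<dots> = ennreal (2 * L) *
      wpint p {\<delta> / real n..pi - \<delta> / real n} (\<lambda>\<alpha>. W (cos \<alpha>) * sin \<alpha>) (\<lambda>\<alpha>. sin \<alpha> ^ k * poly Q (cos \<alpha>))"
      using L0 by (subst set_nn_integral_cmult) (auto simp: ennreal_mult mult.assoc)
    finally show ?thesis .
  qed
  show ?thesis using \<delta>(1,2) L0 by (intro exI[of _ \<delta>] exI[of _ "2 * L"] conjI allI impI main) auto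
qed

lemma phi_cos: "\<alpha> \<in> {0..pi} \<Longrightarrow> phi (cos \<alpha>) = sin \<alpha>"
  unfolding phi_def by (simp add: sin_squared_eq[symmetric] sin_ge_zero)

lemma mid_le_wint:
  assumes [measurable]: "F \<in> borel_measurable borel" "W \<in> borel_measurable borel" and "\<And>x. 0 \<le> W x"
    and "0 \<le> a" and F: "\<And>\<alpha>. \<alpha> \<in> {a..pi - a} \<Longrightarrow> G \<alpha> = F (cos \<alpha>)"
  shows "wpint p {a..pi - a} (\<lambda>\<alpha>. W (cos \<alpha>) * sin \<alpha>) G \<le> wint p W F"
  unfolding wint_cos[OF assms(1-3)] using assms(4) F by (intro set_nn_integral_mono_set) auto

text \<open>Enlarge the Jacobian to sin + 1 / n too, so that the integral falls under
  \<open>ang_int\<close>, and return through the middle part of the circle. The return is possible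
  because \<open>Q\<close> is a polynomial of degree below n.\<close>

lemma realization_weight_change:
  assumes p: "0 < p" "p \<le> 1" and c: "0 \<le> c"
  shows "\<exists>C\<ge>0. \<forall>n\<ge>1. \<forall>Q W. degree Q < n \<longrightarrow> W \<in> borel_measurable borel \<longrightarrow> (\<forall>x. 0 \<le> W x) \<longrightarrow>
     slow_cos n c s W \<longrightarrow>
     wint p W (\<lambda>x. phi_n n x ^ r * poly Q x) \<le> ennreal C * phi_wint r p W Q"
proof -
  obtain \<delta> C where C: "0 < \<delta>" "\<delta> \<le> 1" "0 \<le> C" "\<forall>n\<ge>1. \<forall>Q W. degree Q < n \<longrightarrow> slow_cos n c s W \<longrightarrow>
    ang_int n p W r Q \<le> ennreal C *
      wpint p {\<delta> / real n..pi - \<delta> / real n} (\<lambda>\<alpha>. W (cos \<alpha>) * sin \<alpha>) (\<lambda>\<alpha>. sin \<alpha> ^ r * poly Q (cos \<alpha>))"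
    using ang_int_le_mid[OF p c, of s r] by (elim exE conjE)
  show ?thesis
  proof (rule exI[of _ C], rule conjI[OF C(3)], intro allI impI)
    fix n :: nat and Q :: "real poly" and W
    assume n: "1 \<le> n" and deg: "degree Q < n" and [measurable]: "W \<in> borel_measurable borel" and W0: "\<forall>x. 0 \<le> W x"
      and W: "slow_cos n c s W"
    have [measurable]: "phi_n n \<in> borel_measurable borel" unfolding phi_n_def by measurable
    have "wint p W (\<lambda>x. phi_n n x ^ r * poly Q x) =
      wpint p {0..pi} (\<lambda>\<alpha>. W (cos \<alpha>) * sin \<alpha>) (\<lambda>\<alpha>. phi_n n (cos \<alpha>) ^ r * poly Q (cos \<alpha>))"
      using W0 by (intro wint_cos) auto
    also have "\<dots> \<le> ang_int n p W r Q"
    proof (rule set_nn_integral_mono_set[OF order_refl])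
      fix \<alpha> :: real assume a: "\<alpha> \<in> {0..pi}"
      define y where "y = sin \<alpha> + 1 / real n"
      have s0: "0 \<le> sin \<alpha>" using a by (intro sin_ge_zero) auto
      have y: "0 < y" "sin \<alpha> \<le> y" using s0 n by (auto simp: y_def intro: add_nonneg_pos)
      have "(W (cos \<alpha>) * sin \<alpha>) * (y ^ r) powr p \<le> (W (cos \<alpha>) * y) * (y ^ r) powr p"
        using y W0 by (intro mult_right_mono mult_left_mono) auto
      also have "\<dots> = ang_weight n p W r \<alpha>"
        unfolding ang_weight_def y_def[symmetric] using y by (simp add: powr_add powr_powr powr_realpow[symmetric] mult_ac)
      finally have "ennreal (W (cos \<alpha>) * sin \<alpha>) * pw p (y ^ r) \<le> ennreal (ang_weight n p W r \<alpha>)"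
        using y s0 W0 unfolding pw_def by (subst ennreal_mult[symmetric]) (auto intro!: ennreal_leI)
      from mult_right_mono[OF this zero_le, of "pw p (poly Q (cos \<alpha>))"]
      show "ennreal (W (cos \<alpha>) * sin \<alpha>) * pw p (phi_n n (cos \<alpha>) ^ r * poly Q (cos \<alpha>)) \<le> ennreal (ang_weight n p W r \<alpha>) * pw p (poly Q (cos \<alpha>))"
        unfolding pw_mult phi_n_def phi_cos[OF a] y_def[symmetric] by (simp only: mult.assoc)
    qed
    also have "\<dots> \<le> ennreal C * wpint p {\<delta> / real n..pi - \<delta> / real n} (\<lambda>\<alpha>. W (cos \<alpha>) * sin \<alpha>) (\<lambda>\<alpha>. sin \<alpha> ^ r * poly Q (cos \<alpha>))"
      using C(4)[rule_format, OF n deg W] .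
    also have "\<dots> \<le> ennreal C * phi_wint r p W Q"
    proof (intro mult_left_mono mid_le_wint)
      show "0 \<le> \<delta> / real n" using C by simp
      fix \<alpha> assume "\<alpha> \<in> {\<delta> / real n..pi - \<delta> / real n}"
      then have "\<alpha> \<in> {0..pi}" using \<open>0 \<le> \<delta> / real n\<close> by auto
      then show "sin \<alpha> ^ r * poly Q (cos \<alpha>) = phi (cos \<alpha>) ^ r * poly Q (cos \<alpha>)" by (simp add: phi_cos)
    qed (use W0 in auto)
    finally show "wint p W (\<lambda>x. phi_n n x ^ r * poly Q x) \<le> ennreal C * phi_wint r p W Q" .
  qed
qed


section \<open>Differences of polynomials against their derivatives\<close>

lemma sym_diff_poly_MVT:
  assumes "0 \<le> h" "x - real r * h / 2 \<in> {-1..1}" "x + real r * h / 2 \<in> {-1..1}"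
  shows "\<exists>\<xi>\<in>{-1..1}. \<bar>x - \<xi>\<bar> \<le> real r * h / 2 \<and> sym_diff r h (poly P) x = h ^ r * poly ((pderiv ^^ r) P) \<xi>"
proof -
  obtain \<xi> where \<xi>: "x - real r * h / 2 \<le> \<xi>" "\<xi> \<le> x - real r * h / 2 + real r * h"
    "(fdiff h ^^ r) (poly P) (x - real r * h / 2) = h ^ r * poly ((pderiv ^^ r) P) \<xi>"
    using fdiff_poly_MVT[OF assms(1), of "x - real r * h / 2" r P] by (elim exE conjE)
  define y where "y = real r * h / 2"
  have y: "real r * h = 2 * y" by (simp add: y_def)
  have "\<bar>x - \<xi>\<bar> \<le> y" "\<xi> \<in> {-1..1}" using \<xi>(1,2) assms(2,3) unfolding y_def[symmetric] y by auto
  then show ?thesis using \<xi>(3) sym_diff_eq_fdiff[OF assms(2,3)] unfolding y_def by auto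
qed

lemma sym_diff_outside: "\<not> (x - real r * h / 2 \<in> {-1..1} \<and> x + real r * h / 2 \<in> {-1..1}) \<Longrightarrow> sym_diff r h f x = 0"
  unfolding sym_diff_def by auto

text \<open>The mean value theorem gives a derivative at a nearby point, over whose dependence on x
  there is no control; its angle is off by at most \<open>b / n\<close>, with b = pi r / 2 because
  the nodes spread by r h \<open>phi\<close> / 2 and h <= 1 / n. The maximal estimate
  \<open>slow_weight_sup\<close> absorbs this.\<close>

lemma poly_sym_diff_le:
  assumes p: "0 < p" "p \<le> 1" and c: "0 \<le> c"
  shows "\<exists>C\<ge>0. \<forall>n\<ge>1. \<forall>P W h. degree P < n \<longrightarrow> W \<in> borel_measurable borel \<longrightarrow> (\<forall>x. 0 \<le> W x) \<longrightarrow>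
     slow_cos n c s W \<longrightarrow> 0 < h \<longrightarrow> h \<le> 1 / real n \<longrightarrow>
     step_wint r p W (poly P) h \<le>
       ennreal (C * (h ^ r) powr p) * phi_wint r p W ((pderiv ^^ r) P)"
proof -
  obtain \<delta> C where C: "0 < \<delta>" "\<delta> \<le> 1" "0 \<le> C" "\<forall>n\<ge>1. \<forall>Q W. degree Q < n \<longrightarrow> slow_cos n c s W \<longrightarrow>
    ang_int n p W r Q \<le> ennreal C *
      wpint p {\<delta> / real n..pi - \<delta> / real n} (\<lambda>\<alpha>. W (cos \<alpha>) * sin \<alpha>) (\<lambda>\<alpha>. sin \<alpha> ^ r * poly Q (cos \<alpha>))"
    using ang_int_le_mid[OF p c, of s r] by (elim exE conjE)
  define b where "b = pi * (real r / 2)"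
  have b0: "0 \<le> b" by (simp add: b_def)
  obtain D where D: "D \<ge> 0" "\<forall>n\<ge>1. \<forall>Q v S \<gamma>. degree Q < n \<longrightarrow> slow_weight n c (s + (r + 1)) v \<longrightarrow> S \<subseteq> {0..pi} \<longrightarrow> S \<in> sets borel \<longrightarrow>
    (\<forall>\<alpha>\<in>S. \<gamma> \<alpha> \<in> {0..pi} \<and> \<bar>\<alpha> - \<gamma> \<alpha>\<bar> \<le> b / real n) \<longrightarrow>
    wpint p S v (\<lambda>\<alpha>. poly Q (cos (\<gamma> \<alpha>))) \<le>
      ennreal D * wpint p {0..pi} v (\<lambda>\<alpha>. poly Q (cos \<alpha>))"
    using slow_weight_sup[OF p c b0, of "s + (r + 1)"] by (elim exE conjE)
  show ?thesis
  proof (rule exI[of _ "D * C"], rule conjI, use C D in simp, intro allI impI)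
    fix n :: nat and P :: "real poly" and W and h :: real
    assume n: "1 \<le> n" and deg: "degree P < n" and [measurable]: "W \<in> borel_measurable borel" and W0: "\<forall>x. 0 \<le> W x"
      and W: "slow_cos n c s W" and h: "0 < h" "h \<le> 1 / real n"
    define Q where "Q = (pderiv ^^ r) P"
    have degQ: "degree Q < n" using degree_pderiv_pow_le[of r P] deg unfolding Q_def by linarith
    have "\<exists>\<gamma>. \<forall>\<alpha>\<in>{0..pi}. (\<gamma> \<alpha> \<in> {0..pi} \<and> \<bar>\<alpha> - \<gamma> \<alpha>\<bar> \<le> b / real n) \<and>
       \<bar>sym_diff r (h * phi (cos \<alpha>)) (poly P) (cos \<alpha>)\<bar> \<le> \<bar>(h * sin \<alpha>) ^ r * poly Q (cos (\<gamma> \<alpha>))\<bar>"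
    proof (rule bchoice, rule ballI)
      fix \<alpha> :: real assume a: "\<alpha> \<in> {0..pi}"
      define x where "x = cos \<alpha>"
      define k where "k = h * sin \<alpha>"
      have k0: "0 \<le> k" unfolding k_def using h(1) a by (intro mult_nonneg_nonneg sin_ge_zero) auto
      have bn: "0 \<le> b / real n" using b0 by simp
      have "\<exists>\<gamma>. (\<gamma> \<in> {0..pi} \<and> \<bar>\<alpha> - \<gamma>\<bar> \<le> b / real n) \<and> \<bar>sym_diff r k (poly P) x\<bar> \<le> \<bar>k ^ r * poly Q (cos \<gamma>)\<bar>"
      proof (cases "x - real r * k / 2 \<in> {-1..1} \<and> x + real r * k / 2 \<in> {-1..1}")
        case False
        then show ?thesis using a bn sym_diff_outside[OF False] by (intro exI[of _ \<alpha>]) auto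
      next
        case True
        then obtain \<xi> where \<xi>: "\<xi> \<in> {-1..1}" "\<bar>x - \<xi>\<bar> \<le> real r * k / 2" "sym_diff r k (poly P) x = k ^ r * poly Q \<xi>"
          using sym_diff_poly_MVT[OF k0, of x r P] unfolding Q_def by auto
        define \<gamma> where "\<gamma> = arccos \<xi>"
        have g: "\<gamma> \<in> {0..pi}" "cos \<gamma> = \<xi>" using \<xi>(1) by (auto simp: \<gamma>_def arccos_lbound arccos_ubound)
        have "\<bar>\<alpha> - \<gamma>\<bar> \<le> pi * (real r * h / 2)"
          using \<xi>(2) h(1) by (intro cos_close_imp_angle_close a g(1)) (auto simp: g(2) x_def k_def mult_ac)
        also have "\<dots> = b * h" by (simp add: b_def)
        also have "\<dots> \<le> b * (1 / real n)" using h b0 by (intro mult_left_mono) auto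
        finally show ?thesis using g \<xi>(3) by (intro exI[of _ \<gamma>]) auto
      qed
      then show "\<exists>\<gamma>. (\<gamma> \<in> {0..pi} \<and> \<bar>\<alpha> - \<gamma>\<bar> \<le> b / real n) \<and>
        \<bar>sym_diff r (h * phi (cos \<alpha>)) (poly P) (cos \<alpha>)\<bar> \<le> \<bar>(h * sin \<alpha>) ^ r * poly Q (cos \<gamma>)\<bar>"
        unfolding phi_cos[OF a] x_def k_def .
    qed
    then obtain \<gamma> where g1: "\<forall>\<alpha>\<in>{0..pi}. \<gamma> \<alpha> \<in> {0..pi} \<and> \<bar>\<alpha> - \<gamma> \<alpha>\<bar> \<le> b / real n" and
      g2: "\<And>\<alpha>. \<alpha> \<in> {0..pi} \<Longrightarrow> \<bar>sym_diff r (h * phi (cos \<alpha>)) (poly P) (cos \<alpha>)\<bar> \<le> \<bar>(h * sin \<alpha>) ^ r * poly Q (cos (\<gamma> \<alpha>))\<bar>"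
      by blast
    have "step_wint r p W (poly P) h =
      wpint p {0..pi} (\<lambda>\<alpha>. W (cos \<alpha>) * sin \<alpha>) (\<lambda>\<alpha>. sym_diff r (h * phi (cos \<alpha>)) (poly P) (cos \<alpha>))"
      using W0 by (intro wint_cos) auto
    also have "\<dots> \<le> (\<integral>\<^sup>+\<alpha>\<in>{0..pi}. ennreal ((h ^ r) powr p) * (ennreal (ang_weight n p W r \<alpha>) * pw p (poly Q (cos (\<gamma> \<alpha>)))) \<partial>lborel)"
    proof (rule set_nn_integral_mono_set[OF order_refl])
      fix \<alpha> :: real assume a: "\<alpha> \<in> {0..pi}"
      define y where "y = sin \<alpha> + 1 / real n"
      have s0: "0 \<le> sin \<alpha>" using a by (intro sin_ge_zero) auto
      have y: "0 < y" "sin \<alpha> \<le> y" using s0 n by (auto simp: y_def intro: add_nonneg_pos)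
      have "(W (cos \<alpha>) * sin \<alpha>) * \<bar>(h * sin \<alpha>) ^ r\<bar> powr p \<le> (W (cos \<alpha>) * y) * ((h * y) ^ r) powr p"
        using y W0 s0 h p by (intro mult_mono mult_left_mono powr_mono2) (auto intro!: power_mono)
      also have "\<dots> = (h ^ r) powr p * ang_weight n p W r \<alpha>"
        unfolding ang_weight_def y_def[symmetric] using y h
        by (simp add: power_mult_distrib powr_mult powr_add powr_powr powr_realpow[symmetric] mult_ac)
      finally have "ennreal (W (cos \<alpha>) * sin \<alpha>) * pw p ((h * sin \<alpha>) ^ r) \<le> ennreal ((h ^ r) powr p) * ennreal (ang_weight n p W r \<alpha>)"
        using s0 W0 unfolding pw_def by (subst (1 2) ennreal_mult'[symmetric]) (auto intro!: ennreal_leI)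
      from mult_right_mono[OF this zero_le, of "pw p (poly Q (cos (\<gamma> \<alpha>)))"]
      have "ennreal (W (cos \<alpha>) * sin \<alpha>) * pw p ((h * sin \<alpha>) ^ r * poly Q (cos (\<gamma> \<alpha>))) \<le>
        ennreal ((h ^ r) powr p) * (ennreal (ang_weight n p W r \<alpha>) * pw p (poly Q (cos (\<gamma> \<alpha>))))"
        unfolding pw_mult by (simp only: mult.assoc)
      moreover have "ennreal (W (cos \<alpha>) * sin \<alpha>) * pw p (sym_diff r (h * phi (cos \<alpha>)) (poly P) (cos \<alpha>)) \<le>
        ennreal (W (cos \<alpha>) * sin \<alpha>) * pw p ((h * sin \<alpha>) ^ r * poly Q (cos (\<gamma> \<alpha>)))"
        using g2[OF a] p by (intro mult_left_mono pw_mono) auto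
      ultimately show "ennreal (W (cos \<alpha>) * sin \<alpha>) * pw p (sym_diff r (h * phi (cos \<alpha>)) (poly P) (cos \<alpha>)) \<le>
        ennreal ((h ^ r) powr p) * (ennreal (ang_weight n p W r \<alpha>) * pw p (poly Q (cos (\<gamma> \<alpha>))))"
        by (rule order_trans[rotated])
    qed
    also have "\<dots> = wpint p {0..pi} (\<lambda>\<alpha>. (h ^ r) powr p * ang_weight n p W r \<alpha>) (\<lambda>\<alpha>. poly Q (cos (\<gamma> \<alpha>)))"
      by (simp add: ennreal_mult' mult.assoc)
    also have "\<dots> \<le> ennreal D * wpint p {0..pi} (\<lambda>\<alpha>. (h ^ r) powr p * ang_weight n p W r \<alpha>) (\<lambda>\<alpha>. poly Q (cos \<alpha>))"
      using D(2)[rule_format, OF n degQ slow_weight_cmult[OF slow_ang_weight[OF p n c W]] order_refl _ g1[rule_format]] by auto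
    also have "\<dots> = ennreal ((h ^ r) powr p) * (ennreal D * ang_int n p W r Q)"
    proof -
      note [measurable] = slow_weightD(1)[OF slow_ang_weight[OF p n c W]]
      have "wpint p {0..pi} (\<lambda>\<alpha>. (h ^ r) powr p * ang_weight n p W r \<alpha>) (\<lambda>\<alpha>. poly Q (cos \<alpha>)) =
        (\<integral>\<^sup>+\<alpha>\<in>{0..pi}. ennreal ((h ^ r) powr p) * (ennreal (ang_weight n p W r \<alpha>) * pw p (poly Q (cos \<alpha>))) \<partial>lborel)"
        by (simp add: ennreal_mult' mult.assoc)
      also have "\<dots> = ennreal ((h ^ r) powr p) * ang_int n p W r Q"
        by (rule set_nn_integral_cmult) auto
      finally show ?thesis by (simp only: mult.left_commute)
    qed
    also have "\<dots> \<le> ennreal ((h ^ r) powr p) * (ennreal D * (ennreal C * phi_wint r p W Q))"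
    proof (intro mult_left_mono order_trans[OF C(4)[rule_format, OF n degQ W]] mid_le_wint)
      show dn: "0 \<le> \<delta> / real n" using C by simp
      fix \<alpha> assume "\<alpha> \<in> {\<delta> / real n..pi - \<delta> / real n}"
      then have "\<alpha> \<in> {0..pi}" using dn by auto
      then show "sin \<alpha> ^ r * poly Q (cos \<alpha>) = phi (cos \<alpha>) ^ r * poly Q (cos \<alpha>)" by (simp add: phi_cos)
    qed (use W0 in auto)
    also have "\<dots> = ennreal (D * C * (h ^ r) powr p) * phi_wint r p W Q"
      using D(1) C(3) by (simp add: ennreal_mult mult_ac)
    finally show "step_wint r p W (poly P) h \<le>
       ennreal (D * C * (h ^ r) powr p) * phi_wint r p W ((pderiv ^^ r) P)"
      unfolding Q_def .
  qed
qed


text \<open>On the middle part of the circle the difference deviates from its leading term (h sin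
  \<alpha>)^r Q by one more derivative times h. Bernstein's inequality bounds this deviation by a
  multiple of (h n)^p times the quantity to be estimated, and for small h n it is absorbed.\<close>

lemma poly_derivative_le_sym_diff:
  assumes p: "0 < p" "p \<le> 1" and c: "0 \<le> c"
  shows "\<exists>\<theta> C. 0 < \<theta> \<and> \<theta> \<le> 1 \<and> 0 \<le> C \<and> (\<forall>n\<ge>1. \<forall>P W h. degree P < n \<longrightarrow> W \<in> borel_measurable borel \<longrightarrow> (\<forall>x. 0 \<le> W x) \<longrightarrow>
     slow_cos n c s W \<longrightarrow> 0 < h \<longrightarrow> h \<le> \<theta> / real n \<longrightarrow>
     ennreal ((h ^ r) powr p) * phi_wint r p W ((pderiv ^^ r) P) \<le>
       ennreal C * step_wint r p W (poly P) h)"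
proof -
  obtain \<delta> C where C: "0 < \<delta>" "\<delta> \<le> 1" "0 \<le> C" "\<forall>n\<ge>1. \<forall>Q W. degree Q < n \<longrightarrow> slow_cos n c s W \<longrightarrow>
    ang_int n p W r Q \<le> ennreal C *
      wpint p {\<delta> / real n..pi - \<delta> / real n} (\<lambda>\<alpha>. W (cos \<alpha>) * sin \<alpha>) (\<lambda>\<alpha>. sin \<alpha> ^ r * poly Q (cos \<alpha>))"
    using ang_int_le_mid[OF p c, of s r] by (elim exE conjE)
  define b where "b = pi * (real r / 2)"
  have b0: "0 \<le> b" by (simp add: b_def)
  obtain D where D: "D \<ge> 0" "\<forall>n\<ge>1. \<forall>Q v S \<gamma>. degree Q < n \<longrightarrow> slow_weight n c (s + (Suc r + 1)) v \<longrightarrow> S \<subseteq> {0..pi} \<longrightarrow> S \<in> sets borel \<longrightarrow>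
    (\<forall>\<alpha>\<in>S. \<gamma> \<alpha> \<in> {0..pi} \<and> \<bar>\<alpha> - \<gamma> \<alpha>\<bar> \<le> b / real n) \<longrightarrow>
    wpint p S v (\<lambda>\<alpha>. poly Q (cos (\<gamma> \<alpha>))) \<le>
      ennreal D * wpint p {0..pi} v (\<lambda>\<alpha>. poly Q (cos \<alpha>))"
    using slow_weight_sup[OF p c b0, of "s + (Suc r + 1)"] by (elim exE conjE)
  obtain B where B: "B \<ge> 0" "\<forall>n\<ge>1. \<forall>Q v. degree Q < n \<longrightarrow> slow_weight n c (s + (r + 1)) v \<longrightarrow>
    wpint p {0..pi} v (\<lambda>\<alpha>. (sin \<alpha> + 1 / real n) * poly (pderiv Q) (cos \<alpha>)) \<le>
      ennreal (B * real n powr p) * wpint p {0..pi} v (\<lambda>\<alpha>. poly Q (cos \<alpha>))"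
    using slow_weight_bernstein[OF p c, of "s + (r + 1)"] by (elim exE conjE)
  define K where "K = C * (real r / 2) powr p * D * B"
  have K0: "0 \<le> K" unfolding K_def using C D B by simp
  \<comment> \<open>The three bounds: h <= 1 / n for the shifted points, a factor of at most 1 / 2
    for the absorption, and r h <= sin \<alpha> on the middle part, so that no difference is cut off
    there.\<close>
  define \<theta> where "\<theta> = min (min 1 ((1 / (2 * (K + 1))) powr (1 / p))) (2 * \<delta> / (pi * (real r + 1)))"
  have \<theta>: "0 < \<theta>" "\<theta> \<le> 1" "\<theta> \<le> (1 / (2 * (K + 1))) powr (1 / p)" "\<theta> \<le> 2 * \<delta> / (pi * (real r + 1))"
    using K0 C(1) by (auto simp: \<theta>_def intro!: divide_pos_pos mult_pos_pos)
  have K\<theta>: "K * \<theta> powr p \<le> 1 / 2"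
  proof -
    have "\<theta> powr p \<le> ((1 / (2 * (K + 1))) powr (1 / p)) powr p" using \<theta> p by (intro powr_mono2) auto
    also have "\<dots> = 1 / (2 * (K + 1))" using p K0 by (simp add: powr_powr)
    finally have "K * \<theta> powr p \<le> K * (1 / (2 * (K + 1)))" using K0 by (intro mult_left_mono)
    also have "\<dots> \<le> 1 / 2" using K0 by (simp add: field_simps)
    finally show ?thesis .
  qed
  have main: "ennreal ((h ^ r) powr p) * phi_wint r p W ((pderiv ^^ r) P) \<le>
       ennreal (2 * C) * step_wint r p W (poly P) h"
    if n: "1 \<le> n" and deg: "degree P < n" and Wm[measurable]: "W \<in> borel_measurable borel" and W0: "\<And>x. 0 \<le> W x"
      and W: "slow_cos n c s W" and h: "0 < h" "h \<le> \<theta> / real n" for n P W and h :: real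
  proof -
    define Q where "Q = (pderiv ^^ r) P"
    have degQ: "degree Q < n" using degree_pderiv_pow_le[of r P] deg unfolding Q_def by linarith
    have degQ': "degree (pderiv Q) < n" using degQ by (simp add: degree_pderiv)
    define a where "a = \<delta> / real n"
    have a0: "0 < a" using C(1) n by (simp add: a_def)
    define S where "S = {a..pi - a}"
    have S: "S \<subseteq> {0..pi}" "S \<in> sets borel" using a0 by (auto simp: S_def)
    have hn: "h * real n \<le> \<theta>" using h n by (simp add: field_simps)
    have sinS: "real r * h \<le> sin \<alpha>" "0 < sin \<alpha>" if "\<alpha> \<in> S" for \<alpha>
    proof -
      have "2 * a / pi \<le> sin \<alpha>" using that a0 unfolding S_def by (intro sin_ge_linear) auto
      moreover have "0 < 2 * a / pi" using a0 by simp
      moreover have "real r * h \<le> 2 * a / pi"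
      proof -
        have "real r * h \<le> (real r + 1) * (\<theta> / real n)" using h by (intro mult_mono) auto
        also have "\<dots> \<le> (real r + 1) * ((2 * \<delta> / (pi * (real r + 1))) / real n)"
          using \<theta>(4) by (intro mult_left_mono divide_right_mono) auto
        also have "\<dots> = 2 * a / pi"
        proof -
          define R where "R = real r + 1"
          have "R > 0" by (simp add: R_def)
          then show ?thesis unfolding a_def R_def[symmetric] by (simp add: field_simps)
        qed
        finally show ?thesis .
      qed
      ultimately show "real r * h \<le> sin \<alpha>" "0 < sin \<alpha>" by linarith+
    qed
    have "\<exists>\<gamma>. \<forall>\<alpha>\<in>S. (\<gamma> \<alpha> \<in> {0..pi} \<and> \<bar>\<alpha> - \<gamma> \<alpha>\<bar> \<le> b / real n) \<and>
       \<bar>(h * sin \<alpha>) ^ r * poly Q (cos \<alpha>) - sym_diff r (h * phi (cos \<alpha>)) (poly P) (cos \<alpha>)\<bar> \<le>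
         \<bar>(h * sin \<alpha>) ^ r * (real r / 2 * (h * sin \<alpha>)) * poly (pderiv Q) (cos (\<gamma> \<alpha>))\<bar>"
    proof (rule bchoice, rule ballI)
      fix \<alpha> :: real assume aS: "\<alpha> \<in> S"
      then have a: "\<alpha> \<in> {0..pi}" using S by auto
      define x where "x = cos \<alpha>"
      define k where "k = h * sin \<alpha>"
      have s: "0 < sin \<alpha>" "real r * h \<le> sin \<alpha>" using sinS[OF aS] by auto
      have k0: "0 \<le> k" unfolding k_def using h(1) s by simp
      have "real r * k \<le> sin \<alpha> * sin \<alpha>" using mult_right_mono[OF s(2), of "sin \<alpha>"] s(1) by (simp add: k_def mult_ac)
      also have "\<dots> = (1 - x) * (1 + x)"
        using sin_squared_eq[of \<alpha>] by (simp add: x_def power2_eq_square algebra_simps)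
      finally have rk: "real r * k \<le> (1 - x) * (1 + x)" .
      have x1: "- 1 \<le> x" "x \<le> 1" by (auto simp: x_def)
      have "(1 - x) * (1 + x) \<le> (1 - x) * 2" "(1 - x) * (1 + x) \<le> 2 * (1 + x)"
        using x1 by (intro mult_left_mono mult_right_mono; simp)+
      then have "real r * k \<le> (1 - x) * 2" "real r * k \<le> 2 * (1 + x)"
        using rk by (auto intro: order_trans)
      then have "real r * k / 2 \<le> 1 - x" "real r * k / 2 \<le> 1 + x" by simp_all
      moreover have "0 \<le> real r * k / 2" using k0 by simp
      ultimately have dom: "x - real r * k / 2 \<in> {-1..1}" "x + real r * k / 2 \<in> {-1..1}"
        using x1 unfolding atLeastAtMost_iff by linarith+
      then obtain \<xi> where \<xi>: "\<xi> \<in> {-1..1}" "\<bar>x - \<xi>\<bar> \<le> real r * k / 2" "sym_diff r k (poly P) x = k ^ r * poly Q \<xi>"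
        using sym_diff_poly_MVT[OF k0 dom, of P] unfolding Q_def by auto
      obtain \<eta> where \<eta>: "min x \<xi> \<le> \<eta>" "\<eta> \<le> max x \<xi>" "\<bar>poly Q x - poly Q \<xi>\<bar> = \<bar>x - \<xi>\<bar> * \<bar>poly (pderiv Q) \<eta>\<bar>"
      proof (cases "x \<le> \<xi>")
        case True
        then obtain z where "x \<le> z" "z \<le> \<xi>" "poly Q \<xi> - poly Q x = (\<xi> - x) * poly (pderiv Q) z" by (rule poly_MVT_le)
        then show ?thesis using that[of z] True by (metis abs_minus_commute abs_mult max.absorb2 min.absorb1)
      next
        case False
        then have "\<xi> \<le> x" by simp
        then obtain z where "\<xi> \<le> z" "z \<le> x" "poly Q x - poly Q \<xi> = (x - \<xi>) * poly (pderiv Q) z" by (rule poly_MVT_le)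
        then show ?thesis using that[of z] False by (metis abs_mult linear max.absorb1 min.absorb2)
      qed
      define \<gamma> where "\<gamma> = arccos \<eta>"
      have \<eta>1: "\<eta> \<in> {-1..1}" "\<bar>x - \<eta>\<bar> \<le> \<bar>x - \<xi>\<bar>" using \<eta>(1,2) \<xi>(1) x1 by auto
      have g: "\<gamma> \<in> {0..pi}" "cos \<gamma> = \<eta>" using \<eta>1(1) by (auto simp: \<gamma>_def arccos_lbound arccos_ubound)
      have "\<bar>\<alpha> - \<gamma>\<bar> \<le> pi * (real r * h / 2)"
      proof (rule cos_close_imp_angle_close[OF a g(1)])
        show "\<bar>cos \<alpha> - cos \<gamma>\<bar> \<le> real r * h / 2 * sin \<alpha>"
          using \<eta>1(2) \<xi>(2) unfolding g(2) x_def k_def by (simp add: mult.assoc)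
      qed (use h in simp)
      also have "\<dots> = b * h" by (simp add: b_def)
      also have "\<dots> \<le> b * (1 / real n)" using h \<theta>(2) b0 divide_right_mono[OF \<theta>(2), of "real n"] by (intro mult_left_mono) auto
      finally have ag: "\<bar>\<alpha> - \<gamma>\<bar> \<le> b / real n" by simp
      have "\<bar>k ^ r * poly Q x - sym_diff r k (poly P) x\<bar> = k ^ r * \<bar>poly Q x - poly Q \<xi>\<bar>"
        unfolding \<xi>(3) right_diff_distrib[symmetric] using k0 by (simp add: abs_mult)
      also have "\<dots> \<le> k ^ r * ((real r / 2 * k) * \<bar>poly (pderiv Q) \<eta>\<bar>)"
        unfolding \<eta>(3) using \<xi>(2) k0 by (intro mult_left_mono mult_right_mono) auto
      also have "\<dots> = \<bar>k ^ r * (real r / 2 * k) * poly (pderiv Q) (cos \<gamma>)\<bar>"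
        using k0 by (simp add: abs_mult g(2))
      finally show "\<exists>\<gamma>. (\<gamma> \<in> {0..pi} \<and> \<bar>\<alpha> - \<gamma>\<bar> \<le> b / real n) \<and>
       \<bar>(h * sin \<alpha>) ^ r * poly Q (cos \<alpha>) - sym_diff r (h * phi (cos \<alpha>)) (poly P) (cos \<alpha>)\<bar> \<le>
         \<bar>(h * sin \<alpha>) ^ r * (real r / 2 * (h * sin \<alpha>)) * poly (pderiv Q) (cos \<gamma>)\<bar>"
        using g(1) ag unfolding phi_cos[OF a] x_def k_def by blast
    qed
    then obtain \<gamma> where g1: "\<forall>\<alpha>\<in>S. \<gamma> \<alpha> \<in> {0..pi} \<and> \<bar>\<alpha> - \<gamma> \<alpha>\<bar> \<le> b / real n" and
      g2: "\<And>\<alpha>. \<alpha> \<in> S \<Longrightarrow> \<bar>(h * sin \<alpha>) ^ r * poly Q (cos \<alpha>) - sym_diff r (h * phi (cos \<alpha>)) (poly P) (cos \<alpha>)\<bar> \<le>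
         \<bar>(h * sin \<alpha>) ^ r * (real r / 2 * (h * sin \<alpha>)) * poly (pderiv Q) (cos (\<gamma> \<alpha>))\<bar>"
      by blast
    note aw = slow_ang_weight[OF p n c W, of r] and aw' = slow_ang_weight[OF p n c W, of "Suc r"]
    note [measurable] = slow_weightD(1)[OF aw] slow_weightD(1)[OF aw'] S(2)
    define Z where "Z = ang_int n p W r Q"
    define X where "X = step_wint r p W (poly P) h"
    define k2 where "k2 = (h ^ r) powr p * (real r / 2 * h) powr p"
    have k20: "0 \<le> k2" by (simp add: k2_def)
    have Zfin: "Z < \<infinity>" unfolding Z_def by (rule slow_weight_integral_finite[OF aw c p(1)])
    define R where "R = wpint p S (\<lambda>\<alpha>. k2 * ang_weight n p W (Suc r) \<alpha>) (\<lambda>\<alpha>. poly (pderiv Q) (cos (\<gamma> \<alpha>)))"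
    have R: "R \<le> ennreal ((h ^ r) powr p) * ennreal ((real r / 2) powr p * D * B * \<theta> powr p) * Z"
    proof -
      have "R \<le> ennreal D * wpint p {0..pi} (\<lambda>\<alpha>. k2 * ang_weight n p W (Suc r) \<alpha>) (\<lambda>\<alpha>. poly (pderiv Q) (cos \<alpha>))"
        unfolding R_def using D(2)[rule_format, OF n degQ' slow_weight_cmult[OF aw' k20] S g1[rule_format]] by simp
      also have "wpint p {0..pi} (\<lambda>\<alpha>. k2 * ang_weight n p W (Suc r) \<alpha>) (\<lambda>\<alpha>. poly (pderiv Q) (cos \<alpha>)) =
        (\<integral>\<^sup>+\<alpha>\<in>{0..pi}. ennreal k2 * (ennreal (ang_weight n p W r \<alpha>) * pw p ((sin \<alpha> + 1 / real n) * poly (pderiv Q) (cos \<alpha>))) \<partial>lborel)"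
      proof (intro nn_integral_cong)
        fix \<alpha>
        have "ennreal (k2 * ang_weight n p W (Suc r) \<alpha>) = ennreal k2 * (ennreal (ang_weight n p W r \<alpha>) * pw p (sin \<alpha> + 1 / real n))"
          if "\<alpha> \<in> {0..pi}"
        proof -
          have "0 \<le> sin \<alpha> + 1 / real n" using that sin_ge_zero[of \<alpha>] by auto
          then have "ang_weight n p W (Suc r) \<alpha> = ang_weight n p W r \<alpha> * \<bar>sin \<alpha> + 1 / real n\<bar> powr p"
            unfolding ang_weight_def by (simp add: powr_add[symmetric] algebra_simps)
          then show ?thesis unfolding pw_def using k20 slow_weightD(2)[OF aw] by (simp add: ennreal_mult)
        qed
        then show "ennreal (k2 * ang_weight n p W (Suc r) \<alpha>) * pw p (poly (pderiv Q) (cos \<alpha>)) * indicator {0..pi} \<alpha> =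
          ennreal k2 * (ennreal (ang_weight n p W r \<alpha>) * pw p ((sin \<alpha> + 1 / real n) * poly (pderiv Q) (cos \<alpha>))) * indicator {0..pi} \<alpha>"
          unfolding pw_mult by (cases "\<alpha> \<in> {0..pi}") (simp_all only: mult.assoc, simp)
      qed
      also have "\<dots> = ennreal k2 * wpint p {0..pi} (\<lambda>\<alpha>. ang_weight n p W r \<alpha>) (\<lambda>\<alpha>. (sin \<alpha> + 1 / real n) * poly (pderiv Q) (cos \<alpha>))"
        by (rule set_nn_integral_cmult) auto
      also have "\<dots> \<le> ennreal k2 * (ennreal (B * real n powr p) * Z)"
        unfolding Z_def by (intro mult_left_mono B(2)[rule_format, OF n degQ aw]) auto
      finally have "R \<le> ennreal D * (ennreal k2 * (ennreal (B * real n powr p) * Z))"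
        by (simp add: mult_left_mono)
      also have "\<dots> = ennreal (D * (k2 * (B * real n powr p))) * Z"
        using D(1) k20 B(1) by (simp add: ennreal_mult mult_ac)
      also have "\<dots> \<le> ennreal ((h ^ r) powr p * ((real r / 2) powr p * D * B * \<theta> powr p)) * Z"
      proof (intro mult_right_mono ennreal_leI)
        have "h powr p * real n powr p \<le> \<theta> powr p"
          using hn h p by (subst powr_mult[symmetric]) (auto intro!: powr_mono2)
        then have "((h ^ r) powr p * ((real r / 2) powr p * D * B)) * (h powr p * real n powr p) \<le>
          ((h ^ r) powr p * ((real r / 2) powr p * D * B)) * \<theta> powr p"
          using D(1) B(1) by (intro mult_left_mono) auto
        moreover have "D * (k2 * (B * real n powr p)) = ((h ^ r) powr p * ((real r / 2) powr p * D * B)) * (h powr p * real n powr p)"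
          unfolding k2_def using h by (simp only: powr_mult mult_ac)
        ultimately show "D * (k2 * (B * real n powr p)) \<le> (h ^ r) powr p * ((real r / 2) powr p * D * B * \<theta> powr p)"
          by (simp only: mult_ac)
      qed auto
      finally show ?thesis using D(1) B(1) by (simp add: ennreal_mult mult_ac)
    qed
    have ZS: "Z \<le> ennreal C * wpint p S (\<lambda>\<alpha>. W (cos \<alpha>) * sin \<alpha>) (\<lambda>\<alpha>. sin \<alpha> ^ r * poly Q (cos \<alpha>))"
      using C(4)[rule_format, OF n degQ W] unfolding Z_def S_def a_def .
    have hS: "ennreal ((h ^ r) powr p) * wpint p S (\<lambda>\<alpha>. W (cos \<alpha>) * sin \<alpha>) (\<lambda>\<alpha>. sin \<alpha> ^ r * poly Q (cos \<alpha>)) \<le> X + R"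
    proof -
      define U where "U \<alpha> = ennreal (W (cos \<alpha>) * sin \<alpha>) * pw p (sym_diff r (h * phi (cos \<alpha>)) (poly P) (cos \<alpha>))" for \<alpha>
      define V where "V \<alpha> = ennreal (k2 * ang_weight n p W (Suc r) \<alpha>) * pw p (poly (pderiv Q) (cos (\<gamma> \<alpha>)))" for \<alpha>
      have [measurable]: "U \<in> borel_measurable borel" unfolding U_def by measurable
      define T where "T \<alpha> = ennreal ((h ^ r) powr p) * (ennreal (W (cos \<alpha>) * sin \<alpha>) * pw p (sin \<alpha> ^ r * poly Q (cos \<alpha>)))" for \<alpha>
      have [measurable]: "T \<in> borel_measurable borel" unfolding T_def by measurable
      \<comment> \<open>\<open>V\<close> contains the chosen points \<gamma> and may fail to be
        measurable, so additivity of the integral is not at hand for U + V. The measurable truncated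
        difference \<open>T \<alpha> - U \<alpha>\<close> is integrated instead and compared with
        \<open>V\<close> by monotonicity.\<close>
      have UV: "T \<alpha> - U \<alpha> \<le> V \<alpha>" if aS: "\<alpha> \<in> S" for \<alpha>
      proof -
        have a: "\<alpha> \<in> {0..pi}" using aS S by auto
        have s: "0 < sin \<alpha>" using sinS[OF aS] by auto
        define y where "y = sin \<alpha> + 1 / real n"
        have y: "0 < y" "sin \<alpha> \<le> y" using s n by (auto simp: y_def intro: add_nonneg_pos)
        define w where "w = ennreal (W (cos \<alpha>) * sin \<alpha>)"
        define k where "k = (h * sin \<alpha>) ^ r * (real r / 2 * (h * sin \<alpha>))"
        define sd where "sd = sym_diff r (h * phi (cos \<alpha>)) (poly P) (cos \<alpha>)"
        have "pw p ((h * sin \<alpha>) ^ r * poly Q (cos \<alpha>)) \<le> pw p ((h * sin \<alpha>) ^ r * poly Q (cos \<alpha>) - sd) + pw p sd"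
          using pw_add[OF p, of "(h * sin \<alpha>) ^ r * poly Q (cos \<alpha>) - sd" sd] by simp
        also have "pw p ((h * sin \<alpha>) ^ r * poly Q (cos \<alpha>) - sd) \<le> pw p (k * poly (pderiv Q) (cos (\<gamma> \<alpha>)))"
          using g2[OF aS] p unfolding sd_def k_def by (intro pw_mono) auto
        finally have le1: "pw p ((h * sin \<alpha>) ^ r * poly Q (cos \<alpha>)) \<le> pw p (k * poly (pderiv Q) (cos (\<gamma> \<alpha>))) + pw p sd"
          by (simp add: add_right_mono)
        have T: "T \<alpha> = w * pw p ((h * sin \<alpha>) ^ r * poly Q (cos \<alpha>))"
          unfolding T_def w_def power_mult_distrib pw_mult using h by (simp add: pw_def mult_ac)
        have "w * pw p k \<le> ennreal (k2 * ang_weight n p W (Suc r) \<alpha>)"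
        proof -
          have "(W (cos \<alpha>) * sin \<alpha>) * \<bar>k\<bar> powr p \<le> (W (cos \<alpha>) * y) * ((h * y) ^ r * (real r / 2 * (h * y))) powr p"
            unfolding k_def using y W0 s h p by (intro mult_mono mult_left_mono powr_mono2) (auto intro!: power_mono mult_mono)
          also have "\<dots> = k2 * ang_weight n p W (Suc r) \<alpha>"
          proof -
            have "(h * y) ^ r * (real r / 2 * (h * y)) = h ^ r * (real r / 2 * h) * y ^ Suc r"
              by (simp add: power_mult_distrib mult_ac)
            then have "((h * y) ^ r * (real r / 2 * (h * y))) powr p = (h ^ r) powr p * (real r / 2 * h) powr p * (y ^ Suc r) powr p"
              using y h by (simp only: powr_mult)
            also have "(y ^ Suc r) powr p = y powr (real (Suc r) * p)"
              using y by (simp only: powr_realpow[symmetric] powr_powr)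
            finally show ?thesis unfolding ang_weight_def y_def[symmetric] k2_def
              using y by (simp add: powr_add mult_ac)
          qed
          finally show ?thesis
            using s W0 unfolding w_def pw_def by (subst ennreal_mult'[symmetric]) (auto intro!: ennreal_leI mult_nonneg_nonneg)
        qed
        from mult_right_mono[OF this zero_le, of "pw p (poly (pderiv Q) (cos (\<gamma> \<alpha>)))"]
        have le2: "w * pw p (k * poly (pderiv Q) (cos (\<gamma> \<alpha>))) \<le> V \<alpha>"
          unfolding V_def pw_mult by (simp only: mult.assoc)
        have "T \<alpha> \<le> w * (pw p (k * poly (pderiv Q) (cos (\<gamma> \<alpha>))) + pw p sd)"
          unfolding T by (intro mult_left_mono le1) auto
        also have "\<dots> \<le> V \<alpha> + U \<alpha>"
          unfolding distrib_left using le2 by (intro add_mono) (auto simp: U_def w_def sd_def)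
        finally have "T \<alpha> \<le> U \<alpha> + V \<alpha>" by (simp add: add.commute)
        moreover have "U \<alpha> \<noteq> \<infinity>" unfolding U_def pw_def by (simp add: ennreal_mult_eq_top_iff)
        ultimately show ?thesis by (simp add: ennreal_minus_le_iff)
      qed
      have "ennreal ((h ^ r) powr p) * wpint p S (\<lambda>\<alpha>. W (cos \<alpha>) * sin \<alpha>) (\<lambda>\<alpha>. sin \<alpha> ^ r * poly Q (cos \<alpha>))
         = (\<integral>\<^sup>+\<alpha>\<in>S. T \<alpha> \<partial>lborel)"
        unfolding T_def by (rule set_nn_integral_cmult[symmetric]) auto
      also have "\<dots> \<le> (\<integral>\<^sup>+\<alpha>\<in>S. (U \<alpha> + (T \<alpha> - U \<alpha>)) \<partial>lborel)"
      proof (rule set_nn_integral_mono_set[OF order_refl])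
        show "T \<alpha> \<le> U \<alpha> + (T \<alpha> - U \<alpha>)" for \<alpha>
          by (metis add_increasing2 ennreal_ineq_diff_add le_cases order_refl zero_le)
      qed
      also have "\<dots> = (\<integral>\<^sup>+\<alpha>\<in>S. U \<alpha> \<partial>lborel) + (\<integral>\<^sup>+\<alpha>\<in>S. (T \<alpha> - U \<alpha>) \<partial>lborel)"
        by (rule set_nn_integral_add) auto
      also have "\<dots> \<le> X + R"
      proof (rule add_mono)
        show "(\<integral>\<^sup>+\<alpha>\<in>S. U \<alpha> \<partial>lborel) \<le> X"
          unfolding U_def X_def S_def using W0 a0 by (intro mid_le_wint) auto
        show "(\<integral>\<^sup>+\<alpha>\<in>S. (T \<alpha> - U \<alpha>) \<partial>lborel) \<le> R"
          unfolding R_def V_def[symmetric] by (intro set_nn_integral_mono_set[OF order_refl] UV)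
      qed
      finally show ?thesis .
    qed
    define hp where "hp = ennreal ((h ^ r) powr p)"
    have "hp * Z \<le> hp * (ennreal C * wpint p S (\<lambda>\<alpha>. W (cos \<alpha>) * sin \<alpha>) (\<lambda>\<alpha>. sin \<alpha> ^ r * poly Q (cos \<alpha>)))"
      by (intro mult_left_mono ZS) auto
    also have "\<dots> = ennreal C * (hp * wpint p S (\<lambda>\<alpha>. W (cos \<alpha>) * sin \<alpha>) (\<lambda>\<alpha>. sin \<alpha> ^ r * poly Q (cos \<alpha>)))"
      by (simp only: mult.left_commute)
    also have "\<dots> \<le> ennreal C * (X + R)" unfolding hp_def by (intro mult_left_mono hS) auto
    also have "\<dots> \<le> ennreal C * (X + hp * ennreal ((real r / 2) powr p * D * B * \<theta> powr p) * Z)"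
      unfolding hp_def by (intro mult_left_mono add_left_mono R) auto
    also have "\<dots> = ennreal C * X + ennreal (K * \<theta> powr p) * (hp * Z)"
      unfolding K_def using C(3) D(1) B(1) by (simp add: distrib_left ennreal_mult mult_ac)
    finally have "hp * Z \<le> ennreal C * X + ennreal (K * \<theta> powr p) * (hp * Z)" .
    then have hZ: "hp * Z \<le> 2 * (ennreal C * X)"
      using Zfin K\<theta> by (intro ennreal_absorb_half) (auto simp: hp_def ennreal_mult_less_top)
    have "phi_wint r p W Q \<le> Z"
    proof -
      have "phi_wint r p W Q = wpint p {0..pi} (\<lambda>\<alpha>. W (cos \<alpha>) * sin \<alpha>) (\<lambda>\<alpha>. phi (cos \<alpha>) ^ r * poly Q (cos \<alpha>))"
        using W0 by (intro wint_cos) auto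
      also have "\<dots> \<le> Z"
        unfolding Z_def
      proof (rule set_nn_integral_mono_set[OF order_refl])
        fix \<alpha> :: real assume a: "\<alpha> \<in> {0..pi}"
        define y where "y = sin \<alpha> + 1 / real n"
        have s0: "0 \<le> sin \<alpha>" using a by (intro sin_ge_zero) auto
        have y: "0 < y" "sin \<alpha> \<le> y" using s0 n by (auto simp: y_def intro: add_nonneg_pos)
        have "(W (cos \<alpha>) * sin \<alpha>) * \<bar>sin \<alpha> ^ r\<bar> powr p \<le> (W (cos \<alpha>) * y) * (y ^ r) powr p"
          using y W0 s0 p by (intro mult_mono mult_left_mono powr_mono2) (auto intro!: power_mono)
        also have "\<dots> = ang_weight n p W r \<alpha>"
          unfolding ang_weight_def y_def[symmetric] using y by (simp add: powr_add powr_powr powr_realpow[symmetric] mult_ac)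
        finally have "ennreal (W (cos \<alpha>) * sin \<alpha>) * pw p (sin \<alpha> ^ r) \<le> ennreal (ang_weight n p W r \<alpha>)"
          using s0 W0 unfolding pw_def by (subst ennreal_mult'[symmetric]) (auto intro!: ennreal_leI)
        from mult_right_mono[OF this zero_le, of "pw p (poly Q (cos \<alpha>))"]
        show "ennreal (W (cos \<alpha>) * sin \<alpha>) * pw p (phi (cos \<alpha>) ^ r * poly Q (cos \<alpha>)) \<le> ennreal (ang_weight n p W r \<alpha>) * pw p (poly Q (cos \<alpha>))"
          unfolding pw_mult phi_cos[OF a] by (simp only: mult.assoc)
      qed
      finally show ?thesis .
    qed
    then have "hp * phi_wint r p W Q \<le> hp * Z" by (rule mult_left_mono) simp
    also note hZ
    also have "2 * (ennreal C * X) = ennreal (2 * C) * X" using C(3) by (simp add: ennreal_mult mult.assoc)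
    finally show ?thesis unfolding hp_def Q_def X_def .
  qed
  show ?thesis using \<theta>(1,2) C(3) by (intro exI[of _ \<theta>] exI[of _ "2 * C"] conjI allI impI main) auto
qed

subsection \<open>Boundedness of the differences\<close>

lemma phi_sq: "x \<in> {-1..1} \<Longrightarrow> phi x ^ 2 = (1 - \<bar>x\<bar>) * (1 + \<bar>x\<bar>)"
proof -
  assume "x \<in> {-1..1}"
  then have "x\<^sup>2 \<le> 1" by (auto simp: abs_square_le_1)
  then have "phi x ^ 2 = 1 - \<bar>x\<bar>\<^sup>2" by (simp add: phi_def)
  then show ?thesis by (simp add: power2_eq_square algebra_simps)
qed

lemma sym_diff_domain:
  assumes y: "0 < y" and x: "- 1 < x" "x < 1" and "x - y * phi x \<in> {-1..1}" "x + y * phi x \<in> {-1..1}"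
  shows "(1 + \<bar>x\<bar>) * y\<^sup>2 \<le> 1 - \<bar>x\<bar>"
proof -
  have x': "\<bar>x\<bar> < 1" using x by auto
  have ph: "0 \<le> phi x" using x by (intro phi_nonneg) auto
  have "y * phi x \<le> 1 - \<bar>x\<bar>" using assms(4,5) by auto
  then have "(y * phi x)\<^sup>2 \<le> (1 - \<bar>x\<bar>)\<^sup>2" using y ph by (intro power_mono) auto
  then have "(1 - \<bar>x\<bar>) * ((1 + \<bar>x\<bar>) * y\<^sup>2) \<le> (1 - \<bar>x\<bar>) * (1 - \<bar>x\<bar>)"
    using phi_sq[of x] x by (simp add: power_mult_distrib power2_eq_square mult_ac)
  then show ?thesis using x' by simp
qed

text \<open>\<open>X\<close> solves y \<open>phi\<close> = 1 - x, so on [-X, X] the outer nodes stay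
  in the interval. There |\<kappa> x| \<open>phi\<close> <= (1 - |x|) |x| <= \<open>phi\<close>^2 /
  2, hence x + \<kappa> \<open>phi x\<close> has derivative at least 1 / 2, and the substitution
  costs only a factor 2.\<close>

lemma node_substitution_le:
  fixes F :: "real \<Rightarrow> real"
  assumes y: "0 < y" "y < 1" and \<kappa>: "\<bar>\<kappa>\<bar> \<le> y" and [measurable]: "F \<in> borel_measurable borel" and F0: "\<And>x. 0 \<le> F x"
  defines "X \<equiv> (1 - y\<^sup>2) / (1 + y\<^sup>2)"
  shows "(\<integral>\<^sup>+x\<in>{-X..X}. ennreal (F (x + \<kappa> * phi x)) \<partial>lborel) \<le> 2 * (\<integral>\<^sup>+x\<in>{-1..1}. ennreal (F x) \<partial>lborel)"
proof -
  have y2: "0 < y\<^sup>2" "y\<^sup>2 < 1" using y by (auto simp: power_less_one_iff)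
  have pos: "0 < 1 + y\<^sup>2" using y2 by linarith
  have X: "0 \<le> X" "X < 1" using y2 pos by (auto simp: X_def field_simps)
  have inX: "y * phi x \<le> 1 - \<bar>x\<bar>" "0 < phi x" "\<bar>x\<bar> < 1" if "x \<in> {-X..X}" for x
  proof -
    have ax: "\<bar>x\<bar> \<le> X" using that by auto
    then show x1: "\<bar>x\<bar> < 1" using X by linarith
    have sq: "phi x ^ 2 = (1 - \<bar>x\<bar>) * (1 + \<bar>x\<bar>)" using x1 by (intro phi_sq) auto
    have "0 < (1 - \<bar>x\<bar>) * (1 + \<bar>x\<bar>)" using x1 by (intro mult_pos_pos) auto
    then have "phi x \<noteq> 0" using sq by auto
    moreover have "0 \<le> phi x" using x1 by (intro phi_nonneg) auto
    ultimately show "0 < phi x" by simp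
    have "\<bar>x\<bar> * (1 + y\<^sup>2) \<le> 1 - y\<^sup>2" using ax pos by (simp add: X_def field_simps)
    then have "y\<^sup>2 * (1 + \<bar>x\<bar>) \<le> 1 - \<bar>x\<bar>" by (simp add: algebra_simps)
    then have "(1 - \<bar>x\<bar>) * (y\<^sup>2 * (1 + \<bar>x\<bar>)) \<le> (1 - \<bar>x\<bar>) * (1 - \<bar>x\<bar>)" using x1 by (intro mult_left_mono) auto
    then have sqle: "(y * phi x)\<^sup>2 \<le> (1 - \<bar>x\<bar>)\<^sup>2" unfolding power_mult_distrib sq by (simp add: power2_eq_square mult_ac)
    show "y * phi x \<le> 1 - \<bar>x\<bar>" by (rule power2_le_imp_le[OF sqle]) (use x1 in simp)
  qed
  define g where "g x = x + \<kappa> * phi x" for x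
  define g' where "g' x = 1 - \<kappa> * x / phi x" for x
  have der: "(g has_real_derivative g' x) (at x)" if "x \<in> {-X..X}" for x
  proof -
    have "0 < 1 - x\<^sup>2" using inX(3)[OF that] by (simp add: abs_square_less_1)
    then have "((\<lambda>x. x + \<kappa> * sqrt (1 - x\<^sup>2)) has_real_derivative (1 + \<kappa> * (- x / sqrt (1 - x\<^sup>2)))) (at x)"
      by (auto intro!: derivative_eq_intros simp: field_simps)
    then show ?thesis unfolding g_def g'_def phi_def by simp
  qed
  have g'half: "1 / 2 \<le> g' x" if "x \<in> {-X..X}" for x
  proof -
    note i = inX[OF that]
    have "\<bar>\<kappa> * x\<bar> * phi x \<le> (y * \<bar>x\<bar>) * phi x"
      using \<kappa> i by (intro mult_right_mono) (auto simp: abs_mult intro: mult_right_mono)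
    also have "\<dots> = (y * phi x) * \<bar>x\<bar>" by simp
    also have "\<dots> \<le> (1 - \<bar>x\<bar>) * \<bar>x\<bar>" using i by (intro mult_right_mono) auto
    also have "\<dots> \<le> (1 - \<bar>x\<bar>) * ((1 + \<bar>x\<bar>) / 2)" using i by (intro mult_left_mono) auto
    also have "\<dots> = phi x / 2 * phi x"
    proof -
      have "x \<in> {-1..1}" using i(3) by auto
      from phi_sq[OF this] show ?thesis by (simp add: power2_eq_square)
    qed
    finally have "\<bar>\<kappa> * x\<bar> \<le> phi x / 2" using i(2) by simp
    then have "\<kappa> * x \<le> phi x / 2" by linarith
    then show ?thesis using i(2) by (simp add: g'_def field_simps)
  qed
  have phic: "continuous_on {-X..X} phi" unfolding phi_def by (intro continuous_intros)
  have eq: "(\<integral>\<^sup>+x. ennreal (F x * indicator {g (- X)..g X} x) \<partial>lborel) =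
     (\<integral>\<^sup>+x. ennreal (F (g x) * g' x * indicator {-X..X} x) \<partial>lborel)"
  proof (rule nn_integral_substitution[OF _ der])
    show "set_borel_measurable borel {g (- X)..g X} F" by (simp add: set_borel_measurable_def)
    show "continuous_on {- X..X} g'" unfolding g'_def using inX(2)
      by (intro continuous_intros phic) (auto simp: less_imp_neq[symmetric])
    show "0 \<le> g' x" if "x \<in> {-X..X}" for x using g'half[OF that] by linarith
  qed (use X in auto)
  have le: "(\<integral>\<^sup>+x. ennreal (F x * indicator {g (- X)..g X} x) \<partial>lborel) \<le> (\<integral>\<^sup>+x\<in>{-1..1}. ennreal (F x) \<partial>lborel)"
  proof (intro nn_integral_mono)
    fix x
    have "\<bar>\<kappa> * phi X\<bar> \<le> 1 - X" "\<bar>\<kappa> * phi (- X)\<bar> \<le> 1 - X"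
      using inX(1)[of X] inX(2)[of X] inX(1)[of "- X"] inX(2)[of "- X"] X \<kappa>
      by (auto simp: abs_mult intro: order_trans[OF mult_right_mono[OF \<kappa>]])
    then have "g X \<le> 1" "- 1 \<le> g (- X)" unfolding g_def by linarith+
    then show "ennreal (F x * indicator {g (- X)..g X} x) \<le> ennreal (F x) * indicator {-1..1} x"
      by (auto simp: indicator_def)
  qed
  note le = le[unfolded eq]
  have "(\<integral>\<^sup>+x\<in>{-X..X}. ennreal (F (x + \<kappa> * phi x)) \<partial>lborel) \<le> (\<integral>\<^sup>+x. 2 * ennreal (F (g x) * g' x * indicator {-X..X} x) \<partial>lborel)"
  proof (intro nn_integral_mono)
    fix x
    show "ennreal (F (x + \<kappa> * phi x)) * indicator {-X..X} x \<le> 2 * ennreal (F (g x) * g' x * indicator {-X..X} x)"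
    proof (cases "x \<in> {-X..X}")
      case True
      have "F (g x) * 1 \<le> F (g x) * (2 * g' x)" using g'half[OF True] F0 by (intro mult_left_mono) auto
      then have "ennreal (F (g x)) \<le> ennreal (2 * (F (g x) * g' x))" by (intro ennreal_leI) simp
      then show ?thesis using True by (simp add: g_def ennreal_mult' numeral_mult_ennreal)
    qed simp
  qed
  also have "\<dots> = 2 * (\<integral>\<^sup>+x. ennreal (F (g x) * g' x * indicator {-X..X} x) \<partial>lborel)"
    unfolding g_def g'_def by (rule nn_integral_cmult) measurable
  also have "\<dots> \<le> 2 * (\<integral>\<^sup>+x\<in>{-1..1}. ennreal (F x) \<partial>lborel)" by (intro mult_left_mono le) auto
  finally show ?thesis .
qed

lemma nodes_eq: "x - real r * (h * phi x) / 2 + real i * (h * phi x) = x + ((real i - real r / 2) * h) * phi x"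
  by (simp add: algebra_simps)

text \<open>At \<open>x = 1\<close> and \<open>x = - 1\<close> the step is \<open>0\<close>, so these two points always lie in the domain of the
  difference; hence the exceptional null set.\<close>

lemma sym_diff_nodes:
  assumes r: "1 \<le> r" and h: "0 < h" and x: "x \<in> {-1..1}" "x \<notin> {-1, 0, 1}"
  defines "y \<equiv> real r * h / 2"
  shows "(\<forall>f. sym_diff r (h * phi x) f x = 0) \<or> (y < 1 \<and> \<bar>x\<bar> \<le> (1 - y\<^sup>2) / (1 + y\<^sup>2) \<and>
    (\<forall>i\<le>r. \<bar>(real i - real r / 2) * h\<bar> \<le> y \<and> x + ((real i - real r / 2) * h) * phi x \<in> {-1..1}))"
proof (cases "x - real r * (h * phi x) / 2 \<in> {-1..1} \<and> x + real r * (h * phi x) / 2 \<in> {-1..1}")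
  case False
  then show ?thesis using sym_diff_outside by blast
next
  case True
  have y: "0 < y" using r h by (simp add: y_def)
  have e: "real r * (h * phi x) / 2 = y * phi x" by (simp add: y_def)
  have ph: "0 \<le> phi x" using x by (intro phi_nonneg) auto
  have le: "(1 + \<bar>x\<bar>) * y\<^sup>2 \<le> 1 - \<bar>x\<bar>"
    using True x unfolding e by (intro sym_diff_domain y) auto
  have "\<bar>x\<bar> * (1 + y\<^sup>2) \<le> 1 - y\<^sup>2" using le by (simp add: algebra_simps)
  moreover have "0 < \<bar>x\<bar> * (1 + y\<^sup>2)" using x by (intro mult_pos_pos) (auto intro: add_pos_nonneg)
  ultimately have "y\<^sup>2 < 1" by linarith
  then have "y < 1" using y by (simp add: power_less_one_iff abs_square_less_1)
  moreover have "\<bar>x\<bar> \<le> (1 - y\<^sup>2) / (1 + y\<^sup>2)"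
    using \<open>\<bar>x\<bar> * (1 + y\<^sup>2) \<le> 1 - y\<^sup>2\<close> by (subst pos_le_divide_eq) (auto intro: add_pos_nonneg)
  moreover have "\<bar>(real i - real r / 2) * h\<bar> \<le> y \<and> x + ((real i - real r / 2) * h) * phi x \<in> {-1..1}" if "i \<le> r" for i
  proof -
    have "\<bar>real i - real r / 2\<bar> \<le> real r / 2" using that by linarith
    then have k: "\<bar>(real i - real r / 2) * h\<bar> \<le> y"
      using mult_right_mono[of "\<bar>real i - real r / 2\<bar>" "real r / 2" h] h by (simp add: abs_mult y_def)
    have "\<bar>((real i - real r / 2) * h) * phi x\<bar> \<le> y * phi x"
      using mult_right_mono[OF k ph] ph by (simp add: abs_mult)
    then show ?thesis using k True unfolding e by auto
  qed
  ultimately show ?thesis by blast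
qed

lemma AE_notin_three: "AE x in lborel. x \<notin> {-1, 0, 1 :: real}"
  using AE_lborel_singleton[of "-1"] AE_lborel_singleton[of 0] AE_lborel_singleton[of 1] by eventually_elim auto

lemma sym_diff_cong_nodes:
  assumes "\<And>i. i \<le> r \<Longrightarrow> f (x + ((real i - real r / 2) * h) * phi x) = g (x + ((real i - real r / 2) * h) * phi x)"
  shows "sym_diff r (h * phi x) f x = sym_diff r (h * phi x) g x"
  unfolding sym_diff_def using assms by (auto simp: nodes_eq intro!: sum.cong)

text \<open>The substitution is applied to the indicator of a null set: each node map pulls null
  sets back to null sets. This makes the differences independent of the chosen Borel version of the
  function.\<close>

lemma sym_diff_AE_cong:
  assumes r: "1 \<le> r" and h: "0 < h" and ae: "AE x in lborel. x \<in> {-1..1} \<longrightarrow> f x = g x"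
  shows "AE x in lborel. x \<in> {-1..1} \<longrightarrow> sym_diff r (h * phi x) f x = sym_diff r (h * phi x) g x"
proof -
  obtain Z where Z: "{x. \<not> (x \<in> {-1..1} \<longrightarrow> f x = g x)} \<subseteq> Z" "emeasure lborel Z = 0" "Z \<in> sets lborel"
    using AE_E[OF ae] by auto
  have [measurable]: "Z \<in> sets borel" using Z(3) by simp
  define y where "y = real r * h / 2"
  have y: "0 < y" using r h by (simp add: y_def)
  define X where "X = (1 - y\<^sup>2) / (1 + y\<^sup>2)"
  have 1: "AE x in lborel. y < 1 \<and> \<bar>x\<bar> \<le> X \<longrightarrow> x + ((real i - real r / 2) * h) * phi x \<notin> Z" if i: "i \<le> r" for i
  proof (cases "y < 1")
    case True
    define \<kappa> where "\<kappa> = (real i - real r / 2) * h"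
    have "\<bar>real i - real r / 2\<bar> \<le> real r / 2" using i by linarith
    then have k: "\<bar>\<kappa>\<bar> \<le> y"
      using mult_right_mono[of "\<bar>real i - real r / 2\<bar>" "real r / 2" h] h by (simp add: abs_mult y_def \<kappa>_def)
    have "(\<integral>\<^sup>+x\<in>{-X..X}. ennreal (indicator Z (x + \<kappa> * phi x)) \<partial>lborel) \<le> 2 * (\<integral>\<^sup>+x\<in>{-1..1}. ennreal (indicator Z x) \<partial>lborel)"
      unfolding X_def by (rule node_substitution_le[OF y True k]) auto
    also have "(\<integral>\<^sup>+x\<in>{-1..1}. ennreal (indicator Z x) \<partial>lborel) \<le> (\<integral>\<^sup>+x. indicator Z x \<partial>lborel)"
      by (intro nn_integral_mono) (auto simp: indicator_def)
    also have "\<dots> = 0" using Z by simp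
    finally have "(\<integral>\<^sup>+x\<in>{-X..X}. ennreal (indicator Z (x + \<kappa> * phi x)) \<partial>lborel) = 0"
      by (simp add: mult_left_mono)
    then have "AE x in lborel. ennreal (indicator Z (x + \<kappa> * phi x)) * indicator {-X..X} x = 0"
      by (subst (asm) nn_integral_0_iff_AE) auto
    then show ?thesis unfolding \<kappa>_def[symmetric]
      by eventually_elim (auto simp: indicator_def abs_le_iff split: if_splits)
  qed simp
  have "AE x in lborel. \<forall>i\<in>{..r}. y < 1 \<and> \<bar>x\<bar> \<le> X \<longrightarrow> x + ((real i - real r / 2) * h) * phi x \<notin> Z"
    using 1 by (intro AE_finite_allI) auto
  with AE_notin_three show ?thesis
  proof eventually_elim
    case (elim x)
    show ?case
    proof
      assume x: "x \<in> {-1..1}"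
      show "sym_diff r (h * phi x) f x = sym_diff r (h * phi x) g x"
        using sym_diff_nodes[OF r h x elim(1)]
      proof
        assume *: "real r * h / 2 < 1 \<and> \<bar>x\<bar> \<le> (1 - (real r * h / 2)\<^sup>2) / (1 + (real r * h / 2)\<^sup>2) \<and>
          (\<forall>i\<le>r. \<bar>(real i - real r / 2) * h\<bar> \<le> real r * h / 2 \<and> x + ((real i - real r / 2) * h) * phi x \<in> {-1..1})"
        show ?thesis
        proof (rule sym_diff_cong_nodes)
          fix i assume i: "i \<le> r"
          then have "x + ((real i - real r / 2) * h) * phi x \<notin> Z" using elim(2) * unfolding y_def X_def by auto
          then show "f (x + ((real i - real r / 2) * h) * phi x) = g (x + ((real i - real r / 2) * h) * phi x)"
            using Z(1) * i by blast
        qed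
      qed simp
    qed
  qed
qed

text \<open>For h <= 1 / n the angles of all nodes are within a multiple of 1 / n of the angle of x,
  so the weight can be moved from x to each node at the cost of the constant \<open>K\<close>; then
  one substitutes node by node.\<close>

lemma wint_sym_diff_le:
  assumes p: "0 < p" "p \<le> 1" and r: "1 \<le> r" and c: "0 \<le> c"
  shows "\<exists>C\<ge>0. \<forall>n\<ge>1. \<forall>g W h. g \<in> borel_measurable borel \<longrightarrow> W \<in> borel_measurable borel \<longrightarrow> (\<forall>x. 0 \<le> W x) \<longrightarrow>
     slow_cos n c s W \<longrightarrow> 0 < h \<longrightarrow> h \<le> 1 / real n \<longrightarrow>
     step_wint r p W g h \<le> ennreal C * wint p W g"
proof -
  define K where "K = c * (1 + pi * real r / 2) ^ s"
  have K0: "0 \<le> K" using c by (simp add: K_def)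
  define C where "C = 2 ^ r * (real r + 1) * K * 2"
  have "step_wint r p W g h \<le> ennreal C * wint p W g"
    if n: "1 \<le> n" and [measurable]: "g \<in> borel_measurable borel" "W \<in> borel_measurable borel" and W0: "\<And>x. 0 \<le> W x"
      and W: "slow_cos n c s W" and h: "0 < h" "h \<le> 1 / real n" for n g W and h :: real
  proof -
    define y where "y = real r * h / 2"
    have y: "0 < y" using r h by (simp add: y_def)
    define X where "X = (1 - y\<^sup>2) / (1 + y\<^sup>2)"
    define F where "F x = \<bar>g x\<bar> powr p * W x" for x
    have [measurable]: "F \<in> borel_measurable borel" unfolding F_def by measurable
    have F0: "0 \<le> F x" for x unfolding F_def using W0 by simp
    have F: "ennreal (F x) = pw p (g x) * ennreal (W x)" for x unfolding F_def pw_def by (simp add: ennreal_mult')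
    define \<kappa> where "\<kappa> i = (real i - real r / 2) * h" for i :: nat
    define T where "T i = (if y < 1 then \<integral>\<^sup>+x\<in>{-X..X}. ennreal (F (x + \<kappa> i * phi x)) \<partial>lborel else 0)" for i
    have T: "T i \<le> 2 * wint p W g" if "i \<le> r" for i
    proof (cases "y < 1")
      case True
      have "\<bar>real i - real r / 2\<bar> \<le> real r / 2" using that by linarith
      then have "\<bar>\<kappa> i\<bar> \<le> y"
        using mult_right_mono[of "\<bar>real i - real r / 2\<bar>" "real r / 2" h] h by (simp add: abs_mult y_def \<kappa>_def)
      from node_substitution_le[OF y True this \<open>F \<in> borel_measurable borel\<close> F0] show ?thesis
        using True unfolding T_def X_def wint_def F[symmetric] by simp
    qed (simp add: T_def)
    have pt: "pw p (sym_diff r (h * phi x) g x) * ennreal (W x) \<le>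
        (if y < 1 then (\<Sum>i\<le>r. ennreal (2 ^ r * K) * (ennreal (F (x + \<kappa> i * phi x)) * indicator {-X..X} x)) else 0)"
      if x: "x \<in> {-1..1}" "x \<notin> {-1, 0, 1}" for x
      using sym_diff_nodes[OF r h(1) x]
    proof
      assume *: "real r * h / 2 < 1 \<and> \<bar>x\<bar> \<le> (1 - (real r * h / 2)\<^sup>2) / (1 + (real r * h / 2)\<^sup>2) \<and>
          (\<forall>i\<le>r. \<bar>(real i - real r / 2) * h\<bar> \<le> real r * h / 2 \<and> x + ((real i - real r / 2) * h) * phi x \<in> {-1..1})"
      have xX: "x \<in> {-X..X}" using * unfolding X_def y_def by (auto simp: abs_le_iff)
      have ki: "\<bar>\<kappa> i\<bar> \<le> y" "x + \<kappa> i * phi x \<in> {-1..1}" if "i \<le> r" for i using * that unfolding \<kappa>_def y_def by auto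
      have y1: "y < 1" using * unfolding y_def by auto
      have Wx: "W x \<le> K * W (x + \<kappa> i * phi x)" if i: "i \<le> r" for i
      proof -
        define \<alpha> where "\<alpha> = arccos x"
        define \<gamma> where "\<gamma> = arccos (x + \<kappa> i * phi x)"
        have a: "\<alpha> \<in> {0..pi}" "cos \<alpha> = x" using x(1) by (auto simp: \<alpha>_def arccos_lbound arccos_ubound)
        have g: "\<gamma> \<in> {0..pi}" "cos \<gamma> = x + \<kappa> i * phi x" using ki(2)[OF i] by (auto simp: \<gamma>_def arccos_lbound arccos_ubound)
        have ph: "phi x = sin \<alpha>" using phi_cos[OF a(1)] a(2) by simp
        have s0: "0 \<le> sin \<alpha>" using a(1) by (intro sin_ge_zero) auto
        have "\<bar>\<alpha> - \<gamma>\<bar> \<le> pi * y"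
        proof (rule cos_close_imp_angle_close[OF a(1) g(1)])
          show "\<bar>cos \<alpha> - cos \<gamma>\<bar> \<le> y * sin \<alpha>"
            unfolding a(2) g(2) using mult_right_mono[OF ki(1)[OF i] s0] s0 by (simp add: ph abs_mult)
        qed (use y in simp)
        then have "real n * \<bar>\<alpha> - \<gamma>\<bar> \<le> real n * (pi * y)" by (intro mult_left_mono) auto
        also have "\<dots> = (real n * h) * (pi * real r / 2)" by (simp add: y_def)
        also have "\<dots> \<le> 1 * (pi * real r / 2)" using h n by (intro mult_right_mono) (auto simp: field_simps)
        finally have ang: "real n * \<bar>\<alpha> - \<gamma>\<bar> \<le> pi * real r / 2" by simp
        have "W (cos \<alpha>) \<le> c * (1 + real n * \<bar>\<alpha> - \<gamma>\<bar>) ^ s * W (cos \<gamma>)" by (rule slow_weightD(3)[OF W a(1) g(1)])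
        also have "\<dots> \<le> K * W (cos \<gamma>)"
          unfolding K_def using ang c W0 by (intro mult_right_mono mult_left_mono power_mono) auto
        finally show ?thesis unfolding a(2) g(2) .
      qed
      have "sym_diff r (h * phi x) g x = (fdiff (h * phi x) ^^ r) g (x - real r * (h * phi x) / 2) \<or> sym_diff r (h * phi x) g x = 0"
        using sym_diff_eq_fdiff sym_diff_outside by blast
      then have "pw p (sym_diff r (h * phi x) g x) \<le> ennreal (2 ^ r) * (\<Sum>i\<le>r. pw p (g (x + \<kappa> i * phi x)))"
        using pw_fdiff_le[OF p, of r "h * phi x" g "x - real r * (h * phi x) / 2"] unfolding nodes_eq \<kappa>_def by auto
      then have "pw p (sym_diff r (h * phi x) g x) * ennreal (W x) \<le> (\<Sum>i\<le>r. ennreal (2 ^ r) * pw p (g (x + \<kappa> i * phi x)) * ennreal (W x))"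
        unfolding sum_distrib_left sum_distrib_right[symmetric] by (intro mult_right_mono) (auto simp: sum_distrib_left)
      also have "\<dots> \<le> (\<Sum>i\<le>r. ennreal (2 ^ r * K) * ennreal (F (x + \<kappa> i * phi x)))"
      proof (intro sum_mono)
        fix i assume "i \<in> {..r}"
        then have "ennreal (W x) \<le> ennreal (K * W (x + \<kappa> i * phi x))" by (intro ennreal_leI Wx) auto
        from mult_left_mono[OF this zero_le, of "ennreal (2 ^ r) * pw p (g (x + \<kappa> i * phi x))"]
        show "ennreal (2 ^ r) * pw p (g (x + \<kappa> i * phi x)) * ennreal (W x) \<le> ennreal (2 ^ r * K) * ennreal (F (x + \<kappa> i * phi x))"
          unfolding F using K0 W0 by (simp add: ennreal_mult mult_ac)
      qed
      finally show ?thesis using xX y1 by simp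
    qed simp
    have "step_wint r p W g h \<le>
      (\<integral>\<^sup>+x. (if y < 1 then (\<Sum>i\<le>r. ennreal (2 ^ r * K) * (ennreal (F (x + \<kappa> i * phi x)) * indicator {-X..X} x)) else 0) \<partial>lborel)"
      unfolding wint_def
    proof (rule nn_integral_mono_AE)
      show "AE x in lborel. pw p (sym_diff r (h * phi x) g x) * ennreal (W x) * indicator {-1..1} x \<le>
        (if y < 1 then (\<Sum>i\<le>r. ennreal (2 ^ r * K) * (ennreal (F (x + \<kappa> i * phi x)) * indicator {-X..X} x)) else 0)"
        using AE_notin_three
      proof eventually_elim
        case (elim x)
        then show ?case using pt[of x] by (cases "x \<in> {-1..1}") auto
      qed
    qed
    also have "\<dots> = (\<Sum>i\<le>r. ennreal (2 ^ r * K) * T i)"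
    proof (cases "y < 1")
      case True
      then show ?thesis unfolding T_def by (simp add: nn_integral_sum nn_integral_cmult)
    qed (simp add: T_def)
    also have "\<dots> \<le> (\<Sum>i\<le>r. ennreal (2 ^ r * K) * (2 * wint p W g))"
      by (intro sum_mono mult_left_mono T) auto
    also have "\<dots> = ennreal C * wint p W g"
    proof -
      have "(\<Sum>i\<le>r. ennreal (2 ^ r * K) * (2 * wint p W g)) = ennreal (real (Suc r)) * (ennreal (2 ^ r * K) * (ennreal 2 * wint p W g))"
        by (simp only: sum_constant card_atMost ennreal_of_nat_eq_real_of_nat ennreal_numeral)
      also have "\<dots> = ennreal (real (Suc r) * ((2 ^ r * K) * 2)) * wint p W g"
        using K0 by (simp only: ennreal_mult mult.assoc mult_nonneg_nonneg of_nat_0_le_iff zero_le_power zero_le_numeral)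
      also have "real (Suc r) * ((2 ^ r * K) * 2) = C" by (simp add: C_def algebra_simps)
      finally show ?thesis .
    qed
    finally show ?thesis .
  qed
  moreover have "0 \<le> C" using K0 by (simp add: C_def)
  ultimately show ?thesis by (intro exI[of _ C]) auto
qed

subsection \<open>Averaged doubling weights\<close>

lemma doubling_interval_mono:
  assumes w: "doubling_weight L w" and "a' \<le> a" "b \<le> b'"
  shows "(LINT u:{a..b}|lebesgue. w u) \<le> (LINT u:{a'..b'}|lebesgue. w u)"
proof -
  have w0: "\<And>x. 0 \<le> w x" and wz: "\<And>x. x \<notin> {-1..1} \<Longrightarrow> w x = 0" and int: "set_integrable lebesgue {-1..1} w"
    using w by (auto simp: doubling_weight_def)
  have "(\<lambda>x. indicator {-1..1} x *\<^sub>R w x) = w" using wz by (auto simp: indicator_def fun_eq_iff)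
  then have "integrable lebesgue w" using int by (simp add: set_integrable_def)
  then have I: "integrable lebesgue (\<lambda>x. indicator {c..d} x *\<^sub>R w x)" for c d :: real
    by (intro integrable_mult_indicator) auto
  show ?thesis unfolding set_lebesgue_integral_def
    by (rule integral_mono[OF I I]) (use assms(2,3) w0 in \<open>auto simp: indicator_def\<close>)
qed

lemma doubling_clip:
  assumes w: "doubling_weight L w"
  shows "(LINT u:{a..b}|lebesgue. w u) = (LINT u:{max (-1) a..min 1 b}|lebesgue. w u)"
  using w unfolding doubling_weight_def set_lebesgue_integral_def
  by (intro Bochner_Integration.integral_cong refl) (auto simp: indicator_def)

lemma doubling_nonneg:
  assumes "doubling_weight L w"
  shows "0 \<le> (LINT u:A|lebesgue. w u)"
  using assms unfolding set_lebesgue_integral_def doubling_weight_def by (intro integral_nonneg_AE) auto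

text \<open>The condition concerns only intervals inside [-1, 1], so each doubled interval has to be
  clipped before it is doubled again. When one end is clipped the other still gains half the length,
  whence growth by 3 / 2 instead of 2; an end that has reached the boundary has nothing left to
  cover.\<close>

lemma doubling_iterate:
  assumes w: "doubling_weight L w" and L1: "L \<le> L1" "1 \<le> L1" and ab: "- 1 \<le> a" "a < b" "b \<le> 1"
    and K: "max (-1) (a - ((3 / 2) ^ k - 1) * (b - a)) \<le> u" "v \<le> min 1 (b + ((3 / 2) ^ k - 1) * (b - a))"
  shows "(LINT u:{u..v}|lebesgue. w u) \<le> L1 ^ k * (LINT u:{a..b}|lebesgue. w u)"
  using ab K
proof (induction k arbitrary: a b)
  case 0
  then show ?case using doubling_interval_mono[OF w, of a u v b] by auto
next
  case (Suc k)
  define l where "l = b - a"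
  define a' where "a' = max (-1) (a - l / 2)"
  define b' where "b' = min 1 (b + l / 2)"
  define q where "q = (3 / 2 :: real) ^ k"
  have q: "1 \<le> q" unfolding q_def by (rule one_le_power) simp
  have l: "0 < l" using Suc.prems by (simp add: l_def)
  have bl: "b = a + l" by (simp add: l_def)
  have ab': "- 1 \<le> a'" "a' < b'" "b' \<le> 1" "a' \<le> a" "b \<le> b'"
    unfolding a'_def b'_def using Suc.prems(1-3) l bl by linarith+
  have step: "(LINT u:{a'..b'}|lebesgue. w u) \<le> L1 * (LINT u:{a..b}|lebesgue. w u)"
  proof -
    define c where "c = (a + b) / 2"
    have c: "c - l / 2 = a" "c + l / 2 = b" "c - 2 * (l / 2) = a - l / 2" "c + 2 * (l / 2) = b + l / 2"
      by (auto simp: c_def l_def field_simps)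
    have dbl: "\<And>c d. 0 < d \<Longrightarrow> {c - d..c + d} \<subseteq> {-1..1} \<Longrightarrow>
        (LINT u:{c - 2 * d..c + 2 * d}|lebesgue. w u) \<le> L * (LINT u:{c - d..c + d}|lebesgue. w u)"
      using w unfolding doubling_weight_def by blast
    have "(LINT u:{a'..b'}|lebesgue. w u) = (LINT u:{c - 2 * (l / 2)..c + 2 * (l / 2)}|lebesgue. w u)"
      unfolding c a'_def b'_def by (rule doubling_clip[OF w, symmetric])
    also have "\<dots> \<le> L * (LINT u:{c - l / 2..c + l / 2}|lebesgue. w u)"
      using l Suc.prems by (intro dbl) (auto simp: c)
    also have "\<dots> \<le> L1 * (LINT u:{a..b}|lebesgue. w u)"
      unfolding c using L1 doubling_nonneg[OF w] by (intro mult_right_mono) auto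
    finally show ?thesis .
  qed
  have Q: "(3 / 2) ^ Suc k = 3 / 2 * q" by (simp add: q_def)
  have "(LINT u:{u..v}|lebesgue. w u) \<le> L1 ^ k * (LINT u:{a'..b'}|lebesgue. w u)"
  proof (rule Suc.IH[OF ab'(1-3)])
    have qm: "(q - 1) * (3 / 2 * l) \<le> (q - 1) * (b' - a')" if "3 / 2 * l \<le> b' - a'"
      using that q by (intro mult_left_mono) auto
    have nn: "0 \<le> (q - 1) * (b' - a')" using q ab' by (intro mult_nonneg_nonneg) auto
    have ex: "(3 / 2 * q - 1) * l = (q - 1) * (3 / 2 * l) + l / 2"
    proof -
      have "(3 / 2 * q - 1) * l = 3 / 2 * (q * l) - l" "(q - 1) * (3 / 2 * l) = 3 / 2 * (q * l) - 3 / 2 * l"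
        by (simp_all add: left_diff_distrib)
      then show ?thesis by linarith
    qed
    show "max (- 1) (a' - ((3 / 2) ^ k - 1) * (b' - a')) \<le> u"
    proof (cases "a' = -1")
      case True
      then show ?thesis using Suc.prems(4) nn unfolding q_def[symmetric] by auto
    next
      case False
      then have a': "a' = a - l / 2" by (auto simp: a'_def max_def split: if_splits)
      then have "3 / 2 * l \<le> b' - a'" using ab' bl by linarith
      from qm[OF this] have "a' - (q - 1) * (b' - a') \<le> a - (3 / 2 * q - 1) * l" unfolding ex a' by linarith
      then show ?thesis using Suc.prems(4) unfolding Q q_def[symmetric] l_def[symmetric] by auto
    qed
    show "v \<le> min 1 (b' + ((3 / 2) ^ k - 1) * (b' - a'))"
    proof (cases "b' = 1")
      case True
      then show ?thesis using Suc.prems(5) nn unfolding q_def[symmetric] by auto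
    next
      case False
      then have b': "b' = b + l / 2" by (auto simp: b'_def min_def split: if_splits)
      then have "3 / 2 * l \<le> b' - a'" using ab' bl by linarith
      from qm[OF this] have "b + (3 / 2 * q - 1) * l \<le> b' + (q - 1) * (b' - a')" unfolding ex b' by linarith
      then show ?thesis using Suc.prems(5) unfolding Q q_def[symmetric] l_def[symmetric] by auto
    qed
  qed
  also have "\<dots> \<le> L1 ^ k * (L1 * (LINT u:{a..b}|lebesgue. w u))"
    using L1 by (intro mult_left_mono step) auto
  finally show ?case by (simp add: mult_ac)
qed

section \<open>The averaged weight in the angular variable\<close>

lemma rho_pos: "1 \<le> n \<Longrightarrow> x \<in> {-1..1} \<Longrightarrow> 0 < rho n x"
  using phi_nonneg[of x] unfolding rho_def phi_def by (auto intro!: add_nonneg_pos)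

lemma rho_cos: "1 \<le> n \<Longrightarrow> \<alpha> \<in> {0..pi} \<Longrightarrow> rho n (cos \<alpha>) = (sin \<alpha> + 1 / real n) / real n"
  using phi_cos[of \<alpha>] unfolding rho_def phi_def by (simp add: add_divide_distrib power2_eq_square)

lemma sin_shift_le:
  assumes "1 \<le> n" "\<beta> \<in> {0..pi}"
  shows "sin \<alpha> + 1 / real n \<le> (1 + real n * \<bar>\<alpha> - \<beta>\<bar>) * (sin \<beta> + 1 / real n)"
proof -
  have "sin \<alpha> + 1 / real n \<le> sin \<beta> + 1 / real n + \<bar>\<alpha> - \<beta>\<bar>"
    using abs_sin_diff_le[of \<alpha> \<beta>] by linarith
  also have "\<bar>\<alpha> - \<beta>\<bar> = real n * \<bar>\<alpha> - \<beta>\<bar> * (1 / real n)" using assms(1) by simp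
  also have "\<dots> \<le> real n * \<bar>\<alpha> - \<beta>\<bar> * (sin \<beta> + 1 / real n)"
    using assms(2) sin_ge_zero[of \<beta>] by (intro mult_left_mono) auto
  finally show ?thesis by (simp add: algebra_simps)
qed

lemma abs_cos_diff_le:
  assumes "\<beta> \<in> {0..pi}"
  shows "\<bar>cos \<alpha> - cos \<beta>\<bar> \<le> \<bar>\<alpha> - \<beta>\<bar> * (sin \<beta> + \<bar>\<alpha> - \<beta>\<bar>)"
proof -
  have "\<exists>z. min \<alpha> \<beta> \<le> z \<and> z \<le> max \<alpha> \<beta> \<and> \<bar>cos \<alpha> - cos \<beta>\<bar> = \<bar>\<alpha> - \<beta>\<bar> * \<bar>sin z\<bar>"
  proof (cases \<alpha> \<beta> rule: linorder_cases)
    case less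
    obtain z where "\<alpha> < z" "z < \<beta>" "cos \<beta> - cos \<alpha> = (\<beta> - \<alpha>) * (- sin z)"
      using MVT2[OF less, of cos "\<lambda>x. - sin x"] DERIV_cos by blast
    then show ?thesis using less by (intro exI[of _ z]) (auto simp: abs_mult abs_minus_commute[of "cos \<alpha>" "cos \<beta>"] abs_minus_commute[of \<alpha> \<beta>])
  next
    case greater
    obtain z where "\<beta> < z" "z < \<alpha>" "cos \<alpha> - cos \<beta> = (\<alpha> - \<beta>) * (- sin z)"
      using MVT2[OF greater, of cos "\<lambda>x. - sin x"] DERIV_cos by blast
    then show ?thesis using greater by (intro exI[of _ z]) (auto simp: abs_mult)
  qed auto
  then obtain z where z: "min \<alpha> \<beta> \<le> z" "z \<le> max \<alpha> \<beta>" "\<bar>cos \<alpha> - cos \<beta>\<bar> = \<bar>\<alpha> - \<beta>\<bar> * \<bar>sin z\<bar>" by auto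
  have "\<bar>z - \<beta>\<bar> \<le> \<bar>\<alpha> - \<beta>\<bar>" using z(1,2) by auto
  then have "\<bar>sin z\<bar> \<le> sin \<beta> + \<bar>\<alpha> - \<beta>\<bar>"
    using abs_sin_diff_le[of z \<beta>] sin_ge_zero[of \<beta>] assms by auto
  then show ?thesis unfolding z(3) by (intro mult_left_mono) auto
qed

text \<open>The real \<open>sqrt\<close> is odd, so outside [-1, 1] \<open>rho\<close> may vanish or
  become negative; the cutoff makes the weight nonnegative on the whole line.\<close>

definition wn :: "(real \<Rightarrow> real) \<Rightarrow> nat \<Rightarrow> real \<Rightarrow> real" where
  "wn w n x = avg_weight w n x * indicator {-1..1} x"

lemma wn_nonneg: "doubling_weight L w \<Longrightarrow> 1 \<le> n \<Longrightarrow> 0 \<le> wn w n x"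
  using doubling_nonneg[of L w] rho_pos[of n x] unfolding wn_def avg_weight_def
  by (auto simp: indicator_def intro!: divide_nonneg_pos)

lemma measurable_rho [measurable]: "rho n \<in> borel_measurable borel"
  unfolding rho_def by measurable

lemma measurable_wn [measurable]:
  assumes "doubling_weight L w"
  shows "wn w n \<in> borel_measurable borel"
proof -
  have wz: "\<And>x. x \<notin> {-1..1} \<Longrightarrow> w x = 0" and int: "set_integrable lebesgue {-1..1} w"
    using assms by (auto simp: doubling_weight_def)
  have "(\<lambda>x. indicator {-1..1} x *\<^sub>R w x) = w" using wz by (auto simp: indicator_def fun_eq_iff)
  then have "integrable lebesgue w" using int by (simp add: set_integrable_def)
  then have wm: "w \<in> borel_measurable (completion lborel)" by auto
  \<comment> \<open>The weight is Lebesgue measurable only. A Borel version has the same window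
    integrals, and for it they depend measurably on the endpoints of the window.\<close>
  obtain w' where w'[measurable]: "w' \<in> borel_measurable lborel" and ae: "AE x in lborel. w x = w' x"
    using completion_ex_borel_measurable_real[OF wm] by auto
  have [measurable]: "w' \<in> borel_measurable borel" using w' by simp
  have "(LINT u:{a..b}|lebesgue. w u) = (\<integral>u. (if a \<le> u \<and> u \<le> b then w' u else 0) \<partial>lborel)" for a b
  proof -
    have "(LINT u:{a..b}|lebesgue. w u) = (LINT u:{a..b}|lebesgue. w' u)"
      unfolding set_lebesgue_integral_def
    proof (rule integral_cong_AE)
      show "AE x in lebesgue. indicator {a..b} x *\<^sub>R w x = indicator {a..b} x *\<^sub>R w' x"
        using AE_completion[OF ae] by eventually_elim simp
      show "(\<lambda>x. indicator {a..b} x *\<^sub>R w x) \<in> borel_measurable lebesgue"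
        by (intro borel_measurable_scaleR borel_measurable_indicator wm) auto
      show "(\<lambda>x. indicator {a..b} x *\<^sub>R w' x) \<in> borel_measurable lebesgue"
        by (intro measurable_completion) measurable
    qed
    also have "\<dots> = (\<integral>u. (if a \<le> u \<and> u \<le> b then w' u else 0) \<partial>lborel)"
      unfolding set_lebesgue_integral_def
      by (subst integral_completion) (auto intro!: Bochner_Integration.integral_cong simp: indicator_def)
    finally show ?thesis .
  qed
  then have "wn w n = (\<lambda>x. 1 / rho n x * (\<integral>u. (if x - rho n x \<le> u \<and> u \<le> x + rho n x then w' u else 0) \<partial>lborel) * indicator {-1..1} x)"
    by (auto simp: wn_def avg_weight_def fun_eq_iff)
  moreover have "(\<lambda>x. \<integral>u. (if x - rho n x \<le> u \<and> u \<le> x + rho n x then w' u else 0) \<partial>lborel) \<in> borel_measurable borel"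
    by measurable
  ultimately show ?thesis by simp
qed

text \<open>The window at y is enlarged k times until it covers the window at x. Relative to
  \<open>rho\<close>, distances grow at most quadratically in \<tau> = n |\<alpha> - \<beta>|, so
  (3/2)^k of order (1 + \<tau>)^2 is enough. Bounding L by (3/2)^s0 turns L^k into the power 2 s0 of
  1 + \<tau>; the last power is the ratio of the two window lengths.\<close>

lemma slow_wn:
  assumes L1: "L \<le> (3 / 2) ^ s0" and w: "doubling_weight L w" and n: "1 \<le> n"
  shows "slow_weight n ((9 / 2) ^ s0) (2 * s0 + 1) (\<lambda>\<alpha>. wn w n (cos \<alpha>))"
  unfolding slow_weight_def
proof (intro conjI allI ballI)
  note [measurable] = measurable_wn[OF w]
  show "(\<lambda>\<alpha>. wn w n (cos \<alpha>)) \<in> borel_measurable borel" by measurable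
  show "0 \<le> wn w n (cos \<alpha>)" for \<alpha> by (rule wn_nonneg[OF w n])
  fix \<alpha> \<beta> :: real assume ab: "\<alpha> \<in> {0..pi}" "\<beta> \<in> {0..pi}"
  define x where "x = cos \<alpha>"
  define y where "y = cos \<beta>"
  define \<tau> where "\<tau> = real n * \<bar>\<alpha> - \<beta>\<bar>"
  have t0: "0 \<le> \<tau>" by (simp add: \<tau>_def)
  have xy: "x \<in> {-1..1}" "y \<in> {-1..1}" by (auto simp: x_def y_def)
  define R where "R = rho n y"
  have R0: "0 < R" unfolding R_def by (rule rho_pos[OF n xy(2)])
  have rx0: "0 < rho n x" by (rule rho_pos[OF n xy(1)])
  have R: "R = (sin \<beta> + 1 / real n) / real n" unfolding R_def y_def by (rule rho_cos[OF n ab(2)])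
  have rx: "rho n x \<le> (1 + \<tau>) * R"
    unfolding x_def rho_cos[OF n ab(1)] R \<tau>_def using divide_right_mono[OF sin_shift_le[OF n ab(2), of \<alpha>], of "real n"] by simp
  have rxy: "R \<le> (1 + \<tau>) * rho n x"
    unfolding x_def rho_cos[OF n ab(1)] R \<tau>_def
    using divide_right_mono[OF sin_shift_le[OF n ab(1), of \<beta>], of "real n"] by (simp add: abs_minus_commute)
  have dist: "\<bar>x - y\<bar> \<le> \<tau> * (1 + \<tau>) * R"
  proof -
    have "\<bar>x - y\<bar> \<le> \<bar>\<alpha> - \<beta>\<bar> * (sin \<beta> + \<bar>\<alpha> - \<beta>\<bar>)" unfolding x_def y_def by (rule abs_cos_diff_le[OF ab(2)])
    also have "\<bar>\<alpha> - \<beta>\<bar> = \<tau> / real n" using n by (simp add: \<tau>_def)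
    also have "\<tau> / real n * (sin \<beta> + \<tau> / real n) \<le> \<tau> / real n * ((1 + \<tau>) * (sin \<beta> + 1 / real n))"
    proof (intro mult_left_mono)
      have "0 \<le> sin \<beta>" using ab(2) by (intro sin_ge_zero) auto
      then have "0 \<le> \<tau> * sin \<beta>" using t0 by simp
      moreover have "(1 + \<tau>) * (sin \<beta> + 1 / real n) = sin \<beta> + \<tau> * sin \<beta> + (1 / real n + \<tau> / real n)"
        by (simp add: distrib_left distrib_right add_divide_distrib)
      moreover have "0 \<le> 1 / real n" by simp
      ultimately show "sin \<beta> + \<tau> / real n \<le> (1 + \<tau>) * (sin \<beta> + 1 / real n)" by linarith
    qed (use t0 in simp)
    also have "\<dots> = \<tau> * (1 + \<tau>) * R" unfolding R by simp
    finally show ?thesis .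
  qed
  define a where "a = max (-1) (y - R)"
  define b where "b = min 1 (y + R)"
  \<comment> \<open>Half-length at most 2 and centre in [-1, 1] ensure that clipping leaves at least
    a quarter of the window.\<close>
  have R2: "R \<le> 2"
  proof -
    have "R \<le> (1 + 1 / real n) / real n" unfolding R by (intro divide_right_mono add_right_mono) auto
    also have "\<dots> \<le> (1 + 1) / 1" using n by (intro frac_le add_left_mono) auto
    finally show ?thesis by simp
  qed
  have abl: "- 1 \<le> a" "b \<le> 1" "a \<le> y" "y \<le> b" "R / 2 \<le> b - a"
    using xy R0 R2 unfolding a_def b_def atLeastAtMost_iff by linarith+
  have ablt: "a < b" using abl R0 by linarith
  have ex: "\<exists>k. 1 + 2 * (1 + \<tau>)\<^sup>2 \<le> (3 / 2 :: real) ^ k" using real_arch_pow[of "3 / 2" "1 + 2 * (1 + \<tau>)\<^sup>2"] by (auto intro: less_imp_le)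
  \<comment> \<open>The least exponent overshoots by a factor of at most 3 / 2; with 1 + 2 y <= 3 y
    for y >= 1 this accounts for the constant 9 / 2.\<close>
  define k where "k = (LEAST k. 1 + 2 * (1 + \<tau>)\<^sup>2 \<le> (3 / 2 :: real) ^ k)"
  have k: "1 + 2 * (1 + \<tau>)\<^sup>2 \<le> (3 / 2) ^ k" unfolding k_def using LeastI_ex[OF ex] .
  have t1: "1 \<le> (1 + \<tau>)\<^sup>2" using t0 by (intro one_le_power) auto
  have kle: "(3 / 2) ^ k \<le> 9 / 2 * (1 + \<tau>)\<^sup>2"
  proof (cases k)
    case 0
    then show ?thesis using t1 by simp
  next
    case (Suc j)
    have "\<not> 1 + 2 * (1 + \<tau>)\<^sup>2 \<le> (3 / 2 :: real) ^ j"
      using not_less_Least[of j "\<lambda>k. 1 + 2 * (1 + \<tau>)\<^sup>2 \<le> (3 / 2 :: real) ^ k"] Suc unfolding k_def by auto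
    then have "(3 / 2) ^ j \<le> 3 * (1 + \<tau>)\<^sup>2" using t1 by linarith
    then show ?thesis using Suc by simp
  qed
  define L1 where "L1 = (3 / 2 :: real) ^ s0"
  have L11: "1 \<le> L1" unfolding L1_def by (rule one_le_power) simp
  have grow: "\<bar>x - y\<bar> + rho n x \<le> ((3 / 2) ^ k - 1) * (b - a)"
  proof -
    have "\<bar>x - y\<bar> + rho n x \<le> \<tau> * (1 + \<tau>) * R + (1 + \<tau>) * R" using dist rx by linarith
    also have "\<dots> = 2 * (1 + \<tau>)\<^sup>2 * (R / 2)" by (simp add: power2_eq_square algebra_simps)
    also have "\<dots> \<le> ((3 / 2) ^ k - 1) * (b - a)" using k abl(5) R0 t1 by (intro mult_mono) auto
    finally show ?thesis .
  qed
  have "(LINT u:{x - rho n x..x + rho n x}|lebesgue. w u) = (LINT u:{max (-1) (x - rho n x)..min 1 (x + rho n x)}|lebesgue. w u)"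
    by (rule doubling_clip[OF w])
  also have "\<dots> \<le> L1 ^ k * (LINT u:{a..b}|lebesgue. w u)"
  proof (rule doubling_iterate[OF w L1[folded L1_def] L11 abl(1) ablt abl(2)])
    define g where "g = ((3 / 2) ^ k - 1) * (b - a)"
    have g: "\<bar>x - y\<bar> + rho n x \<le> g" using grow unfolding g_def .
    show "max (- 1) (a - ((3 / 2) ^ k - 1) * (b - a)) \<le> max (- 1) (x - rho n x)"
      unfolding g_def[symmetric] using g abl by linarith
    show "min 1 (x + rho n x) \<le> min 1 (b + ((3 / 2) ^ k - 1) * (b - a))"
      unfolding g_def[symmetric] using g abl by linarith
  qed
  also have "(LINT u:{a..b}|lebesgue. w u) = (LINT u:{y - R..y + R}|lebesgue. w u)"
    unfolding a_def b_def by (rule doubling_clip[OF w, symmetric])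
  also have "\<dots> = R * wn w n y" using R0 xy unfolding wn_def avg_weight_def R_def by simp
  finally have I: "(LINT u:{x - rho n x..x + rho n x}|lebesgue. w u) \<le> L1 ^ k * (R * wn w n y)" .
  have Lk: "L1 ^ k \<le> (9 / 2) ^ s0 * (1 + \<tau>) ^ (2 * s0)"
  proof -
    have "L1 ^ k = ((3 / 2) ^ k) ^ s0" unfolding L1_def by (simp add: power_mult[symmetric] mult.commute)
    also have "\<dots> \<le> (9 / 2 * (1 + \<tau>)\<^sup>2) ^ s0" by (intro power_mono kle) simp
    also have "\<dots> = (9 / 2) ^ s0 * (1 + \<tau>) ^ (2 * s0)" by (simp only: power_mult_distrib power_mult)
    finally show ?thesis .
  qed
  have wy: "0 \<le> wn w n y" by (rule wn_nonneg[OF w n])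
  have "wn w n x = (LINT u:{x - rho n x..x + rho n x}|lebesgue. w u) / rho n x"
    using xy unfolding wn_def avg_weight_def by simp
  also have "\<dots> \<le> L1 ^ k * (R * wn w n y) / rho n x" using I rx0 by (intro divide_right_mono) auto
  also have "\<dots> = L1 ^ k * wn w n y * (R / rho n x)" by simp
  also have "\<dots> \<le> ((9 / 2) ^ s0 * (1 + \<tau>) ^ (2 * s0)) * wn w n y * (1 + \<tau>)"
    using rxy rx0 R0 Lk wy L11 t0 by (intro mult_mono) (auto simp: pos_divide_le_eq)
  finally show "wn w n (cos \<alpha>) \<le> (9 / 2) ^ s0 * (1 + real n * \<bar>\<alpha> - \<beta>\<bar>) ^ (2 * s0 + 1) * wn w n (cos \<beta>)"
    unfolding x_def y_def \<tau>_def by (simp add: mult_ac)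
qed

subsection \<open>Jackson's inequality\<close>

text \<open>Images of equidistant angles. They decrease with the index, hence the reversed endpoints
  of the cells.\<close>

abbreviation knot :: "nat \<Rightarrow> nat \<Rightarrow> real" where
  "knot N i \<equiv> cos (real i * pi / real N)"

abbreviation mid_angle :: "nat \<Rightarrow> nat \<Rightarrow> real" where
  "mid_angle N i \<equiv> (real i + 1 / 2) * pi / real N"

lemma arccos_between:
  assumes "0 \<le> a" "a \<le> b" "b \<le> pi" "x \<in> {cos b..cos a}"
  shows "arccos x \<in> {a..b}" "cos (arccos x) = x" "arccos x \<in> {0..pi}"
proof -
  have x: "- 1 \<le> x" "x \<le> 1" using assms(4) cos_ge_minus_one[of b] cos_le_one[of a] unfolding atLeastAtMost_iff by linarith+
  have "arccos (cos a) \<le> arccos x" "arccos x \<le> arccos (cos b)"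
    using assms(4) x by (auto intro!: arccos_le_arccos)
  then show "arccos x \<in> {a..b}" using assms by (simp add: arccos_cos)
  show "cos (arccos x) = x" using x by simp
  show "arccos x \<in> {0..pi}" using x by (simp add: arccos_lbound arccos_ubound)
qed

lemma cell_angles:
  assumes "i \<le> k" "k \<le> N" "1 \<le> N"
  shows "0 \<le> real i * pi / real N" "real i * pi / real N \<le> real k * pi / real N" "real k * pi / real N \<le> pi"
proof -
  show "0 \<le> real i * pi / real N" by simp
  show "real i * pi / real N \<le> real k * pi / real N" using assms by (intro divide_right_mono mult_right_mono) auto
  have "real k * pi \<le> real N * pi" using assms by (intro mult_right_mono) auto
  then show "real k * pi / real N \<le> pi" using assms by (simp add: field_simps)
qed

lemma cos_diff_le_sin:
  assumes "0 \<le> a" "a \<le> \<theta>" "\<theta> \<le> pi / 2"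
  shows "cos a - cos \<theta> \<le> (\<theta> - a) * sin \<theta>"
proof (cases "a = \<theta>")
  case False
  then have lt: "a < \<theta>" using assms by simp
  obtain z where z: "a < z" "z < \<theta>" "cos \<theta> - cos a = (\<theta> - a) * (- sin z)"
    using MVT2[OF lt, of cos "\<lambda>x. - sin x"] DERIV_cos by blast
  have "sin z \<le> sin \<theta>" using z assms by (intro sin_monotone_2pi_le) auto
  then have "(\<theta> - a) * sin z \<le> (\<theta> - a) * sin \<theta>" using lt by (intro mult_left_mono) auto
  then show ?thesis using z(3) by simp
qed simp

lemma mid_angle_sin_ge:
  assumes "i < N" shows "1 / real N \<le> sin (mid_angle N i)"
proof -
  have N: "real N > 0" using assms by simp
  have iN: "real i + 1 \<le> real N" using assms by linarith
  have "2 * (pi / (2 * real N)) / pi \<le> sin (mid_angle N i)"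
  proof (rule sin_ge_linear)
    have "(1 / 2) * pi / real N \<le> (real i + 1 / 2) * pi / real N" by (intro divide_right_mono mult_right_mono) auto
    moreover have "(real i + 1 / 2) * pi / real N \<le> (real N - 1 / 2) * pi / real N"
      using iN by (intro divide_right_mono mult_right_mono) auto
    moreover have "(real N - 1 / 2) * pi / real N = pi - pi / (2 * real N)" using N by (simp add: field_simps)
    ultimately show "mid_angle N i \<in> {pi / (2 * real N)..pi - pi / (2 * real N)}" by simp
  qed simp
  then show ?thesis using N by simp
qed

lemma cell_length:
  assumes "1 \<le> N"
  shows "knot N i - knot N (Suc i) = 2 * sin (mid_angle N i) * sin (pi / (2 * real N))"
proof -
  have N: "real N > 0" using assms by simp
  have "(real i * pi / real N + real (Suc i) * pi / real N) / 2 = mid_angle N i"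
    "(real (Suc i) * pi / real N - real i * pi / real N) / 2 = pi / (2 * real N)"
    using N by (simp_all add: field_simps)
  then show ?thesis by (simp only: cos_diff_cos)
qed

lemma mid_angle_diff: "\<bar>mid_angle N i - mid_angle N l\<bar> = \<bar>real i - real l\<bar> * pi / real N"
proof -
  have "mid_angle N i - mid_angle N l = (real i - real l) * (pi / real N)" by (simp add: left_diff_distrib distrib_right add_divide_distrib diff_divide_distrib)
  then show ?thesis by (simp add: abs_mult)
qed

text \<open>With d = |i - l|, the points of cell i are within a multiple of (1 + d)^2 lengths of
  cell l, which gives the power 2 r through \<open>poly_growth\<close>; the ratio of the two lengths
  is at most linear in 1 + d and gives one more power.\<close>

lemma cell_growth:
  assumes p: "0 < p" "p \<le> 1" and r: "1 \<le> r" and deg: "degree q < r" and i: "i < N" and l: "l < N"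
  shows "pint p {knot N (Suc i)..knot N i} (\<lambda>x. poly q x) \<le>
     ennreal (4 * real r ^ (r + 2) * 15 ^ r * (1 + \<bar>real i - real l\<bar>) ^ (1 + 2 * r)) *
     pint p {knot N (Suc l)..knot N l} (\<lambda>x. poly q x)"
proof -
  define d where "d = \<bar>real i - real l\<bar>"
  have d0: "0 \<le> d" by (simp add: d_def)
  have N1: "1 \<le> N" and N: "real N > 0" using i by auto
  define sl where "sl = sin (mid_angle N l)"
  define si where "si = sin (mid_angle N i)"
  have sl: "1 / real N \<le> sl" unfolding sl_def by (rule mid_angle_sin_ge[OF l])
  then have sl0: "0 < sl" using N by (smt (verit) divide_pos_pos)
  have si0: "0 < si" unfolding si_def using mid_angle_sin_ge[OF i] N by (smt (verit) divide_pos_pos)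
  define z where "z = sin (pi / (2 * real N))"
  have z: "1 / real N \<le> z"
    unfolding z_def using mid_angle_sin_ge[of 0 N] N1 by simp
  then have z0: "0 < z" using N by (smt (verit) divide_pos_pos)
  define a where "a = knot N (Suc l)"
  define b where "b = knot N l"
  define I where "I = pint p {a..b} (\<lambda>x. poly q x)"
  have ba: "b - a = 2 * sl * z" unfolding a_def b_def sl_def z_def by (rule cell_length[OF N1])
  have ba': "knot N i - knot N (Suc i) = 2 * si * z" unfolding si_def z_def by (rule cell_length[OF N1])
  have ab: "a < b" using ba sl0 z0 by (metis diff_gt_0_iff_gt mult_pos_pos zero_less_numeral)
  have dist: "\<bar>x - a\<bar> \<le> 14 * (1 + d)\<^sup>2 * (b - a)" if x: "x \<in> {knot N (Suc i)..knot N i}" for x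
  proof -
    define \<theta> where "\<theta> = arccos x"
    define \<alpha> where "\<alpha> = real (Suc l) * pi / real N"
    have \<theta>: "\<theta> \<in> {real i * pi / real N..real (Suc i) * pi / real N}" "cos \<theta> = x"
      unfolding \<theta>_def using arccos_between[OF cell_angles[of i "Suc i" N] x] i N1 by auto
    have \<alpha>: "\<alpha> \<in> {0..pi}" using cell_angles[of "Suc l" "Suc l" N] l N1 by (auto simp: \<alpha>_def)
    have step: "\<bar>\<theta> - \<alpha>\<bar> \<le> (d + 1) * pi / real N"
    proof -
      define t where "t = pi / real N"
      have t: "0 \<le> t" using N by (simp add: t_def)
      have 1: "real i * t \<le> \<theta>" "\<theta> \<le> (real i + 1) * t" "\<alpha> = (real l + 1) * t"
        using \<theta>(1) by (auto simp: t_def \<alpha>_def algebra_simps)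
      have 2: "(real i - real l) * t \<le> d * t" "(real l - real i) * t \<le> d * t" unfolding d_def using t by (intro mult_right_mono; simp)+
      have "\<bar>\<theta> - \<alpha>\<bar> \<le> d * t + t" using 1 2 t by (auto simp: algebra_simps abs_le_iff)
      then show ?thesis by (simp add: t_def algebra_simps add_divide_distrib)
    qed
    have sa: "sin \<alpha> \<le> sl + pi / (2 * real N)"
    proof -
      have "\<alpha> - mid_angle N l = pi / (2 * real N)" using N by (simp add: \<alpha>_def field_simps)
      then show ?thesis using abs_sin_diff_le[of \<alpha> "mid_angle N l"] unfolding sl_def by simp
    qed
    have sa0: "0 \<le> sin \<alpha>" using \<alpha> by (intro sin_ge_zero) auto
    have "\<bar>x - a\<bar> \<le> \<bar>\<theta> - \<alpha>\<bar> * (sin \<alpha> + \<bar>\<theta> - \<alpha>\<bar>)"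
      using abs_cos_diff_le[OF \<alpha>, of \<theta>] unfolding \<theta>(2) a_def \<alpha>_def .
    also have "\<dots> \<le> ((d + 1) * pi / real N) * ((sl + pi / (2 * real N)) + (d + 1) * pi / real N)"
      using step sa sa0 d0 by (intro mult_mono add_mono) auto
    also have "\<dots> \<le> ((d + 1) * pi / real N) * (7 * (d + 1) * sl)"
    proof (rule mult_left_mono)
      have pN: "pi / (2 * real N) \<le> 2 * sl" 
      proof -
        have "pi / (2 * real N) = pi / 2 * (1 / real N)" by simp
        also have "\<dots> \<le> 2 * sl" using sl sl0 pi_less_4 N by (intro mult_mono) auto
        finally show ?thesis .
      qed
      have "(d + 1) * pi / real N = (d + 1) * (2 * (pi / (2 * real N)))" by simp
      also have "\<dots> \<le> (d + 1) * (2 * (2 * sl))" using pN d0 by (intro mult_left_mono) auto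
      finally have "sl + pi / (2 * real N) + (d + 1) * pi / real N \<le> 3 * sl + (d + 1) * (4 * sl)" using pN by simp
      also have "\<dots> \<le> 7 * (d + 1) * sl" using d0 sl0 by (simp add: algebra_simps)
      finally show "sl + pi / (2 * real N) + (d + 1) * pi / real N \<le> 7 * (d + 1) * sl" .
    qed (use d0 N in auto)
    also have "\<dots> = (pi / 2) * 7 * (d + 1)\<^sup>2 * (2 * sl * (1 / real N))" by (simp add: power2_eq_square)
    also have "\<dots> \<le> 2 * 7 * (d + 1)\<^sup>2 * (2 * sl * z)"
      using z sl0 pi_less_4 N d0 by (intro mult_mono) auto
    finally show ?thesis unfolding ba by (simp add: add.commute)
  qed
  have pt: "ennreal (b - a) * pw p (poly q x) \<le> ennreal (real r ^ (r + 2) * (15 * (1 + d)\<^sup>2) ^ r) * I"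
    if x: "x \<in> {knot N (Suc i)..knot N i}" for x
  proof -
    have "\<bar>x - a\<bar> / (b - a) \<le> 14 * (1 + d)\<^sup>2" using dist[OF x] ab by (simp add: pos_divide_le_eq)
    moreover have "1 \<le> (1 + d)\<^sup>2" using d0 by (intro one_le_power) auto
    ultimately have "1 + \<bar>x - a\<bar> / (b - a) \<le> 15 * (1 + d)\<^sup>2" by linarith
    then have "real r ^ (r + 2) * (1 + \<bar>x - a\<bar> / (b - a)) ^ r \<le> real r ^ (r + 2) * (15 * (1 + d)\<^sup>2) ^ r"
      using ab by (intro mult_left_mono power_mono) auto
    then show ?thesis unfolding I_def
      using poly_growth[OF p r deg ab, of x] by (elim order_trans) (intro mult_right_mono ennreal_leI, auto)
  qed
  have len: "knot N i - knot N (Suc i) \<le> 4 * (1 + d) * (b - a)"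
  proof -
    have "si \<le> sl + d * pi / real N"
      using abs_sin_diff_le[of "mid_angle N i" "mid_angle N l"] unfolding si_def sl_def mid_angle_diff d_def by linarith
    also have "d * pi / real N = d * pi * (1 / real N)" by simp
    also have "\<dots> \<le> d * 4 * sl" using d0 sl sl0 N pi_less_4 by (intro mult_mono) auto
    finally have "si \<le> 4 * (1 + d) * sl" using sl0 by (simp add: algebra_simps)
    then have "2 * si * z \<le> 2 * (4 * (1 + d) * sl) * z" using z0 by (intro mult_right_mono mult_left_mono) auto
    then show ?thesis unfolding ba ba' by (simp add: mult_ac)
  qed
  have "ennreal (b - a) * pint p {knot N (Suc i)..knot N i} (\<lambda>x. poly q x) =
     wpint p {knot N (Suc i)..knot N i} (\<lambda>x. b - a) (\<lambda>x. poly q x)"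
    by (rule set_nn_integral_cmult[symmetric]) auto
  also have "\<dots> \<le> (ennreal (real r ^ (r + 2) * (15 * (1 + d)\<^sup>2) ^ r) * I) * ennreal (knot N i - knot N (Suc i))"
  proof (intro set_nn_integral_const_mult_le pt)
    have "0 \<le> knot N i - knot N (Suc i)" unfolding ba' using si0 z0 by simp
    then show "knot N (Suc i) \<le> knot N i" by (simp only: diff_ge_0_iff_ge)
  qed
  also have "\<dots> \<le> (ennreal (real r ^ (r + 2) * (15 * (1 + d)\<^sup>2) ^ r) * I) * ennreal (4 * (1 + d) * (b - a))"
    by (intro mult_left_mono ennreal_leI len) auto
  also have "\<dots> = ennreal (b - a) * (ennreal (4 * real r ^ (r + 2) * 15 ^ r * (1 + d) ^ (1 + 2 * r)) * I)"
  proof -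
    have e: "4 * real r ^ (r + 2) * 15 ^ r * (1 + d) ^ (1 + 2 * r) = (real r ^ (r + 2) * (15 * (1 + d)\<^sup>2) ^ r) * (4 * (1 + d))"
    proof -
      have "(1 + d) ^ (1 + 2 * r) = (1 + d) * ((1 + d)\<^sup>2) ^ r" by (simp add: power_mult)
      then show ?thesis by (simp only: power_mult_distrib mult_ac)
    qed
    have n: "0 \<le> real r ^ (r + 2) * (15 * (1 + d)\<^sup>2) ^ r" "0 \<le> 4 * (1 + d)" "0 \<le> b - a" using d0 ab by auto
    show ?thesis unfolding e using n by (simp add: ennreal_mult mult_ac)
  qed
  finally show ?thesis unfolding I_def a_def[symmetric] b_def[symmetric] d_def[symmetric]
    using ab by (subst (asm) ennreal_mult_le_mult_iff) auto
qed

text \<open>The geometric hypotheses of \<open>whitney_phi\<close>, for two adjacent cells and M =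
  N. Pairs of cells are used so that consecutive ones overlap and their approximants can be compared
  on a common cell.\<close>

lemma double_cell:
  assumes j: "Suc (Suc j) \<le> N" and r: "1 \<le> r" and t: "4 * pi / real N \<le> t"
  defines "a \<equiv> knot N (Suc (Suc j))" and "b \<equiv> knot N j"
  shows "a < b" "{a..b} \<subseteq> {-1..1}"
    "\<And>x s. 0 \<le> s \<Longrightarrow> a \<le> x - real r * s / 2 \<Longrightarrow> x + real r * s / 2 \<le> b \<Longrightarrow> s \<le> t * phi x"
    "\<And>x. x \<in> {a..b} \<Longrightarrow> phi x \<le> real N * (b - a)"
proof -
  have N1: "1 \<le> N" "2 \<le> N" and N: "real N > 0" using j by auto
  define a' where "a' = real j * pi / real N"
  define b' where "b' = real (Suc (Suc j)) * pi / real N"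
  define c where "c = real (Suc j) * pi / real N"
  have ang: "0 \<le> a'" "a' \<le> b'" "b' \<le> pi" using cell_angles[of j "Suc (Suc j)" N] j N1 by (auto simp: a'_def b'_def)
  have ba': "b' - a' = 2 * pi / real N" "(a' + b') / 2 = c" "(b' - a') / 2 = pi / real N"
    using N by (simp_all add: a'_def b'_def c_def field_simps)
  have ba: "b - a = 2 * sin c * sin (pi / real N)"
    unfolding a_def b_def a'_def[symmetric] b'_def[symmetric] cos_diff_cos[of a' b'] ba'(2,3) ..
  have piN: "pi / real N \<le> pi / 2" using N1 by (intro divide_left_mono) auto
  have sinN: "2 / real N \<le> sin (pi / real N)"
    using sin_ge_linear[of "pi / real N" "pi / real N"] piN by simp
  have cN: "c \<in> {pi / real N..pi - pi / real N}"
  proof -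
    have jN: "1 \<le> real (Suc j)" "real (Suc j) \<le> real N - 1" using j by linarith+
    have "1 * pi / real N \<le> c" "c \<le> (real N - 1) * pi / real N"
      unfolding c_def using jN by (intro divide_right_mono mult_right_mono; simp)+
    moreover have "(real N - 1) * pi / real N = pi - pi / real N" using N by (simp add: field_simps)
    ultimately show ?thesis by simp
  qed
  have sinc: "2 / real N \<le> sin c" using sin_ge_linear[OF _ cN] by simp
  have pos: "0 < 2 / real N" using N by simp
  show ab: "a < b" using ba sinc sinN pos by (metis diff_gt_0_iff_gt mult_pos_pos zero_less_numeral less_le_trans)
  show sub: "{a..b} \<subseteq> {-1..1}" unfolding a_def b_def by (auto intro: order_trans[OF cos_ge_minus_one] order_trans[OF _ cos_le_one])
  show "s \<le> t * phi x" if s: "0 \<le> s" "a \<le> x - real r * s / 2" "x + real r * s / 2 \<le> b" for x s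
  proof -
    have rs: "s \<le> real r * s" using r s(1) by (simp add: mult_le_cancel_right1)
    have x: "x \<in> {a..b}" using s rs by (auto simp: field_simps)
    define \<theta> where "\<theta> = arccos x"
    have \<theta>: "a' \<le> \<theta>" "\<theta> \<le> b'" "cos \<theta> = x" "\<theta> \<in> {0..pi}"
      using arccos_between[OF ang, of x] x unfolding \<theta>_def a_def b_def a'_def b'_def by auto
    have ph: "phi x = sin \<theta>" using phi_cos[OF \<theta>(4)] \<theta>(3) by simp
    have s0: "0 \<le> sin \<theta>" using \<theta>(4) by (intro sin_ge_zero) auto
    have "s / 2 \<le> (2 * pi / real N) * sin \<theta>"
    \<comment> \<open>Measure \<open>s\<close> against the end of the pair on the side of the nearer
      endpoint of [-1, 1]: on the way there the sine decreases, so \<open>sin \<theta>\<close> is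
      its largest value.\<close>
    proof (cases "\<theta> \<le> pi / 2")
      case True
      have "s / 2 \<le> b - x" using s(3) rs by linarith
      also have "\<dots> = cos a' - cos \<theta>" unfolding \<theta>(3) b_def a'_def ..
      also have "\<dots> \<le> (\<theta> - a') * sin \<theta>" by (rule cos_diff_le_sin[OF ang(1) \<theta>(1) True])
      also have "\<dots> \<le> (2 * pi / real N) * sin \<theta>" using \<theta>(2) ba'(1) s0 by (intro mult_right_mono) linarith+
      finally show ?thesis .
    next
      case False
      have "s / 2 \<le> x - a" using s(2) rs by linarith
      also have "\<dots> = cos (pi - b') - cos (pi - \<theta>)" unfolding \<theta>(3)[symmetric] a_def b'_def by (simp add: cos_pi_minus)
      also have "\<dots> \<le> ((pi - \<theta>) - (pi - b')) * sin (pi - \<theta>)"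
        using ang \<theta> False by (intro cos_diff_le_sin) auto
      also have "\<dots> = (b' - \<theta>) * sin \<theta>" by simp
      also have "\<dots> \<le> (2 * pi / real N) * sin \<theta>" using \<theta>(1) ba'(1) s0 by (intro mult_right_mono) linarith+
      finally show ?thesis .
    qed
    then have "s \<le> (4 * pi / real N) * sin \<theta>" by simp
    also have "\<dots> \<le> t * sin \<theta>" using t s0 by (intro mult_right_mono)
    finally show ?thesis unfolding ph .
  qed
  show "phi x \<le> real N * (b - a)" if x: "x \<in> {a..b}" for x
  proof -
    define \<theta> where "\<theta> = arccos x"
    have \<theta>: "a' \<le> \<theta>" "\<theta> \<le> b'" "cos \<theta> = x" "\<theta> \<in> {0..pi}"
      using arccos_between[OF ang, of x] x unfolding \<theta>_def a_def b_def a'_def b'_def by auto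
    have ph: "phi x = sin \<theta>" using phi_cos[OF \<theta>(4)] \<theta>(3) by simp
    have "\<bar>\<theta> - c\<bar> \<le> pi / real N" 
    proof -
      define u where "u = pi / real N"
      have "a' = (a' + b') / 2 - (b' - a') / 2" "b' = (a' + b') / 2 + (b' - a') / 2" by (simp_all add: field_simps)
      then have "a' = c - u" "b' = c + u" unfolding u_def ba'(2,3) .
      then show ?thesis using \<theta>(1,2) unfolding u_def[symmetric] by (simp add: abs_le_iff)
    qed
    then have "sin \<theta> \<le> sin c + pi / real N" using abs_sin_diff_le[of \<theta> c] by linarith
    also have "pi / real N = pi / 2 * (2 / real N)" by simp
    also have "\<dots> \<le> 2 * sin c" using sinc pos pi_less_4 by (intro mult_mono) auto
    finally have "sin \<theta> \<le> 4 * sin c" using sinc pos by linarith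
    also have "\<dots> = real N * (2 * sin c * (2 / real N))" using N by simp
    also have "\<dots> \<le> real N * (2 * sin c * sin (pi / real N))"
    proof (intro mult_left_mono sinN)
      show "0 \<le> 2 * sin c" using sinc pos by linarith
    qed simp
    finally show ?thesis unfolding ph ba .
  qed
qed

section \<open>Summation over cells\<close>

lemma sum_inverse_squares_le: "(\<Sum>d<N. 1 / (1 + real d)\<^sup>2) \<le> 2"
proof -
  have *: "(\<Sum>d<Suc N. 1 / (1 + real d)\<^sup>2) \<le> 2 - 1 / (1 + real N)" for N
  proof (induction N)
    case (Suc N)
    define x where "x = 1 + real N"
    have x: "x > 0" by (simp add: x_def)
    have "1 / (x + 1)\<^sup>2 \<le> 1 / (x * (x + 1))"
      using x by (intro divide_left_mono) (auto simp: power2_eq_square)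
    also have "\<dots> = 1 / x - 1 / (x + 1)" using x by (simp add: field_simps)
    finally have "1 / (x + 1)\<^sup>2 \<le> 1 / x - 1 / (x + 1)" .
    then show ?case using Suc.IH unfolding sum.lessThan_Suc[of _ "Suc N"] by (simp add: x_def add.commute)
  qed simp
  show ?thesis
  proof (cases N)
    case (Suc M)
    have "0 \<le> 1 / (1 + real M)" by simp
    then show ?thesis unfolding Suc using *[of M] by linarith
  qed simp
qed

lemma sum_inverse_dist_squares_le: "(\<Sum>j<N. 1 / (1 + \<bar>real i - real j\<bar>)\<^sup>2) \<le> 4"
proof -
  have "(\<Sum>j<N. 1 / (1 + \<bar>real i - real j\<bar>)\<^sup>2) \<le> (\<Sum>j\<in>{..i} \<union> {i..<i + N}. 1 / (1 + \<bar>real i - real j\<bar>)\<^sup>2)"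
    by (intro sum_mono2) auto
  also have "\<dots> \<le> (\<Sum>j\<le>i. 1 / (1 + \<bar>real i - real j\<bar>)\<^sup>2) + (\<Sum>j\<in>{i..<i + N}. 1 / (1 + \<bar>real i - real j\<bar>)\<^sup>2)"
    by (subst sum_Un) (auto intro!: sum_nonneg)
  also have "(\<Sum>j\<le>i. 1 / (1 + \<bar>real i - real j\<bar>)\<^sup>2) = (\<Sum>d<Suc i. 1 / (1 + real d)\<^sup>2)"
    by (rule sum.reindex_bij_witness[of _ "\<lambda>d. i - d" "\<lambda>j. i - j"]) (auto simp: of_nat_diff)
  also have "(\<Sum>j\<in>{i..<i + N}. 1 / (1 + \<bar>real i - real j\<bar>)\<^sup>2) = (\<Sum>d<N. 1 / (1 + real d)\<^sup>2)"
    by (rule sum.reindex_bij_witness[of _ "\<lambda>d. i + d" "\<lambda>j. j - i"]) (auto simp: of_nat_diff)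
  finally show ?thesis using sum_inverse_squares_le[of "Suc i"] sum_inverse_squares_le[of N] by linarith
qed

lemma knot_antimono:
  assumes "i \<le> k" "k \<le> N" "1 \<le> N"
  shows "knot N k \<le> knot N i"
  using cell_angles[OF assms] by (intro cos_monotone_0_pi_le) auto

abbreviation cell :: "nat \<Rightarrow> nat \<Rightarrow> real set" where
  "cell N i \<equiv> {knot N (Suc i)..knot N i}"

lemma cells_cover:
  assumes "1 \<le> N"
  shows "{-1..1} \<subseteq> (\<Union>i<N. cell N i)"
proof
  fix x :: real assume x: "x \<in> {-1..1}"
  define \<alpha> where "\<alpha> = arccos x"
  have \<alpha>: "0 \<le> \<alpha>" "\<alpha> \<le> pi" "cos \<alpha> = x" using x by (auto simp: \<alpha>_def arccos_lbound arccos_ubound)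
  have N: "real N > 0" using assms by simp
  define k where "k = nat \<lfloor>\<alpha> * real N / pi\<rfloor>"
  \<comment> \<open>The angle pi would get the index \<open>N\<close>, hence the minimum.\<close>
  define i where "i = min k (N - 1)"
  have i: "i < N" using assms by (auto simp: i_def)
  have "0 \<le> \<lfloor>\<alpha> * real N / pi\<rfloor>" using \<alpha> by simp
  then have k: "real k \<le> \<alpha> * real N / pi" "\<alpha> * real N / pi < real k + 1" unfolding k_def by linarith+
  have up: "\<alpha> * real N / pi \<le> real N" using \<alpha>(2) N by (simp add: field_simps)
  have "real i \<le> \<alpha> * real N / pi" using k(1) unfolding i_def by linarith
  then have lo: "real i * pi / real N \<le> \<alpha>" using N by (simp add: field_simps)
  have "\<alpha> * real N / pi \<le> real (Suc i)"
  proof (cases "k \<le> N - 1")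
    case True
    then show ?thesis using k(2) by (simp add: i_def)
  next
    case False
    then show ?thesis using up assms by (simp add: i_def)
  qed
  then have hi: "\<alpha> \<le> real (Suc i) * pi / real N" using N by (simp add: field_simps)
  have "knot N (Suc i) \<le> cos \<alpha>" "cos \<alpha> \<le> knot N i"
    using cell_angles[of i "Suc i" N] i assms \<alpha> lo hi by (auto intro!: cos_monotone_0_pi_le)
  then show "x \<in> (\<Union>i<N. cell N i)" using i \<alpha>(3) by auto
qed

text \<open>Walk from cell i to cell j, exchanging the approximant for its neighbour at each step. A
  jump is estimated on the cell where both neighbours approximate \<open>f\<close>, then carried
  back to cell i by the growth bound for polynomials.\<close>

lemma cell_telescope:
  assumes p: "0 < p" "p \<le> 1" and r: "1 \<le> r" and deg: "\<And>l. degree (q l) < r"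
    and [measurable]: "f \<in> borel_measurable borel"
    and F1: "\<And>i. i < N \<Longrightarrow> pint p (cell N i) (\<lambda>x. f x - poly (q i) x) \<le> U i"
    and F2: "\<And>l k. Suc l < N \<Longrightarrow> k = l \<or> k = Suc l \<Longrightarrow>
      pint p (cell N (Suc l)) (\<lambda>x. poly (q (Suc l)) x - poly (q l) x) \<le> 2 * U k"
    and ij: "i < N" "j < N"
  defines "\<Gamma> \<equiv> 4 * real r ^ (r + 2) * 15 ^ r"
  shows "pint p (cell N i) (\<lambda>x. f x - poly (q j) x) \<le>
    (\<Sum>l\<in>{min i j..max i j}. ennreal (2 * \<Gamma> * (1 + \<bar>real i - real l\<bar>) ^ (1 + 2 * r)) * U l)"
proof -
  define b where "b l = ennreal (2 * \<Gamma> * (1 + \<bar>real i - real l\<bar>) ^ (1 + 2 * r))" for l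
  have \<Gamma>1: "1 \<le> 2 * \<Gamma>"
  proof -
    have "1 * 1 \<le> real r ^ (r + 2) * 15 ^ r" using r by (intro mult_mono one_le_power) auto
    then show ?thesis by (simp add: \<Gamma>_def)
  qed
  then have \<Gamma>0: "0 \<le> \<Gamma>" by simp
  \<comment> \<open>The jump is charged to the index \<open>k\<close> farther from i. Then each
    index between i and j is charged once, i itself being used for the initial error.\<close>
  have jump: "pint p (cell N i) (\<lambda>x. poly (q (Suc l)) x - poly (q l) x) \<le> b k * U k"
    if l: "Suc l < N" and k: "k = l \<or> k = Suc l" "\<bar>real i - real (Suc l)\<bar> \<le> \<bar>real i - real k\<bar>" for l k
  proof -
    define Q where "Q = q (Suc l) - q l"
    have "degree Q < r" unfolding Q_def using deg by (intro degree_diff_less) auto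
    from cell_growth[OF p r this ij(1) l]
    have "pint p (cell N i) (\<lambda>x. poly Q x) \<le>
       ennreal (\<Gamma> * (1 + \<bar>real i - real (Suc l)\<bar>) ^ (1 + 2 * r)) * pint p (cell N (Suc l)) (\<lambda>x. poly Q x)"
      unfolding \<Gamma>_def .
    also have "\<dots> \<le> ennreal (\<Gamma> * (1 + \<bar>real i - real k\<bar>) ^ (1 + 2 * r)) * (2 * U k)"
    proof (rule mult_mono)
      show "ennreal (\<Gamma> * (1 + \<bar>real i - real (Suc l)\<bar>) ^ (1 + 2 * r)) \<le> ennreal (\<Gamma> * (1 + \<bar>real i - real k\<bar>) ^ (1 + 2 * r))"
        using k(2) \<Gamma>0 by (intro ennreal_leI mult_left_mono power_mono) auto
      show "pint p (cell N (Suc l)) (\<lambda>x. poly Q x) \<le> 2 * U k"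
        using F2[OF l k(1)] by (simp add: Q_def)
    qed auto
    also have "\<dots> = b k * U k"
    proof -
      have "b k = ennreal 2 * ennreal (\<Gamma> * (1 + \<bar>real i - real k\<bar>) ^ (1 + 2 * r))"
        unfolding b_def mult.assoc using \<Gamma>0 by (subst ennreal_mult) auto
      then show ?thesis by (simp add: mult_ac)
    qed
    finally show ?thesis by (simp add: Q_def)
  qed
  have add: "pint p (cell N i) (\<lambda>x. f x - poly (q a) x) \<le>
     pint p (cell N i) (\<lambda>x. f x - poly (q c) x) + pint p (cell N i) (\<lambda>x. poly (q a) x - poly (q c) x)" for a c
  proof -
    have "pint p (cell N i) (\<lambda>x. f x - poly (q a) x) \<le>
      (\<integral>\<^sup>+x\<in>cell N i. (pw p (f x - poly (q c) x) + pw p (poly (q a) x - poly (q c) x)) \<partial>lborel)"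
    proof (rule set_nn_integral_mono_set[OF order_refl])
      fix x show "pw p (f x - poly (q a) x) \<le> pw p (f x - poly (q c) x) + pw p (poly (q a) x - poly (q c) x)"
        using pw_diff[OF p, of "f x - poly (q c) x" "poly (q a) x - poly (q c) x"] by simp
    qed
    also have "\<dots> = pint p (cell N i) (\<lambda>x. f x - poly (q c) x) + pint p (cell N i) (\<lambda>x. poly (q a) x - poly (q c) x)"
      by (rule set_nn_integral_add) auto
    finally show ?thesis .
  qed
  have bi: "U i \<le> b i * U i"
  proof -
    have "1 * U i \<le> ennreal (2 * \<Gamma>) * U i" using \<Gamma>1 by (intro mult_right_mono) auto
    then show ?thesis by (simp add: b_def)
  qed
  have "pint p (cell N i) (\<lambda>x. f x - poly (q j) x) \<le> (\<Sum>l\<in>{min i j..max i j}. b l * U l)"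
  proof (cases "i \<le> j")
    case True
    then show ?thesis using ij(2)
    proof (induction j rule: dec_induct)
      case base
      then show ?case using F1[of i] bi ij by (auto intro: order_trans)
    next
      case (step j)
      have "pint p (cell N i) (\<lambda>x. f x - poly (q (Suc j)) x) \<le>
        (\<Sum>l\<in>{min i j..max i j}. b l * U l) + b (Suc j) * U (Suc j)"
        using step by (intro order_trans[OF add[of "Suc j" j]] add_mono jump) auto
      also have "\<dots> = (\<Sum>l\<in>{min i (Suc j)..max i (Suc j)}. b l * U l)"
        using step by (simp add: min_def max_def atLeastAtMostSuc_conv add.commute)
      finally show ?case .
    qed
  next
    case False
    then have "j \<le> i" by simp
    then show ?thesis
    proof (induction j rule: inc_induct)
      case base
      then show ?case using F1[of i] bi ij by (auto intro: order_trans)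
    next
      case (step j)
      have "pint p (cell N i) (\<lambda>x. poly (q j) x - poly (q (Suc j)) x) =
        pint p (cell N i) (\<lambda>x. poly (q (Suc j)) x - poly (q j) x)"
        by (metis (no_types, lifting) minus_diff_eq pw_minus)
      also have "\<dots> \<le> b j * U j" using step ij by (intro jump) auto
      finally have "pint p (cell N i) (\<lambda>x. f x - poly (q j) x) \<le>
        (\<Sum>l\<in>{min i (Suc j)..max i (Suc j)}. b l * U l) + b j * U j"
        using step by (intro order_trans[OF add[of j "Suc j"]] add_mono) auto
      also have "\<dots> = (\<Sum>l\<in>{min i j..max i j}. b l * U l)"
      proof -
        have "{min i j..max i j} = insert j {min i (Suc j)..max i (Suc j)}" using step by auto
        moreover have "j \<notin> {min i (Suc j)..max i (Suc j)}" using step by auto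
        ultimately show ?thesis by (simp add: add.commute)
      qed
      finally show ?case .
    qed
  qed
  then show ?thesis unfolding b_def .
qed

lemma card_near_le: "card {l :: nat. \<bar>a - real l\<bar> \<le> 3} \<le> 7" "finite {l :: nat. \<bar>a - real l\<bar> \<le> 3}"
proof -
  have sub: "{l :: nat. \<bar>a - real l\<bar> \<le> 3} \<subseteq> nat ` {\<lceil>a - 3\<rceil>..\<lfloor>a + 3\<rfloor>}"
  proof
    fix l :: nat assume "l \<in> {l. \<bar>a - real l\<bar> \<le> 3}"
    then have "a - 3 \<le> real l" "real l \<le> a + 3" by auto
    then have "\<lceil>a - 3\<rceil> \<le> int l" "int l \<le> \<lfloor>a + 3\<rfloor>" by linarith+
    then have "int l \<in> {\<lceil>a - 3\<rceil>..\<lfloor>a + 3\<rfloor>}" by (simp only: atLeastAtMost_iff)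
    then show "l \<in> nat ` {\<lceil>a - 3\<rceil>..\<lfloor>a + 3\<rfloor>}" by (intro image_eqI[of _ _ "int l"]) auto
  qed
  then show "finite {l :: nat. \<bar>a - real l\<bar> \<le> 3}" by (rule finite_subset) simp
  have "card {l :: nat. \<bar>a - real l\<bar> \<le> 3} \<le> card (nat ` {\<lceil>a - 3\<rceil>..\<lfloor>a + 3\<rfloor>})"
    using sub by (intro card_mono) auto
  also have "\<dots> \<le> card {\<lceil>a - 3\<rceil>..\<lfloor>a + 3\<rfloor>}" by (rule card_image_le) simp
  also have "\<dots> \<le> 7"
  proof -
    have "\<lfloor>a + 3\<rfloor> - \<lceil>a - 3\<rceil> \<le> 6" by linarith
    then show ?thesis unfolding card_atLeastAtMost_int by linarith
  qed
  finally show "card {l :: nat. \<bar>a - real l\<bar> \<le> 3} \<le> 7" .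
qed

text \<open>A Schur-type summation. Of the decay order \<kappa> + s + 4, the part \<kappa> pays for
  the growth of polynomials along the walk, s for moving the weight from cell i to cell l, and 2 + 2
  for summing over j and over i. As l lies between i and j, powers of 1 + |i - j| may be spent on 1
  + |i - l|.\<close>

lemma weighted_cell_sum:
  fixes Wl :: "nat \<Rightarrow> real" and U :: "nat \<Rightarrow> ennreal" and T :: "nat \<Rightarrow> nat \<Rightarrow> ennreal"
  assumes k: "0 \<le> k0" "0 \<le> G1" and c: "0 \<le> c" and Wl: "\<And>l. 0 \<le> Wl l"
    and slow: "\<And>i l. i < N \<Longrightarrow> l < N \<Longrightarrow> Wl i \<le> c * (1 + \<bar>real i - real l\<bar>) ^ s * Wl l"
    and T: "\<And>i j. i < N \<Longrightarrow> j < N \<Longrightarrow> T i j \<le> (\<Sum>l\<in>{min i j..max i j}. ennreal (k0 * (1 + \<bar>real i - real l\<bar>) ^ \<kappa>) * U l)"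
  shows "(\<Sum>i<N. \<Sum>j<N. ennreal (G1 / (1 + \<bar>real i - real j\<bar>) ^ (\<kappa> + s + 4)) * (ennreal (Wl i) * T i j)) \<le>
    ennreal (16 * G1 * k0 * c) * (\<Sum>l<N. ennreal (Wl l) * U l)"
proof -
  define a where "a i j = 1 / (1 + \<bar>real i - real j\<bar>)\<^sup>2" for i j :: nat
  have a0: "0 \<le> a i j" for i j by (simp add: a_def)
  define K where "K = G1 * k0 * c"
  have K0: "0 \<le> K" using k c by (simp add: K_def)
  have summand: "ennreal (G1 / (1 + \<bar>real i - real j\<bar>) ^ (\<kappa> + s + 4)) * (ennreal (Wl i) * T i j) \<le>
      (\<Sum>l<N. ennreal (K * a i l * a i j) * (ennreal (Wl l) * U l))" if ij: "i < N" "j < N" for i j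
  proof -
    define y where "y = 1 + \<bar>real i - real j\<bar>"
    have y: "1 \<le> y" by (simp add: y_def)
    have co: "ennreal (G1 / y ^ (\<kappa> + s + 4)) * (ennreal (Wl i) * ennreal (k0 * (1 + \<bar>real i - real l\<bar>) ^ \<kappa>)) \<le> ennreal (K * a i l * a i j) * ennreal (Wl l)"
      if l: "l \<in> {min i j..max i j}" for l
    proof -
      define z where "z = 1 + \<bar>real i - real l\<bar>"
      have z: "1 \<le> z" by (simp add: z_def)
      have zy: "z \<le> y" using l by (auto simp: z_def y_def)
      have lN: "l < N" using l ij by auto
      have "G1 / y ^ (\<kappa> + s + 4) * (Wl i * (k0 * z ^ \<kappa>)) \<le> G1 / (y ^ 2 * z ^ (\<kappa> + s + 2)) * ((c * z ^ s * Wl l) * (k0 * z ^ \<kappa>))"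
      proof (intro mult_mono divide_left_mono)
        have "y\<^sup>2 * z ^ (\<kappa> + s + 2) \<le> y\<^sup>2 * y ^ (\<kappa> + s + 2)" using y z zy by (intro mult_left_mono power_mono) auto
        also have "\<dots> = y ^ (\<kappa> + s + 4)" by (simp add: power_add power2_eq_square power4_eq_xxxx)
        finally show "y\<^sup>2 * z ^ (\<kappa> + s + 2) \<le> y ^ (\<kappa> + s + 4)" .
        show "Wl i \<le> c * z ^ s * Wl l" using slow[OF ij(1) lN] by (simp add: z_def)
      qed (use y z k c Wl in auto)
      also have "\<dots> = K * (1 / z\<^sup>2) * (1 / y\<^sup>2) * Wl l"
        using y z by (simp add: K_def power_add power2_eq_square field_simps)
      also have "\<dots> = K * a i l * a i j * Wl l" by (simp add: a_def z_def y_def)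
      finally have "ennreal (G1 / y ^ (\<kappa> + s + 4) * (Wl i * (k0 * z ^ \<kappa>))) \<le> ennreal (K * a i l * a i j * Wl l)" by (rule ennreal_leI)
      then show ?thesis using y z k Wl K0 a0 by (simp only: z_def ennreal_mult mult_nonneg_nonneg divide_nonneg_nonneg zero_le_power order_trans[OF zero_le_one])
    qed
    have "ennreal (G1 / y ^ (\<kappa> + s + 4)) * (ennreal (Wl i) * T i j) \<le>
      ennreal (G1 / y ^ (\<kappa> + s + 4)) * (ennreal (Wl i) * (\<Sum>l\<in>{min i j..max i j}. ennreal (k0 * (1 + \<bar>real i - real l\<bar>) ^ \<kappa>) * U l))"
      by (intro mult_left_mono T ij) auto
    also have "\<dots> = (\<Sum>l\<in>{min i j..max i j}. (ennreal (G1 / y ^ (\<kappa> + s + 4)) * (ennreal (Wl i) * ennreal (k0 * (1 + \<bar>real i - real l\<bar>) ^ \<kappa>))) * U l)"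
      by (simp only: sum_distrib_left mult.assoc)
    also have "\<dots> \<le> (\<Sum>l\<in>{min i j..max i j}. (ennreal (K * a i l * a i j) * ennreal (Wl l)) * U l)"
      by (intro sum_mono mult_right_mono co) auto
    also have "\<dots> \<le> (\<Sum>l<N. (ennreal (K * a i l * a i j) * ennreal (Wl l)) * U l)"
      using ij by (intro sum_mono2) auto
    finally show ?thesis unfolding y_def by (simp only: mult.assoc)
  qed
  have "(\<Sum>i<N. \<Sum>j<N. ennreal (G1 / (1 + \<bar>real i - real j\<bar>) ^ (\<kappa> + s + 4)) * (ennreal (Wl i) * T i j)) \<le>
     (\<Sum>i<N. \<Sum>j<N. \<Sum>l<N. ennreal (K * a i l * a i j) * (ennreal (Wl l) * U l))"
    by (intro sum_mono summand) auto
  also have "\<dots> = (\<Sum>i<N. \<Sum>l<N. \<Sum>j<N. ennreal (K * a i l * a i j) * (ennreal (Wl l) * U l))"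
    by (intro sum.cong refl sum.swap)
  also have "\<dots> = (\<Sum>l<N. \<Sum>i<N. \<Sum>j<N. ennreal (K * a i l * a i j) * (ennreal (Wl l) * U l))"
    by (rule sum.swap)
  also have "\<dots> = (\<Sum>l<N. ennreal (\<Sum>i<N. \<Sum>j<N. K * a i l * a i j) * (ennreal (Wl l) * U l))"
    using K0 a0 by (intro sum.cong refl) (simp add: sum_distrib_right[symmetric] sum_nonneg)
  also have "\<dots> \<le> (\<Sum>l<N. ennreal (16 * K) * (ennreal (Wl l) * U l))"
  proof (intro sum_mono mult_right_mono ennreal_leI)
    fix l
    have "(\<Sum>i<N. \<Sum>j<N. K * a i l * a i j) = (\<Sum>i<N. K * a i l * (\<Sum>j<N. a i j))" by (simp add: sum_distrib_left)
    also have "\<dots> \<le> (\<Sum>i<N. K * a i l * 4)"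
      using K0 a0 sum_inverse_dist_squares_le unfolding a_def by (intro sum_mono mult_left_mono) auto
    also have "\<dots> = 4 * K * (\<Sum>i<N. a l i)" by (simp add: sum_distrib_left a_def abs_minus_commute mult_ac)
    also have "\<dots> \<le> 4 * K * 4" using K0 sum_inverse_dist_squares_le unfolding a_def by (intro mult_left_mono) auto
    finally show "(\<Sum>i<N. \<Sum>j<N. K * a i l * a i j) \<le> 16 * K" by simp
  qed auto
  also have "\<dots> = ennreal (16 * G1 * k0 * c) * (\<Sum>l<N. ennreal (Wl l) * U l)"
    by (simp only: sum_distrib_left[symmetric] K_def mult.assoc)
  finally show ?thesis .
qed

section \<open>Partition of unity and approximants on the cells\<close>

lemma cell_angle:
  assumes "i < N" "x \<in> cell N i"
  shows "\<bar>arccos x - mid_angle N i\<bar> \<le> pi / (2 * real N)" "cos (arccos x) = x" "arccos x \<in> {0..pi}"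
proof -
  have N: "1 \<le> N" using assms by simp
  have ang: "0 \<le> real i * pi / real N" "real i * pi / real N \<le> real (Suc i) * pi / real N" "real (Suc i) * pi / real N \<le> pi"
    using cell_angles[of i "Suc i" N] assms N by auto
  note * = arccos_between[OF ang assms(2)]
  show "cos (arccos x) = x" "arccos x \<in> {0..pi}" using * by auto
  define u where "u = pi / (2 * real N)"
  have "real i * pi / real N = mid_angle N i - u" "real (Suc i) * pi / real N = mid_angle N i + u"
    using N by (auto simp: u_def field_simps)
  then show "\<bar>arccos x - mid_angle N i\<bar> \<le> pi / (2 * real N)" using *(1) unfolding u_def[symmetric]
    by (simp only: atLeastAtMost_iff abs_le_iff) linarith
qed

lemma mid_angle_mem: "i < N \<Longrightarrow> mid_angle N i \<in> {0..pi}"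
  using mult_left_mono[of "1 + real i * 2" "real N * 2" pi] by (auto simp: field_simps)

text \<open>Symmetry of the localizer turns the sum over centres into a sum over nodes, which does
  not depend on the remaining angle; dividing by its value \<open>S\<close> gives the partition. The
  degree leaves room for a factor of degree below \<open>r\<close>. Localization at scale 1 / n
  survives even when n is close to r, because n <= r (n - r + 1).\<close>

lemma partition_of_unity:
  assumes r: "1 \<le> r" "r \<le> n" and m: "1 \<le> m" and N: "n \<le> N" "real N \<le> K * real n" and K: "0 \<le> K"
  obtains E :: "nat \<Rightarrow> real poly" where
    "\<And>j. degree (E j) \<le> n - r" "\<And>x. x \<in> {-1..1} \<Longrightarrow> (\<Sum>j<N. poly (E j) x) = 1"
    "\<And>i j x. i < N \<Longrightarrow> j < N \<Longrightarrow> x \<in> cell N i \<Longrightarrow>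
       \<bar>poly (E j) x\<bar> \<le> 2 * ((1 + pi) * (2 + K * real (r * m)) / (1 + \<bar>real i - real j\<bar>)) ^ (2 * m)"
proof -
  \<comment> \<open>The largest \<nu> with m (\<nu> - 1) <= n - r; it is positive even if n - r <
    m.\<close>
  define \<nu> where "\<nu> = (n - r) div m + 1"
  have \<nu>: "1 \<le> \<nu>" by (simp add: \<nu>_def)
  have deg: "m * (\<nu> - 1) \<le> n - r" by (simp add: \<nu>_def)
  have m\<nu>: "n - r + 1 \<le> m * \<nu>"
  proof -
    have "n - r < m * Suc ((n - r) div m)" using dividend_less_div_times[of m "n - r"] m by (simp add: mult.commute)
    then show ?thesis by (simp add: \<nu>_def)
  qed
  have "n \<le> r * (n - r + 1)"
  proof -
    obtain d where "n = r + d" using r(2) le_Suc_ex by blast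
    then show ?thesis using r(1) by simp
  qed
  also have "\<dots> \<le> r * (m * \<nu>)" using m\<nu> by (intro mult_left_mono) auto
  finally have n\<nu>: "real n \<le> real (r * m) * real \<nu>" by (simp add: mult.assoc flip: of_nat_mult)
  have N0: "0 < N" using r N by linarith
  have dN: "m * (\<nu> - 1) < 2 * N" using deg N r by linarith
  obtain D :: "real \<Rightarrow> real poly" where D: "\<And>\<alpha>. degree (D \<alpha>) \<le> m * (\<nu> - 1)"
    "\<And>\<alpha> \<beta>. poly (D \<alpha>) (cos \<beta>) = poly (D \<beta>) (cos \<alpha>)"
    "\<And>\<alpha> \<beta>. 0 \<le> poly (D \<alpha>) (cos \<beta>)" "\<And>\<alpha>. 1 \<le> poly (D \<alpha>) (cos \<alpha>)"
    "\<And>\<alpha> \<beta>. \<alpha> \<in> {0..pi} \<Longrightarrow> \<beta> \<in> {0..pi} \<Longrightarrow>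
       poly (D \<alpha>) (cos \<beta>) \<le> 2 * ((1 + pi) / (1 + real \<nu> * \<bar>\<alpha> - \<beta>\<bar>)) ^ (2 * m)"
    "\<And>N \<alpha> \<alpha>'. m * (\<nu> - 1) < 2 * N \<Longrightarrow>
       (\<Sum>i<N. poly (D \<alpha>) (cos ((real i + 1 / 2) * pi / real N))) =
       (\<Sum>i<N. poly (D \<alpha>') (cos ((real i + 1 / 2) * pi / real N)))"
    using localizer[OF \<nu>, of m] by blast
  define S where "S = (\<Sum>i<N. poly (D 0) (cos (mid_angle N i)))"
  have S: "(\<Sum>j<N. poly (D (mid_angle N j)) (cos \<alpha>)) = S" for \<alpha>
    unfolding S_def using D(6)[OF dN, of \<alpha> 0] D(2)[of _ \<alpha>] by simp
  have S1: "1 \<le> S"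
  proof -
    have "1 \<le> poly (D (mid_angle N 0)) (cos (mid_angle N 0))" by (rule D(4))
    also have "\<dots> \<le> (\<Sum>j<N. poly (D (mid_angle N j)) (cos (mid_angle N 0)))"
      using N0 D(3) by (intro member_le_sum) auto
    finally show ?thesis unfolding S .
  qed
  define E where "E j = smult (1 / S) (D (mid_angle N j))" for j
  show thesis
  proof
    show "degree (E j) \<le> n - r" for j
      using D(1) deg degree_smult_le[of "1 / S" "D (mid_angle N j)"] unfolding E_def by (meson order_trans)
    show "(\<Sum>j<N. poly (E j) x) = 1" if "x \<in> {-1..1}" for x
      using S[of "arccos x"] S1 that by (simp add: E_def sum_divide_distrib[symmetric])
    fix i j :: nat and x :: real assume ij: "i < N" "j < N" and x: "x \<in> cell N i"
    define \<alpha> where "\<alpha> = arccos x"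
    have \<alpha>: "\<bar>\<alpha> - mid_angle N i\<bar> \<le> pi / (2 * real N)" "cos \<alpha> = x" "\<alpha> \<in> {0..pi}"
      using cell_angle[OF ij(1) x] by (auto simp: \<alpha>_def)
    define \<delta> where "\<delta> = \<bar>mid_angle N j - \<alpha>\<bar>"
    define B where "B = 2 + K * real (r * m)"
    have B: "0 \<le> B" using K by (simp add: B_def)
    have "1 + \<bar>real i - real j\<bar> = 1 + (real N / pi) * \<bar>mid_angle N i - mid_angle N j\<bar>"
      unfolding mid_angle_diff using N0 by simp
    also have "\<dots> \<le> 1 + (real N / pi) * (pi / (2 * real N) + \<delta>)"
    proof (intro add_left_mono mult_left_mono)
      show "\<bar>mid_angle N i - mid_angle N j\<bar> \<le> pi / (2 * real N) + \<delta>" using \<alpha>(1) unfolding \<delta>_def by linarith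
    qed simp
    also have "\<dots> = 3 / 2 + (real N / pi) * \<delta>" using N0 by (simp add: distrib_left)
    also have "\<dots> \<le> B * 1 + B * (real \<nu> * \<delta>)"
    proof (intro add_mono)
      show "3 / 2 \<le> B * 1" using K by (simp add: B_def add_increasing2)
      have "real N / pi \<le> real N / 1" using pi_ge_two by (intro divide_left_mono) auto
      also have "\<dots> \<le> K * (real (r * m) * real \<nu>)" using N(2) mult_left_mono[OF n\<nu> K] by simp
      also have "\<dots> \<le> B * real \<nu>" using mult_right_mono[of "K * real (r * m)" B "real \<nu>"] by (simp add: B_def mult.assoc)
      finally have "real N / pi * \<delta> \<le> B * real \<nu> * \<delta>" by (rule mult_right_mono) (simp add: \<delta>_def)
      then show "real N / pi * \<delta> \<le> B * (real \<nu> * \<delta>)" by (simp add: mult.assoc)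
    qed
    finally have le: "1 + \<bar>real i - real j\<bar> \<le> B * (1 + real \<nu> * \<delta>)" by (simp add: distrib_left)
    have \<delta>0: "0 < 1 + real \<nu> * \<delta>" by (simp add: \<delta>_def add_pos_nonneg)
    have "\<bar>poly (E j) x\<bar> = poly (D (mid_angle N j)) (cos \<alpha>) / S"
      using D(3)[of "mid_angle N j" \<alpha>] S1 \<alpha>(2) by (simp add: E_def)
    also have "\<dots> \<le> poly (D (mid_angle N j)) (cos \<alpha>) / 1"
      using D(3)[of "mid_angle N j" \<alpha>] S1 by (intro divide_left_mono) auto
    also have "\<dots> \<le> 2 * ((1 + pi) / (1 + real \<nu> * \<delta>)) ^ (2 * m)"
      using D(5)[OF mid_angle_mem[OF ij(2)] \<alpha>(3)] by (simp add: \<delta>_def)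
    also have "\<dots> \<le> 2 * ((1 + pi) * B / (1 + \<bar>real i - real j\<bar>)) ^ (2 * m)"
    proof (intro mult_left_mono power_mono)
      have "(1 + pi) * (1 + \<bar>real i - real j\<bar>) \<le> (1 + pi) * (B * (1 + real \<nu> * \<delta>))"
        using le pi_gt_zero by (intro mult_left_mono) linarith+
      then show "(1 + pi) / (1 + real \<nu> * \<delta>) \<le> (1 + pi) * B / (1 + \<bar>real i - real j\<bar>)"
        using \<delta>0 by (simp add: divide_le_eq pos_le_divide_eq mult_ac add_pos_nonneg)
      show "0 \<le> (1 + pi) / (1 + real \<nu> * \<delta>)" using \<delta>0 pi_gt_zero by (intro divide_nonneg_pos) linarith+
    qed auto
    finally show "\<bar>poly (E j) x\<bar> \<le> 2 * ((1 + pi) * (2 + K * real (r * m)) / (1 + \<bar>real i - real j\<bar>)) ^ (2 * m)"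
      unfolding B_def .
  qed
qed

text \<open>Three angular cell widths to either side of the midpoint suffice to contain every pair
  of cells that is charged to cell l.\<close>

abbreviation window_avg :: "nat \<Rightarrow> real \<Rightarrow> nat \<Rightarrow> real \<Rightarrow> (real \<Rightarrow> real) \<Rightarrow> nat \<Rightarrow> ennreal" where
  "window_avg r p N t f l \<equiv> (\<integral>\<^sup>+x\<in>{-1..1}. pint p {0..t} (\<lambda>h. sym_diff r (h * phi x) f x) *
          indicator {x. \<bar>arccos x - mid_angle N l\<bar> \<le> 3 * pi / real N} x \<partial>lborel)"

abbreviation cell_control :: "real \<Rightarrow> nat \<Rightarrow> (real \<Rightarrow> real) \<Rightarrow> (nat \<Rightarrow> real poly) \<Rightarrow> (nat \<Rightarrow> ennreal) \<Rightarrow> bool" where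
  "cell_control p N f q U \<equiv> (\<forall>i<N. pint p (cell N i) (\<lambda>x. f x - poly (q i) x) \<le> U i) \<and>
     (\<forall>l k. Suc l < N \<longrightarrow> k = l \<or> k = Suc l \<longrightarrow>
        pint p (cell N (Suc l)) (\<lambda>x. poly (q (Suc l)) x - poly (q l) x) \<le> 2 * U k)"

lemma cell_approximants:
  assumes p: "0 < p" "p \<le> 1" and r: "1 \<le> r"
  shows "\<exists>C\<ge>0. \<forall>N f t. 2 \<le> N \<longrightarrow> f \<in> borel_measurable borel \<longrightarrow> pint p {-1..1} f < \<infinity> \<longrightarrow>
    4 * pi / real N \<le> t \<longrightarrow>
    (\<exists>q. (\<forall>l. degree (q l) < r) \<and>
      cell_control p N f q (\<lambda>l. ennreal (C * real N) * window_avg r p N t f l))"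
proof -
  obtain C where C: "C \<ge> 0" "\<forall>f a b t M. f \<in> borel_measurable borel \<longrightarrow> a < b \<longrightarrow> {a..b} \<subseteq> {-1..1} \<longrightarrow>
     pint p {a..b} f < \<infinity> \<longrightarrow> 0 < t \<longrightarrow> 0 \<le> M \<longrightarrow>
     (\<forall>x s. 0 \<le> s \<longrightarrow> a \<le> x - real r * s / 2 \<longrightarrow> x + real r * s / 2 \<le> b \<longrightarrow> s \<le> t * phi x) \<longrightarrow>
     (\<forall>x\<in>{a..b}. phi x \<le> M * (b - a)) \<longrightarrow>
     (\<exists>q. degree q < r \<and> pint p {a..b} (\<lambda>x. f x - poly q x) \<le>
       ennreal (C * M) * (\<integral>\<^sup>+x\<in>{a..b}. pint p {0..t} (\<lambda>h. sym_diff r (h * phi x) f x) \<partial>lborel))"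
    using whitney_phi[OF p r] by blast
  show ?thesis
  proof (intro exI[of _ C] conjI allI impI C(1))
    fix N :: nat and f :: "real \<Rightarrow> real" and t :: real
    assume N: "2 \<le> N" and f[measurable]: "f \<in> borel_measurable borel"
      and fin: "pint p {-1..1} f < \<infinity>" and t: "4 * pi / real N \<le> t"
    define G where "G x = pint p {0..t} (\<lambda>h. sym_diff r (h * phi x) f x)" for x
    define J where "J j = {knot N (Suc (Suc j))..knot N j}" for j
    define V where "V l = {x. \<bar>arccos x - mid_angle N l\<bar> \<le> 3 * pi / real N}" for l
    define U where "U l = ennreal (C * real N) * (\<integral>\<^sup>+x\<in>{-1..1}. G x * indicator (V l) x \<partial>lborel)" for l
    have N0: "real N > 0" using N by simp
    have t0: "0 < t" using t N0 by (intro less_le_trans[OF _ t]) simp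
    have "\<exists>q. degree q < r \<and> pint p (J j) (\<lambda>x. f x - poly q x) \<le> ennreal (C * real N) * (\<integral>\<^sup>+x\<in>J j. G x \<partial>lborel)"
      if j: "Suc (Suc j) \<le> N" for j
    proof -
      note d = double_cell[OF j r t]
      have "pint p (J j) f \<le> pint p {-1..1} f"
        unfolding J_def by (rule set_nn_integral_mono_set[OF d(2)]) simp
      then have "pint p (J j) f < \<infinity>" using fin by (rule le_less_trans)
      then show ?thesis using C(2)[rule_format, OF f d(1,2) _ t0 _ d(3,4)] unfolding J_def G_def by auto
    qed
    then obtain Q where Q: "degree (Q j) < r"
      "pint p (J j) (\<lambda>x. f x - poly (Q j) x) \<le> ennreal (C * real N) * (\<integral>\<^sup>+x\<in>J j. G x \<partial>lborel)"
      if "Suc (Suc j) \<le> N" for j by metis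
    \<comment> \<open>The slack in \<open>k\<close> is what allows the jump between two neighbouring
      approximants to be charged to either of them.\<close>
    have window: "J j \<subseteq> V k" if j: "Suc (Suc j) \<le> N" and k: "j \<le> k + 1" "k \<le> j + 2" for j k
    proof
      fix x assume x: "x \<in> J j"
      have ang: "0 \<le> real j * pi / real N" "real j * pi / real N \<le> real (Suc (Suc j)) * pi / real N" "real (Suc (Suc j)) * pi / real N \<le> pi"
        using cell_angles[of j "Suc (Suc j)" N] j by auto
      have "arccos x \<in> {real j * pi / real N..real (Suc (Suc j)) * pi / real N}"
        using arccos_between(1)[OF ang] x unfolding J_def by blast
      moreover have "real (Suc (Suc j)) * pi / real N \<le> mid_angle N k + 3 * pi / real N"
      proof -
        have "real (Suc (Suc j)) * (pi / real N) \<le> ((real k + 1 / 2) + 3) * (pi / real N)"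
          using k by (intro mult_right_mono) auto
        then show ?thesis by (simp add: distrib_right add_divide_distrib)
      qed
      moreover have "mid_angle N k \<le> real j * pi / real N + 3 * pi / real N"
      proof -
        have "(real k + 1 / 2) * (pi / real N) \<le> (real j + 3) * (pi / real N)"
          using k by (intro mult_right_mono) auto
        then show ?thesis by (simp add: distrib_right add_divide_distrib)
      qed
      ultimately show "x \<in> V k" unfolding V_def by (simp only: mem_Collect_eq atLeastAtMost_iff abs_le_iff) linarith
    qed
    have J1: "J j \<subseteq> {-1..1}" if "Suc (Suc j) \<le> N" for j unfolding J_def using double_cell(2)[OF that r t] .
    have piece: "pint p (cell N i) (\<lambda>x. f x - poly (Q j) x) \<le> U k"
      if j: "Suc (Suc j) \<le> N" and k: "j \<le> k + 1" "k \<le> j + 2" and i: "i = j \<or> i = Suc j" for i j k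
    proof -
      have sub: "cell N i \<subseteq> J j"
        using i knot_antimono[of j "Suc j" N] knot_antimono[of "Suc j" "Suc (Suc j)" N] j N unfolding J_def by auto
      have "pint p (cell N i) (\<lambda>x. f x - poly (Q j) x) \<le> pint p (J j) (\<lambda>x. f x - poly (Q j) x)"
        by (rule set_nn_integral_mono_set[OF sub]) simp
      also have "\<dots> \<le> ennreal (C * real N) * (\<integral>\<^sup>+x\<in>J j. G x \<partial>lborel)" by (rule Q(2)[OF j])
      also have "\<dots> \<le> U k" unfolding U_def
      proof (rule mult_left_mono)
        show "(\<integral>\<^sup>+x\<in>J j. G x \<partial>lborel) \<le> (\<integral>\<^sup>+x\<in>{-1..1}. G x * indicator (V k) x \<partial>lborel)"
          using window[OF j k] by (intro set_nn_integral_mono_set[OF J1[OF j]]) auto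
      qed simp
      finally show ?thesis .
    qed
    \<comment> \<open>No pair starts at the last cell, so it takes over the approximant of the pair
      that ends there.\<close>
    define q where "q i = Q (min i (N - 2))" for i
    have adm: "Suc (Suc (min i (N - 2))) \<le> N" for i using N by simp
    have "pint p (cell N i) (\<lambda>x. f x - poly (q i) x) \<le> U i" if "i < N" for i
      unfolding q_def using that N by (intro piece[OF adm]) auto
    moreover have "pint p (cell N (Suc l)) (\<lambda>x. poly (q (Suc l)) x - poly (q l) x) \<le> 2 * U k"
      if l: "Suc l < N" and k: "k = l \<or> k = Suc l" for l k
    proof -
      have "pint p (cell N (Suc l)) (\<lambda>x. poly (q (Suc l)) x - poly (q l) x) \<le>
        (\<integral>\<^sup>+x\<in>cell N (Suc l). (pw p (f x - poly (q l) x) + pw p (f x - poly (q (Suc l)) x)) \<partial>lborel)"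
      proof (rule set_nn_integral_mono_set[OF order_refl])
        fix x show "pw p (poly (q (Suc l)) x - poly (q l) x) \<le> pw p (f x - poly (q l) x) + pw p (f x - poly (q (Suc l)) x)"
          using pw_diff[OF p, of "f x - poly (q l) x" "f x - poly (q (Suc l)) x"] by simp
      qed
      also have "\<dots> = pint p (cell N (Suc l)) (\<lambda>x. f x - poly (q l) x) + pint p (cell N (Suc l)) (\<lambda>x. f x - poly (q (Suc l)) x)"
        by (rule set_nn_integral_add) auto
      also have "\<dots> \<le> U k + U k"
        unfolding q_def using l k N by (intro add_mono piece[OF adm]) auto
      finally show ?thesis by (simp add: mult_2)
    qed
    moreover have "degree (q l) < r" for l unfolding q_def by (rule Q(1)[OF adm])
    ultimately have "(\<forall>l. degree (q l) < r) \<and> cell_control p N f q U" by blast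
    then show "\<exists>q. (\<forall>l. degree (q l) < r) \<and>
      cell_control p N f q (\<lambda>l. ennreal (C * real N) * window_avg r p N t f l)"
      unfolding U_def V_def G_def by blast
  qed
qed

lemma slow_weight_near:
  assumes "slow_weight n c s v" "0 \<le> c" "\<alpha> \<in> {0..pi}" "\<beta> \<in> {0..pi}" "real n * \<bar>\<alpha> - \<beta>\<bar> \<le> d"
  shows "v \<alpha> \<le> c * (1 + d) ^ s * v \<beta>"
proof -
  have "v \<alpha> \<le> c * (1 + real n * \<bar>\<alpha> - \<beta>\<bar>) ^ s * v \<beta>" by (rule slow_weightD(3)[OF assms(1,3,4)])
  also have "\<dots> \<le> c * (1 + d) ^ s * v \<beta>"
    using assms slow_weightD(2)[OF assms(1)] by (intro mult_right_mono mult_left_mono power_mono) auto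
  finally show ?thesis .
qed

lemma pw_localized_le:
  assumes p: "0 < p" and B: "0 \<le> B" and y: "1 \<le> y" and M: "real M \<le> 2 * real m * p"
    and z: "\<bar>z\<bar> \<le> 2 * (B / y) ^ (2 * m)"
  shows "pw p z \<le> ennreal ((2 * B ^ (2 * m)) powr p / y ^ M)"
  unfolding pw_def
proof (rule ennreal_leI)
  have y0: "0 < y" using y by simp
  have "\<bar>z\<bar> powr p \<le> (2 * B ^ (2 * m) / y ^ (2 * m)) powr p"
    using z p by (intro powr_mono2) (auto simp: power_divide)
  also have "\<dots> = (2 * B ^ (2 * m)) powr p / y powr (real (2 * m) * p)"
    using B y0 by (simp add: powr_divide powr_powr flip: powr_realpow)
  also have "\<dots> \<le> (2 * B ^ (2 * m)) powr p / y powr real M"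
    using M y y0 by (intro divide_left_mono powr_mono) auto
  finally show "\<bar>z\<bar> powr p \<le> (2 * B ^ (2 * m)) powr p / y ^ M" using y0 by (simp add: powr_realpow)
qed

text \<open>A point lies in at most seven windows, and over each window the cell weight is
  comparable with \<open>W\<close>, so the sum of the local integrals collapses to the global
  one.\<close>

lemma window_sum_le:
  assumes N: "1 \<le> N" and K: "0 \<le> k" and [measurable]: "G \<in> borel_measurable borel" "W \<in> borel_measurable borel"
    and Wl: "\<And>l x. l < N \<Longrightarrow> x \<in> {-1..1} \<Longrightarrow> \<bar>arccos x - mid_angle N l\<bar> \<le> 3 * pi / real N \<Longrightarrow> Wl l \<le> k * W x"
  shows "(\<Sum>l<N. ennreal (Wl l) * (\<integral>\<^sup>+x\<in>{-1..1}. G x * indicator {x. \<bar>arccos x - mid_angle N l\<bar> \<le> 3 * pi / real N} x \<partial>lborel)) \<le>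
    ennreal (7 * k) * (\<integral>\<^sup>+x\<in>{-1..1}. ennreal (W x) * G x \<partial>lborel)"
proof -
  \<comment> \<open>As a preimage under arccos restricted to [-1, 1], where it is continuous, the
    window is a closed set and hence measurable.\<close>
  define V where "V l = {-1..1} \<inter> arccos -` {mid_angle N l - 3 * pi / real N..mid_angle N l + 3 * pi / real N}" for l
  have "closed (V l)" for l unfolding V_def by (intro continuous_closed_preimage continuous_on_arccos' closed_atLeastAtMost)
  then have [measurable]: "V l \<in> sets borel" for l by simp
  have V_iff: "x \<in> V l \<longleftrightarrow> x \<in> {-1..1} \<and> \<bar>arccos x - mid_angle N l\<bar> \<le> 3 * pi / real N" for x l
    unfolding V_def by (auto simp: abs_le_iff)
  have near: "(\<Sum>l<N. indicator (V l) x :: ennreal) \<le> 7" for x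
  proof -
    define a where "a = arccos x * real N / pi - 1 / 2"
    have "\<bar>a - real l\<bar> \<le> 3" if "x \<in> V l" for l
    proof -
      have "\<bar>a - real l\<bar> = \<bar>arccos x - mid_angle N l\<bar> * (real N / pi)"
      proof -
        have "a - real l = (arccos x - mid_angle N l) * (real N / pi)" using N by (simp add: a_def field_simps)
        then show ?thesis by (simp add: abs_mult)
      qed
      also have "\<dots> \<le> (3 * pi / real N) * (real N / pi)" using that by (intro mult_right_mono) (auto simp: V_iff)
      finally show ?thesis using N by simp
    qed
    then have "{l \<in> {..<N}. x \<in> V l} \<subseteq> {l. \<bar>a - real l\<bar> \<le> 3}" by blast
    then have "card {l \<in> {..<N}. x \<in> V l} \<le> 7" using card_near_le[of a] by (meson card_mono order_trans)
    moreover have "(\<Sum>l<N. indicator (V l) x :: ennreal) = of_nat (card {l \<in> {..<N}. x \<in> V l})"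
    proof -
      have "(\<Sum>l<N. indicator (V l) x :: ennreal) = (\<Sum>l<N. if x \<in> V l then 1 else 0)" by (intro sum.cong refl) (auto simp: indicator_def)
      then show ?thesis by (simp add: sum.If_cases Int_def)
    qed
    ultimately show ?thesis by (metis of_nat_mono of_nat_numeral)
  qed
  have "(\<Sum>l<N. ennreal (Wl l) * (\<integral>\<^sup>+x\<in>{-1..1}. G x * indicator {x. \<bar>arccos x - mid_angle N l\<bar> \<le> 3 * pi / real N} x \<partial>lborel)) \<le>
    (\<Sum>l<N. \<integral>\<^sup>+x\<in>{-1..1}. (ennreal (k * W x) * G x) * indicator (V l) x \<partial>lborel)"
  proof (rule sum_mono)
    fix l assume l: "l \<in> {..<N}"
    have "ennreal (Wl l) * (\<integral>\<^sup>+x\<in>{-1..1}. G x * indicator {x. \<bar>arccos x - mid_angle N l\<bar> \<le> 3 * pi / real N} x \<partial>lborel) =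
      ennreal (Wl l) * (\<integral>\<^sup>+x\<in>V l. G x \<partial>lborel)"
    proof -
      have "(\<integral>\<^sup>+x\<in>{-1..1}. G x * indicator {x. \<bar>arccos x - mid_angle N l\<bar> \<le> 3 * pi / real N} x \<partial>lborel) = (\<integral>\<^sup>+x\<in>V l. G x \<partial>lborel)"
        by (rule nn_integral_cong) (auto simp: V_iff split: split_indicator)
      then show ?thesis by simp
    qed
    also have "\<dots> = (\<integral>\<^sup>+x\<in>V l. ennreal (Wl l) * G x \<partial>lborel)"
      by (rule set_nn_integral_cmult[symmetric]) auto
    also have "\<dots> \<le> (\<integral>\<^sup>+x\<in>{-1..1}. (ennreal (k * W x) * G x) * indicator (V l) x \<partial>lborel)"
    proof (rule set_nn_integral_mono_set)
      show "V l \<subseteq> {-1..1}" by (auto simp: V_iff)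
      show "ennreal (Wl l) * G x \<le> (ennreal (k * W x) * G x) * indicator (V l) x" if x: "x \<in> V l" for x
      proof -
        have "Wl l \<le> k * W x" using x l by (intro Wl) (auto simp: V_iff)
        then show ?thesis using x by (auto intro!: mult_right_mono ennreal_leI)
      qed
    qed
    finally show "ennreal (Wl l) * (\<integral>\<^sup>+x\<in>{-1..1}. G x * indicator {x. \<bar>arccos x - mid_angle N l\<bar> \<le> 3 * pi / real N} x \<partial>lborel) \<le>
      (\<integral>\<^sup>+x\<in>{-1..1}. (ennreal (k * W x) * G x) * indicator (V l) x \<partial>lborel)" .
  qed
  also have "\<dots> = (\<integral>\<^sup>+x\<in>{-1..1}. (\<Sum>l<N. (ennreal (k * W x) * G x) * indicator (V l) x) \<partial>lborel)"
    by (rule set_nn_integral_sum[symmetric]) auto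
  also have "\<dots> \<le> (\<integral>\<^sup>+x\<in>{-1..1}. ennreal (7 * k) * (ennreal (W x) * G x) \<partial>lborel)"
  proof (rule set_nn_integral_mono_set[OF order_refl])
    fix x
    have "(\<Sum>l<N. (ennreal (k * W x) * G x) * indicator (V l) x) = (ennreal (k * W x) * G x) * (\<Sum>l<N. indicator (V l) x)"
      by (simp only: sum_distrib_left)
    also have "\<dots> \<le> (ennreal (k * W x) * G x) * 7" by (intro mult_left_mono near) auto
    also have "\<dots> = ennreal (7 * k) * (ennreal (W x) * G x)"
      using K by (simp add: ennreal_mult' mult_ac)
    finally show "(\<Sum>l<N. (ennreal (k * W x) * G x) * indicator (V l) x) \<le> ennreal (7 * k) * (ennreal (W x) * G x)" .
  qed
  also have "\<dots> = ennreal (7 * k) * (\<integral>\<^sup>+x\<in>{-1..1}. ennreal (W x) * G x \<partial>lborel)"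
    by (rule set_nn_integral_cmult) auto
  finally show ?thesis .
qed

text \<open>Blend the local approximants: P is the sum of E j q j. Since the \<open>E j\<close> sum
  to 1, the error f - P is the sum of E j (f - q j). On cell i the growth of f - q j with |i - j| is
  only polynomial, and the decay of \<open>E j\<close> is chosen to beat it together with the
  variation of the weight.\<close>

lemma jackson:
  assumes p: "0 < p" "p \<le> 1" and r: "1 \<le> r" and c: "0 \<le> c" and A: "0 < A" "A \<le> 1"
  shows "\<exists>C\<ge>0. \<forall>n f W. r \<le> n \<longrightarrow> f \<in> borel_measurable borel \<longrightarrow> pint p {-1..1} f < \<infinity> \<longrightarrow>
    W \<in> borel_measurable borel \<longrightarrow> (\<forall>x. 0 \<le> W x) \<longrightarrow> slow_cos n c s W \<longrightarrow>
    (\<exists>P. degree P < n \<and> wint p W (\<lambda>x. f x - poly P x) \<le>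
      ennreal (C * real n) * (\<integral>\<^sup>+h\<in>{0..A / real n}. step_wint r p W f h \<partial>lborel))"
proof -
  \<comment> \<open>\<kappa> is the growth exponent of the walk between cells and \<open>M\<close>
    the decay that the summation demands; \<open>m\<close> is taken so large that the p-th power of
    the kernel has decay \<open>M\<close>.\<close>
  define \<kappa> where "\<kappa> = 1 + 2 * r"
  define M where "M = \<kappa> + s + 4"
  define m where "m = nat \<lceil>real M / (2 * p)\<rceil>"
  have mM: "real M / (2 * p) \<le> real m" unfolding m_def by (rule real_nat_ceiling_ge)
  then have mp: "real M \<le> 2 * real m * p" using p by (simp add: field_simps)
  have m1: "1 \<le> m"
  proof -
    have "0 < real m" using mM p by (intro less_le_trans[OF _ mM] divide_pos_pos) (auto simp: M_def)
    then show ?thesis by simp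
  qed
  define K where "K = 4 * pi / A + 1"
  have K0: "0 \<le> K" using A by (simp add: K_def)
  define B where "B = (1 + pi) * (2 + K * real (r * m))"
  have B0: "0 \<le> B" using K0 pi_gt_zero by (simp add: B_def)
  define G1 where "G1 = (2 * B ^ (2 * m)) powr p"
  have G10: "0 \<le> G1" by (simp add: G1_def)
  define k0 where "k0 = 2 * (4 * real r ^ (r + 2) * 15 ^ r)"
  have k00: "0 \<le> k0" by (simp add: k0_def)
  obtain C1 where C1: "C1 \<ge> 0" "\<forall>N f t. 2 \<le> N \<longrightarrow> f \<in> borel_measurable borel \<longrightarrow> pint p {-1..1} f < \<infinity> \<longrightarrow>
    4 * pi / real N \<le> t \<longrightarrow>
    (\<exists>q. (\<forall>l. degree (q l) < r) \<and>
      cell_control p N f q (\<lambda>l. ennreal (C1 * real N) * window_avg r p N t f l))"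
    using cell_approximants[OF p r] by blast
  define k2 where "k2 = c * 2 ^ s"
  have k20: "0 \<le> k2" using c by (simp add: k2_def)
  define C where "C = 16 * G1 * k0 * c * (C1 * K) * (7 * (k2 * k2))"
  show ?thesis
  proof (intro exI[of _ C] conjI allI impI)
    show "0 \<le> C" using C1(1) G10 k00 c K0 k20 by (simp add: C_def)
    fix n :: nat and f W :: "real \<Rightarrow> real"
    assume n: "r \<le> n" and f[measurable]: "f \<in> borel_measurable borel"
      and fin: "pint p {-1..1} f < \<infinity>"
      and W[measurable]: "W \<in> borel_measurable borel" and W0: "\<forall>x. 0 \<le> W x"
      and slow: "slow_cos n c s W"
    have n1: "1 \<le> real n" using n r by simp
    \<comment> \<open>Chosen so that 4 pi / N <= A / n, the step condition of the pairs of cells.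
      Because A <= 1, an angular cell is at most 1 / (3 n) wide, hence the weight varies over half a
      window by at most the factor \<open>c * 2 ^ s\<close>.\<close>
    define N where "N = nat \<lceil>4 * pi * real n / A\<rceil>"
    have x0: "0 \<le> 4 * pi * real n / A" using A by simp
    have N: "4 * pi * real n / A \<le> real N" "real N \<le> 4 * pi * real n / A + 1"
      using x0 unfolding N_def by linarith+
    have N12: "12 * real n \<le> real N"
    proof -
      have "12 * real n / 1 \<le> 4 * pi * real n / A"
        using A pi_gt3 n1 by (intro frac_le mult_right_mono) auto
      then show ?thesis using N(1) by simp
    qed
    have N2: "2 \<le> N" "n \<le> N" "1 \<le> N" using N12 n1 by linarith+
    have NK: "real N \<le> K * real n" using N(2) n1 by (simp add: K_def distrib_right)
    define t where "t = A / real n"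
    have tN: "4 * pi / real N \<le> t"
      using N(1) A n1 N2 unfolding t_def by (simp add: field_simps)
    define u where "u = real n * (pi / real N)"
    have "real n * pi / real N \<le> real n * 4 / (12 * real n)"
      using N12 n1 pi_less_4 by (intro frac_le mult_left_mono) auto
    then have nN: "u \<le> 1 / 3" using n1 by (simp add: u_def)
    obtain E where E: "\<And>j. degree (E j) \<le> n - r" "\<And>x. x \<in> {-1..1} \<Longrightarrow> (\<Sum>j<N. poly (E j) x) = 1"
      "\<And>i j x. i < N \<Longrightarrow> j < N \<Longrightarrow> x \<in> cell N i \<Longrightarrow> \<bar>poly (E j) x\<bar> \<le> 2 * (B / (1 + \<bar>real i - real j\<bar>)) ^ (2 * m)"
      using partition_of_unity[OF r n m1 N2(2) NK K0] unfolding B_def by blast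
    define G where "G x = pint p {0..t} (\<lambda>h. sym_diff r (h * phi x) f x)" for x
    have [measurable]: "G \<in> borel_measurable borel" unfolding G_def by measurable
    define S where "S l = (\<integral>\<^sup>+x\<in>{-1..1}. G x * indicator {x. \<bar>arccos x - mid_angle N l\<bar> \<le> 3 * pi / real N} x \<partial>lborel)" for l
    define U where "U l = ennreal (C1 * real N) * S l" for l
    have "\<exists>q. (\<forall>l. degree (q l) < r) \<and>
       cell_control p N f q U"
      using C1(2)[rule_format, OF N2(1) f fin tN] unfolding U_def S_def G_def .
    then obtain q where q: "\<And>l. degree (q l) < r"
      "\<And>i. i < N \<Longrightarrow> pint p (cell N i) (\<lambda>x. f x - poly (q i) x) \<le> U i"
      "\<And>l k. Suc l < N \<Longrightarrow> k = l \<or> k = Suc l \<Longrightarrow>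
          pint p (cell N (Suc l)) (\<lambda>x. poly (q (Suc l)) x - poly (q l) x) \<le> 2 * U k" by blast
    define T where "T i j = pint p (cell N i) (\<lambda>x. f x - poly (q j) x)" for i j
    have T: "T i j \<le> (\<Sum>l\<in>{min i j..max i j}. ennreal (k0 * (1 + \<bar>real i - real l\<bar>) ^ \<kappa>) * U l)"
      if "i < N" "j < N" for i j
      using cell_telescope[OF p r q(1) f q(2,3) that] unfolding T_def k0_def \<kappa>_def .
    \<comment> \<open>The factor \<open>k2\<close> makes this an upper bound for \<open>W\<close> on
      the whole cell; comparing the midpoint with the points of a window costs a second factor
      \<open>k2\<close>.\<close>
    define Wl where "Wl l = k2 * W (cos (mid_angle N l))" for l
    have Wl0: "0 \<le> Wl l" for l using k20 W0 by (simp add: Wl_def)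
    have Wl_slow: "Wl i \<le> c * (1 + \<bar>real i - real l\<bar>) ^ s * Wl l" if "i < N" "l < N" for i l
    proof -
      have "real n * \<bar>mid_angle N i - mid_angle N l\<bar> = \<bar>real i - real l\<bar> * u"
        unfolding mid_angle_diff u_def by simp
      also have "\<dots> \<le> \<bar>real i - real l\<bar> * 1" using nN by (intro mult_left_mono) auto
      finally have "W (cos (mid_angle N i)) \<le> c * (1 + \<bar>real i - real l\<bar>) ^ s * W (cos (mid_angle N l))"
        using slow_weight_near[OF slow c mid_angle_mem[OF that(1)] mid_angle_mem[OF that(2)]] by simp
      from mult_left_mono[OF this k20] show ?thesis by (simp add: Wl_def mult_ac)
    qed
    have cellW: "W x \<le> Wl i" if i: "i < N" and x: "x \<in> cell N i" for i x
    proof -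
      note a = cell_angle[OF that]
      have "real n * \<bar>arccos x - mid_angle N i\<bar> \<le> real n * (pi / (2 * real N))" using a(1) by (intro mult_left_mono) auto
      also have "\<dots> = u / 2" by (simp add: u_def)
      also have "\<dots> \<le> 1" using nN by linarith
      finally have "W (cos (arccos x)) \<le> c * (1 + 1) ^ s * W (cos (mid_angle N i))"
        by (rule slow_weight_near[OF slow c a(3) mid_angle_mem[OF i]])
      then show ?thesis unfolding a(2) Wl_def k2_def by simp
    qed
    have windowW: "Wl l \<le> (k2 * k2) * W x"
      if l: "l < N" and x: "x \<in> {-1..1}" "\<bar>arccos x - mid_angle N l\<bar> \<le> 3 * pi / real N" for l x
    proof -
      have a: "cos (arccos x) = x" "arccos x \<in> {0..pi}" using x(1) by (auto simp: arccos_lbound arccos_ubound)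
      have "real n * \<bar>mid_angle N l - arccos x\<bar> \<le> real n * (3 * pi / real N)"
        using x(2) by (intro mult_left_mono) (auto simp: abs_minus_commute)
      also have "\<dots> = 3 * u" by (simp add: u_def)
      also have "\<dots> \<le> 1" using nN by linarith
      finally have "W (cos (mid_angle N l)) \<le> c * (1 + 1) ^ s * W (cos (arccos x))"
        by (rule slow_weight_near[OF slow c mid_angle_mem[OF l] a(2)])
      then have "W (cos (mid_angle N l)) \<le> k2 * W x" unfolding a(1) k2_def by simp
      from mult_left_mono[OF this k20] show ?thesis by (simp add: Wl_def mult.assoc)
    qed
    define P where "P = (\<Sum>j<N. E j * q j)"
    show "\<exists>P. degree P < n \<and> wint p W (\<lambda>x. f x - poly P x) \<le>
      ennreal (C * real n) * (\<integral>\<^sup>+h\<in>{0..A / real n}. step_wint r p W f h \<partial>lborel)"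
    proof (intro exI[of _ P] conjI)
      have "degree P \<le> n - 1" unfolding P_def
      proof (rule degree_sum_le)
        fix j
        have "degree (E j * q j) \<le> degree (E j) + degree (q j)" by (rule degree_mult_le)
        also have "\<dots> \<le> n - 1" using E(1)[of j] q(1)[of j] n by linarith
        finally show "degree (E j * q j) \<le> n - 1" .
      qed simp
      then show "degree P < n" using n r by linarith
      have cell1: "cell N i \<subseteq> {-1..1}" for i by (auto intro: order_trans[OF cos_ge_minus_one] order_trans[OF _ cos_le_one])
      have pointwise: "pw p (f x - poly P x) * ennreal (W x) \<le>
          (\<Sum>j<N. ennreal (G1 / (1 + \<bar>real i - real j\<bar>) ^ M) * (ennreal (Wl i) * pw p (f x - poly (q j) x)))"
        if i: "i < N" and x: "x \<in> cell N i" for i x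
      proof -
        have "f x - poly P x = (\<Sum>j<N. poly (E j) x * (f x - poly (q j) x))"
          using E(2)[OF subsetD[OF cell1 x]] by (simp add: P_def poly_sum right_diff_distrib sum_subtractf sum_distrib_right[symmetric])
        then have "pw p (f x - poly P x) \<le> (\<Sum>j<N. pw p (poly (E j) x * (f x - poly (q j) x)))"
          using pw_sum[OF p] by simp
        also have "\<dots> \<le> (\<Sum>j<N. ennreal (G1 / (1 + \<bar>real i - real j\<bar>) ^ M) * pw p (f x - poly (q j) x))"
          unfolding pw_mult G1_def
          by (intro sum_mono mult_right_mono pw_localized_le[OF p(1) B0 _ mp] E(3) i x) auto
        finally have "pw p (f x - poly P x) * ennreal (W x) \<le>
          (\<Sum>j<N. ennreal (G1 / (1 + \<bar>real i - real j\<bar>) ^ M) * pw p (f x - poly (q j) x)) * ennreal (Wl i)"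
          using cellW[OF that] by (intro mult_mono ennreal_leI) auto
        then show ?thesis by (simp only: sum_distrib_left sum_distrib_right mult_ac)
      qed
      have "wint p W (\<lambda>x. f x - poly P x) \<le> (\<integral>\<^sup>+x\<in>(\<Union>i\<in>{..<N}. cell N i). pw p (f x - poly P x) * ennreal (W x) \<partial>lborel)"
        unfolding wint_def using cells_cover[OF N2(3)] by (intro set_nn_integral_mono_set) auto
      also have "\<dots> \<le> (\<Sum>i<N. \<integral>\<^sup>+x\<in>cell N i. pw p (f x - poly P x) * ennreal (W x) \<partial>lborel)"
        by (rule set_nn_integral_UN_le) auto
      also have "\<dots> \<le> (\<Sum>i<N. \<integral>\<^sup>+x\<in>cell N i. (\<Sum>j<N. ennreal (G1 / (1 + \<bar>real i - real j\<bar>) ^ M) * (ennreal (Wl i) * pw p (f x - poly (q j) x))) \<partial>lborel)"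
        using pointwise by (intro sum_mono set_nn_integral_mono_set) auto
      also have "\<dots> = (\<Sum>i<N. \<Sum>j<N. ennreal (G1 / (1 + \<bar>real i - real j\<bar>) ^ M) * (ennreal (Wl i) * T i j))"
      proof (intro sum.cong refl)
        fix i
        have "(\<integral>\<^sup>+x\<in>cell N i. (\<Sum>j<N. ennreal (G1 / (1 + \<bar>real i - real j\<bar>) ^ M) * (ennreal (Wl i) * pw p (f x - poly (q j) x))) \<partial>lborel) =
          (\<Sum>j<N. \<integral>\<^sup>+x\<in>cell N i. ennreal (G1 / (1 + \<bar>real i - real j\<bar>) ^ M) * (ennreal (Wl i) * pw p (f x - poly (q j) x)) \<partial>lborel)"
          by (rule set_nn_integral_sum) auto
        also have "\<dots> = (\<Sum>j<N. ennreal (G1 / (1 + \<bar>real i - real j\<bar>) ^ M) * (ennreal (Wl i) * T i j))"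
          unfolding T_def by (simp add: set_nn_integral_cmult)
        finally show "(\<integral>\<^sup>+x\<in>cell N i. (\<Sum>j<N. ennreal (G1 / (1 + \<bar>real i - real j\<bar>) ^ M) * (ennreal (Wl i) * pw p (f x - poly (q j) x))) \<partial>lborel) =
          (\<Sum>j<N. ennreal (G1 / (1 + \<bar>real i - real j\<bar>) ^ M) * (ennreal (Wl i) * T i j))" .
      qed
      also have "\<dots> \<le> ennreal (16 * G1 * k0 * c) * (\<Sum>l<N. ennreal (Wl l) * U l)"
        unfolding M_def by (rule weighted_cell_sum[OF k00 G10 c Wl0 Wl_slow T])
      also have "\<dots> = ennreal (16 * G1 * k0 * c) * (ennreal (C1 * real N) * (\<Sum>l<N. ennreal (Wl l) * S l))"
        by (simp only: U_def sum_distrib_left mult_ac)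
      also have "\<dots> \<le> ennreal (16 * G1 * k0 * c) * (ennreal (C1 * K * real n) * (ennreal (7 * (k2 * k2)) * (\<integral>\<^sup>+x\<in>{-1..1}. ennreal (W x) * G x \<partial>lborel)))"
      proof (rule mult_left_mono[OF mult_mono])
        show "ennreal (C1 * real N) \<le> ennreal (C1 * K * real n)"
          using mult_left_mono[OF NK C1(1)] by (intro ennreal_leI) (simp add: mult.assoc)
        show "(\<Sum>l<N. ennreal (Wl l) * S l) \<le> ennreal (7 * (k2 * k2)) * (\<integral>\<^sup>+x\<in>{-1..1}. ennreal (W x) * G x \<partial>lborel)"
          unfolding S_def using k20 by (intro window_sum_le N2(3) windowW) auto
      qed auto
      also have "(\<integral>\<^sup>+x\<in>{-1..1}. ennreal (W x) * G x \<partial>lborel) = (\<integral>\<^sup>+h\<in>{0..t}. step_wint r p W f h \<partial>lborel)"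
      proof -
        have "(\<integral>\<^sup>+x\<in>{-1..1}. ennreal (W x) * G x \<partial>lborel) =
          (\<integral>\<^sup>+x\<in>{-1..1}. (\<integral>\<^sup>+h\<in>{0..t}. pw p (sym_diff r (h * phi x) f x) * ennreal (W x) \<partial>lborel) \<partial>lborel)"
        proof -
          have "ennreal (W x) * G x = (\<integral>\<^sup>+h\<in>{0..t}. pw p (sym_diff r (h * phi x) f x) * ennreal (W x) \<partial>lborel)" for x
            unfolding G_def by (subst set_nn_integral_multc) (auto simp: mult.commute)
          then show ?thesis by simp
        qed
        also have "\<dots> = (\<integral>\<^sup>+h\<in>{0..t}. step_wint r p W f h \<partial>lborel)"
          unfolding wint_def by (rule set_nn_integral_swap) auto
        finally show ?thesis .
      qed
      also have "ennreal (16 * G1 * k0 * c) * (ennreal (C1 * K * real n) * (ennreal (7 * (k2 * k2)) * (\<integral>\<^sup>+h\<in>{0..t}. step_wint r p W f h \<partial>lborel))) =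
        ennreal (C * real n) * (\<integral>\<^sup>+h\<in>{0..t}. step_wint r p W f h \<partial>lborel)"
      proof -
        have "ennreal (16 * G1 * k0 * c) * (ennreal (C1 * K * real n) * ennreal (7 * (k2 * k2))) =
          ennreal ((16 * G1 * k0 * c) * ((C1 * K * real n) * (7 * (k2 * k2))))"
          using G10 k00 c C1(1) K0 k20 by (simp only: ennreal_mult mult_nonneg_nonneg of_nat_0_le_iff zero_le_numeral)
        also have "(16 * G1 * k0 * c) * ((C1 * K * real n) * (7 * (k2 * k2))) = C * real n" by (simp add: C_def)
        finally show ?thesis by (simp only: mult.assoc[symmetric])
      qed
      finally show "wint p W (\<lambda>x. f x - poly P x) \<le>
        ennreal (C * real n) * (\<integral>\<^sup>+h\<in>{0..A / real n}. step_wint r p W f h \<partial>lborel)" unfolding t_def .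
    qed
  qed
qed

subsection \<open>The cycle of inequalities\<close>

text \<open>Counterpart of \<open>Lp_norm\<close> for Borel functions. An infinite integral would
  yield 0, so to compare two norms the larger integral must be known to be finite.\<close>

definition wnorm :: "real \<Rightarrow> (real \<Rightarrow> real) \<Rightarrow> (real \<Rightarrow> real) \<Rightarrow> real" where
  "wnorm p W F = enn2real (wint p W F) powr (1 / p)"

lemma wnorm_nonneg [simp]: "0 \<le> wnorm p W F"
  by (simp add: wnorm_def)

lemma wnorm_powr: "0 < p \<Longrightarrow> wnorm p W F powr p = enn2real (wint p W F)"
  by (simp add: wnorm_def powr_powr)

lemma wint_add_le:
  assumes p: "0 < p" "p \<le> 1" and [measurable]: "F \<in> borel_measurable borel" "G \<in> borel_measurable borel" "W \<in> borel_measurable borel"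
  shows "wint p W (\<lambda>x. F x + G x) \<le> wint p W F + wint p W G"
proof -
  have "wint p W (\<lambda>x. F x + G x) \<le> (\<integral>\<^sup>+x\<in>{-1..1}. (pw p (F x) * ennreal (W x) + pw p (G x) * ennreal (W x)) \<partial>lborel)"
    unfolding wint_def
  proof (rule set_nn_integral_mono_set[OF order_refl])
    fix x show "pw p (F x + G x) * ennreal (W x) \<le> pw p (F x) * ennreal (W x) + pw p (G x) * ennreal (W x)"
      unfolding distrib_right[symmetric] by (intro mult_right_mono pw_add p) auto
  qed
  also have "\<dots> = wint p W F + wint p W G" unfolding wint_def by (rule set_nn_integral_add) auto
  finally show ?thesis .
qed

lemma wint_mono: "0 \<le> p \<Longrightarrow> (\<And>x. x \<in> {-1..1} \<Longrightarrow> \<bar>F x\<bar> \<le> \<bar>G x\<bar>) \<Longrightarrow> wint p W F \<le> wint p W G"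
  unfolding wint_def by (intro set_nn_integral_mono_set mult_right_mono pw_mono) auto

lemma slow_weight_bounded:
  assumes "slow_cos n c s W" "0 \<le> c"
  obtains K where "0 \<le> K" "\<And>x. x \<in> {-1..1} \<Longrightarrow> W x \<le> K"
proof
  define K where "K = c * (1 + real n * pi) ^ s * W (cos 0)"
  show "0 \<le> K" using assms slow_weightD(2)[OF assms(1), of 0] unfolding K_def by (intro mult_nonneg_nonneg) auto
  fix x :: real assume x: "x \<in> {-1..1}"
  then have a: "arccos x \<in> {0..pi}" "cos (arccos x) = x" by (auto simp: arccos_lbound arccos_ubound)
  have "W (cos (arccos x)) \<le> K" unfolding K_def
    using a by (intro slow_weight_near[OF assms a(1)] mult_left_mono) auto
  then show "W x \<le> K" using a by simp
qed

text \<open>For fixed n a slowly varying weight is bounded, so unweighted integrability suffices.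
  The bound depends on n, which does no harm since only finiteness is drawn from it.\<close>

lemma wint_finite:
  assumes "slow_cos n c s W" "0 \<le> c" and [measurable]: "F \<in> borel_measurable borel"
    and F: "pint p {-1..1} F < \<infinity>"
  shows "wint p W F < \<infinity>"
proof -
  obtain K where K: "0 \<le> K" "\<And>x. x \<in> {-1..1} \<Longrightarrow> W x \<le> K" using slow_weight_bounded[OF assms(1,2)] by blast
  have "wint p W F \<le> (\<integral>\<^sup>+x\<in>{-1..1}. pw p (F x) * ennreal K \<partial>lborel)"
    unfolding wint_def using K by (intro set_nn_integral_mono_set mult_left_mono ennreal_leI) auto
  also have "\<dots> = pint p {-1..1} F * ennreal K" by (rule set_nn_integral_multc) auto
  also have "\<dots> < \<infinity>" using F by (simp add: ennreal_mult_less_top)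
  finally show ?thesis .
qed

lemma continuous_pw_integral_finite:
  fixes F :: "real \<Rightarrow> real"
  assumes "continuous_on {-1..1} F" "0 < p"
  shows "pint p {-1..1} F < \<infinity>"
proof -
  have "compact (F ` {-1..1})" using assms by (intro compact_continuous_image) auto
  then have "bounded (F ` {-1..1})" by (rule compact_imp_bounded)
  then obtain B where B: "\<forall>y\<in>F ` {-1..1}. norm y \<le> B" unfolding bounded_iff ..
  have "pint p {-1..1} F \<le> (\<integral>\<^sup>+x\<in>{-1..1::real}. pw p B \<partial>lborel)"
  proof (rule set_nn_integral_mono_set[OF order_refl])
    fix x :: real assume "x \<in> {-1..1}"
    then have "\<bar>F x\<bar> \<le> B" using B by auto
    then show "pw p (F x) \<le> pw p B" using assms(2) by (intro pw_mono) linarith+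
  qed
  also have "\<dots> < \<infinity>" using pw_less_top(1)[of p B] by (simp add: nn_integral_cmult_indicator ennreal_mult_less_top)
  finally show ?thesis .
qed

lemma sym_diff_add: "sym_diff r h (\<lambda>x. f x + g x) x = sym_diff r h f x + sym_diff r h g x"
  by (simp add: sym_diff_def distrib_left sum.distrib)

lemma sym_diff_uminus: "sym_diff r h (\<lambda>x. - f x) x = - sym_diff r h f x"
  by (simp add: sym_diff_def sum_negf)

lemma wint_uminus: "wint p W (\<lambda>x. - F x) = wint p W F"
  by (simp add: wint_def)

text \<open>The quasi-triangle inequality: p-th powers add exactly, and taking the root of order 1 /
  p costs the factor 2^(1/p).\<close>

lemma root_le_sum:
  fixes x y z p C :: real
  assumes "0 < p" "0 \<le> x" "0 \<le> y" "0 \<le> C" "0 \<le> z" "z \<le> C * (x powr p + y powr p)"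
  shows "z powr (1 / p) \<le> (2 * C) powr (1 / p) * (x + y)"
proof -
  have "C * (x powr p + y powr p) \<le> C * ((x + y) powr p + (x + y) powr p)"
    by (rule mult_left_mono[OF add_mono]; (rule powr_mono2)?) (use assms in auto)
  then have "z \<le> (2 * C) * (x + y) powr p" using assms(6) by simp
  then have "z powr (1 / p) \<le> ((2 * C) * (x + y) powr p) powr (1 / p)" using assms by (intro powr_mono2) auto
  also have "\<dots> = (2 * C) powr (1 / p) * (x + y)" using assms by (simp add: powr_mult powr_powr)
  finally show ?thesis .
qed

lemma enn2real_le_lincomb:
  assumes "x \<le> ennreal a * y + ennreal b * z" "y < \<infinity>" "z < \<infinity>" "0 \<le> a" "0 \<le> b"
  shows "enn2real x \<le> a * enn2real y + b * enn2real z"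
proof -
  obtain y' z' where y: "y = ennreal y'" "0 \<le> y'" and z: "z = ennreal z'" "0 \<le> z'"
    using assms(2,3) by (cases y; cases z) auto
  have "x \<le> ennreal (a * y' + b * z')"
    using assms(1,4,5) y z by (simp only: ennreal_mult ennreal_plus mult_nonneg_nonneg)
  then show ?thesis using assms(4,5) y z by (intro enn2real_leI) auto
qed

definition avg_norm :: "nat \<Rightarrow> real \<Rightarrow> (real \<Rightarrow> real) \<Rightarrow> (real \<Rightarrow> real) \<Rightarrow> real \<Rightarrow> real" where
  "avg_norm r p W f t = (1 / t * enn2real (\<integral>\<^sup>+h\<in>{0..t}. step_wint r p W f h \<partial>lborel)) powr (1 / p)"

lemma measurable_step_wint [measurable]:
  assumes [measurable]: "f \<in> borel_measurable borel" "W \<in> borel_measurable borel"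
  shows "step_wint r p W f \<in> borel_measurable borel"
  unfolding wint_def by measurable

lemma avg_norm_powr: "0 < p \<Longrightarrow> 0 < t \<Longrightarrow>
    avg_norm r p W f t powr p = enn2real (\<integral>\<^sup>+h\<in>{0..t}. step_wint r p W f h \<partial>lborel) / t"
  by (simp add: avg_norm_def powr_powr)

abbreviation deriv_norm :: "nat \<Rightarrow> real \<Rightarrow> (real \<Rightarrow> real) \<Rightarrow> real poly \<Rightarrow> real" where
  "deriv_norm r p W P \<equiv> wnorm p W (\<lambda>x. phi x ^ r * poly ((pderiv ^^ r) P) x)"

lemma step_wint_split:
  assumes p: "0 < p" "p \<le> 1" and [measurable]: "f \<in> borel_measurable borel" "g \<in> borel_measurable borel" "W \<in> borel_measurable borel"
  shows "step_wint r p W f h \<le> step_wint r p W (\<lambda>x. f x - g x) h + step_wint r p W g h"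
proof -
  have "sym_diff r k f x = sym_diff r k (\<lambda>x. f x - g x) x + sym_diff r k g x" for k x
    using sym_diff_add[of r k "\<lambda>x. f x - g x" g x] by simp
  then show ?thesis using wint_add_le[OF p] by simp
qed

lemma step_wint_split':
  assumes p: "0 < p" "p \<le> 1" and [measurable]: "f \<in> borel_measurable borel" "g \<in> borel_measurable borel" "W \<in> borel_measurable borel"
  shows "step_wint r p W g h \<le> step_wint r p W f h + step_wint r p W (\<lambda>x. f x - g x) h"
proof -
  have "sym_diff r k g x = sym_diff r k f x + - sym_diff r k (\<lambda>x. f x - g x) x" for k x
    using sym_diff_add[of r k f "\<lambda>x. - (f x - g x)" x] sym_diff_uminus[of r k "\<lambda>x. f x - g x" x] by simp
  then have "step_wint r p W g h = wint p W (\<lambda>x. sym_diff r (h * phi x) f x + - sym_diff r (h * phi x) (\<lambda>x. f x - g x) x)"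
    by simp
  also have "\<dots> \<le> step_wint r p W f h + wint p W (\<lambda>x. - sym_diff r (h * phi x) (\<lambda>x. f x - g x) x)"
    by (rule wint_add_le[OF p]) auto
  finally show ?thesis unfolding wint_uminus .
qed

context
  fixes p c :: real and r s :: nat
  assumes p: "0 < p" "p \<le> 1" and r: "1 \<le> r" and c: "0 \<le> c"
begin

text \<open>The parameters p, r, c, s are fixed by the context, so constants chosen before n, W and
  f depend on these parameters only.\<close>

definition admissible :: "nat \<Rightarrow> (real \<Rightarrow> real) \<Rightarrow> (real \<Rightarrow> real) \<Rightarrow> bool" where
  "admissible n W f \<longleftrightarrow> r \<le> n \<and> f \<in> borel_measurable borel \<and> pint p {-1..1} f < \<infinity> \<and>
     W \<in> borel_measurable borel \<and> (\<forall>x. 0 \<le> W x) \<and> slow_cos n c s W"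

lemma admissibleD:
  assumes "admissible n W f"
  shows "r \<le> n" "1 \<le> n" "f \<in> borel_measurable borel" "pint p {-1..1} f < \<infinity>"
    "W \<in> borel_measurable borel" "\<forall>x. 0 \<le> W x" "slow_cos n c s W"
  using assms r unfolding admissible_def by auto

lemma wint_minus_poly_finite:
  assumes "admissible n W f"
  shows "wint p W (\<lambda>x. f x - poly P x) < \<infinity>"
proof -
  note a = admissibleD[OF assms]
  note [measurable] = a(3,5)
  have "wint p W (\<lambda>x. f x - poly P x) \<le> wint p W f + wint p W (\<lambda>x. - poly P x)"
    using wint_add_le[OF p, of f "\<lambda>x. - poly P x" W] by simp
  also have "\<dots> < \<infinity>"
    unfolding wint_uminus using wint_finite[OF a(7) c a(3,4)] wint_finite[OF a(7) c _ continuous_pw_integral_finite[OF _ p(1)], of "poly P"]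
    by (simp add: continuous_on_poly continuous_on_id)
  finally show ?thesis .
qed

lemma wint_weighted_poly_finite:
  assumes "admissible n W f"
  shows "phi_wint r p W P < \<infinity>" "wint p W (\<lambda>x. phi_n n x ^ r * poly P x) < \<infinity>"
proof -
  note a = admissibleD[OF assms]
  have m[measurable]: "phi_n n \<in> borel_measurable borel" unfolding phi_n_def[abs_def] by measurable
  have c1: "continuous_on {-1..1} phi" unfolding phi_def[abs_def] by (intro continuous_intros)
  then have c2: "continuous_on {-1..1} (phi_n n)" unfolding phi_n_def[abs_def] by (intro continuous_intros)
  show "phi_wint r p W P < \<infinity>"
    using c1 by (intro wint_finite[OF a(7) c _ continuous_pw_integral_finite[OF _ p(1)]] continuous_intros) auto
  show "wint p W (\<lambda>x. phi_n n x ^ r * poly P x) < \<infinity>"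
    using c2 by (intro wint_finite[OF a(7) c _ continuous_pw_integral_finite[OF _ p(1)]] continuous_intros) auto
qed

text \<open>The last bound splits \<open>f\<close> into f - P and P: differences of the first are
  bounded by the function itself, those of the second by its \<open>r\<close>-th derivative.\<close>

lemma step_bounds:
  "\<exists>C\<ge>0. \<forall>n W f h. admissible n W f \<longrightarrow> 0 < h \<longrightarrow> h \<le> 1 / real n \<longrightarrow>
     step_wint r p W f h \<le> ennreal C * wint p W f \<and>
     (\<forall>P. step_wint r p W (\<lambda>x. f x - poly P x) h \<le> ennreal C * wint p W (\<lambda>x. f x - poly P x)) \<and>
     (\<forall>P. degree P < n \<longrightarrow> wnorm p W (\<lambda>x. sym_diff r (h * phi x) f x) \<le>
        C * (wnorm p W (\<lambda>x. f x - poly P x) + h ^ r * deriv_norm r p W P))"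
proof -
  obtain C where C: "C \<ge> 0" "\<forall>n\<ge>1. \<forall>g W h. g \<in> borel_measurable borel \<longrightarrow> W \<in> borel_measurable borel \<longrightarrow> (\<forall>x. 0 \<le> W x) \<longrightarrow>
     slow_cos n c s W \<longrightarrow> 0 < h \<longrightarrow> h \<le> 1 / real n \<longrightarrow>
     wint p W (\<lambda>x. sym_diff r (h * phi x) g x) \<le> ennreal C * wint p W g"
    using wint_sym_diff_le[OF p r c] by blast
  obtain D where D: "D \<ge> 0" "\<forall>n\<ge>1. \<forall>P W h. degree P < n \<longrightarrow> W \<in> borel_measurable borel \<longrightarrow> (\<forall>x. 0 \<le> W x) \<longrightarrow>
     slow_cos n c s W \<longrightarrow> 0 < h \<longrightarrow> h \<le> 1 / real n \<longrightarrow>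
     wint p W (\<lambda>x. sym_diff r (h * phi x) (poly P) x) \<le>
       ennreal (D * (h ^ r) powr p) * phi_wint r p W ((pderiv ^^ r) P)"
    using poly_sym_diff_le[OF p c] by blast
  define E where "E = max C ((2 * max C D) powr (1 / p))"
  have E: "0 \<le> E" "C \<le> E" "(2 * max C D) powr (1 / p) \<le> E" using C(1) by (auto simp: E_def le_max_iff_disj)
  show ?thesis
  proof (intro exI[of _ E] conjI E(1) allI impI)
    fix n W f h assume adm: "admissible n W f" and h: "0 < h" "h \<le> 1 / real n"
    note a = admissibleD[OF adm]
    note [measurable] = a(3,5)
    have "step_wint r p W f h \<le> ennreal C * wint p W f"
      using C(2) a h by blast
    also have "\<dots> \<le> ennreal E * wint p W f" using E by (intro mult_right_mono ennreal_leI) auto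
    finally show "step_wint r p W f h \<le> ennreal E * wint p W f" .
    have s1: "step_wint r p W (\<lambda>x. f x - poly P x) h \<le> ennreal C * wint p W (\<lambda>x. f x - poly P x)" for P
      using a h by (intro C(2)[rule_format]) auto
    also have "\<dots> P \<le> ennreal E * wint p W (\<lambda>x. f x - poly P x)" for P using E by (intro mult_right_mono ennreal_leI) auto
    finally show "step_wint r p W (\<lambda>x. f x - poly P x) h \<le> ennreal E * wint p W (\<lambda>x. f x - poly P x)" for P .
    fix P :: "real poly" assume P: "degree P < n"
    define X1 where "X1 = wint p W (\<lambda>x. f x - poly P x)"
    define X2 where "X2 = phi_wint r p W ((pderiv ^^ r) P)"
    have fin: "X1 < \<infinity>" "X2 < \<infinity>" unfolding X1_def X2_def
      using wint_minus_poly_finite[OF adm] wint_weighted_poly_finite(1)[OF adm] by auto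
    have "step_wint r p W f h \<le> step_wint r p W (\<lambda>x. f x - poly P x) h + step_wint r p W (poly P) h"
      by (rule step_wint_split[OF p]) auto
    also have "\<dots> \<le> ennreal C * X1 + ennreal (D * (h ^ r) powr p) * X2"
      using s1[of P] D(2)[rule_format, OF a(2) P a(5) _ a(7) h] a(6) unfolding X1_def X2_def by (intro add_mono) auto
    finally have "enn2real (step_wint r p W f h) \<le> C * enn2real X1 + (D * (h ^ r) powr p) * enn2real X2"
      using fin C(1) D(1) by (intro enn2real_le_lincomb) auto
    also have "\<dots> \<le> max C D * enn2real X1 + max C D * ((h ^ r) powr p * enn2real X2)"
      unfolding mult.assoc by (intro add_mono mult_right_mono) auto
    also have "\<dots> = max C D * (wnorm p W (\<lambda>x. f x - poly P x) powr p + (h ^ r * deriv_norm r p W P) powr p)"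
      using h p by (simp add: powr_mult wnorm_powr X1_def X2_def distrib_left)
    finally have "wnorm p W (\<lambda>x. sym_diff r (h * phi x) f x) \<le>
        (2 * max C D) powr (1 / p) * (wnorm p W (\<lambda>x. f x - poly P x) + h ^ r * deriv_norm r p W P)"
      unfolding wnorm_def[of p W "\<lambda>x. sym_diff r (h * phi x) f x"]
      using h p C(1) by (intro root_le_sum) auto
    also have "\<dots> \<le> E * (wnorm p W (\<lambda>x. f x - poly P x) + h ^ r * deriv_norm r p W P)"
      using E h by (intro mult_right_mono) auto
    finally show "wnorm p W (\<lambda>x. sym_diff r (h * phi x) f x) \<le>
        E * (wnorm p W (\<lambda>x. f x - poly P x) + h ^ r * deriv_norm r p W P)" .
  qed
qed

lemma deriv_norm_phi_n:
  "\<exists>C\<ge>0. \<forall>n W f P. admissible n W f \<longrightarrow> degree P < n \<longrightarrow>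
     wnorm p W (\<lambda>x. phi_n n x ^ r * poly ((pderiv ^^ r) P) x) \<le> C * deriv_norm r p W P"
proof -
  obtain C where C: "C \<ge> 0" "\<forall>n\<ge>1. \<forall>Q W. degree Q < n \<longrightarrow> W \<in> borel_measurable borel \<longrightarrow> (\<forall>x. 0 \<le> W x) \<longrightarrow>
     slow_cos n c s W \<longrightarrow>
     wint p W (\<lambda>x. phi_n n x ^ r * poly Q x) \<le> ennreal C * phi_wint r p W Q"
    using realization_weight_change[OF p c] by blast
  show ?thesis
  proof (intro exI[of _ "C powr (1 / p)"] conjI allI impI)
    fix n W f and P :: "real poly" assume adm: "admissible n W f" and P: "degree P < n"
    note a = admissibleD[OF adm]
    define Q where "Q = (pderiv ^^ r) P"
    have "degree Q < n" using degree_pderiv_pow_le[of r P] P unfolding Q_def by linarith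
    then have "wint p W (\<lambda>x. phi_n n x ^ r * poly Q x) \<le> ennreal C * phi_wint r p W Q + ennreal 0 * 0"
      using C(2) a by simp
    then have "enn2real (wint p W (\<lambda>x. phi_n n x ^ r * poly Q x)) \<le> C * enn2real (phi_wint r p W Q) + 0 * enn2real 0"
      using wint_weighted_poly_finite(1)[OF adm] C(1) by (intro enn2real_le_lincomb) auto
    then have "enn2real (wint p W (\<lambda>x. phi_n n x ^ r * poly Q x)) powr (1 / p) \<le> (C * enn2real (phi_wint r p W Q)) powr (1 / p)"
      using p by (intro powr_mono2) auto
    then show "wnorm p W (\<lambda>x. phi_n n x ^ r * poly ((pderiv ^^ r) P) x) \<le> C powr (1 / p) * deriv_norm r p W P"
      using C(1) unfolding wnorm_def Q_def by (simp add: powr_mult)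
  qed simp
qed

lemma avg_finite:
  assumes adm: "admissible n W f" and t: "0 < t" "t \<le> 1 / real n"
  shows "(\<integral>\<^sup>+h\<in>{0..t}. step_wint r p W f h \<partial>lborel) < \<infinity>"
    "\<exists>B\<ge>0. \<forall>h. 0 < h \<longrightarrow> h \<le> t \<longrightarrow> step_wint r p W f h \<le> ennreal B"
proof -
  note a = admissibleD[OF adm]
  note [measurable] = a(3,5)
  obtain C where C: "C \<ge> 0" "\<And>h. 0 < h \<Longrightarrow> h \<le> 1 / real n \<Longrightarrow> step_wint r p W f h \<le> ennreal C * wint p W f"
    using step_bounds adm by blast
  have "wint p W f < \<infinity>" by (rule wint_finite[OF a(7) c a(3,4)])
  then have w: "wint p W f = ennreal (enn2real (wint p W f))" by simp
  define B where "B = C * enn2real (wint p W f)"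
  have B: "0 \<le> B" "\<And>h. 0 < h \<Longrightarrow> h \<le> t \<Longrightarrow> step_wint r p W f h \<le> ennreal B"
  proof -
    show "0 \<le> B" using C(1) by (simp add: B_def)
    show "step_wint r p W f h \<le> ennreal B" if "0 < h" "h \<le> t" for h
      using C(2)[of h] that t(2) C(1) w unfolding B_def by (simp add: ennreal_mult)
  qed
  then show "\<exists>B\<ge>0. \<forall>h. 0 < h \<longrightarrow> h \<le> t \<longrightarrow> step_wint r p W f h \<le> ennreal B" by blast
  have "(\<integral>\<^sup>+h\<in>{0..t}. step_wint r p W f h \<partial>lborel) \<le> (\<integral>\<^sup>+h\<in>{0..t}. ennreal B \<partial>lborel)"
  proof (rule nn_integral_mono_AE)
    have "AE h in lborel. h \<noteq> (0::real)" by (rule AE_lborel_singleton)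
    then show "AE h in lborel. step_wint r p W f h * indicator {0..t} h \<le> ennreal B * indicator {0..t} h"
    proof (rule AE_mp, intro AE_I2 impI)
      fix h :: real assume "h \<noteq> 0"
      then show "step_wint r p W f h * indicator {0..t} h \<le> ennreal B * indicator {0..t} h"
        using B(2)[of h] by (auto simp: indicator_def)
    qed
  qed
  also have "\<dots> < \<infinity>" using t by (simp add: nn_integral_cmult_indicator ennreal_mult_less_top)
  finally show "(\<integral>\<^sup>+h\<in>{0..t}. step_wint r p W f h \<partial>lborel) < \<infinity>" .
qed

text \<open>The lower bound on t lets the range of steps grow from A / n to t, and n t <= 1 turns
  the factor n of Jackson's inequality into the 1 / t of an average.\<close>

lemma jackson_avg:
  assumes A: "0 < A" "A \<le> 1"
  shows "\<exists>C\<ge>0. \<forall>n W f t. admissible n W f \<longrightarrow> A / real n \<le> t \<longrightarrow> t \<le> 1 / real n \<longrightarrow>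
    (\<exists>P. degree P < n \<and> wnorm p W (\<lambda>x. f x - poly P x) \<le> C * avg_norm r p W f t)"
proof -
  obtain C where C: "C \<ge> 0" "\<forall>n f W. r \<le> n \<longrightarrow> f \<in> borel_measurable borel \<longrightarrow> pint p {-1..1} f < \<infinity> \<longrightarrow>
    W \<in> borel_measurable borel \<longrightarrow> (\<forall>x. 0 \<le> W x) \<longrightarrow> slow_cos n c s W \<longrightarrow>
    (\<exists>P. degree P < n \<and> wint p W (\<lambda>x. f x - poly P x) \<le>
      ennreal (C * real n) * (\<integral>\<^sup>+h\<in>{0..A / real n}. wint p W (\<lambda>x. sym_diff r (h * phi x) f x) \<partial>lborel))"
    using jackson[OF p r c A] by blast
  show ?thesis
  proof (intro exI[of _ "C powr (1 / p)"] conjI allI impI)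
    fix n W f t assume adm: "admissible n W f" and t: "A / real n \<le> t" "t \<le> 1 / real n"
    note a = admissibleD[OF adm]
    have n0: "0 < real n" using a(2) by simp
    have t0: "0 < t" using A n0 by (intro less_le_trans[OF _ t(1)]) simp
    define J where "J = (\<integral>\<^sup>+h\<in>{0..t}. step_wint r p W f h \<partial>lborel)"
    have Jfin: "J < \<infinity>" unfolding J_def by (rule avg_finite(1)[OF adm t0 t(2)])
    obtain P where P: "degree P < n" "wint p W (\<lambda>x. f x - poly P x) \<le>
      ennreal (C * real n) * (\<integral>\<^sup>+h\<in>{0..A / real n}. wint p W (\<lambda>x. sym_diff r (h * phi x) f x) \<partial>lborel)"
      using C(2) a by blast
    note P(2)
    also have "\<dots> \<le> ennreal (C * real n) * J"
      unfolding J_def using t by (intro mult_left_mono set_nn_integral_mono_set) auto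
    finally have "enn2real (wint p W (\<lambda>x. f x - poly P x)) \<le> C * real n * enn2real J + 0 * enn2real 0"
      using Jfin C(1) by (intro enn2real_le_lincomb) auto
    also have "\<dots> = C * (real n * t) * (enn2real J / t)" using t0 by simp
    also have "\<dots> \<le> C * 1 * (enn2real J / t)"
      using t t0 n0 C(1) by (intro mult_right_mono mult_left_mono) (auto simp: field_simps)
    finally have "enn2real (wint p W (\<lambda>x. f x - poly P x)) powr (1 / p) \<le> (C * (enn2real J / t)) powr (1 / p)"
      using p by (intro powr_mono2) auto
    then have "wnorm p W (\<lambda>x. f x - poly P x) \<le> C powr (1 / p) * avg_norm r p W f t"
      using C(1) t0 unfolding wnorm_def avg_norm_def J_def[symmetric] by (simp add: powr_mult powr_divide)
    then show "\<exists>P. degree P < n \<and> wnorm p W (\<lambda>x. f x - poly P x) \<le> C powr (1 / p) * avg_norm r p W f t"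
      using P(1) by blast
  qed simp
qed

text \<open>The reverse estimate holds for every small step. Integrating it over [t / 2, t], where
  h^r is comparable with t^r, puts the average modulus on the right side.\<close>

lemma deriv_norm_le_avg:
  "\<exists>\<theta> C. 0 < \<theta> \<and> \<theta> \<le> 1 \<and> 0 \<le> C \<and> (\<forall>n W f t P. admissible n W f \<longrightarrow> 0 < t \<longrightarrow> t \<le> \<theta> / real n \<longrightarrow> degree P < n \<longrightarrow>
     t ^ r * deriv_norm r p W P \<le> C * (avg_norm r p W f t + wnorm p W (\<lambda>x. f x - poly P x)))"
proof -
  obtain C where C: "C \<ge> 0" "\<And>n W f h P. admissible n W f \<Longrightarrow> 0 < h \<Longrightarrow> h \<le> 1 / real n \<Longrightarrow>
     step_wint r p W (\<lambda>x. f x - poly P x) h \<le> ennreal C * wint p W (\<lambda>x. f x - poly P x)"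
    using step_bounds by blast
  obtain \<theta> D where \<theta>: "0 < \<theta>" "\<theta> \<le> 1" "0 \<le> D" "\<forall>n\<ge>1. \<forall>P W h. degree P < n \<longrightarrow> W \<in> borel_measurable borel \<longrightarrow> (\<forall>x. 0 \<le> W x) \<longrightarrow>
     slow_cos n c s W \<longrightarrow> 0 < h \<longrightarrow> h \<le> \<theta> / real n \<longrightarrow>
     ennreal ((h ^ r) powr p) * phi_wint r p W ((pderiv ^^ r) P) \<le>
       ennreal D * wint p W (\<lambda>x. sym_diff r (h * phi x) (poly P) x)"
    using poly_derivative_le_sym_diff[OF p c] by blast
  define E where "E = (2 ^ r) powr p * D * (2 + C)"
  have E0: "0 \<le> E" using \<theta>(3) C(1) by (simp add: E_def)
  show ?thesis
  proof (rule exI[of _ \<theta>], intro exI[of _ "(2 * E) powr (1 / p)"] conjI allI impI \<theta>(1,2))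
    fix n W f t and P :: "real poly" assume adm: "admissible n W f" and t: "0 < t" "t \<le> \<theta> / real n" and P: "degree P < n"
    note a = admissibleD[OF adm]
    note [measurable] = a(3,5)
    have t1: "t \<le> 1 / real n" using t \<theta>(2) by (meson divide_right_mono of_nat_0_le_iff order_trans)
    define J where "J = (\<integral>\<^sup>+h\<in>{0..t}. step_wint r p W f h \<partial>lborel)"
    have Jfin: "J < \<infinity>" unfolding J_def by (rule avg_finite(1)[OF adm t(1) t1])
    define X1 where "X1 = wint p W (\<lambda>x. f x - poly P x)"
    define X2 where "X2 = phi_wint r p W ((pderiv ^^ r) P)"
    have fin: "X1 < \<infinity>" "X2 < \<infinity>" unfolding X1_def X2_def
      using wint_minus_poly_finite[OF adm] wint_weighted_poly_finite(1)[OF adm] by auto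
    have h: "ennreal (((t / 2) ^ r) powr p) * X2 \<le> ennreal D * step_wint r p W f h + ennreal D * (ennreal C * X1)"
      if h: "h \<in> {t / 2..t}" for h
    proof -
      have h0: "0 < h" "h \<le> \<theta> / real n" "h \<le> 1 / real n" using h t t1 by auto
      have "ennreal (((t / 2) ^ r) powr p) * X2 \<le> ennreal ((h ^ r) powr p) * X2"
        using h t p by (intro mult_right_mono ennreal_leI powr_mono2 power_mono) auto
      also have "\<dots> \<le> ennreal D * step_wint r p W (poly P) h"
        unfolding X2_def using \<theta>(4) a P h0 by blast
      also have "\<dots> \<le> ennreal D * (step_wint r p W f h + step_wint r p W (\<lambda>x. f x - poly P x) h)"
        by (intro mult_left_mono step_wint_split'[OF p]) auto
      also have "\<dots> \<le> ennreal D * (step_wint r p W f h + ennreal C * X1)"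
        unfolding X1_def by (intro mult_left_mono add_left_mono C(2)[OF adm h0(1,3)]) auto
      finally show ?thesis by (simp add: distrib_left)
    qed
    have const: "(\<integral>\<^sup>+h\<in>{t / 2..t}. k \<partial>lborel) = ennreal (t / 2) * k" for k
      using t by (simp add: nn_integral_cmult_indicator mult.commute)
    have "ennreal (t / 2) * (ennreal (((t / 2) ^ r) powr p) * X2) = (\<integral>\<^sup>+h\<in>{t / 2..t}. ennreal (((t / 2) ^ r) powr p) * X2 \<partial>lborel)"
      by (rule const[symmetric])
    also have "\<dots> \<le> (\<integral>\<^sup>+h\<in>{t / 2..t}. (ennreal D * step_wint r p W f h + ennreal D * (ennreal C * X1)) \<partial>lborel)"
      by (rule set_nn_integral_mono_set[OF order_refl h])
    also have "\<dots> = (\<integral>\<^sup>+h\<in>{t / 2..t}. ennreal D * step_wint r p W f h \<partial>lborel) + (\<integral>\<^sup>+h\<in>{t / 2..t}. ennreal D * (ennreal C * X1) \<partial>lborel)"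
      by (rule set_nn_integral_add) auto
    also have "\<dots> = ennreal D * (\<integral>\<^sup>+h\<in>{t / 2..t}. step_wint r p W f h \<partial>lborel) + ennreal (t / 2) * (ennreal D * (ennreal C * X1))"
      unfolding const by (subst set_nn_integral_cmult) auto
    also have "\<dots> \<le> ennreal D * J + ennreal (t / 2) * (ennreal D * (ennreal C * X1))"
      unfolding J_def using t by (intro add_right_mono mult_left_mono set_nn_integral_mono_set) auto
    also have "ennreal (t / 2) * (ennreal D * (ennreal C * X1)) = ennreal (t / 2 * (D * C)) * X1"
    proof -
      have "ennreal (t / 2 * (D * C)) = ennreal (t / 2) * (ennreal D * ennreal C)"
        using t \<theta>(3) C(1) by (subst ennreal_mult, simp, simp, subst ennreal_mult) auto
      then show ?thesis by (simp only: mult.assoc)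
    qed
    finally have "enn2real (ennreal (t / 2) * (ennreal (((t / 2) ^ r) powr p) * X2)) \<le> D * enn2real J + (t / 2 * (D * C)) * enn2real X1"
      using Jfin fin t \<theta>(3) C(1) by (intro enn2real_le_lincomb) auto
    then have "t / 2 * (((t / 2) ^ r) powr p * enn2real X2) \<le> D * enn2real J + (t / 2 * (D * C)) * enn2real X1"
      using t by (simp only: enn2real_mult enn2real_ennreal powr_ge_zero less_imp_le half_gt_zero)
    also have "D * enn2real J + (t / 2 * (D * C)) * enn2real X1 = t / 2 * (D * (2 * (enn2real J / t) + C * enn2real X1))"
    proof -
      define j where "j = enn2real J / t"
      have "enn2real J = t * j" using t by (simp add: j_def)
      then show ?thesis unfolding j_def[symmetric] by (simp add: algebra_simps)
    qed
    finally have "t / 2 * (((t / 2) ^ r) powr p * enn2real X2) \<le> t / 2 * (D * (2 * (enn2real J / t) + C * enn2real X1))" .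
    then have *: "((t / 2) ^ r) powr p * enn2real X2 \<le> D * (2 * (enn2real J / t) + C * enn2real X1)"
      by (rule mult_left_le_imp_le) (use t in simp)
    have e: "t ^ r = 2 ^ r * (t / 2) ^ r" by (simp add: power_divide)
    have tr: "(t ^ r) powr p = (2 ^ r) powr p * ((t / 2) ^ r) powr p"
      unfolding e by (rule powr_mult)
    define j where "j = enn2real J / t"
    have j: "avg_norm r p W f t powr p = j" "0 \<le> j" using avg_norm_powr[OF p(1) t(1)] t by (simp_all add: j_def J_def)
    have x1: "wnorm p W (\<lambda>x. f x - poly P x) powr p = enn2real X1" using wnorm_powr[OF p(1)] by (simp add: X1_def)
    have "2 * j + C * enn2real X1 \<le> (2 + C) * (j + enn2real X1)"
      using C(1) j(2) by (simp add: algebra_simps)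
    from order_trans[OF *[folded j_def] mult_left_mono[OF this \<theta>(3)]]
    have "(2 ^ r) powr p * (((t / 2) ^ r) powr p * enn2real X2) \<le> (2 ^ r) powr p * (D * ((2 + C) * (j + enn2real X1)))"
      by (rule mult_left_mono) simp
    then have "(t ^ r) powr p * enn2real X2 \<le> E * (avg_norm r p W f t powr p + wnorm p W (\<lambda>x. f x - poly P x) powr p)"
      unfolding tr j(1) x1 E_def by (simp only: mult.assoc)
    then have "((t ^ r) powr p * enn2real X2) powr (1 / p) \<le> (2 * E) powr (1 / p) * (avg_norm r p W f t + wnorm p W (\<lambda>x. f x - poly P x))"
      by (intro root_le_sum[OF p(1) _ _ E0]) (simp_all add: avg_norm_def)
    moreover have "((t ^ r) powr p * enn2real X2) powr (1 / p) = t ^ r * deriv_norm r p W P"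
    proof -
      have "((t ^ r) powr p) powr (1 / p) = t ^ r" using p t by (simp add: powr_powr)
      then show ?thesis unfolding wnorm_def X2_def powr_mult by (rule arg_cong)
    qed
    ultimately show "t ^ r * deriv_norm r p W P \<le> (2 * E) powr (1 / p) * (avg_norm r p W f t + wnorm p W (\<lambda>x. f x - poly P x))" by simp
  qed simp
qed

end

section \<open>From Lebesgue measurable to Borel functions\<close>

lemma Lp_norm_eq_wnorm:
  assumes ae: "AE x in lborel. x \<in> {-1..1} \<longrightarrow> g x = g' x"
    and [measurable]: "g' \<in> borel_measurable borel" "W \<in> borel_measurable borel" and W: "\<And>x. 0 \<le> W x"
    and v: "\<And>x. x \<in> {-1..1} \<Longrightarrow> v x = W x"
  shows "Lp_norm p v g = wnorm p W g'"
proof -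
  define H where "H x = indicator {-1..1} x *\<^sub>R (\<bar>g' x\<bar> powr p * W x)" for x :: real
  define G where "G x = indicator {-1..1} x *\<^sub>R (\<bar>g x\<bar> powr p * v x)" for x :: real
  have H[measurable]: "H \<in> borel_measurable borel" unfolding H_def[abs_def] by measurable
  have H_leb: "H \<in> borel_measurable lebesgue" by (rule measurable_completion) simp
  have "AE x in lborel. H x = G x"
    using ae by eventually_elim (auto simp: H_def G_def v indicator_def)
  then have HG: "AE x in lebesgue. H x = G x" by (rule AE_completion)
  \<comment> \<open>Completeness of Lebesgue measure: a function that agrees almost everywhere with
    a measurable one is measurable.\<close>
  have G_leb: "G \<in> borel_measurable lebesgue" by (rule borel_measurable_AE[OF H_leb HG])
  have "(LINT x|lebesgue. G x) = (LINT x|lebesgue. H x)"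
    using HG by (intro integral_cong_AE[OF G_leb H_leb]) (auto elim: eventually_mono)
  also have "\<dots> = (LINT x|lborel. H x)" by (rule integral_completion) simp
  also have "\<dots> = enn2real (\<integral>\<^sup>+x. ennreal (H x) \<partial>lborel)"
    using W by (intro integral_eq_nn_integral) (auto simp: H_def)
  also have "(\<integral>\<^sup>+x. ennreal (H x) \<partial>lborel) = wint p W g'"
    unfolding wint_def by (rule nn_integral_cong) (auto simp: H_def pw_def indicator_def ennreal_mult W)
  finally have "(LINT x|lebesgue. G x) = enn2real (wint p W g')" .
  then show ?thesis unfolding Lp_norm_def wnorm_def set_lebesgue_integral_def G_def[abs_def] by simp
qed

lemma Lp_space_borel_representative:
  assumes f: "f \<in> Lp_space p"
  obtains f' where "f' \<in> borel_measurable borel" "AE x in lborel. x \<in> {-1..1} \<longrightarrow> f x = f' x"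
    "pint p {-1..1} f' < \<infinity>"
proof -
  have "(\<lambda>x. indicator {-1..1} x *\<^sub>R f x) \<in> borel_measurable (completion lborel)"
    using f unfolding Lp_space_def set_borel_measurable_def by simp
  then obtain f' where f': "f' \<in> borel_measurable lborel" "AE x in lborel. indicator {-1..1} x *\<^sub>R f x = f' x"
    using completion_ex_borel_measurable_real by blast
  have [measurable]: "f' \<in> borel_measurable borel" using f'(1) by simp
  have ae: "AE x in lborel. x \<in> {-1..1} \<longrightarrow> f x = f' x" using f'(2) by eventually_elim auto
  define H where "H x = indicator {-1..1} x *\<^sub>R (\<bar>f' x\<bar> powr p)" for x :: real
  have [measurable]: "H \<in> borel_measurable borel" unfolding H_def[abs_def] by measurable
  have H_leb: "H \<in> borel_measurable lebesgue" by (rule measurable_completion) simp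
  have "AE x in lborel. indicator {-1..1} x *\<^sub>R (\<bar>f x\<bar> powr p) = H x"
    using ae by eventually_elim (auto simp: H_def indicator_def)
  then have "AE x in lebesgue. indicator {-1..1} x *\<^sub>R (\<bar>f x\<bar> powr p) = H x" by (rule AE_completion)
  moreover have "integrable lebesgue (\<lambda>x. indicator {-1..1} x *\<^sub>R (\<bar>f x\<bar> powr p))"
    using f unfolding Lp_space_def set_integrable_def by simp
  ultimately have "integrable lebesgue H" by (rule Bochner_Integration.integrable_cong_AE_imp[OF _ H_leb, rotated])
  then have "integrable lborel H" by (simp add: integrable_completion)
  then have "(\<integral>\<^sup>+x. ennreal (norm (H x)) \<partial>lborel) < \<infinity>" by (simp add: integrable_iff_bounded)
  also have "(\<integral>\<^sup>+x. ennreal (norm (H x)) \<partial>lborel) = pint p {-1..1} f'"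
    by (rule nn_integral_cong) (auto simp: H_def pw_def indicator_def)
  finally have "pint p {-1..1} f' < \<infinity>" .
  then show thesis using f'(1) by (intro that[OF _ ae]) auto
qed

text \<open>Around the cycle only three of the five links cost a factor \<open>K\<close>, so the way
  from any member to any other costs at most \<open>K ^ 3\<close>.\<close>

lemma cyclic_equiv_upto:
  assumes K: "1 \<le> K" and nonneg: "0 \<le> a" "0 \<le> m" "0 \<le> \<rho>" "0 \<le> \<sigma>" "0 \<le> \<tau>"
    and le: "a \<le> m" "m \<le> K * \<rho>" "\<rho> \<le> \<sigma>" "\<sigma> \<le> K * \<tau>" "\<tau> \<le> K * a"
  shows "equiv_upto (K ^ 3) m a \<and> equiv_upto (K ^ 3) a \<rho> \<and> equiv_upto (K ^ 3) \<rho> \<sigma> \<and> equiv_upto (K ^ 3) \<sigma> \<tau>"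
proof -
  \<comment> \<open>With multiplication by \<open>K\<close> as an opaque monotone map, all
    comparisons become linear in its iterates.\<close>
  define M where "M x = K * x" for x
  have mono: "x \<le> y \<Longrightarrow> M x \<le> M y" for x y unfolding M_def using K by (intro mult_left_mono) auto
  have up: "0 \<le> x \<Longrightarrow> x \<le> M x" for x unfolding M_def using mult_right_mono[OF K] by simp
  have pos: "0 \<le> x \<Longrightarrow> 0 \<le> M x" for x unfolding M_def using K by simp
  have I: "equiv_upto (K ^ 3) x y" if "x \<le> M (M (M y))" "y \<le> M (M (M x))" for x y
    using that K unfolding equiv_upto_def M_def by (auto simp: inverse_eq_divide divide_le_eq power3_eq_cube mult_ac)
  have le': "m \<le> M \<rho>" "\<sigma> \<le> M \<tau>" "\<tau> \<le> M a" using le unfolding M_def by auto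
  note mono1 = mono[OF le(1)] mono[OF le'(1)] mono[OF le(3)] mono[OF le'(2)] mono[OF le'(3)]
  note mono2 = mono1[THEN mono]
  note up1 = nonneg[THEN up]
  note up2 = nonneg[THEN pos, THEN up]
  note up3 = nonneg[THEN pos, THEN pos, THEN up]
  note all = le(1,3) le' mono1 mono2 up1 up2 up3 mono2[THEN mono]
  show ?thesis by (intro conjI I) (use all in linarith)+
qed

lemma Lp_norm_nonneg: "0 \<le> Lp_norm p v g"
  by (simp add: Lp_norm_def)

lemma realization_at_nonneg: "0 \<le> t \<Longrightarrow> 0 \<le> realization_at r \<psi> f t p v P"
  unfolding realization_at_def by (intro add_nonneg_nonneg mult_nonneg_nonneg Lp_norm_nonneg) auto

lemma Polys_iff: "1 \<le> n \<Longrightarrow> P \<in> Polys n \<longleftrightarrow> degree P < n"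
  unfolding Polys_def by auto

theorem corollary8p2:
  fixes c0 p L :: real and r :: nat
  assumes "1 \<le> c0" and "0 < p" and "p < 1" and "1 \<le> r"
  shows "\<exists>\<theta>>0. \<forall>A. 0 < A \<and> A < \<theta> \<longrightarrow>
    (\<exists>C>0. \<forall>(w :: real \<Rightarrow> real) (f :: real \<Rightarrow> real) (n :: nat) (t :: real) (Pstar :: real poly).
       doubling_weight L w \<longrightarrow> f \<in> Lp_space p \<longrightarrow> r \<le> n \<longrightarrow>
       A / real n \<le> t \<longrightarrow> t \<le> \<theta> / real n \<longrightarrow>
       near_best c0 n f p (avg_weight w n) Pstar \<longrightarrow>
       equiv_upto C (modulus r f t p (avg_weight w n))
                    (avg_modulus r f t p (avg_weight w n)) \<and>
       equiv_upto C (avg_modulus r f t p (avg_weight w n))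
                    (realization r phi n f t p (avg_weight w n)) \<and>
       equiv_upto C (realization r phi n f t p (avg_weight w n))
                    (realization r (phi_n n) n f t p (avg_weight w n)) \<and>
       equiv_upto C (realization r (phi_n n) n f t p (avg_weight w n))
                    (realization_at r phi f t p (avg_weight w n) Pstar))"
proof -
  let ?equivs = "\<lambda>C w f n t Pstar. equiv_upto C (modulus r f t p (avg_weight w n)) (avg_modulus r f t p (avg_weight w n)) \<and>
       equiv_upto C (avg_modulus r f t p (avg_weight w n)) (realization r phi n f t p (avg_weight w n)) \<and>
       equiv_upto C (realization r phi n f t p (avg_weight w n)) (realization r (phi_n n) n f t p (avg_weight w n)) \<and>
       equiv_upto C (realization r (phi_n n) n f t p (avg_weight w n)) (realization_at r phi f t p (avg_weight w n) Pstar)"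
  have p: "0 < p" "p \<le> 1" and r: "1 \<le> r" and c0: "0 \<le> c0" using assms by auto
  \<comment> \<open>The only trace of the doubling constant: \<open>c\<close>, \<open>s\<close> and
    all later constants are derived from \<open>s0\<close>, so none depends on the weight
    itself.\<close>
  obtain s0 where s0: "L < (3 / 2) ^ s0" using real_arch_pow[of "3 / 2" L] by auto
  define c :: real where "c = (9 / 2) ^ s0"
  define s where "s = 2 * s0 + 1"
  have c: "0 \<le> c" by (simp add: c_def)
  obtain C1 where C1: "0 \<le> C1" "\<And>n W f h P. admissible p c r s n W f \<Longrightarrow> 0 < h \<Longrightarrow> h \<le> 1 / real n \<Longrightarrow> degree P < n \<Longrightarrow>
      wnorm p W (\<lambda>x. sym_diff r (h * phi x) f x) \<le> C1 * (wnorm p W (\<lambda>x. f x - poly P x) + h ^ r * deriv_norm r p W P)"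
    using step_bounds[OF p r c, of s] by blast
  obtain C2 where C2: "0 \<le> C2" "\<And>n W f P. admissible p c r s n W f \<Longrightarrow> degree P < n \<Longrightarrow>
     wnorm p W (\<lambda>x. phi_n n x ^ r * poly ((pderiv ^^ r) P) x) \<le> C2 * deriv_norm r p W P"
    using deriv_norm_phi_n[OF p r c, of s] by blast
  \<comment> \<open>The threshold is the one of the reverse estimate and is fixed before
    \<open>A\<close>; of the constants below only \<open>C3\<close>, from Jackson's inequality,
    depends on \<open>A\<close>.\<close>
  obtain \<theta> C4 where \<theta>: "0 < \<theta>" "\<theta> \<le> 1" and C4: "0 \<le> C4"
    "\<And>n W f t P. admissible p c r s n W f \<Longrightarrow> 0 < t \<Longrightarrow> t \<le> \<theta> / real n \<Longrightarrow> degree P < n \<Longrightarrow>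
     t ^ r * deriv_norm r p W P \<le> C4 * (avg_norm r p W f t + wnorm p W (\<lambda>x. f x - poly P x))"
    using deriv_norm_le_avg[OF p r c, of s] by blast
  show ?thesis
  proof (rule exI[of _ \<theta>], intro conjI allI impI \<theta>(1))
    fix A assume A: "0 < A \<and> A < \<theta>"
    obtain C3 where C3: "0 \<le> C3" "\<And>n W f t. admissible p c r s n W f \<Longrightarrow> A / real n \<le> t \<Longrightarrow> t \<le> 1 / real n \<Longrightarrow>
        (\<exists>P. degree P < n \<and> wnorm p W (\<lambda>x. f x - poly P x) \<le> C3 * avg_norm r p W f t)"
      using jackson_avg[OF p r c, of A s] A \<theta>(2) by (auto dest: order_trans[OF less_imp_le])
    \<comment> \<open>One constant for all links: C1 bounds the modulus by the realization, 1 + C2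
      exchanges \<open>phi_n\<close> for \<open>phi\<close>, and the last summand bounds the
      realization at \<open>Pstar\<close>, its error by near-optimality and Jackson, its derivative
      by the reverse estimate.\<close>
    define K where "K = 1 + C1 + C2 + (c0 * C3 + C4 * (1 + c0 * C3))"
    have c3: "0 \<le> c0 * C3" using c0 C3(1) by simp
    have c34: "0 \<le> c0 * C3 + C4 * (1 + c0 * C3)" using c3 C4(1) by simp
    have K: "1 \<le> K" "C1 \<le> K" "1 + C2 \<le> K" "c0 * C3 + C4 * (1 + c0 * C3) \<le> K"
      using c34 C1(1) C2(1) by (auto simp: K_def)
    show "\<exists>C>0. \<forall>(w :: real \<Rightarrow> real) (f :: real \<Rightarrow> real) (n :: nat) (t :: real) (Pstar :: real poly).
       doubling_weight L w \<longrightarrow> f \<in> Lp_space p \<longrightarrow> r \<le> n \<longrightarrow>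
       A / real n \<le> t \<longrightarrow> t \<le> \<theta> / real n \<longrightarrow>
       near_best c0 n f p (avg_weight w n) Pstar \<longrightarrow>
       ?equivs C w f n t Pstar"
    proof (rule exI[of _ "K ^ 3"], intro conjI[of "0 < K ^ 3"] allI impI)
      show "0 < K ^ 3" using K(1) by simp
      fix w f :: "real \<Rightarrow> real" and n :: nat and t :: real and Pstar :: "real poly"
      assume w: "doubling_weight L w" and f: "f \<in> Lp_space p" and n: "r \<le> n"
        and tA: "A / real n \<le> t" and t\<theta>: "t \<le> \<theta> / real n" and near: "near_best c0 n f p (avg_weight w n) Pstar"
      have n1: "1 \<le> n" using n r by linarith
      have n0: "0 < real n" using n1 by simp
      have t0: "0 < t" using A n0 by (intro less_le_trans[OF _ tA]) simp
      have t1: "t \<le> 1 / real n" using t\<theta> \<theta>(2) by (meson divide_right_mono of_nat_0_le_iff order_trans)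
      obtain f' where f'[measurable]: "f' \<in> borel_measurable borel" and ae: "AE x in lborel. x \<in> {-1..1} \<longrightarrow> f x = f' x"
        and fin: "pint p {-1..1} f' < \<infinity>"
        using Lp_space_borel_representative[OF f] by blast
      define W where "W = wn w n"
      define v where "v = avg_weight w n"
      have W[measurable]: "W \<in> borel_measurable borel" unfolding W_def by (rule measurable_wn[OF w])
      have W0: "0 \<le> W x" for x unfolding W_def by (rule wn_nonneg[OF w n1])
      have vW: "v x = W x" if "x \<in> {-1..1}" for x using that by (simp add: v_def W_def wn_def)
      have adm: "admissible p c r s n W f'"
      proof -
        have "slow_cos n c s W"
          unfolding c_def s_def W_def by (rule slow_wn[OF less_imp_le[OF s0] w n1])
        then show ?thesis using n fin W0 by (simp add: admissible_def[OF p r c])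
      qed
      have norm: "Lp_norm p v g = wnorm p W g'" if "AE x in lborel. x \<in> {-1..1} \<longrightarrow> g x = g' x" "g' \<in> borel_measurable borel" for g g'
        by (rule Lp_norm_eq_wnorm[OF that W W0 vW])
      define N where "N h = wnorm p W (\<lambda>x. sym_diff r (h * phi x) f' x)" for h
      \<comment> \<open>Positive steps are enough: the modulus excludes h = 0, and for the average
        it is a null set.\<close>
      have N: "Lp_norm p v (\<lambda>x. sym_diff r (h * phi x) f x) = N h" if "0 < h" for h
        unfolding N_def by (rule norm[OF sym_diff_AE_cong[OF r that ae]]) measurable
      have N_powr: "N h powr p = enn2real (step_wint r p W f' h)" for h
        unfolding N_def by (rule wnorm_powr[OF p(1)])
      define J where "J = (\<integral>\<^sup>+h\<in>{0..t}. step_wint r p W f' h \<partial>lborel)"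
      obtain B where B: "0 \<le> B" "\<And>h. 0 < h \<Longrightarrow> h \<le> t \<Longrightarrow> step_wint r p W f' h \<le> ennreal B"
        using avg_finite(2)[OF p r c adm t0 t1] by blast
      have step: "step_wint r p W f' h = ennreal (N h powr p)" if "0 < h" "h \<le> t" for h
      proof -
        have "step_wint r p W f' h < top" using B(2)[OF that] by (rule le_less_trans) simp
        then show ?thesis unfolding N_powr by simp
      qed
      have ne0: "AE h in lborel. h \<noteq> (0 :: real)" by (rule AE_lborel_singleton)
      have avg: "avg_modulus r f t p v = avg_norm r p W f' t"
      proof -
        define F where "F h = indicator {0..t} h *\<^sub>R enn2real (step_wint r p W f' h)" for h
        define G where "G h = indicator {0..t} h *\<^sub>R Lp_norm p v (\<lambda>x. sym_diff r (h * phi x) f x) powr p" for h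
        have [measurable]: "F \<in> borel_measurable borel" unfolding F_def[abs_def] by measurable
        have F_leb: "F \<in> borel_measurable lebesgue" by (rule measurable_completion) simp
        have "AE h in lborel. F h = G h"
          using ne0 by eventually_elim (auto simp: F_def G_def N N_powr indicator_def)
        then have FG: "AE h in lebesgue. F h = G h" by (rule AE_completion)
        have G_leb: "G \<in> borel_measurable lebesgue" by (rule borel_measurable_AE[OF F_leb FG])
        have "(LINT h|lebesgue. G h) = (LINT h|lebesgue. F h)"
          using FG by (intro integral_cong_AE[OF G_leb F_leb]) (auto elim: eventually_mono)
        also have "\<dots> = (LINT h|lborel. F h)" by (rule integral_completion) simp
        also have "\<dots> = enn2real (\<integral>\<^sup>+h. ennreal (F h) \<partial>lborel)"
          by (intro integral_eq_nn_integral) (auto simp: F_def)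
        also have "(\<integral>\<^sup>+h. ennreal (F h) \<partial>lborel) = J"
          unfolding J_def
        proof (rule nn_integral_cong_AE)
          show "AE h in lborel. ennreal (F h) = step_wint r p W f' h * indicator {0..t} h"
            using ne0 by eventually_elim (auto simp: F_def step indicator_def)
        qed
        finally show ?thesis
          unfolding avg_modulus_def avg_norm_def set_lebesgue_integral_def G_def[abs_def] J_def[symmetric] by simp
      qed
      have modulus: "modulus r f t p v = (SUP h\<in>{0<..t}. N h)"
        unfolding modulus_def by (rule SUP_cong) (auto simp: N)
      \<comment> \<open>The supremum is taken in the reals, so it is an upper bound only once
        boundedness is known.\<close>
      have bdd: "bdd_above (N ` {0<..t})"
      proof (rule bdd_aboveI2)
        fix h assume "h \<in> {0<..t}"
        then have "N h powr p \<le> B" unfolding N_powr using B by (intro enn2real_leI) auto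
        then have "(N h powr p) powr (1 / p) \<le> B powr (1 / p)" using p by (intro powr_mono2) auto
        then show "N h \<le> B powr (1 / p)" using p by (simp add: powr_powr N_def)
      qed
      define m where "m = (SUP h\<in>{0<..t}. N h)"
      have Nm: "N h \<le> m" if "0 < h" "h \<le> t" for h
        unfolding m_def using that by (intro cSUP_upper bdd) auto
      have m0: "0 \<le> m" using Nm[OF t0 order_refl] by (rule order_trans[rotated]) (simp add: N_def)
      have avg_le: "avg_norm r p W f' t \<le> m"
      proof -
        have "J \<le> (\<integral>\<^sup>+h\<in>{0..t}. ennreal (m powr p) \<partial>lborel)" unfolding J_def
        proof (rule nn_integral_mono_AE)
          show "AE h in lborel. step_wint r p W f' h * indicator {0..t} h \<le> ennreal (m powr p) * indicator {0..t} h"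
            using ne0
          proof eventually_elim
            case (elim h)
            show ?case
            proof (cases "h \<in> {0..t}")
              case True
              then have "N h powr p \<le> m powr p" using elim Nm[of h] p by (intro powr_mono2) (auto simp: N_def)
              then show ?thesis using True elim step[of h] by (auto intro: ennreal_leI)
            qed simp
          qed
        qed
        also have "\<dots> = ennreal (m powr p * t)" using t0 by (simp add: nn_integral_cmult_indicator ennreal_mult)
        finally have "enn2real J \<le> m powr p * t" using t0 by (intro enn2real_leI) auto
        then have "1 / t * enn2real J \<le> m powr p" using t0 by (simp add: divide_le_eq)
        then have "(1 / t * enn2real J) powr (1 / p) \<le> (m powr p) powr (1 / p)" using p t0 by (intro powr_mono2) auto
        then show ?thesis using p m0 unfolding avg_norm_def J_def[symmetric] by (simp add: powr_powr)
      qed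
      have phi_n_m[measurable]: "phi_n n \<in> borel_measurable borel" unfolding phi_n_def[abs_def] by measurable
      have approx: "Lp_norm p v (\<lambda>x. f x - poly P x) = wnorm p W (\<lambda>x. f' x - poly P x)" for P
        using ae by (intro norm) (auto elim: eventually_mono)
      have real_phi: "realization_at r phi f t p v P = wnorm p W (\<lambda>x. f' x - poly P x) + t ^ r * deriv_norm r p W P" for P
        unfolding realization_at_def approx by (subst norm) auto
      have real_phi_n: "realization_at r (phi_n n) f t p v P =
          wnorm p W (\<lambda>x. f' x - poly P x) + t ^ r * wnorm p W (\<lambda>x. phi_n n x ^ r * poly ((pderiv ^^ r) P) x)" for P
        unfolding realization_at_def approx by (subst norm[where g' = "\<lambda>x. phi_n n x ^ r * poly ((pderiv ^^ r) P) x"]) auto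
      have ne: "Polys n \<noteq> {}" unfolding Polys_def by (auto intro: exI[of _ 0])
      have bdd_real: "bdd_below (realization_at r \<psi> f t p v ` Polys n)" for \<psi>
        using t0 by (intro bdd_belowI2[where m = 0] realization_at_nonneg) simp
      have R0: "0 \<le> realization r \<psi> n f t p v" for \<psi>
        unfolding realization_def using t0 by (intro cINF_greatest ne realization_at_nonneg) simp
      have mod_le: "m \<le> K * realization r phi n f t p v"
      proof -
        have "m \<le> K * realization_at r phi f t p v P" if P: "P \<in> Polys n" for P
          unfolding m_def
        proof (rule cSUP_least)
          show "{0<..t} \<noteq> {}" using t0 by auto
          fix h assume h: "h \<in> {0<..t}"
          have "N h \<le> C1 * (wnorm p W (\<lambda>x. f' x - poly P x) + h ^ r * deriv_norm r p W P)"
            unfolding N_def using h t1 P by (intro C1(2)[OF adm]) (auto simp: Polys_iff[OF n1])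
          also have "\<dots> \<le> C1 * (wnorm p W (\<lambda>x. f' x - poly P x) + t ^ r * deriv_norm r p W P)"
            using h C1(1) by (intro mult_left_mono add_left_mono mult_right_mono power_mono) auto
          also have "\<dots> \<le> K * realization_at r phi f t p v P"
            unfolding real_phi[symmetric] using K(2) t0 by (intro mult_right_mono realization_at_nonneg) auto
          finally show "N h \<le> K * realization_at r phi f t p v P" .
        qed
        \<comment> \<open>Dividing by \<open>K\<close> lets the bound, valid for each polynomial,
          pass to the infimum.\<close>
        then have "m / K \<le> realization r phi n f t p v"
          unfolding realization_def using K(1) by (intro cINF_greatest ne) (simp add: divide_le_eq mult.commute)
        then show ?thesis using K(1) by (simp add: divide_le_eq mult.commute)
      qed
      have R_mono: "realization r phi n f t p v \<le> realization r (phi_n n) n f t p v"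
        unfolding realization_def
      proof (rule cINF_mono[OF ne bdd_real])
        fix P assume P: "P \<in> Polys n"
        have "phi_wint r p W ((pderiv ^^ r) P) \<le> wint p W (\<lambda>x. phi_n n x ^ r * poly ((pderiv ^^ r) P) x)"
        proof (rule wint_mono)
          fix x :: real assume "x \<in> {-1..1}"
          then have "\<bar>phi x ^ r\<bar> \<le> \<bar>phi_n n x ^ r\<bar>"
            using phi_nonneg[of x] unfolding phi_n_def power_abs by (intro power_mono) auto
          then show "\<bar>phi x ^ r * poly ((pderiv ^^ r) P) x\<bar> \<le> \<bar>phi_n n x ^ r * poly ((pderiv ^^ r) P) x\<bar>"
            unfolding abs_mult by (rule mult_right_mono) simp
        qed (use p in simp)
        then have "deriv_norm r p W P \<le> wnorm p W (\<lambda>x. phi_n n x ^ r * poly ((pderiv ^^ r) P) x)"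
          unfolding wnorm_def using wint_weighted_poly_finite(2)[OF p r c adm] p
          by (intro powr_mono2 enn2real_mono) auto
        then have "realization_at r phi f t p v P \<le> realization_at r (phi_n n) f t p v P"
          unfolding real_phi real_phi_n using t0 by (intro add_left_mono mult_left_mono) auto
        then show "\<exists>Q\<in>Polys n. realization_at r phi f t p v Q \<le> realization_at r (phi_n n) f t p v P" using P by blast
      qed
      have Ps: "Pstar \<in> Polys n" and near': "Lp_norm p v (\<lambda>x. f x - poly Pstar x) \<le> c0 * best_approx n f p v"
        using near unfolding near_best_def v_def by auto
      have R_star: "realization r (phi_n n) n f t p v \<le> K * realization_at r phi f t p v Pstar"
      proof -
        define Y where "Y = wnorm p W (\<lambda>x. f' x - poly Pstar x)"
        define Z where "Z = t ^ r * deriv_norm r p W Pstar"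
        have YZ: "0 \<le> Y" "0 \<le> Z" using t0 by (auto simp: Y_def Z_def)
        have "realization r (phi_n n) n f t p v \<le> realization_at r (phi_n n) f t p v Pstar"
          unfolding realization_def by (rule cINF_lower[OF bdd_real Ps])
        also have "\<dots> \<le> Y + t ^ r * (C2 * deriv_norm r p W Pstar)"
          unfolding real_phi_n Y_def using t0 Ps by (intro add_left_mono mult_left_mono C2(2)[OF adm]) (auto simp: Polys_iff[OF n1])
        also have "\<dots> = Y + C2 * Z" by (simp add: Z_def)
        also have "\<dots> \<le> (1 + C2) * (Y + Z)" using YZ C2(1) by (simp add: algebra_simps)
        also have "\<dots> \<le> K * (Y + Z)" using K(3) YZ by (intro mult_right_mono) auto
        finally show ?thesis unfolding real_phi Y_def Z_def .
      qed
      \<comment> \<open>The closing link, and the place where near-optimality enters: the error of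
        \<open>Pstar\<close> is at most c0 times that of the Jackson polynomial, and with this error
        known the reverse estimate controls its derivative.\<close>
      have star_avg: "realization_at r phi f t p v Pstar \<le> K * avg_norm r p W f' t"
      proof -
        define a where "a = avg_norm r p W f' t"
        have a0: "0 \<le> a" by (simp add: a_def avg_norm_def)
        obtain P where P: "degree P < n" "wnorm p W (\<lambda>x. f' x - poly P x) \<le> C3 * a"
          using C3(2)[OF adm tA t1] unfolding a_def by blast
        have "best_approx n f p v \<le> wnorm p W (\<lambda>x. f' x - poly P x)"
          unfolding best_approx_def approx[symmetric] using P(1)
          by (intro cINF_lower bdd_belowI2[where m = 0] Lp_norm_nonneg) (simp add: Polys_iff[OF n1])
        then have Y: "wnorm p W (\<lambda>x. f' x - poly Pstar x) \<le> c0 * C3 * a"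
          using near' mult_left_mono[OF order_trans[OF _ P(2)] c0] unfolding approx by (metis mult.assoc order_trans)
        have "t ^ r * deriv_norm r p W Pstar \<le> C4 * (a + wnorm p W (\<lambda>x. f' x - poly Pstar x))"
          unfolding a_def using Ps by (intro C4(2)[OF adm t0 t\<theta>]) (simp add: Polys_iff[OF n1])
        also have "\<dots> \<le> C4 * (a + c0 * C3 * a)" using Y C4(1) by (intro mult_left_mono add_left_mono)
        finally have "realization_at r phi f t p v Pstar \<le> c0 * C3 * a + C4 * (a + c0 * C3 * a)"
          unfolding real_phi using Y by (rule add_mono[rotated])
        also have "\<dots> = (c0 * C3 + C4 * (1 + c0 * C3)) * a" by (simp add: algebra_simps)
        also have "\<dots> \<le> K * a" using K(4) a0 by (intro mult_right_mono)
        finally show ?thesis unfolding a_def .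
      qed
      show "?equivs (K ^ 3) w f n t Pstar"
        unfolding v_def[symmetric] modulus avg m_def[symmetric]
        by (rule cyclic_equiv_upto[OF K(1) _ m0 R0 R0 realization_at_nonneg avg_le mod_le R_mono R_star star_avg])
          (use t0 in \<open>simp_all add: avg_norm_def\<close>)
    qed
  qed
qed

end
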